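(* Let $\mathcal F$ be a saturated fusion system on a finite $p$-group $S$, and let $A^{\mathrm{char}}(\mathcal F)_{(p)}$ be the subring of $A(S,S)_{(p)}$ formed by all elements that are $\mathcal F$-stable as well as $\mathcal F$-generated. Then $A^{\mathrm{char}}(\mathcal F)_{(p)}$ is also the subring of $A(S,S)_{(p)}$ generated by the $\mathcal F$-characteristic elements, and it has a $\mathbb Z_{(p)}$-basis consisting of the elements $\beta_{\Delta(P,\mathrm{id})}=\omega_{\mathcal F}\circ[P,\mathrm{id}]_S^S\circ\omega_{\mathcal F}$, which are in one-to-one correspondence with the $\mathcal F$-conjugacy classes of subgroups $P\le S$. The $\mathcal F$-characteristic elements are those elements $X\in A^{\mathrm{char}}(\mathcal F)_{(p)}$ for which the coefficient of $X$ at the basis element $\beta_{\Delta(S,\mathrm{id})}=\omega_{\mathcal F}$ is invertible in $\mathbb Z_{(p)}$.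
   Context: Here $p$ is a prime and $p$-groups are finite. A fusion system $\mathcal F$ on a $p$-group $S$ is a category whose objects are the subgroups of $S$, whose morphism sets $\mathcal F(P,Q)=\mathrm{Hom}_{\mathcal F}(P,Q)$ consist of injective group homomorphisms $P\to Q$ (composed as homomorphisms) and contain all homomorphisms $P\to Q$ induced by conjugation by elements of $S$, and such that for each $\varphi\in\mathcal F(P,Q)$ the isomorphism $\varphi\colon P\to\varphi P$ and its inverse are morphisms of $\mathcal F$. Write $\mathrm{Aut}_{\mathcal F}(P)=\mathcal F(P,P)$. Subgroups $P,Q$ are $\mathcal F$-conjugate if they are isomorphic in $\mathcal F$; $[P]_{\mathcal F}$ is the set of $\mathcal F$-conjugates of $P$. $P$ is fully $\mathcal F$-normalized (resp. fully $\mathcal F$-centralized) if $|N_SP|\ge|N_SQ|$ (resp. $|C_SP|\ge|C_SQ|$) for all $Q\in[P]_{\mathcal F}$. $\mathcal F$ is saturated if for all $P\le S$: (1) if $P$ is fully $\mathcal F$-normalized, then $P$ is fully $\mathcal F$-centralized and $\mathrm{Aut}_S(P)$ is a Sylow $p$-subgroup of $\mathrm{Aut}_{\mathcal F}(P)$; (2) every $\varphi\in\mathcal F(P,S)$ with $\varphi(P)$ fully $\mathcal F$-centralized extends to a morphism in $\mathcal F(N_\varphi,S)$, where $N_\varphi=\{x\in N_S(P)\mid \exists y\in S:\varphi\circ c_x=c_y\circ\varphi\}$. Bisets: for finite groups $G,H$, a $(G,H)$-biset is a finite set with commuting right $G$-action and left $H$-action, regarded as a left $(H\times G)$-set via $(h,g).x=hxg^{-1}$.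 $A(G,H)$ is the Grothendieck group of isomorphism classes of $(G,H)$-bisets under disjoint union. Composition $\circ\colon A(H,K)\times A(G,H)\to A(G,K)$ is induced by $Y\circ X=Y\times_HX$; it makes $A(S,S)$ a ring. For $U\le G$ and a homomorphism $\varphi\colon U\to H$, $\Delta(U,\varphi)=\{(\varphi(u),u)\mid u\in U\}\le H\times G$ and $[U,\varphi]_G^H=[(H\times G)/\Delta(U,\varphi)]$. The subscript $(p)$ denotes tensoring with $\mathbb Z_{(p)}$. $X\in A(S,S)_{(p)}$ is $\mathcal F$-generated if it is a $\mathbb Z_{(p)}$-linear combination of elements $[P,\varphi]_S^S$ with $P\le S$, $\varphi\in\mathcal F(P,S)$. It is $\mathcal F$-stable if it is right $\mathcal F$-stable, $X\circ[P,\varphi]_P^S=X\circ[P,\mathrm{id}]_P^S$, and left $\mathcal F$-stable, $[\varphi P,\varphi^{-1}]_S^P\circ X=[P,\mathrm{id}]_S^P\circ X$, for all $P\le S$, $\varphi\in\mathcal F(P,S)$. It is $\mathcal F$-characteristic if it is $\mathcal F$-generated, $\mathcal F$-stable, and $\varepsilon(X)$ is invertible in $\mathbb Z_{(p)}$, where $\varepsilon$ is the $\mathbb Z_{(p)}$-linear extension of $X\mapsto|X|/|S|$ to the span of left-free bisets. $\omega_{\mathcal F}$ is the characteristic idempotent of $\mathcal F$: the unique idempotent (with respect to $\circ$) of $A(S,S)_{(p)}$ that is $\mathcal F$-characteristic. Subrings of $A(S,S)_{(p)}$ here need not contain the identity $[S,\mathrm{id}]_S^S$. *)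

theory Defs
  imports
    Complex_Main
    "HOL-Algebra.Group_Action"
    "HOL-Algebra.Left_Coset"
    "HOL-Algebra.Module"
    "HOL-Library.Poly_Mapping"
    "HOL-Computational_Algebra.Primes"
begin

section \<open>Linear algebra over a commutative ring\<close>

definition mod_span ::
  "('r, 'm) ring_scheme \<Rightarrow> ('r, 'v, 'n) module_scheme \<Rightarrow> 'v set \<Rightarrow> 'v set"
  where "mod_span R M B =
    {finsum M (\<lambda>b. c b \<odot>\<^bsub>M\<^esub> b) B0 | c B0. finite B0 \<and> B0 \<subseteq> B \<and> c \<in> B0 \<rightarrow> carrier R}"

definition mod_independent ::
  "('r, 'm) ring_scheme \<Rightarrow> ('r, 'v, 'n) module_scheme \<Rightarrow> 'v set \<Rightarrow> bool"
  where "mod_independent R M B \<longleftrightarrow>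
    (\<forall>B0 c. finite B0 \<and> B0 \<subseteq> B \<and> c \<in> B0 \<rightarrow> carrier R \<and>
       finsum M (\<lambda>b. c b \<odot>\<^bsub>M\<^esub> b) B0 = \<zero>\<^bsub>M\<^esub> \<longrightarrow> (\<forall>b\<in>B0. c b = \<zero>\<^bsub>R\<^esub>))"

definition mod_basis ::
  "('r, 'm) ring_scheme \<Rightarrow> ('r, 'v, 'n) module_scheme \<Rightarrow> 'v set \<Rightarrow> 'v set \<Rightarrow> bool"
  where "mod_basis R M A B \<longleftrightarrow>
    B \<subseteq> carrier M \<and> mod_independent R M B \<and> mod_span R M B = A"

text \<open>The coefficient of \<open>x\<close> at \<open>b\<close>, for \<open>b\<close> in a basis \<open>B\<close> and \<open>x\<close> in its span.\<close>

definition basis_coeff ::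
  "('r, 'm) ring_scheme \<Rightarrow> ('r, 'v, 'n) module_scheme \<Rightarrow> 'v set \<Rightarrow> 'v \<Rightarrow> 'v \<Rightarrow> 'r"
  where "basis_coeff R M B x b =
    (THE k. \<exists>c B0. finite B0 \<and> b \<in> B0 \<and> B0 \<subseteq> B \<and> c \<in> B0 \<rightarrow> carrier R \<and>
       x = finsum M (\<lambda>b. c b \<odot>\<^bsub>M\<^esub> b) B0 \<and> k = c b)"

text \<open>Unlike the subrings of HOL-Algebra, these need not contain the unit of the ambient
  ring.\<close>

definition nonunital_subring :: "'v set \<Rightarrow> ('v, 'm) ring_scheme \<Rightarrow> bool"
  where "nonunital_subring A R \<longleftrightarrow>
    subgroup A (add_monoid R) \<and> (\<forall>x\<in>A. \<forall>y\<in>A. x \<otimes>\<^bsub>R\<^esub> y \<in> A)"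

definition nonunital_subring_generated :: "('v, 'm) ring_scheme \<Rightarrow> 'v set \<Rightarrow> 'v set"
  where "nonunital_subring_generated R B = \<Inter>{A. nonunital_subring A R \<and> B \<subseteq> A}"


section \<open>The ring of integers localized at a prime\<close>

definition Z_loc :: "nat \<Rightarrow> rat ring"
  where "Z_loc p =
    \<lparr>carrier = {of_int a / of_int b | a b. \<not> int p dvd b},
     monoid.mult = (*), one = 1, zero = 0, add = (+)\<rparr>"


section \<open>Fusion systems\<close>

definition finite_p_group :: "nat \<Rightarrow> ('a, 'm) monoid_scheme \<Rightarrow> bool"
  where "finite_p_group p S \<longleftrightarrow> group S \<and> finite (carrier S) \<and> (\<exists>n. order S = p ^ n)"

definition centralizer :: "('a, 'm) monoid_scheme \<Rightarrow> 'a set \<Rightarrow> 'a set"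
  where "centralizer S P = {s \<in> carrier S. \<forall>x\<in>P. s \<otimes>\<^bsub>S\<^esub> x = x \<otimes>\<^bsub>S\<^esub> s}"

definition conj_map :: "('a, 'm) monoid_scheme \<Rightarrow> 'a \<Rightarrow> 'a set \<Rightarrow> 'a \<Rightarrow> 'a"
  where "conj_map S s P = (\<lambda>x\<in>P. s \<otimes>\<^bsub>S\<^esub> x \<otimes>\<^bsub>S\<^esub> inv\<^bsub>S\<^esub> s)"

definition inv_map :: "'a set \<Rightarrow> ('a \<Rightarrow> 'b) \<Rightarrow> 'b \<Rightarrow> 'a"
  where "inv_map P \<phi> = restrict (inv_into P \<phi>) (\<phi> ` P)"

text \<open>\<open>F P Q\<close> is the set of morphisms from \<open>P\<close> to \<open>Q\<close>. Morphisms are extensional functions,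
  so that two of them with the same source are equal iff they agree on that source.
  Identities and inclusions are the maps induced by conjugation with the unit.\<close>

locale fusion_system =
  fixes S :: "('a, 'm) monoid_scheme" and F :: "'a set \<Rightarrow> 'a set \<Rightarrow> ('a \<Rightarrow> 'a) set"
  assumes is_group: "group S"
    and morphism: "\<lbrakk>subgroup P S; subgroup Q S; \<phi> \<in> F P Q\<rbrakk> \<Longrightarrow>
      \<phi> \<in> mon (S\<lparr>carrier := P\<rparr>) (S\<lparr>carrier := Q\<rparr>) \<and> \<phi> \<in> extensional P"
    and conj_closed: "\<lbrakk>subgroup P S; subgroup Q S; s \<in> carrier S; conj_map S s P ` P \<subseteq> Q\<rbrakk> \<Longrightarrow>
      conj_map S s P \<in> F P Q"
    and comp_closed: "\<lbrakk>subgroup P S; subgroup Q S; subgroup R S; \<phi> \<in> F P Q; \<psi> \<in> F Q R\<rbrakk> \<Longrightarrow>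
      compose P \<psi> \<phi> \<in> F P R"
    and corestrict: "\<lbrakk>subgroup P S; subgroup Q S; \<phi> \<in> F P Q\<rbrakk> \<Longrightarrow> \<phi> \<in> F P (\<phi> ` P)"
    and inverse: "\<lbrakk>subgroup P S; subgroup Q S; \<phi> \<in> F P Q\<rbrakk> \<Longrightarrow> inv_map P \<phi> \<in> F (\<phi> ` P) P"

definition F_conjugates ::
  "('a, 'm) monoid_scheme \<Rightarrow> ('a set \<Rightarrow> 'a set \<Rightarrow> ('a \<Rightarrow> 'a) set) \<Rightarrow> 'a set \<Rightarrow> 'a set set"
  where "F_conjugates S F P =
    {Q. subgroup Q S \<and> (\<exists>\<phi>\<in>F P Q. \<exists>\<psi>\<in>F Q P.
       compose P \<psi> \<phi> = (\<lambda>x\<in>P. x) \<and> compose Q \<phi> \<psi> = (\<lambda>x\<in>Q. x))}"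

definition fully_normalized ::
  "('a, 'm) monoid_scheme \<Rightarrow> ('a set \<Rightarrow> 'a set \<Rightarrow> ('a \<Rightarrow> 'a) set) \<Rightarrow> 'a set \<Rightarrow> bool"
  where "fully_normalized S F P \<longleftrightarrow>
    (\<forall>Q\<in>F_conjugates S F P. card (normalizer S P) \<ge> card (normalizer S Q))"

definition fully_centralized ::
  "('a, 'm) monoid_scheme \<Rightarrow> ('a set \<Rightarrow> 'a set \<Rightarrow> ('a \<Rightarrow> 'a) set) \<Rightarrow> 'a set \<Rightarrow> bool"
  where "fully_centralized S F P \<longleftrightarrow>
    (\<forall>Q\<in>F_conjugates S F P. card (centralizer S P) \<ge> card (centralizer S Q))"

definition Aut_F :: "('a set \<Rightarrow> 'a set \<Rightarrow> ('a \<Rightarrow> 'a) set) \<Rightarrow> 'a set \<Rightarrow> ('a \<Rightarrow> 'a) monoid"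
  where "Aut_F F P = (BijGroup P)\<lparr>carrier := F P P\<rparr>"

definition Aut_S :: "('a, 'm) monoid_scheme \<Rightarrow> 'a set \<Rightarrow> ('a \<Rightarrow> 'a) set"
  where "Aut_S S P = (\<lambda>s. conj_map S s P) ` normalizer S P"

definition sylow_subgroup :: "nat \<Rightarrow> 'g set \<Rightarrow> ('g, 'm) monoid_scheme \<Rightarrow> bool"
  where "sylow_subgroup p Q G \<longleftrightarrow> subgroup Q G \<and> card Q = p ^ multiplicity p (order G)"

definition N_phi :: "('a, 'm) monoid_scheme \<Rightarrow> 'a set \<Rightarrow> ('a \<Rightarrow> 'a) \<Rightarrow> 'a set"
  where "N_phi S P \<phi> =
    {x \<in> normalizer S P. \<exists>y\<in>carrier S. \<forall>u\<in>P.
       \<phi> (x \<otimes>\<^bsub>S\<^esub> u \<otimes>\<^bsub>S\<^esub> inv\<^bsub>S\<^esub> x) = y \<otimes>\<^bsub>S\<^esub> \<phi> u \<otimes>\<^bsub>S\<^esub> inv\<^bsub>S\<^esub> y}"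

definition saturated ::
  "nat \<Rightarrow> ('a, 'm) monoid_scheme \<Rightarrow> ('a set \<Rightarrow> 'a set \<Rightarrow> ('a \<Rightarrow> 'a) set) \<Rightarrow> bool"
  where "saturated p S F \<longleftrightarrow> (\<forall>P. subgroup P S \<longrightarrow>
    (fully_normalized S F P \<longrightarrow>
       fully_centralized S F P \<and> sylow_subgroup p (Aut_S S P) (Aut_F F P)) \<and>
    (\<forall>\<phi>\<in>F P (carrier S). fully_centralized S F (\<phi> ` P) \<longrightarrow>
       (\<exists>\<psi>\<in>F (N_phi S P \<phi>) (carrier S). \<forall>u\<in>P. \<psi> u = \<phi> u)))"


section \<open>Bisets\<close>

record ('x, 'g, 'h) biset =
  points :: "'x set"
  lact :: "'h \<Rightarrow> 'x \<Rightarrow> 'x"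
  ract :: "'x \<Rightarrow> 'g \<Rightarrow> 'x"

text \<open>A \<open>(G,H)\<close>-biset has a right action of \<open>G\<close> and a left action of \<open>H\<close>.\<close>

definition is_biset ::
  "('g, 'm) monoid_scheme \<Rightarrow> ('h, 'n) monoid_scheme \<Rightarrow> ('x, 'g, 'h) biset \<Rightarrow> bool"
  where "is_biset G H X \<longleftrightarrow> finite (points X) \<and>
    (\<forall>x\<in>points X.
      (\<forall>h\<in>carrier H. lact X h x \<in> points X) \<and>
      (\<forall>g\<in>carrier G. ract X x g \<in> points X) \<and>
      lact X \<one>\<^bsub>H\<^esub> x = x \<and> ract X x \<one>\<^bsub>G\<^esub> = x \<and>
      (\<forall>h\<in>carrier H. \<forall>h'\<in>carrier H. lact X (h \<otimes>\<^bsub>H\<^esub> h') x = lact X h (lact X h' x)) \<and>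
      (\<forall>g\<in>carrier G. \<forall>g'\<in>carrier G. ract X x (g \<otimes>\<^bsub>G\<^esub> g') = ract X (ract X x g) g') \<and>
      (\<forall>h\<in>carrier H. \<forall>g\<in>carrier G. ract X (lact X h x) g = lact X h (ract X x g)))"

definition biset_isomorphic ::
  "('g, 'm) monoid_scheme \<Rightarrow> ('h, 'n) monoid_scheme \<Rightarrow>
   ('x, 'g, 'h) biset \<Rightarrow> ('y, 'g, 'h) biset \<Rightarrow> bool"
  where "biset_isomorphic G H X Y \<longleftrightarrow> (\<exists>f. bij_betw f (points X) (points Y) \<and>
    (\<forall>x\<in>points X. (\<forall>h\<in>carrier H. f (lact X h x) = lact Y h (f x)) \<and>
                  (\<forall>g\<in>carrier G. f (ract X x g) = ract Y (f x) g)))"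

definition left_free :: "('h, 'n) monoid_scheme \<Rightarrow> ('x, 'g, 'h) biset \<Rightarrow> bool"
  where "left_free H X \<longleftrightarrow>
    (\<forall>h\<in>carrier H. \<forall>x\<in>points X. lact X h x = x \<longrightarrow> h = \<one>\<^bsub>H\<^esub>)"

definition biset_sum ::
  "('x, 'g, 'h) biset \<Rightarrow> ('y, 'g, 'h) biset \<Rightarrow> ('x + 'y, 'g, 'h) biset"
  where "biset_sum X Y =
    \<lparr>points = points X <+> points Y,
     lact = (\<lambda>h. map_sum (lact X h) (lact Y h)),
     ract = (\<lambda>z g. map_sum (\<lambda>x. ract X x g) (\<lambda>y. ract Y y g) z)\<rparr>"

text \<open>\<open>Y \<times>\<^sub>H X\<close>: the quotient of \<open>Y \<times> X\<close> by \<open>(y h, x) \<sim> (y, h x)\<close>.\<close>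

definition tensor_rel ::
  "('h, 'n) monoid_scheme \<Rightarrow> ('y, 'h, 'k) biset \<Rightarrow> ('x, 'g, 'h) biset \<Rightarrow>
   (('y \<times> 'x) \<times> ('y \<times> 'x)) set"
  where "tensor_rel H Y X =
    {((ract Y y h, x), (y, lact X h x)) | y h x.
       y \<in> points Y \<and> x \<in> points X \<and> h \<in> carrier H}"

definition biset_tensor ::
  "('h, 'n) monoid_scheme \<Rightarrow> ('y, 'h, 'k) biset \<Rightarrow> ('x, 'g, 'h) biset \<Rightarrow>
   (('y \<times> 'x) set, 'g, 'k) biset"
  where "biset_tensor H Y X =
    \<lparr>points = (points Y \<times> points X) // tensor_rel H Y X,
     lact = (\<lambda>k C. (\<lambda>(y, x). (lact Y k y, x)) ` C),
     ract = (\<lambda>C g. (\<lambda>(y, x). (y, ract X x g)) ` C)\<rparr>"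

text \<open>The transitive biset \<open>(H \<times> G)/\<Delta>(U,\<phi>)\<close>. A left \<open>(H \<times> G)\<close>-set and a biset
  correspond via \<open>(h,g).x = h x g\<^sup>-\<^sup>1\<close>, whence the inverse in the right action.\<close>

definition graph_subgroup :: "'g set \<Rightarrow> ('g \<Rightarrow> 'h) \<Rightarrow> ('h \<times> 'g) set"
  where "graph_subgroup U \<phi> = (\<lambda>u. (\<phi> u, u)) ` U"

definition transitive_biset ::
  "('g, 'm) monoid_scheme \<Rightarrow> ('h, 'n) monoid_scheme \<Rightarrow> 'g set \<Rightarrow> ('g \<Rightarrow> 'h) \<Rightarrow>
   (('h \<times> 'g) set, 'g, 'h) biset"
  where "transitive_biset G H U \<phi> =
    \<lparr>points = lcosets\<^bsub>H \<times>\<times> G\<^esub> (graph_subgroup U \<phi>),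
     lact = (\<lambda>h C. (h, \<one>\<^bsub>G\<^esub>) <#\<^bsub>H \<times>\<times> G\<^esub> C),
     ract = (\<lambda>C g. (\<one>\<^bsub>H\<^esub>, inv\<^bsub>G\<^esub> g) <#\<^bsub>H \<times>\<times> G\<^esub> C)\<rparr>"


section \<open>The p-localized Burnside module of bisets\<close>

text \<open>Tensoring is right exact, so \<open>A(G,H)\<^sub>(\<^sub>p\<^sub>)\<close> is the \<open>\<int>\<^sub>(\<^sub>p\<^sub>)\<close>-module with the same
  generators and relations as the Grothendieck group \<open>A(G,H)\<close>: finite bisets, modulo
  isomorphisms and \<open>X \<squnion> Y = X + Y\<close>. Every finite biset is isomorphic to one whose points are
  natural numbers, so these suffice as generators. An element of \<open>A(G,H)\<^sub>(\<^sub>p\<^sub>)\<close> is a coset of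
  the module of relations.\<close>

type_synonym ('g, 'h) formal = "(nat, 'g, 'h) biset \<Rightarrow>\<^sub>0 rat"

abbreviation formal_scale :: "rat \<Rightarrow> ('g, 'h) formal \<Rightarrow> ('g, 'h) formal"
  where "formal_scale c \<equiv> Poly_Mapping.map ((*) c)"

definition formal_bisets ::
  "nat \<Rightarrow> ('g, 'm) monoid_scheme \<Rightarrow> ('h, 'n) monoid_scheme \<Rightarrow> ('g, 'h) formal set"
  where "formal_bisets p G H =
    {f. (\<forall>X\<in>Poly_Mapping.keys f. is_biset G H X) \<and>
        (\<forall>X. Poly_Mapping.lookup f X \<in> carrier (Z_loc p))}"

inductive_set biset_relations ::
  "nat \<Rightarrow> ('g, 'm) monoid_scheme \<Rightarrow> ('h, 'n) monoid_scheme \<Rightarrow> ('g, 'h) formal set"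
  for p G H
  where
    zero: "0 \<in> biset_relations p G H"
  | iso: "\<lbrakk>is_biset G H X; is_biset G H Y; biset_isomorphic G H X Y\<rbrakk> \<Longrightarrow>
      Poly_Mapping.single X 1 - Poly_Mapping.single Y 1 \<in> biset_relations p G H"
  | sum: "\<lbrakk>is_biset G H X; is_biset G H Y; is_biset G H Z;
        biset_isomorphic G H Z (biset_sum X Y)\<rbrakk> \<Longrightarrow>
      Poly_Mapping.single Z 1 - Poly_Mapping.single X 1 - Poly_Mapping.single Y 1
        \<in> biset_relations p G H"
  | add: "\<lbrakk>f \<in> biset_relations p G H; g \<in> biset_relations p G H\<rbrakk> \<Longrightarrow>
      f + g \<in> biset_relations p G H"
  | scale: "\<lbrakk>c \<in> carrier (Z_loc p); f \<in> biset_relations p G H\<rbrakk> \<Longrightarrow>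
      formal_scale c f \<in> biset_relations p G H"

definition formal_class ::
  "nat \<Rightarrow> ('g, 'm) monoid_scheme \<Rightarrow> ('h, 'n) monoid_scheme \<Rightarrow> ('g, 'h) formal \<Rightarrow>
   ('g, 'h) formal set"
  where "formal_class p G H f = {g \<in> formal_bisets p G H. g - f \<in> biset_relations p G H}"

definition formal_gen ::
  "('g, 'm) monoid_scheme \<Rightarrow> ('h, 'n) monoid_scheme \<Rightarrow> ('x, 'g, 'h) biset \<Rightarrow> ('g, 'h) formal"
  where "formal_gen G H X =
    Poly_Mapping.single (SOME Y :: (nat, 'g, 'h) biset. is_biset G H Y \<and> biset_isomorphic G H X Y) 1"

definition biset_class ::
  "nat \<Rightarrow> ('g, 'm) monoid_scheme \<Rightarrow> ('h, 'n) monoid_scheme \<Rightarrow> ('x, 'g, 'h) biset \<Rightarrow>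
   ('g, 'h) formal set"
  where "biset_class p G H X = formal_class p G H (formal_gen G H X)"

text \<open>\<open>[U,\<phi>]\<^sub>G\<^sup>H\<close>\<close>

definition transitive_class ::
  "nat \<Rightarrow> ('g, 'm) monoid_scheme \<Rightarrow> ('h, 'n) monoid_scheme \<Rightarrow> 'g set \<Rightarrow> ('g \<Rightarrow> 'h) \<Rightarrow>
   ('g, 'h) formal set"
  where "transitive_class p G H U \<phi> = biset_class p G H (transitive_biset G H U \<phi>)"

text \<open>The operations on cosets are induced from representatives; the unions below are over
  equal sets.\<close>

definition burnside_carrier ::
  "nat \<Rightarrow> ('g, 'm) monoid_scheme \<Rightarrow> ('h, 'n) monoid_scheme \<Rightarrow> ('g, 'h) formal set set"
  where "burnside_carrier p G H = formal_class p G H ` formal_bisets p G H"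

definition burnside_add ::
  "nat \<Rightarrow> ('g, 'm) monoid_scheme \<Rightarrow> ('h, 'n) monoid_scheme \<Rightarrow>
   ('g, 'h) formal set \<Rightarrow> ('g, 'h) formal set \<Rightarrow> ('g, 'h) formal set"
  where "burnside_add p G H a b = (\<Union>f\<in>a. \<Union>g\<in>b. formal_class p G H (f + g))"

definition burnside_smult ::
  "nat \<Rightarrow> ('g, 'm) monoid_scheme \<Rightarrow> ('h, 'n) monoid_scheme \<Rightarrow>
   rat \<Rightarrow> ('g, 'h) formal set \<Rightarrow> ('g, 'h) formal set"
  where "burnside_smult p G H c a = (\<Union>f\<in>a. formal_class p G H (formal_scale c f))"

definition formal_comp ::
  "('g, 'm) monoid_scheme \<Rightarrow> ('h, 'n) monoid_scheme \<Rightarrow> ('k, 'l) monoid_scheme \<Rightarrow>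
   ('h, 'k) formal \<Rightarrow> ('g, 'h) formal \<Rightarrow> ('g, 'k) formal"
  where "formal_comp G H K f g =
    (\<Sum>Y\<in>Poly_Mapping.keys f. \<Sum>X\<in>Poly_Mapping.keys g.
       formal_scale (Poly_Mapping.lookup f Y * Poly_Mapping.lookup g X)
         (formal_gen G K (biset_tensor H Y X)))"

text \<open>\<open>\<circ> : A(H,K)\<^sub>(\<^sub>p\<^sub>) \<times> A(G,H)\<^sub>(\<^sub>p\<^sub>) \<rightarrow> A(G,K)\<^sub>(\<^sub>p\<^sub>)\<close>\<close>

definition burnside_comp ::
  "nat \<Rightarrow> ('g, 'm) monoid_scheme \<Rightarrow> ('h, 'n) monoid_scheme \<Rightarrow> ('k, 'l) monoid_scheme \<Rightarrow>
   ('h, 'k) formal set \<Rightarrow> ('g, 'h) formal set \<Rightarrow> ('g, 'k) formal set"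
  where "burnside_comp p G H K b a = (\<Union>f\<in>b. \<Union>g\<in>a. formal_class p G K (formal_comp G H K f g))"

text \<open>\<open>A(S,S)\<^sub>(\<^sub>p\<^sub>)\<close> as a ring under composition and as a \<open>\<int>\<^sub>(\<^sub>p\<^sub>)\<close>-module.\<close>

definition burnside_ring ::
  "nat \<Rightarrow> ('a, 'm) monoid_scheme \<Rightarrow> (rat, ('a, 'a) formal set) module"
  where "burnside_ring p S =
    \<lparr>carrier = burnside_carrier p S S,
     monoid.mult = burnside_comp p S S S,
     one = transitive_class p S S (carrier S) (\<lambda>x\<in>carrier S. x),
     zero = formal_class p S S 0,
     add = burnside_add p S S,
     smult = burnside_smult p S S\<rparr>"


section \<open>Characteristic elements\<close>

text \<open>\<open>\<epsilon>\<close> is only meaningful on the span of the left-free bisets, which contains all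
  \<open>F\<close>-generated elements.\<close>

definition augmentation :: "('a, 'm) monoid_scheme \<Rightarrow> ('a, 'a) formal set \<Rightarrow> rat"
  where "augmentation S a =
    (THE r. \<exists>f\<in>a. (\<forall>X\<in>Poly_Mapping.keys f. left_free S X) \<and>
       r = (\<Sum>X\<in>Poly_Mapping.keys f.
              Poly_Mapping.lookup f X * (of_nat (card (points X)) / of_nat (order S))))"

definition F_generated ::
  "nat \<Rightarrow> ('a, 'm) monoid_scheme \<Rightarrow> ('a set \<Rightarrow> 'a set \<Rightarrow> ('a \<Rightarrow> 'a) set) \<Rightarrow>
   ('a, 'a) formal set \<Rightarrow> bool"
  where "F_generated p S F X \<longleftrightarrow>
    X \<in> mod_span (Z_loc p) (burnside_ring p S)
      {transitive_class p S S P \<phi> | P \<phi>. subgroup P S \<and> \<phi> \<in> F P (carrier S)}"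

definition right_F_stable ::
  "nat \<Rightarrow> ('a, 'm) monoid_scheme \<Rightarrow> ('a set \<Rightarrow> 'a set \<Rightarrow> ('a \<Rightarrow> 'a) set) \<Rightarrow>
   ('a, 'a) formal set \<Rightarrow> bool"
  where "right_F_stable p S F X \<longleftrightarrow>
    (\<forall>P. \<forall>\<phi>. subgroup P S \<and> \<phi> \<in> F P (carrier S) \<longrightarrow>
       (let SP = S\<lparr>carrier := P\<rparr> in
        burnside_comp p SP S S X (transitive_class p SP S P \<phi>) =
        burnside_comp p SP S S X (transitive_class p SP S P (\<lambda>x\<in>P. x))))"

definition left_F_stable ::
  "nat \<Rightarrow> ('a, 'm) monoid_scheme \<Rightarrow> ('a set \<Rightarrow> 'a set \<Rightarrow> ('a \<Rightarrow> 'a) set) \<Rightarrow>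
   ('a, 'a) formal set \<Rightarrow> bool"
  where "left_F_stable p S F X \<longleftrightarrow>
    (\<forall>P. \<forall>\<phi>. subgroup P S \<and> \<phi> \<in> F P (carrier S) \<longrightarrow>
       (let SP = S\<lparr>carrier := P\<rparr> in
        burnside_comp p S S SP (transitive_class p S SP (\<phi> ` P) (inv_map P \<phi>)) X =
        burnside_comp p S S SP (transitive_class p S SP P (\<lambda>x\<in>P. x)) X))"

definition F_stable ::
  "nat \<Rightarrow> ('a, 'm) monoid_scheme \<Rightarrow> ('a set \<Rightarrow> 'a set \<Rightarrow> ('a \<Rightarrow> 'a) set) \<Rightarrow>
   ('a, 'a) formal set \<Rightarrow> bool"
  where "F_stable p S F X \<longleftrightarrow> right_F_stable p S F X \<and> left_F_stable p S F X"

definition F_characteristic ::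
  "nat \<Rightarrow> ('a, 'm) monoid_scheme \<Rightarrow> ('a set \<Rightarrow> 'a set \<Rightarrow> ('a \<Rightarrow> 'a) set) \<Rightarrow>
   ('a, 'a) formal set \<Rightarrow> bool"
  where "F_characteristic p S F X \<longleftrightarrow>
    F_generated p S F X \<and> F_stable p S F X \<and> augmentation S X \<in> Units (Z_loc p)"

definition A_char ::
  "nat \<Rightarrow> ('a, 'm) monoid_scheme \<Rightarrow> ('a set \<Rightarrow> 'a set \<Rightarrow> ('a \<Rightarrow> 'a) set) \<Rightarrow>
   ('a, 'a) formal set set"
  where "A_char p S F =
    {X \<in> carrier (burnside_ring p S). F_stable p S F X \<and> F_generated p S F X}"

definition characteristic_idempotent ::
  "nat \<Rightarrow> ('a, 'm) monoid_scheme \<Rightarrow> ('a set \<Rightarrow> 'a set \<Rightarrow> ('a \<Rightarrow> 'a) set) \<Rightarrow>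
   ('a, 'a) formal set"
  where "characteristic_idempotent p S F =
    (THE \<omega>. \<omega> \<in> carrier (burnside_ring p S) \<and>
       \<omega> \<otimes>\<^bsub>burnside_ring p S\<^esub> \<omega> = \<omega> \<and> F_characteristic p S F \<omega>)"

definition beta ::
  "nat \<Rightarrow> ('a, 'm) monoid_scheme \<Rightarrow> ('a set \<Rightarrow> 'a set \<Rightarrow> ('a \<Rightarrow> 'a) set) \<Rightarrow>
   'a set \<Rightarrow> ('a, 'a) formal set"
  where "beta p S F P =
    characteristic_idempotent p S F \<otimes>\<^bsub>burnside_ring p S\<^esub>
      transitive_class p S S P (\<lambda>x\<in>P. x) \<otimes>\<^bsub>burnside_ring p S\<^esub>
      characteristic_idempotent p S F"

definition beta_basis ::
  "nat \<Rightarrow> ('a, 'm) monoid_scheme \<Rightarrow> ('a set \<Rightarrow> 'a set \<Rightarrow> ('a \<Rightarrow> 'a) set) \<Rightarrow>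
   ('a, 'a) formal set set"
  where "beta_basis p S F = {beta p S F P | P. subgroup P S}"

end

theory Submission
  imports Defs "HOL-Number_Theory.Cong" "HOL-Algebra.Generated_Groups"
begin

text \<open>An element of \<open>A(G,H)\<^sub>(\<^sub>p\<^sub>)\<close> is determined by its \<^emph>\<open>stabilizer counts\<close>: for
\<open>D \<le> H \<times> G\<close>, the number of points with stabilizer \<open>D\<close>, extended linearly. The reason is that a
transitive biset is determined by one of its point stabilizers (\<open>formal_class_eq\<close>). The
\<^emph>\<open>mark\<close> of \<open>X\<close> at \<open>Z\<close>, the sum of the counts over all \<open>D \<supseteq> Z\<close>, is the number of points fixed by
\<open>Z\<close>; marks carry the same information and are easier to multiply. The whole proof takes place in
terms of counts and marks.

A fusion system is treated as the set \<open>\<G>\<close> of the graphs of its morphisms. It is closed under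
relational composition, converse, conjugation and passage to subgroups. An element is
\<open>F\<close>-generated iff its counts vanish outside \<open>\<G>\<close> (\<open>F_generated_iff\<close>), and an \<open>F\<close>-generated element
is \<open>F\<close>-stable iff its mark at a graph depends only on the \<open>F\<close>-conjugacy class of the source of the
graph (\<open>F_stable_iff\<close>). Hence an element \<open>X\<close> of \<open>A\<^sup>c\<^sup>h\<^sup>a\<^sup>r\<close> is determined by the class function
\<open>m X\<close>, where \<open>m X Q\<close> is the number of fixed points of \<open>Q\<close> on the set of left \<open>S\<close>-orbits of \<open>X\<close>. This
function is additive and multiplicative in \<open>X\<close> (\<open>m_mult\<close>), and \<open>m X Q\<close> is congruent to \<open>m X S\<close>
modulo \<open>p\<close> (\<open>m_cong\<close>), as one expects of the fixed points of a \<open>p\<close>-group. Its value at the trivial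
subgroup is the augmentation, so \<open>X\<close> is characteristic iff \<open>m X S\<close> is a unit
(\<open>characteristic_iff_S\<close>).

Since \<open>m\<close> is injective and multiplicative on \<open>A\<^sup>c\<^sup>h\<^sup>a\<^sup>r\<close>, the characteristic idempotent is the element
with \<open>m \<omega> = 1\<close>, once such an element is found (\<open>exists_identity\<close>). This is where saturation enters.
Marks can be altered freely on graphs of one order, as far as the Cauchy--Frobenius congruence
permits, without touching those on larger graphs (\<open>adjust_level\<close>). Starting from the identity of
\<open>S\<close>, one makes the marks stable on smaller and smaller graphs by giving a graph with source \<open>Q\<close> the
mark at the identity of a fully normalized conjugate \<open>P\<close> of \<open>Q\<close>. The congruence needed for this holds
because, by saturation, the graph and its whole normalizer can be carried into \<open>N\<^sub>S(P) \<times> N\<^sub>S(P)\<close>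
(\<open>move_to_fully_normalized\<close>): the Cauchy--Frobenius sums for the two normalizers then agree in all
terms but one. The outcome is a stable element with \<open>m X S\<close> prime to \<open>p\<close>, which may be scaled to
\<open>m X S = 1\<close>. Then \<open>1 - m X\<close> takes values in \<open>p \<int>\<^sub>(\<^sub>p\<^sub>)\<close>. The class function \<open>1 - (1 - m X)\<^sup>k\<close> comes
from a polynomial in \<open>X\<close> without constant term, and for large \<open>k\<close> the function \<open>(1 - m X)\<^sup>k\<close> is so
divisible by \<open>p\<close> that an element with these values exists for trivial reasons
(\<open>exists_stable_with_marks\<close>). The sum of the two elements is \<open>\<omega>\<close>.

Multiplying an \<open>F\<close>-generated element by \<open>\<omega>\<close> on both sides averages its marks:
\<open>m (\<omega> X \<omega>) Q\<close> is the mean of \<open>m X\<close> over the images of all \<open>F\<close>-morphisms \<open>Q \<rightarrow> S\<close> (\<open>sandwich_m\<close>). For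
\<open>X = [P,id]\<close> this gives
\<open>m (\<beta> P) Q = |S| |F(Q,P)| / (|P| |F(Q,S)|)\<close> (\<open>m_beta\<close>),
which depends only on the class of \<open>P\<close> and vanishes unless \<open>Q\<close> is \<open>F\<close>-conjugate to a subgroup of \<open>P\<close>.
By this triangularity the \<open>\<beta> P\<close> are linearly independent and distinguish the classes. They span:
averaging does not change \<open>m X\<close> for \<open>X\<close> in \<open>A\<^sup>c\<^sup>h\<^sup>a\<^sup>r\<close>, so averaging an expansion of \<open>X\<close> into the
generators \<open>[P,\<phi>]\<close> expresses \<open>X\<close> by elements \<open>\<beta> P\<close> (\<open>basis_expansion\<close>). Of all basis elements only
\<open>\<beta> S = \<omega>\<close> has \<open>m b S \<noteq> 0\<close>, so the coefficient of \<open>X\<close> at \<open>\<omega>\<close> is \<open>m X S\<close>. Finally, if \<open>m X S\<close> is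
not a unit, then \<open>m (X + \<omega>) S\<close> is one, and \<open>X\<close> is the difference of the characteristic elements
\<open>X + \<omega>\<close> and \<open>\<omega>\<close>.\<close>


section \<open>Actions of finite groups\<close>

locale finite_action = group G for G (structure) +
  fixes E :: "'x set" and act :: "'a \<Rightarrow> 'x \<Rightarrow> 'x"
  assumes finite_G: "finite (carrier G)" and finite_E: "finite E"
    and act_closed: "g \<in> carrier G \<Longrightarrow> x \<in> E \<Longrightarrow> act g x \<in> E"
    and act_one: "x \<in> E \<Longrightarrow> act \<one> x = x"
    and act_mult: "g \<in> carrier G \<Longrightarrow> h \<in> carrier G \<Longrightarrow> x \<in> E \<Longrightarrow>
      act (g \<otimes> h) x = act g (act h x)"
begin

definition stabilizes :: "'x \<Rightarrow> 'a set" where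
  "stabilizes x = {g \<in> carrier G. act g x = x}"

definition orb :: "'x \<Rightarrow> 'x set" where
  "orb x = (\<lambda>g. act g x) ` carrier G"

lemma act_inv: "g \<in> carrier G \<Longrightarrow> x \<in> E \<Longrightarrow> act (inv g) (act g x) = x"
  by (metis act_mult act_one inv_closed l_inv)

lemma act_inv': "g \<in> carrier G \<Longrightarrow> x \<in> E \<Longrightarrow> act g (act (inv g) x) = x"
  by (metis act_mult act_one inv_closed r_inv)

lemma orb_subset: "x \<in> E \<Longrightarrow> orb x \<subseteq> E"
  by (auto simp: orb_def act_closed)

lemma orb_self: "x \<in> E \<Longrightarrow> x \<in> orb x"
  unfolding orb_def using act_one by (metis image_eqI one_closed)

lemma orb_closed: "x \<in> E \<Longrightarrow> g \<in> carrier G \<Longrightarrow> y \<in> orb x \<Longrightarrow> act g y \<in> orb x"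
  unfolding orb_def by (auto simp: act_mult[symmetric])

lemma fibre_card:
  assumes "x \<in> E" "k \<in> carrier G"
  shows "card {g \<in> carrier G. act g x = act k x} = card (stabilizes x)"
proof (rule sym, rule bij_betw_same_card)
  show "bij_betw (\<lambda>g. k \<otimes> g) (stabilizes x) {g \<in> carrier G. act g x = act k x}"
  proof (rule bij_betw_byWitness[where f' = "\<lambda>g. inv k \<otimes> g"])
    show "(\<lambda>g. k \<otimes> g) ` stabilizes x \<subseteq> {g \<in> carrier G. act g x = act k x}"
      using assms by (auto simp: stabilizes_def act_mult)
    show "(\<lambda>g. inv k \<otimes> g) ` {g \<in> carrier G. act g x = act k x} \<subseteq> stabilizes x"
      using assms by (auto simp: stabilizes_def act_mult act_inv)
  qed (use assms in \<open>auto simp: stabilizes_def m_assoc[symmetric]\<close>)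
qed

lemma sum_over_group:
  fixes w :: "'x \<Rightarrow> rat"
  assumes "x \<in> E"
  shows "(\<Sum>g\<in>carrier G. w (act g x)) = of_nat (card (stabilizes x)) * (\<Sum>y\<in>orb x. w y)"
proof -
  have "(\<Sum>g\<in>carrier G. w (act g x)) =
      (\<Sum>y\<in>orb x. \<Sum>g\<in>{g\<in>carrier G. act g x = y}. w (act g x))"
    unfolding orb_def by (rule sum.image_gen[OF finite_G])
  also have "\<dots> = (\<Sum>y\<in>orb x. of_nat (card (stabilizes x)) * w y)"
  proof (rule sum.cong)
    fix y assume "y \<in> orb x"
    then obtain k where k: "k \<in> carrier G" "y = act k x" by (auto simp: orb_def)
    have "(\<Sum>g\<in>{g\<in>carrier G. act g x = y}. w (act g x)) =
        (\<Sum>g\<in>{g\<in>carrier G. act g x = y}. w y)" by (rule sum.cong) auto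
    then show "(\<Sum>g\<in>{g\<in>carrier G. act g x = y}. w (act g x)) =
        of_nat (card (stabilizes x)) * w y"
      using fibre_card[OF assms k(1)] k by simp
  qed simp
  finally show ?thesis by (simp add: sum_distrib_left)
qed

lemma orbit_stabilizer:
  assumes "x \<in> E"
  shows "card (orb x) * card (stabilizes x) = card (carrier G)"
proof -
  have "(of_nat (card (carrier G)) :: rat) = of_nat (card (stabilizes x) * card (orb x))"
    using sum_over_group[OF assms, of "\<lambda>_. 1"] by simp
  then show ?thesis by (metis mult.commute of_nat_eq_iff)
qed

lemma orb_eq:
  assumes "x \<in> E" "y \<in> orb x"
  shows "orb y = orb x"
proof -
  obtain k where k: "k \<in> carrier G" "y = act k x" using assms by (auto simp: orb_def)
  show ?thesis
  proof
    show "orb y \<subseteq> orb x"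
      unfolding orb_def[of y] using orb_closed[OF assms(1) _ assms(2)] by blast
    show "orb x \<subseteq> orb y"
    proof
      fix z assume "z \<in> orb x"
      then obtain g where g: "g \<in> carrier G" "z = act g x" by (auto simp: orb_def)
      have "z = act (g \<otimes> inv k) y" using k g assms by (simp add: act_mult act_closed act_inv)
      then show "z \<in> orb y" using g k by (auto simp: orb_def)
    qed
  qed
qed

lemma orb_eq_iff: "x \<in> E \<Longrightarrow> y \<in> E \<Longrightarrow> orb x = orb y \<longleftrightarrow> x \<in> orb y"
  using orb_eq orb_self by blast

lemma card_stabilizes_orb:
  assumes "x \<in> E" "y \<in> orb x"
  shows "card (stabilizes y) = card (stabilizes x)"
proof -
  have "orb y = orb x" using orb_eq assms .
  moreover have "y \<in> E" using assms orb_subset by blast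
  ultimately have "card (orb x) * card (stabilizes y) = card (orb x) * card (stabilizes x)"
    using orbit_stabilizer[OF assms(1)] orbit_stabilizer[of y] by simp
  moreover have "card (orb x) \<noteq> 0"
    using orb_self[OF assms(1)] finite_G by (auto simp: orb_def)
  ultimately show ?thesis by simp
qed

lemma sum_over_orbits:
  fixes w :: "'x set \<Rightarrow> rat"
  shows "(\<Sum>x\<in>E. w (orb x) * (of_nat (card (stabilizes x)) / of_nat (card (carrier G)))) =
    (\<Sum>C\<in>orb ` E. w C)"
proof -
  let ?t = "\<lambda>x. w (orb x) * (of_nat (card (stabilizes x)) / of_nat (card (carrier G)))"
  have "(\<Sum>x\<in>E. ?t x) = (\<Sum>C\<in>orb ` E. \<Sum>x\<in>{x\<in>E. orb x = C}. ?t x)"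
    by (rule sum.image_gen[OF finite_E])
  also have "\<dots> = (\<Sum>C\<in>orb ` E. w C)"
  proof (rule sum.cong)
    fix C assume "C \<in> orb ` E"
    then obtain x where x: "x \<in> E" "C = orb x" by blast
    have "{y \<in> E. orb y = C} = orb x"
      using x orb_eq orb_self orb_subset[OF x(1)] by blast
    then have "(\<Sum>y\<in>{y\<in>E. orb y = C}. ?t y) =
        (\<Sum>y\<in>orb x. w C * (of_nat (card (stabilizes x)) / of_nat (card (carrier G))))"
      using x orb_eq[OF x(1)] card_stabilizes_orb[OF x(1)] by (auto intro: sum.cong)
    also have "\<dots> = w C * (of_nat (card (orb x) * card (stabilizes x)) / of_nat (card (carrier G)))"
      by simp
    also have "\<dots> = w C"
      using orbit_stabilizer[OF x(1)] finite_G by (auto simp del: of_nat_mult)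
    finally show "(\<Sum>y\<in>{y\<in>E. orb y = C}. ?t y) = w C" .
  qed simp
  finally show ?thesis .
qed

lemma act_eq_iff:
  assumes "x \<in> E" "g \<in> carrier G" "k \<in> carrier G"
  shows "act g x = act k x \<longleftrightarrow> inv k \<otimes> g \<in> stabilizes x"
proof
  assume "act g x = act k x"
  then show "inv k \<otimes> g \<in> stabilizes x"
    using assms by (simp add: stabilizes_def act_mult act_inv)
next
  assume "inv k \<otimes> g \<in> stabilizes x"
  then have "act k (act (inv k) (act g x)) = act k x"
    using assms by (simp add: stabilizes_def act_mult)
  then show "act g x = act k x" using assms by (simp add: act_inv' act_closed)
qed

lemma stabilizes_act:
  assumes "x \<in> E" "k \<in> carrier G"
  shows "stabilizes (act k x) = (\<lambda>g. k \<otimes> g \<otimes> inv k) ` stabilizes x"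
proof
  show "(\<lambda>g. k \<otimes> g \<otimes> inv k) ` stabilizes x \<subseteq> stabilizes (act k x)"
    using assms by (auto simp: stabilizes_def act_mult act_inv act_closed)
  show "stabilizes (act k x) \<subseteq> (\<lambda>g. k \<otimes> g \<otimes> inv k) ` stabilizes x"
  proof
    fix g assume g: "g \<in> stabilizes (act k x)"
    then have "inv k \<otimes> g \<otimes> k \<in> stabilizes x"
      using assms by (auto simp: stabilizes_def act_mult act_inv act_closed)
    moreover have "g = k \<otimes> (inv k \<otimes> g \<otimes> k) \<otimes> inv k"
      using g assms by (auto simp: stabilizes_def m_assoc) (simp add: m_assoc[symmetric])
    ultimately show "g \<in> (\<lambda>g. k \<otimes> g \<otimes> inv k) ` stabilizes x" by blast
  qed
qed

lemma subgroup_stabilizes: "x \<in> E \<Longrightarrow> subgroup (stabilizes x) G"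
  by (rule subgroupI) (auto simp: stabilizes_def act_mult act_one intro: exI[of _ \<one>], metis act_inv)

text \<open>Invariant subsets are built up one orbit at a time; this replaces choosing a system of orbit
  representatives.\<close>

lemma orbit_induct [consumes 2, case_names empty orbit]:
  assumes "A \<subseteq> E" and "\<forall>g\<in>carrier G. \<forall>x\<in>A. act g x \<in> A"
    and empty: "Q {}"
    and orbit: "\<And>A x. A \<subseteq> E \<Longrightarrow> x \<in> E \<Longrightarrow> A \<inter> orb x = {} \<Longrightarrow> Q A \<Longrightarrow> Q (A \<union> orb x)"
  shows "Q A"
proof -
  have "finite A" using assms(1) finite_E finite_subset by blast
  then show ?thesis using assms(1,2)
  proof (induction A rule: finite_psubset_induct)
    case (psubset A)
    show ?case
    proof (cases "A = {}")
      case False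
      then obtain x where x: "x \<in> A" by blast
      have xE: "x \<in> E" using x psubset by blast
      have oA: "orb x \<subseteq> A" using x psubset(4) by (auto simp: orb_def)
      have inv: "act g y \<in> A - orb x" if "g \<in> carrier G" "y \<in> A - orb x" for g y
      proof -
        have "act (inv g) (act g y) = y" using that psubset(3) by (intro act_inv) auto
        then show ?thesis using that psubset(4) orb_closed[OF xE] by (metis DiffD1 DiffD2 DiffI inv_closed)
      qed
      have "Q (A - orb x)"
        using psubset(2)[of "A - orb x"] x orb_self[OF xE] psubset(3) inv by blast
      then have "Q (A - orb x \<union> orb x)"
        using psubset(3) xE by (intro orbit) auto
      then show ?thesis using oA by (simp add: Un_absorb2)
    qed (use empty in simp)
  qed
qed

text \<open>By the orbit-stabilizer theorem each orbit contributes exactly \<open>|G|\<close>; this is the Cauchy--Frobenius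
  lemma before exchanging the order of summation.\<close>

lemma card_dvd_sum_stabilizes: "card (carrier G) dvd (\<Sum>x\<in>E. card (stabilizes x))"
proof -
  have "card (carrier G) dvd (\<Sum>x\<in>A. card (stabilizes x))"
    if "A \<subseteq> E" "\<forall>g\<in>carrier G. \<forall>x\<in>A. act g x \<in> A" for A
    using that
  proof (induction rule: orbit_induct)
    case (orbit A x)
    have fin: "finite A" "finite (orb x)"
      using orbit finite_E orb_subset by (meson finite_subset)+
    have "(\<Sum>y\<in>orb x. card (stabilizes y)) = card (carrier G)"
      using card_stabilizes_orb[OF orbit(2)] orbit_stabilizer[OF orbit(2)] by simp
    then show ?case using orbit fin by (simp add: sum.union_disjoint)
  qed simp
  then show ?thesis using act_closed by blast
qed

lemma fixed_points_cong:
  assumes "prime p" "card (carrier G) = p ^ n"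
  shows "[card E = card {x \<in> E. \<forall>g\<in>carrier G. act g x = x}] (mod p)"
proof -
  have "[card A = card {x \<in> A. \<forall>g\<in>carrier G. act g x = x}] (mod p)"
    if "A \<subseteq> E" "\<forall>g\<in>carrier G. \<forall>x\<in>A. act g x \<in> A" for A
    using that
  proof (induction rule: orbit_induct)
    case (orbit A x)
    let ?fix = "\<lambda>A. {x \<in> A. \<forall>g\<in>carrier G. act g x = x}"
    have fin: "finite A" "finite (orb x)"
      using orbit finite_E orb_subset by (meson finite_subset)+
    have "[card (orb x) = card (?fix (orb x))] (mod p)"
    proof (cases "?fix (orb x) = {}")
      case False
      then obtain y where y: "y \<in> orb x" "\<forall>g\<in>carrier G. act g y = y" by blast
      then have yE: "y \<in> E" using orb_subset orbit by blast
      have "stabilizes y = carrier G" using y by (auto simp: stabilizes_def)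
      then have "card (stabilizes x) = card (carrier G)"
        using card_stabilizes_orb orbit y by metis
      moreover have "card (carrier G) \<noteq> 0" using finite_G by auto
      ultimately have "card (orb x) = 1" using orbit_stabilizer[OF orbit(2)] by auto
      then have "orb x = {y}" using y by (metis card_1_singletonE singletonD)
      then have "?fix (orb x) = orb x" using y by auto
      then show ?thesis by simp
    next
      case True
      have "card (orb x) dvd p ^ n"
        using orbit_stabilizer[OF orbit(2)] assms(2) by (metis dvd_triv_left)
      then obtain i where i: "card (orb x) = p ^ i" using assms(1) divides_primepow_nat by blast
      have "i \<noteq> 0"
      proof
        assume "i = 0"
        then have "orb x = {x}" using i orb_self[OF orbit(2)] by (metis card_1_singletonE power_0 singletonD)
        then have "x \<in> ?fix (orb x)" by (auto simp: orb_def)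
        then show False using True by blast
      qed
      then have "p dvd card (orb x)" using i by simp
      then show ?thesis by (simp only: True) (simp add: cong_def)
    qed
    moreover have "?fix (A \<union> orb x) = ?fix A \<union> ?fix (orb x)" by blast
    moreover have "card (?fix A \<union> ?fix (orb x)) = card (?fix A) + card (?fix (orb x))"
      using fin orbit by (intro card_Un_disjoint) auto
    moreover have "card (A \<union> orb x) = card A + card (orb x)"
      using fin orbit by (intro card_Un_disjoint) auto
    ultimately show ?case using orbit by (simp add: cong_add)
  qed simp
  then show ?thesis using act_closed by blast
qed

end


section \<open>The localized integers\<close>

lemma Z_loc_iff: "x \<in> carrier (Z_loc p) \<longleftrightarrow>
    (\<exists>a b. x = of_int a / of_int b \<and> \<not> int p dvd b)"
  by (auto simp: Z_loc_def)

lemma Z_loc_add: "prime p \<Longrightarrow> x \<in> carrier (Z_loc p) \<Longrightarrow> y \<in> carrier (Z_loc p) \<Longrightarrow>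
    x + y \<in> carrier (Z_loc p)"
proof -
  assume p: "prime p" and "x \<in> carrier (Z_loc p)" "y \<in> carrier (Z_loc p)"
  then obtain a b c d where "x = of_int a / of_int b" "y = of_int c / of_int d"
    and n: "\<not> int p dvd b" "\<not> int p dvd d" by (auto simp: Z_loc_iff)
  moreover have "b \<noteq> 0" "d \<noteq> 0" using n by auto
  ultimately have "x + y = of_int (a * d + c * b) / of_int (b * d)"
    by (simp add: add_frac_eq)
  moreover have "\<not> int p dvd b * d" using n p by (simp add: prime_dvd_mult_iff)
  ultimately show ?thesis unfolding Z_loc_iff by blast
qed

lemma Z_loc_mult: "prime p \<Longrightarrow> x \<in> carrier (Z_loc p) \<Longrightarrow> y \<in> carrier (Z_loc p) \<Longrightarrow>
    x * y \<in> carrier (Z_loc p)"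
proof -
  assume p: "prime p" and "x \<in> carrier (Z_loc p)" "y \<in> carrier (Z_loc p)"
  then obtain a b c d where "x = of_int a / of_int b" "y = of_int c / of_int d"
    and n: "\<not> int p dvd b" "\<not> int p dvd d" by (auto simp: Z_loc_def)
  then have "x * y = of_int (a * c) / of_int (b * d)" by simp
  moreover have "\<not> int p dvd b * d" using n p by (simp add: prime_dvd_mult_iff)
  ultimately show ?thesis unfolding Z_loc_iff by blast
qed

lemma Z_loc_of_int: "prime p \<Longrightarrow> of_int a \<in> carrier (Z_loc p)"
proof -
  assume "prime p"
  then have "\<not> int p dvd 1" by auto
  moreover have "(of_int a :: rat) = of_int a / of_int 1" by simp
  ultimately show ?thesis unfolding Z_loc_iff by blast
qed

lemma Z_loc_of_nat: "prime p \<Longrightarrow> of_nat a \<in> carrier (Z_loc p)"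
  using Z_loc_of_int[of p "int a"] by simp

lemma Z_loc_0: "prime p \<Longrightarrow> 0 \<in> carrier (Z_loc p)" and Z_loc_1: "prime p \<Longrightarrow> 1 \<in> carrier (Z_loc p)"
  using Z_loc_of_int[of p 0] Z_loc_of_int[of p 1] by simp_all

lemma Z_loc_uminus: "prime p \<Longrightarrow> x \<in> carrier (Z_loc p) \<Longrightarrow> - x \<in> carrier (Z_loc p)"
  using Z_loc_mult[of p "-1" x] Z_loc_of_int[of p "-1"] by simp

lemma Z_loc_diff: "prime p \<Longrightarrow> x \<in> carrier (Z_loc p) \<Longrightarrow> y \<in> carrier (Z_loc p) \<Longrightarrow>
    x - y \<in> carrier (Z_loc p)"
  using Z_loc_add[of p x "- y"] Z_loc_uminus[of p y] by simp

lemma Z_loc_sum: "prime p \<Longrightarrow> (\<And>x. x \<in> A \<Longrightarrow> f x \<in> carrier (Z_loc p)) \<Longrightarrow> sum f A \<in> carrier (Z_loc p)"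
  by (induction A rule: infinite_finite_induct) (auto simp: Z_loc_0 Z_loc_add)

lemma Z_loc_power: "prime p \<Longrightarrow> x \<in> carrier (Z_loc p) \<Longrightarrow> x ^ n \<in> carrier (Z_loc p)"
  by (induction n) (auto simp: Z_loc_1 Z_loc_mult)

section \<open>Stabilizers of points of a biset\<close>

text \<open>With \<open>(h,g).x = h x g\<^sup>-\<^sup>1\<close> this is the stabilizer of \<open>x\<close> in \<open>H \<times> G\<close>; the equation avoids the inverse,
  which makes stabilizers of composites relational composites.\<close>

definition stab ::
  "('g, 'm) monoid_scheme \<Rightarrow> ('h, 'n) monoid_scheme \<Rightarrow> ('x, 'g, 'h) biset \<Rightarrow> 'x \<Rightarrow> ('h \<times> 'g) set"
  where "stab G H X x = {(h, g). h \<in> carrier H \<and> g \<in> carrier G \<and> lact X h x = ract X x g}"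

definition stab_count ::
  "('g, 'm) monoid_scheme \<Rightarrow> ('h, 'n) monoid_scheme \<Rightarrow> ('x, 'g, 'h) biset \<Rightarrow> ('h \<times> 'g) set \<Rightarrow> nat"
  where "stab_count G H X D = card {x \<in> points X. stab G H X x = D}"

definition formal_count ::
  "('g, 'm) monoid_scheme \<Rightarrow> ('h, 'n) monoid_scheme \<Rightarrow> ('g, 'h) formal \<Rightarrow> ('h \<times> 'g) set \<Rightarrow> rat"
  where "formal_count G H f D =
    (\<Sum>X\<in>Poly_Mapping.keys f. Poly_Mapping.lookup f X * of_nat (stab_count G H X D))"

text \<open>A biset as a left \<open>(H \<times> G)\<close>-set.\<close>

definition biset_act ::
  "('g, 'm) monoid_scheme \<Rightarrow> ('x, 'g, 'h) biset \<Rightarrow> 'h \<times> 'g \<Rightarrow> 'x \<Rightarrow> 'x"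
  where "biset_act G X z x = lact X (fst z) (ract X x (inv\<^bsub>G\<^esub> (snd z)))"

lemma formal_count_superset:
  assumes "finite T" "Poly_Mapping.keys f \<subseteq> T"
  shows "formal_count G H f D = (\<Sum>X\<in>T. Poly_Mapping.lookup f X * of_nat (stab_count G H X D))"
  unfolding formal_count_def
  by (rule sum.mono_neutral_left) (use assms in \<open>auto simp: in_keys_iff\<close>)

lemma formal_count_add: "formal_count G H (f + g) D = formal_count G H f D + formal_count G H g D"
proof -
  let ?T = "Poly_Mapping.keys f \<union> Poly_Mapping.keys g"
  have "Poly_Mapping.keys (f + g) \<subseteq> ?T" by (rule Poly_Mapping.keys_add)
  then show ?thesis
    by (simp add: formal_count_superset[of ?T] lookup_add sum.distrib distrib_right)
qed

lemma lookup_formal_scale: "Poly_Mapping.lookup (formal_scale c f) X = c * Poly_Mapping.lookup f X"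
  by (simp add: Poly_Mapping.map.rep_eq when_def)

lemma keys_formal_scale: "Poly_Mapping.keys (formal_scale c f) \<subseteq> Poly_Mapping.keys f"
  by (auto simp: in_keys_iff lookup_formal_scale)

lemma formal_count_scale: "formal_count G H (formal_scale c f) D = c * formal_count G H f D"
  using formal_count_superset[of "Poly_Mapping.keys f" "formal_scale c f" G H D]
  by (simp add: keys_formal_scale lookup_formal_scale formal_count_def sum_distrib_left mult.assoc)

lemma formal_scale_minus_one: "formal_scale (- 1) f = - f"
  by (rule poly_mapping_eqI) (simp add: lookup_formal_scale)

lemma formal_count_uminus: "formal_count G H (- f) D = - formal_count G H f D"
  using formal_count_scale[of G H "-1" f D] by (simp add: formal_scale_minus_one)

lemma formal_count_diff: "formal_count G H (f - g) D = formal_count G H f D - formal_count G H g D"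
  using formal_count_add[of G H f "- g" D] by (simp add: formal_count_uminus)

lemma formal_count_zero: "formal_count G H 0 D = 0"
  by (simp add: formal_count_def)

lemma formal_count_single: "formal_count G H (Poly_Mapping.single X c) D = c * of_nat (stab_count G H X D)"
  by (simp add: formal_count_superset[of "{X}"])

lemma formal_count_sum: "formal_count G H (sum f A) D = (\<Sum>i\<in>A. formal_count G H (f i) D)"
  by (induction A rule: infinite_finite_induct) (auto simp: formal_count_zero formal_count_add)

lemma stab_isomorphism:
  assumes "\<forall>x\<in>points X. (\<forall>h\<in>carrier H. f (lact X h x) = lact Y h (f x)) \<and>
                  (\<forall>g\<in>carrier G. f (ract X x g) = ract Y (f x) g)"
    and "is_biset G H X" "inj_on f (points X)" "x \<in> points X"
  shows "stab G H Y (f x) = stab G H X x"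
proof -
  have "lact Y h (f x) = ract Y (f x) g \<longleftrightarrow> lact X h x = ract X x g"
    if "h \<in> carrier H" "g \<in> carrier G" for h g
  proof -
    have "lact Y h (f x) = f (lact X h x)" "ract Y (f x) g = f (ract X x g)"
      using assms that by auto
    moreover have "lact X h x \<in> points X" "ract X x g \<in> points X"
      using assms that by (auto simp: is_biset_def)
    ultimately show ?thesis using assms(3) by (auto simp: inj_on_def)
  qed
  then show ?thesis by (auto simp: stab_def)
qed

lemma stab_count_isomorphic:
  assumes "biset_isomorphic G H X Y" "is_biset G H X"
  shows "stab_count G H X D = stab_count G H Y D"
proof -
  obtain f where f: "bij_betw f (points X) (points Y)"
    and eq: "\<forall>x\<in>points X. (\<forall>h\<in>carrier H. f (lact X h x) = lact Y h (f x)) \<and>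
                  (\<forall>g\<in>carrier G. f (ract X x g) = ract Y (f x) g)"
    using assms by (auto simp: biset_isomorphic_def)
  have st: "stab G H Y (f x) = stab G H X x" if "x \<in> points X" for x
    using stab_isomorphism[OF eq assms(2) _ that] f by (auto simp: bij_betw_def)
  have "f ` {x \<in> points X. stab G H X x = D} = {x \<in> points Y. stab G H Y x = D}"
  proof -
    have pY: "points Y = f ` points X" using f by (simp add: bij_betw_def)
    show ?thesis unfolding pY using st by auto
  qed
  then have "bij_betw f {x \<in> points X. stab G H X x = D} {x \<in> points Y. stab G H Y x = D}"
    using f unfolding bij_betw_def by (auto simp: inj_on_def)
  then show ?thesis unfolding stab_count_def by (rule bij_betw_same_card)
qed

lemma stab_count_sum:
  assumes "is_biset G H X" "is_biset G H Y"
  shows "stab_count G H (biset_sum X Y) D = stab_count G H X D + stab_count G H Y D"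
proof -
  have "stab G H (biset_sum X Y) (Inl x) = stab G H X x" for x
    by (auto simp: stab_def biset_sum_def)
  moreover have "stab G H (biset_sum X Y) (Inr x) = stab G H Y x" for x
    by (auto simp: stab_def biset_sum_def)
  ultimately have "{z \<in> points (biset_sum X Y). stab G H (biset_sum X Y) z = D} =
     {x \<in> points X. stab G H X x = D} <+> {x \<in> points Y. stab G H Y x = D}"
    by (auto simp: biset_sum_def)
  then show ?thesis unfolding stab_count_def
    using assms by (simp add: card_Plus is_biset_def)
qed

lemma biset_isomorphic_refl: "biset_isomorphic G H X X"
  unfolding biset_isomorphic_def by (rule exI[of _ id]) auto

lemma biset_isomorphic_sym:
  assumes "biset_isomorphic G H X Y" "is_biset G H X"
  shows "biset_isomorphic G H Y X"
proof -
  obtain f where f: "bij_betw f (points X) (points Y)"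
    and eq: "\<forall>x\<in>points X. (\<forall>h\<in>carrier H. f (lact X h x) = lact Y h (f x)) \<and>
                  (\<forall>g\<in>carrier G. f (ract X x g) = ract Y (f x) g)"
    using assms by (auto simp: biset_isomorphic_def)
  let ?f = "inv_into (points X) f"
  have inv: "?f (f x) = x" if "x \<in> points X" for x
    using f that by (auto simp: bij_betw_def)
  have "?f (lact Y h y) = lact X h (?f y)" if y: "y \<in> points Y" "h \<in> carrier H" for y h
  proof -
    obtain x where x: "x \<in> points X" "y = f x" using f y unfolding bij_betw_def by blast
    have "lact X h x \<in> points X" using assms(2) that x by (auto simp: is_biset_def)
    then show ?thesis using x y that eq inv by metis
  qed
  moreover have "?f (ract Y y g) = ract X (?f y) g" if y: "y \<in> points Y" "g \<in> carrier G" for y g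
  proof -
    obtain x where x: "x \<in> points X" "y = f x" using f y unfolding bij_betw_def by blast
    have "ract X x g \<in> points X" using assms(2) that x by (auto simp: is_biset_def)
    then show ?thesis using x y that eq inv by metis
  qed
  ultimately show ?thesis unfolding biset_isomorphic_def
    using bij_betw_inv_into[OF f] by blast
qed

lemma biset_isomorphic_trans:
  assumes "biset_isomorphic G H X Y" "biset_isomorphic G H Y W"
  shows "biset_isomorphic G H X W"
proof -
  obtain f where f: "bij_betw f (points X) (points Y)"
    "\<forall>x\<in>points X. (\<forall>h\<in>carrier H. f (lact X h x) = lact Y h (f x)) \<and>
                  (\<forall>g\<in>carrier G. f (ract X x g) = ract Y (f x) g)"
    using assms by (auto simp: biset_isomorphic_def)
  obtain f' where f': "bij_betw f' (points Y) (points W)"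
    "\<forall>x\<in>points Y. (\<forall>h\<in>carrier H. f' (lact Y h x) = lact W h (f' x)) \<and>
                  (\<forall>g\<in>carrier G. f' (ract Y x g) = ract W (f' x) g)"
    using assms by (auto simp: biset_isomorphic_def)
  have "f x \<in> points Y" if "x \<in> points X" for x using that f by (auto simp: bij_betw_def)
  then show ?thesis unfolding biset_isomorphic_def
    using f f' bij_betw_trans[OF f(1) f'(1)] by (intro exI[of _ "f' \<circ> f"]) auto
qed

text \<open>Generators of the Burnside module have natural numbers as points, whereas constructions such as the
  tensor product produce points of other types; finiteness bridges the gap.\<close>

lemma biset_nat_copy:
  assumes "is_biset G H X"
  shows "\<exists>Y :: (nat, 'g, 'h) biset. is_biset G H Y \<and> biset_isomorphic G H (X :: ('x,'g,'h) biset) Y"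
proof -
  have fin: "finite (points X)" using assms by (simp add: is_biset_def)
  obtain f :: "'x \<Rightarrow> nat" where f: "inj_on f (points X)"
    using finite_imp_inj_to_nat_seg[OF fin] by blast
  let ?i = "inv_into (points X) f"
  define Y where "Y = \<lparr>points = f ` points X, lact = (\<lambda>h y. f (lact X h (?i y))),
     ract = (\<lambda>y g. f (ract X (?i y) g))\<rparr>"
  have i: "?i (f x) = x" if "x \<in> points X" for x using f that by simp
  have "is_biset G H Y"
    using assms unfolding is_biset_def Y_def by (auto simp: i)
  moreover have "biset_isomorphic G H X Y"
    unfolding biset_isomorphic_def Y_def
    by (rule exI[of _ f]) (auto simp: i f bij_betw_def)
  ultimately show ?thesis by blast
qed

lemma formal_gen_nat:
  assumes "is_biset G H (X :: ('x,'g,'h) biset)"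
  obtains Y :: "(nat, 'g, 'h) biset" where "is_biset G H Y" "biset_isomorphic G H X Y"
    "formal_gen G H X = Poly_Mapping.single Y 1"
proof -
  let ?Y = "SOME Y :: (nat, 'g, 'h) biset. is_biset G H Y \<and> biset_isomorphic G H X Y"
  have "is_biset G H ?Y \<and> biset_isomorphic G H X ?Y"
    using someI_ex[OF biset_nat_copy[OF assms]] .
  then show thesis by (intro that[of ?Y]) (simp_all add: formal_gen_def)
qed

lemma formal_count_gen:
  assumes "is_biset G H X"
  shows "formal_count G H (formal_gen G H X) D = of_nat (stab_count G H X D)"
  using formal_gen_nat[OF assms] stab_count_isomorphic[OF _ assms]
  by (metis formal_count_single mult_1)


section \<open>Stabilizer counts determine an element\<close>

definition transitive ::
  "('g, 'm) monoid_scheme \<Rightarrow> ('h, 'n) monoid_scheme \<Rightarrow> ('x, 'g, 'h) biset \<Rightarrow> bool"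
  where "transitive G H X \<longleftrightarrow> is_biset G H X \<and>
    (\<exists>x\<in>points X. points X \<subseteq> (\<lambda>z. biset_act G X z x) ` carrier (H \<times>\<times> G))"

text \<open>One biset from each isomorphism class of transitive bisets: isomorphic bisets satisfy the same
  choice predicate.\<close>

definition canonical ::
  "('g, 'm) monoid_scheme \<Rightarrow> ('h, 'n) monoid_scheme \<Rightarrow> (nat, 'g, 'h) biset \<Rightarrow> (nat, 'g, 'h) biset"
  where "canonical G H X = (SOME Y. transitive G H Y \<and> biset_isomorphic G H X Y)"

locale two_groups = G: group G + H: group H
  for p :: nat and G :: "('g, 'm) monoid_scheme" and H :: "('h, 'n) monoid_scheme" +
  assumes prime_p: "prime p" and fin_G: "finite (carrier G)" and fin_H: "finite (carrier H)"
begin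

sublocale HG: group "H \<times>\<times> G" by (rule DirProd_group[OF H.is_group G.is_group])

lemma fin_HG: "finite (carrier (H \<times>\<times> G))" using fin_G fin_H by simp

lemma biset_action:
  assumes "is_biset G H X"
  shows "finite_action (H \<times>\<times> G) (points X) (biset_act G X)"
proof
  show "finite (points X)" using assms by (simp add: is_biset_def)
next
  fix z w x assume "z \<in> carrier (H \<times>\<times> G)" "w \<in> carrier (H \<times>\<times> G)" "x \<in> points X"
  moreover then have "ract X (ract X x (inv\<^bsub>G\<^esub> snd w)) (inv\<^bsub>G\<^esub> snd z) \<in> points X"
     "ract X x (inv\<^bsub>G\<^esub> snd w) \<in> points X" using assms by (auto simp: is_biset_def)
  ultimately show "biset_act G X (z \<otimes>\<^bsub>H \<times>\<times> G\<^esub> w) x = biset_act G X z (biset_act G X w x)"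
    using assms by (cases z; cases w) (auto simp: is_biset_def biset_act_def G.inv_mult_group)
qed (use assms fin_HG in \<open>auto simp: is_biset_def biset_act_def\<close>)

lemma act_eq_iff_stab:
  assumes "is_biset G H X" "x \<in> points X" "h \<in> carrier H" "g \<in> carrier G"
  shows "biset_act G X (h, g) x = x \<longleftrightarrow> (h, g) \<in> stab G H X x"
proof -
  have 1: "ract X (biset_act G X (h, g) x) g = lact X h x"
  proof -
    have "ract X (lact X h (ract X x (inv\<^bsub>G\<^esub> g))) g = lact X h (ract X (ract X x (inv\<^bsub>G\<^esub> g)) g)"
      using assms by (auto simp: is_biset_def)
    also have "ract X (ract X x (inv\<^bsub>G\<^esub> g)) g = ract X x (inv\<^bsub>G\<^esub> g \<otimes>\<^bsub>G\<^esub> g)"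
      using assms G.inv_closed unfolding is_biset_def by metis
    also have "\<dots> = x" using assms by (auto simp: is_biset_def)
    finally show ?thesis by (simp add: biset_act_def)
  qed
  have 2: "biset_act G X (h, g) x = x" if "lact X h x = ract X x g"
  proof -
    have "biset_act G X (h, g) x = ract X (lact X h x) (inv\<^bsub>G\<^esub> g)"
      using assms by (auto simp: is_biset_def biset_act_def)
    also have "\<dots> = ract X x (g \<otimes>\<^bsub>G\<^esub> inv\<^bsub>G\<^esub> g)"
      using assms that G.inv_closed unfolding is_biset_def by metis
    finally show ?thesis using assms by (auto simp: is_biset_def)
  qed
  show ?thesis using 1 2 assms by (auto simp: stab_def)
qed

lemma stab_eq_stabilizes:
  assumes "is_biset G H X" "x \<in> points X"
  shows "finite_action.stabilizes (H \<times>\<times> G) (biset_act G X) x = stab G H X x"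
proof -
  interpret finite_action "H \<times>\<times> G" "points X" "biset_act G X" by (rule biset_action[OF assms(1)])
  show ?thesis using act_eq_iff_stab[OF assms] by (auto simp: stabilizes_def stab_def)
qed

lemma stab_subgroup: "is_biset G H X \<Longrightarrow> x \<in> points X \<Longrightarrow> subgroup (stab G H X x) (H \<times>\<times> G)"
  using finite_action.subgroup_stabilizes[OF biset_action] stab_eq_stabilizes by metis

lemma stab_act:
  assumes "is_biset G H X" "x \<in> points X" "z \<in> carrier (H \<times>\<times> G)"
  shows "stab G H X (biset_act G X z x) =
    (\<lambda>w. z \<otimes>\<^bsub>H \<times>\<times> G\<^esub> w \<otimes>\<^bsub>H \<times>\<times> G\<^esub> inv\<^bsub>H \<times>\<times> G\<^esub> z) ` stab G H X x"
  using finite_action.stabilizes_act[OF biset_action[OF assms(1)] assms(2,3)]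
    stab_eq_stabilizes[OF assms(1)] assms finite_action.act_closed[OF biset_action[OF assms(1)]]
  by metis

lemma lact_as_act: "is_biset G H X \<Longrightarrow> x \<in> points X \<Longrightarrow> lact X h x = biset_act G X (h, \<one>\<^bsub>G\<^esub>) x"
  by (simp add: biset_act_def is_biset_def)

lemma ract_as_act: "is_biset G H X \<Longrightarrow> x \<in> points X \<Longrightarrow> g \<in> carrier G \<Longrightarrow>
    ract X x g = biset_act G X (\<one>\<^bsub>H\<^esub>, inv\<^bsub>G\<^esub> g) x"
  by (simp add: biset_act_def is_biset_def)

lemma transitive_from:
  assumes "transitive G H X" "x \<in> points X"
  shows "points X = (\<lambda>z. biset_act G X z x) ` carrier (H \<times>\<times> G)"
proof -
  have X: "is_biset G H X" using assms by (simp add: transitive_def)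
  interpret finite_action "H \<times>\<times> G" "points X" "biset_act G X" by (rule biset_action[OF X])
  obtain x0 where x0: "x0 \<in> points X" "points X \<subseteq> orb x0"
    using assms by (auto simp: transitive_def orb_def)
  obtain k where k: "k \<in> carrier (H \<times>\<times> G)" "x = biset_act G X k x0"
    using x0 assms unfolding orb_def by blast
  have "points X \<subseteq> orb x"
  proof
    fix y assume "y \<in> points X"
    then obtain z where z: "z \<in> carrier (H \<times>\<times> G)" "y = biset_act G X z x0"
      using x0 unfolding orb_def by blast
    have "y = biset_act G X (z \<otimes>\<^bsub>H \<times>\<times> G\<^esub> inv\<^bsub>H \<times>\<times> G\<^esub> k) x"
      using z k x0 by (metis HG.inv_closed act_closed act_inv act_mult)
    then show "y \<in> orb x" using z k unfolding orb_def by blast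
  qed
  then show ?thesis using orb_subset[OF assms(2)] unfolding orb_def by blast
qed

text \<open>Both bisets are isomorphic to the cosets of the common stabilizer: \<open>z.x \<mapsto> z.y\<close> is well defined and
  injective because \<open>z.x\<close> and \<open>z.y\<close> depend on \<open>z\<close> through the same cosets.\<close>

lemma transitive_isomorphic:
  assumes "transitive G H X" "transitive G H Y" "x \<in> points X" "y \<in> points Y"
    "stab G H X x = stab G H Y y"
  shows "biset_isomorphic G H X Y"
proof -
  have bX: "is_biset G H X" and bY: "is_biset G H Y" using assms by (auto simp: transitive_def)
  interpret X: finite_action "H \<times>\<times> G" "points X" "biset_act G X" by (rule biset_action[OF bX])
  interpret Y: finite_action "H \<times>\<times> G" "points Y" "biset_act G Y" by (rule biset_action[OF bY])
  let ?C = "carrier (H \<times>\<times> G)"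
  have key: "biset_act G X z x = biset_act G X w x \<longleftrightarrow> biset_act G Y z y = biset_act G Y w y"
    if "z \<in> ?C" "w \<in> ?C" for z w
  proof -
    have "X.stabilizes x = Y.stabilizes y"
      using assms stab_eq_stabilizes[OF bX] stab_eq_stabilizes[OF bY] by simp
    then show ?thesis
      using X.act_eq_iff[OF assms(3) that] Y.act_eq_iff[OF assms(4) that] by simp
  qed
  define f where "f u = biset_act G Y (SOME z. z \<in> ?C \<and> u = biset_act G X z x) y" for u
  have f: "f (biset_act G X z x) = biset_act G Y z y" if z: "z \<in> ?C" for z
  proof -
    let ?w = "SOME w. w \<in> ?C \<and> biset_act G X z x = biset_act G X w x"
    have "\<exists>w. w \<in> ?C \<and> biset_act G X z x = biset_act G X w x" using z by blast
    from someI_ex[OF this] have w: "?w \<in> ?C" "biset_act G X z x = biset_act G X ?w x" by auto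
    have "biset_act G Y z y = biset_act G Y ?w y" using key[OF z w(1)] w(2) by (rule iffD1)
    then show ?thesis by (simp only: f_def)
  qed
  have pX: "points X = (\<lambda>z. biset_act G X z x) ` ?C" and pY: "points Y = (\<lambda>z. biset_act G Y z y) ` ?C"
    by (rule transitive_from[OF assms(1,3)], rule transitive_from[OF assms(2,4)])
  have "inj_on f (points X)"
  proof (rule inj_onI)
    fix u v assume "u \<in> points X" "v \<in> points X" and fuv: "f u = f v"
    then obtain z w where zw: "z \<in> ?C" "u = biset_act G X z x" "w \<in> ?C" "v = biset_act G X w x"
      unfolding pX by blast
    then have "biset_act G Y z y = biset_act G Y w y" using fuv f by simp
    then show "u = v" using key[OF zw(1,3)] zw by blast
  qed
  moreover have "f ` points X = points Y"
    unfolding pX pY image_image by (rule image_cong[OF refl f])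
  ultimately have "bij_betw f (points X) (points Y)" by (simp add: bij_betw_def)
  moreover have eq: "f (biset_act G X w u) = biset_act G Y w (f u)" if u: "u \<in> points X" "w \<in> ?C" for u w
  proof -
    obtain z where z: "z \<in> ?C" "u = biset_act G X z x" using u pX by blast
    have "f (biset_act G X w u) = f (biset_act G X (w \<otimes>\<^bsub>H \<times>\<times> G\<^esub> z) x)"
      using X.act_mult[OF u(2) z(1) assms(3)] z(2) by simp
    also have "\<dots> = biset_act G Y (w \<otimes>\<^bsub>H \<times>\<times> G\<^esub> z) y" by (rule f[OF HG.m_closed[OF u(2) z(1)]])
    also have "\<dots> = biset_act G Y w (biset_act G Y z y)" by (rule Y.act_mult[OF u(2) z(1) assms(4)])
    finally show ?thesis using f[OF z(1)] z(2) by simp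
  qed
  moreover have "f u \<in> points Y" if "u \<in> points X" for u
    using calculation(1) that by (auto simp: bij_betw_def)
  ultimately show ?thesis unfolding biset_isomorphic_def
    using lact_as_act[OF bX] ract_as_act[OF bX] lact_as_act[OF bY] ract_as_act[OF bY]
    by (intro exI[of _ f]) simp
qed

lemma restrict_biset:
  assumes "is_biset G H X" "A \<subseteq> points X"
    "\<forall>z\<in>carrier (H \<times>\<times> G). \<forall>x\<in>A. biset_act G X z x \<in> A"
  shows "is_biset G H (X\<lparr>points := A\<rparr>)"
proof -
  have "lact X h x \<in> A" if "h \<in> carrier H" "x \<in> A" for h x
  proof -
    have "biset_act G X (h, \<one>\<^bsub>G\<^esub>) x \<in> A" using that assms(3) by auto
    then show ?thesis using lact_as_act[OF assms(1)] that assms(2) by (metis subsetD)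
  qed
  moreover have "ract X x g \<in> A" if "g \<in> carrier G" "x \<in> A" for g x
  proof -
    have "biset_act G X (\<one>\<^bsub>H\<^esub>, inv\<^bsub>G\<^esub> g) x \<in> A" using that assms(3) by auto
    then show ?thesis using ract_as_act[OF assms(1)] that assms(2) by (metis subsetD)
  qed
  moreover have "finite A" using assms by (auto simp: is_biset_def intro: finite_subset)
  ultimately show ?thesis using assms(1,2) by (auto simp: is_biset_def subset_iff)
qed

lemma canonical:
  assumes "transitive G H X"
  shows "transitive G H (canonical G H X)" "biset_isomorphic G H X (canonical G H X)"
proof -
  have "transitive G H (canonical G H X) \<and> biset_isomorphic G H X (canonical G H X)"
    unfolding canonical_def by (rule someI[of _ X]) (simp add: assms biset_isomorphic_refl)
  then show "transitive G H (canonical G H X)" "biset_isomorphic G H X (canonical G H X)" by auto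
qed

lemma canonical_eq:
  assumes "transitive G H X" "transitive G H Y" "biset_isomorphic G H X Y"
  shows "canonical G H X = canonical G H Y"
proof -
  have "biset_isomorphic G H X W \<longleftrightarrow> biset_isomorphic G H Y W" for W :: "(nat, 'g, 'h) biset"
    using assms biset_isomorphic_sym biset_isomorphic_trans unfolding transitive_def by metis
  then show ?thesis by (simp add: canonical_def)
qed

abbreviation "rels \<equiv> biset_relations p G H"

lemma rels_uminus: "f \<in> rels \<Longrightarrow> - f \<in> rels"
  using biset_relations.scale[of "-1" p f G H] Z_loc_of_int[OF prime_p, of "-1"]
  by (simp add: formal_scale_minus_one)

lemma formal_bisets_add: "f \<in> formal_bisets p G H \<Longrightarrow> g \<in> formal_bisets p G H \<Longrightarrow> f + g \<in> formal_bisets p G H"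
  using Poly_Mapping.keys_add[of f g]
  by (auto simp: formal_bisets_def lookup_add Z_loc_add[OF prime_p])

lemma formal_bisets_scale: "c \<in> carrier (Z_loc p) \<Longrightarrow> f \<in> formal_bisets p G H \<Longrightarrow> formal_scale c f \<in> formal_bisets p G H"
  using keys_formal_scale[of c f]
  by (auto simp: formal_bisets_def lookup_formal_scale Z_loc_mult[OF prime_p])

lemma formal_bisets_single: "is_biset G H X \<Longrightarrow> c \<in> carrier (Z_loc p) \<Longrightarrow> Poly_Mapping.single X c \<in> formal_bisets p G H"
  by (auto simp: formal_bisets_def lookup_single when_def Z_loc_0[OF prime_p])

lemma formal_bisets_zero: "0 \<in> formal_bisets p G H"
  by (auto simp: formal_bisets_def Z_loc_0[OF prime_p])

lemma formal_bisets_uminus: "f \<in> formal_bisets p G H \<Longrightarrow> - f \<in> formal_bisets p G H"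
  using formal_bisets_scale[of "-1" f] Z_loc_of_int[OF prime_p, of "-1"]
  by (simp add: formal_scale_minus_one)

lemma formal_bisets_diff: "f \<in> formal_bisets p G H \<Longrightarrow> g \<in> formal_bisets p G H \<Longrightarrow> f - g \<in> formal_bisets p G H"
  using formal_bisets_add[of f "- g"] formal_bisets_uminus[of g] by simp

lemma formal_bisets_sum: "(\<And>i. i \<in> A \<Longrightarrow> f i \<in> formal_bisets p G H) \<Longrightarrow> sum f A \<in> formal_bisets p G H"
  by (induction A rule: infinite_finite_induct) (auto simp: formal_bisets_zero formal_bisets_add)

lemma formal_gen_closed: "is_biset G H X \<Longrightarrow> formal_gen G H X \<in> formal_bisets p G H"
  using formal_gen_nat[of G H X] formal_bisets_single Z_loc_1[OF prime_p] by metis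

lemma formal_count_rels: "f \<in> rels \<Longrightarrow> formal_count G H f D = 0"
proof (induction rule: biset_relations.induct)
  case (sum X Y Z)
  then show ?case
    by (simp add: formal_count_diff formal_count_single stab_count_sum stab_count_isomorphic)
qed (auto simp: formal_count_zero formal_count_diff formal_count_single formal_count_add
    formal_count_scale stab_count_isomorphic)

definition canonicals :: "(nat, 'g, 'h) biset set"
  where "canonicals = canonical G H ` {X. transitive G H X}"

text \<open>Modulo the relations a biset is the sum of its orbits, and each orbit may be replaced by its canonical
  isomorphic copy.\<close>

lemma decompose_biset:
  assumes "is_biset G H (X :: (nat, 'g, 'h) biset)"
  shows "\<exists>g\<in>formal_bisets p G H. Poly_Mapping.keys g \<subseteq> canonicals \<and> Poly_Mapping.single X 1 - g \<in> rels"
proof -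
  interpret finite_action "H \<times>\<times> G" "points X" "biset_act G X" by (rule biset_action[OF assms])
  let ?C = "carrier (H \<times>\<times> G)"
  let ?Q = "\<lambda>A. (\<forall>z\<in>?C. \<forall>x\<in>A. biset_act G X z x \<in> A) \<and> (\<exists>g\<in>formal_bisets p G H.
    Poly_Mapping.keys g \<subseteq> canonicals \<and> Poly_Mapping.single (X\<lparr>points := A\<rparr>) 1 - g \<in> rels)"
  have "?Q A" if "A \<subseteq> points X" "\<forall>z\<in>?C. \<forall>x\<in>A. biset_act G X z x \<in> A" for A
    using that
  proof (induction rule: orbit_induct)
    case empty
    let ?E = "X\<lparr>points := {}\<rparr>"
    have E: "is_biset G H ?E" using assms by (simp add: is_biset_def)
    \<comment> \<open>The empty biset is its own double, so its class is zero.\<close>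
    have "biset_isomorphic G H ?E (biset_sum ?E ?E)"
      by (auto simp: biset_isomorphic_def biset_sum_def bij_betw_def)
    from biset_relations.sum[OF E E E this, of p] have "- Poly_Mapping.single ?E 1 \<in> rels" by simp
    from rels_uminus[OF this] have "Poly_Mapping.single ?E 1 - 0 \<in> rels" by simp
    then show ?case using formal_bisets_zero by (intro conjI bexI[of _ 0]) auto
  next
    case (orbit A x)
    let ?U = "X\<lparr>points := A \<union> orb x\<rparr>" and ?A = "X\<lparr>points := A\<rparr>" and ?O = "X\<lparr>points := orb x\<rparr>"
    have inv: "\<forall>z\<in>?C. \<forall>u\<in>orb x. biset_act G X z u \<in> orb x" using orb_closed orbit by blast
    have invU: "\<forall>z\<in>?C. \<forall>u\<in>A \<union> orb x. biset_act G X z u \<in> A \<union> orb x" using inv orbit by blast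
    have bs: "is_biset G H ?U" "is_biset G H ?A" "is_biset G H ?O"
      using orbit orb_subset[OF orbit(2)] inv invU by (auto intro!: restrict_biset[OF assms])
    have act: "biset_act G (X\<lparr>points := B\<rparr>) = biset_act G X" for B
      by (simp add: biset_act_def fun_eq_iff)
    have tO: "transitive G H ?O"
      unfolding transitive_def using bs(3) orb_self[OF orbit(2)]
      by (intro conjI bexI[of _ x]) (simp_all add: act orb_def)
    have "biset_isomorphic G H ?U (biset_sum ?A ?O)"
      unfolding biset_isomorphic_def
    proof (intro exI[of _ "\<lambda>u. if u \<in> A then Inl u else Inr u"] conjI ballI)
      show "bij_betw (\<lambda>u. if u \<in> A then Inl u else Inr u) (points ?U) (points (biset_sum ?A ?O))"
        using orbit(3) by (auto simp: bij_betw_def inj_on_def biset_sum_def image_iff split: if_splits)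
    next
      fix u h assume "u \<in> points ?U" "h \<in> carrier H"
      moreover have "lact X h u \<in> A \<longleftrightarrow> u \<in> A"
        using calculation bs(2,3) orbit(3) by (auto simp: is_biset_def)
      ultimately show "(if lact ?U h u \<in> A then Inl (lact ?U h u) else Inr (lact ?U h u)) =
          lact (biset_sum ?A ?O) h (if u \<in> A then Inl u else Inr u)"
        by (simp add: biset_sum_def)
    next
      fix u g assume "u \<in> points ?U" "g \<in> carrier G"
      moreover have "ract X u g \<in> A \<longleftrightarrow> u \<in> A"
        using calculation bs(2,3) orbit(3) by (auto simp: is_biset_def)
      ultimately show "(if ract ?U u g \<in> A then Inl (ract ?U u g) else Inr (ract ?U u g)) =
          ract (biset_sum ?A ?O) (if u \<in> A then Inl u else Inr u) g"
        by (simp add: biset_sum_def)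
    qed
    from biset_relations.sum[OF bs(2,3,1) this, of p]
    have 1: "Poly_Mapping.single ?U 1 - Poly_Mapping.single ?A 1 - Poly_Mapping.single ?O 1 \<in> rels" .
    let ?c = "canonical G H ?O"
    have 2: "Poly_Mapping.single ?O 1 - Poly_Mapping.single ?c 1 \<in> rels"
      using canonical[OF tO] bs(3) by (intro biset_relations.iso) (auto simp: transitive_def)
    obtain g where g: "g \<in> formal_bisets p G H" "Poly_Mapping.keys g \<subseteq> canonicals"
      "Poly_Mapping.single ?A 1 - g \<in> rels" using orbit by blast
    have "Poly_Mapping.single ?U 1 - (g + Poly_Mapping.single ?c 1) \<in> rels"
      using biset_relations.add[OF biset_relations.add[OF 1 2] g(3)] by (simp add: algebra_simps)
    moreover have "Poly_Mapping.keys (g + Poly_Mapping.single ?c 1) \<subseteq> canonicals"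
      using g(2) tO Poly_Mapping.keys_add[of g "Poly_Mapping.single ?c 1"] by (auto simp: canonicals_def)
    moreover have "g + Poly_Mapping.single ?c 1 \<in> formal_bisets p G H"
      using g(1) canonical[OF tO] Z_loc_1[OF prime_p]
      by (intro formal_bisets_add formal_bisets_single) (auto simp: transitive_def)
    ultimately show ?case using invU by blast
  qed
  from this[of "points X"] show ?thesis using act_closed by simp
qed

lemma decompose:
  assumes "f \<in> formal_bisets p G H"
  shows "\<exists>g\<in>formal_bisets p G H. Poly_Mapping.keys g \<subseteq> canonicals \<and> f - g \<in> rels"
proof -
  have "\<exists>g\<in>formal_bisets p G H. Poly_Mapping.keys g \<subseteq> canonicals \<and>
      (\<Sum>X\<in>K. Poly_Mapping.single X (Poly_Mapping.lookup f X)) - g \<in> rels"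
    if "finite K" "K \<subseteq> Poly_Mapping.keys f" for K
    using that
  proof (induction K rule: finite_induct)
    case empty
    then show ?case using formal_bisets_zero biset_relations.zero by (intro bexI[of _ 0]) auto
  next
    case (insert X K)
    let ?c = "Poly_Mapping.lookup f X"
    have X: "is_biset G H X" and c: "?c \<in> carrier (Z_loc p)"
      using insert assms by (auto simp: formal_bisets_def)
    obtain g1 where g1: "g1 \<in> formal_bisets p G H" "Poly_Mapping.keys g1 \<subseteq> canonicals"
      "Poly_Mapping.single X 1 - g1 \<in> rels" using decompose_biset[OF X] by blast
    obtain g2 where g2: "g2 \<in> formal_bisets p G H" "Poly_Mapping.keys g2 \<subseteq> canonicals"
      "(\<Sum>X\<in>K. Poly_Mapping.single X (Poly_Mapping.lookup f X)) - g2 \<in> rels" using insert by blast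
    have "formal_scale ?c (Poly_Mapping.single X 1 - g1) = Poly_Mapping.single X ?c - formal_scale ?c g1"
      by (rule poly_mapping_eqI)
        (simp add: lookup_formal_scale lookup_minus lookup_single when_def algebra_simps)
    then have "Poly_Mapping.single X ?c - formal_scale ?c g1 \<in> rels"
      using biset_relations.scale[OF c g1(3)] by simp
    from biset_relations.add[OF this g2(3)]
    have "(\<Sum>X\<in>insert X K. Poly_Mapping.single X (Poly_Mapping.lookup f X)) -
        (formal_scale ?c g1 + g2) \<in> rels"
      using insert by (simp add: algebra_simps)
    moreover have "Poly_Mapping.keys (formal_scale ?c g1 + g2) \<subseteq> canonicals"
      using g1(2) g2(2) keys_formal_scale[of ?c g1] Poly_Mapping.keys_add[of "formal_scale ?c g1" g2] by blast
    ultimately show ?case using formal_bisets_add[OF formal_bisets_scale[OF c g1(1)] g2(1)] by blast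
  qed
  moreover have "(\<Sum>X\<in>Poly_Mapping.keys f. Poly_Mapping.single X (Poly_Mapping.lookup f X)) = f"
    by (rule poly_mapping_eqI) (auto simp: lookup_sum lookup_single when_def in_keys_iff)
  ultimately show ?thesis by (metis finite_keys subset_refl)
qed

text \<open>Reduce to a combination of pairwise non-isomorphic transitive bisets. The count at the stabilizer of
  a point of one of them involves only its own coefficient, since no other biset in the combination has a
  point with that stabilizer; so all coefficients vanish.\<close>

lemma formal_count_zero_imp_rels:
  assumes "f \<in> formal_bisets p G H" "\<And>D. formal_count G H f D = 0"
  shows "f \<in> rels"
proof -
  obtain g where g: "g \<in> formal_bisets p G H" "Poly_Mapping.keys g \<subseteq> canonicals" "f - g \<in> rels"
    using decompose[OF assms(1)] by blast
  have zero: "formal_count G H g D = 0" for D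
    using formal_count_rels[OF g(3), of D] assms(2) by (simp add: formal_count_diff)
  have "Poly_Mapping.keys g = {}"
  proof (rule ccontr)
    assume "Poly_Mapping.keys g \<noteq> {}"
    then obtain Y where Y: "Y \<in> Poly_Mapping.keys g" by blast
    have tr: "transitive G H W" "canonical G H W = W" if "W \<in> canonicals" for W
      using that canonical canonical_eq unfolding canonicals_def by (auto, metis)
    have tY: "transitive G H Y" using Y g tr by blast
    then obtain y where y: "y \<in> points Y" by (auto simp: transitive_def)
    let ?D = "stab G H Y y"
    have "stab_count G H W ?D = 0" if W: "W \<in> Poly_Mapping.keys g" "W \<noteq> Y" for W
    proof (rule ccontr)
      assume "stab_count G H W ?D \<noteq> 0"
      then obtain w where "w \<in> points W" "stab G H W w = ?D"
        unfolding stab_count_def by (metis (mono_tags, lifting) card.empty empty_Collect_eq)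
      moreover have tW: "transitive G H W" using W g tr by blast
      ultimately have "canonical G H W = canonical G H Y"
        using transitive_isomorphic[OF tW tY _ y] canonical_eq tY by metis
      then show False using W Y g tr by (metis subsetD)
    qed
    then have "formal_count G H g ?D = Poly_Mapping.lookup g Y * of_nat (stab_count G H Y ?D)"
      unfolding formal_count_def using Y by (subst sum.remove[of _ Y]) auto
    moreover have "stab_count G H Y ?D \<noteq> 0"
      unfolding stab_count_def using y tY by (auto simp: transitive_def is_biset_def)
    ultimately show False using zero[of ?D] Y by (simp add: in_keys_iff)
  qed
  then show ?thesis using g(3) by simp
qed

lemma rels_iff_count:
  assumes "f \<in> formal_bisets p G H"
  shows "f \<in> rels \<longleftrightarrow> (\<forall>D. formal_count G H f D = 0)"
  using formal_count_rels formal_count_zero_imp_rels[OF assms] by blast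

text \<open>The relations are exactly the formal combinations with vanishing counts.\<close>

lemma formal_class_eq:
  assumes "f \<in> formal_bisets p G H"
  shows "formal_class p G H f = {g \<in> formal_bisets p G H. formal_count G H g = formal_count G H f}"
  unfolding formal_class_def using rels_iff_count[OF formal_bisets_diff[OF _ assms]]
  by (auto simp: formal_count_diff fun_eq_iff)

end


section \<open>Marks\<close>

text \<open>All representatives of a class have the same counts.\<close>

definition class_count ::
  "('g, 'm) monoid_scheme \<Rightarrow> ('h, 'n) monoid_scheme \<Rightarrow> ('g, 'h) formal set \<Rightarrow> ('h \<times> 'g) set \<Rightarrow> rat"
  where "class_count G H a = formal_count G H (SOME f. f \<in> a)"

definition mark ::
  "('g, 'm) monoid_scheme \<Rightarrow> ('h, 'n) monoid_scheme \<Rightarrow> ('g, 'h) formal set \<Rightarrow> ('h \<times> 'g) set \<Rightarrow> rat"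
  where "mark G H a Z = (\<Sum>D | D \<subseteq> carrier H \<times> carrier G \<and> Z \<subseteq> D. class_count G H a D)"

definition conj_set :: "('k, 'm) monoid_scheme \<Rightarrow> 'k \<Rightarrow> 'k set \<Rightarrow> 'k set"
  where "conj_set K z D = (\<lambda>w. z \<otimes>\<^bsub>K\<^esub> w \<otimes>\<^bsub>K\<^esub> inv\<^bsub>K\<^esub> z) ` D"

lemma (in group) conj_set_mult:
  assumes "z \<in> carrier G" "w \<in> carrier G" "D \<subseteq> carrier G"
  shows "conj_set G (z \<otimes> w) D = conj_set G z (conj_set G w D)"
  unfolding conj_set_def image_image
  by (rule image_cong[OF refl]) (use assms in \<open>auto simp: inv_mult_group m_assoc subset_iff\<close>)

lemma (in group) conj_set_one: "D \<subseteq> carrier G \<Longrightarrow> conj_set G \<one> D = D"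
  unfolding conj_set_def by (auto simp: subset_iff image_iff)

lemma (in group) conj_set_inv:
  assumes "z \<in> carrier G" "D \<subseteq> carrier G"
  shows "conj_set G (inv z) (conj_set G z D) = D"
  using assms conj_set_mult[of "inv z" z D] conj_set_one by simp

lemma (in group) conj_set_inv':
  assumes "z \<in> carrier G" "D \<subseteq> carrier G"
  shows "conj_set G z (conj_set G (inv z) D) = D"
  using assms conj_set_mult[of z "inv z" D] conj_set_one by simp

lemma conj_set_mono: "A \<subseteq> B \<Longrightarrow> conj_set K z A \<subseteq> conj_set K z B"
  unfolding conj_set_def by blast

lemma (in group) conj_set_subset_iff:
  assumes "z \<in> carrier G" "A \<subseteq> carrier G" "B \<subseteq> carrier G"
  shows "conj_set G z A \<subseteq> conj_set G z B \<longleftrightarrow> A \<subseteq> B"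
  using conj_set_mono[of A B G z] conj_set_mono[of "conj_set G z A" "conj_set G z B" G "inv z"]
    conj_set_inv[OF assms(1)] assms by auto

lemma (in group) card_conj_set:
  assumes "z \<in> carrier G" "D \<subseteq> carrier G"
  shows "card (conj_set G z D) = card D"
  unfolding conj_set_def by (rule card_image) (use assms in \<open>auto simp: inj_on_def subset_iff\<close>)

definition set_normalizer :: "('k, 'm) monoid_scheme \<Rightarrow> 'k set \<Rightarrow> 'k set"
  where "set_normalizer K D = {z \<in> carrier K. conj_set K z D = D}"

lemma (in group) set_normalizer_subgroup:
  assumes "D \<subseteq> carrier G"
  shows "subgroup (set_normalizer G D) G"
proof (rule subgroupI)
  show "set_normalizer G D \<noteq> {}" using conj_set_one[OF assms] by (auto simp: set_normalizer_def)
  show "inv z \<in> set_normalizer G D" if "z \<in> set_normalizer G D" for z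
    using that conj_set_inv[OF _ assms, of z] by (auto simp: set_normalizer_def)
qed (auto simp: set_normalizer_def conj_set_mult assms)

lemma (in group) subgroup_normalizes_self:
  assumes "subgroup D G" shows "D \<subseteq> set_normalizer G D"
proof
  fix z assume z: "z \<in> D"
  interpret subgroup D G by fact
  have sub: "conj_set G w D \<subseteq> D" if "w \<in> D" for w
    using that unfolding conj_set_def by auto
  have "D = conj_set G z (conj_set G (inv z) D)" using z by (simp add: conj_set_inv' subset)
  also have "\<dots> \<subseteq> conj_set G z D" using sub[of "inv z"] z by (intro conj_set_mono) auto
  finally show "z \<in> set_normalizer G D" using sub[OF z] z by (auto simp: set_normalizer_def)
qed

lemma finite_action_subgroup:
  assumes "finite_action K E act" "subgroup N K" "A \<subseteq> E" "\<And>z x. z \<in> N \<Longrightarrow> x \<in> A \<Longrightarrow> act z x \<in> A"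
  shows "finite_action (K\<lparr>carrier := N\<rparr>) A act"
proof -
  interpret finite_action K E act by fact
  interpret N: group "K\<lparr>carrier := N\<rparr>" using assms(2) by (rule subgroup.subgroup_is_group[OF _ is_group])
  have sub: "N \<subseteq> carrier K" using assms(2) by (rule subgroup.subset)
  show ?thesis
    using assms(3,4) sub finite_subset[OF assms(3) finite_E] finite_subset[OF sub finite_G]
      act_one act_mult
    by unfold_locales (auto simp: subset_iff)
qed

context two_groups
begin

abbreviation "cset \<equiv> conj_set (H \<times>\<times> G)"

lemma sum_points:
  fixes w :: "('h \<times> 'g) set \<Rightarrow> rat"
  assumes "is_biset G H X"
  shows "(\<Sum>x\<in>points X. w (stab G H X x)) =
    (\<Sum>D\<in>Pow (carrier H \<times> carrier G). of_nat (stab_count G H X D) * w D)"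
proof -
  have "(\<Sum>x\<in>points X. w (stab G H X x)) =
      (\<Sum>D\<in>Pow (carrier H \<times> carrier G). \<Sum>x\<in>{x\<in>points X. stab G H X x = D}. w (stab G H X x))"
    by (rule sum.group[symmetric]) (use assms fin_G fin_H in \<open>auto simp: is_biset_def stab_def\<close>)
  also have "\<dots> = (\<Sum>D\<in>Pow (carrier H \<times> carrier G). of_nat (stab_count G H X D) * w D)"
    by (rule sum.cong) (auto simp: stab_count_def)
  finally show ?thesis .
qed

lemma stab_count_outside: "is_biset G H X \<Longrightarrow> \<not> subgroup D (H \<times>\<times> G) \<Longrightarrow> stab_count G H X D = 0"
  unfolding stab_count_def using stab_subgroup by (metis (mono_tags, lifting) card.empty empty_Collect_eq)

lemma formal_count_outside:
  assumes "f \<in> formal_bisets p G H" "\<not> subgroup D (H \<times>\<times> G)"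
  shows "formal_count G H f D = 0"
  unfolding formal_count_def using assms(1) by (auto simp: formal_bisets_def stab_count_outside[OF _ assms(2)] intro!: sum.neutral)

lemma card_fixed:
  assumes "is_biset G H X"
  shows "card {x \<in> points X. Z \<subseteq> stab G H X x} =
    (\<Sum>D | D \<subseteq> carrier H \<times> carrier G \<and> Z \<subseteq> D. stab_count G H X D)"
proof -
  have fin: "finite (points X)" using assms by (simp add: is_biset_def)
  have "(of_nat (card {x \<in> points X. Z \<subseteq> stab G H X x}) :: rat) =
      (\<Sum>x\<in>points X. if Z \<subseteq> stab G H X x then 1 else 0)"
    using fin by (simp add: sum.If_cases Int_def)
  also have "\<dots> = (\<Sum>D\<in>Pow (carrier H \<times> carrier G). of_nat (stab_count G H X D) * (if Z \<subseteq> D then 1 else 0))"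
    by (rule sum_points[OF assms])
  also have "\<dots> = (\<Sum>D | D \<subseteq> carrier H \<times> carrier G \<and> Z \<subseteq> D. of_nat (stab_count G H X D))"
    by (rule sum.mono_neutral_cong_right) (use fin_G fin_H in auto)
  finally have "(of_nat (card {x \<in> points X. Z \<subseteq> stab G H X x}) :: rat) =
      of_nat (\<Sum>D | D \<subseteq> carrier H \<times> carrier G \<and> Z \<subseteq> D. stab_count G H X D)" by simp
  then show ?thesis by (simp only: of_nat_eq_iff)
qed

lemma stab_act_conj:
  "is_biset G H X \<Longrightarrow> x \<in> points X \<Longrightarrow> z \<in> carrier (H \<times>\<times> G) \<Longrightarrow>
    stab G H X (biset_act G X z x) = cset z (stab G H X x)"
  by (simp only: stab_act conj_set_def)

lemma stab_subset: "stab G H X x \<subseteq> carrier (H \<times>\<times> G)"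
  by (auto simp: stab_def)

text \<open>The bijection is \<open>x \<mapsto> z.x\<close>.\<close>

lemma card_fixed_conj:
  assumes "is_biset G H X" "z \<in> carrier (H \<times>\<times> G)" "Z \<subseteq> carrier (H \<times>\<times> G)"
  shows "card {x \<in> points X. cset z Z \<subseteq> stab G H X x} = card {x \<in> points X. Z \<subseteq> stab G H X x}"
proof -
  interpret finite_action "H \<times>\<times> G" "points X" "biset_act G X" by (rule biset_action[OF assms(1)])
  have iff: "cset w A \<subseteq> stab G H X (biset_act G X w x) \<longleftrightarrow> A \<subseteq> stab G H X x"
    if "w \<in> carrier (H \<times>\<times> G)" "A \<subseteq> carrier (H \<times>\<times> G)" "x \<in> points X" for w x A
    using that stab_act_conj[OF assms(1)] HG.conj_set_subset_iff[OF _ _ stab_subset] by simp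
  have "bij_betw (biset_act G X z) {x \<in> points X. Z \<subseteq> stab G H X x} {x \<in> points X. cset z Z \<subseteq> stab G H X x}"
  proof (rule bij_betw_byWitness[where f' = "biset_act G X (inv\<^bsub>H \<times>\<times> G\<^esub> z)"])
    show "biset_act G X z ` {x \<in> points X. Z \<subseteq> stab G H X x} \<subseteq> {x \<in> points X. cset z Z \<subseteq> stab G H X x}"
      using iff[OF assms(2,3)] act_closed[OF assms(2)] by auto
    show "biset_act G X (inv\<^bsub>H \<times>\<times> G\<^esub> z) ` {x \<in> points X. cset z Z \<subseteq> stab G H X x} \<subseteq> {x \<in> points X. Z \<subseteq> stab G H X x}"
    proof
      fix y assume "y \<in> biset_act G X (inv\<^bsub>H \<times>\<times> G\<^esub> z) ` {x \<in> points X. cset z Z \<subseteq> stab G H X x}"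
      then obtain x where x: "x \<in> points X" "cset z Z \<subseteq> stab G H X x" "y = biset_act G X (inv\<^bsub>H \<times>\<times> G\<^esub> z) x"
        by blast
      have y: "y \<in> points X" using x act_closed assms(2) HG.inv_closed by blast
      have "biset_act G X z y = x" using x act_inv' assms(2) by simp
      then show "y \<in> {x \<in> points X. Z \<subseteq> stab G H X x}" using y x iff[OF assms(2,3) y] by simp
    qed
  qed (use assms(2) act_inv act_inv' in auto)
  then show ?thesis by (rule bij_betw_same_card[symmetric])
qed

text \<open>The Cauchy--Frobenius congruence for the action of \<open>N\<close> on the points fixed by \<open>Z\<close>.\<close>

lemma card_dvd_sum_fixed:
  assumes "is_biset G H X" "subgroup N (H \<times>\<times> G)" "Z \<subseteq> carrier (H \<times>\<times> G)" "\<And>k. k \<in> N \<Longrightarrow> cset k Z = Z"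
  shows "card N dvd (\<Sum>k\<in>N. card {x \<in> points X. insert k Z \<subseteq> stab G H X x})"
proof -
  let ?A = "{x \<in> points X. Z \<subseteq> stab G H X x}"
  interpret X: finite_action "H \<times>\<times> G" "points X" "biset_act G X" by (rule biset_action[OF assms(1)])
  have sub: "N \<subseteq> carrier (H \<times>\<times> G)" using assms(2) by (rule subgroup.subset)
  have cl: "biset_act G X k x \<in> ?A" if "k \<in> N" "x \<in> ?A" for k x
  proof -
    have k: "k \<in> carrier (H \<times>\<times> G)" using that sub by blast
    have "cset k Z \<subseteq> cset k (stab G H X x)" using that by (intro conj_set_mono) auto
    then show ?thesis using that stab_act_conj[OF assms(1) _ k] assms(4) X.act_closed[OF k] by auto
  qed
  interpret A: finite_action "(H \<times>\<times> G)\<lparr>carrier := N\<rparr>" ?A "biset_act G X"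
    by (rule finite_action_subgroup[OF biset_action[OF assms(1)] assms(2)]) (use cl in auto)
  have finN: "finite N" using A.finite_G by simp
  have st: "A.stabilizes x = {k \<in> N. k \<in> stab G H X x}" if "x \<in> ?A" for x
  proof -
    have "biset_act G X k x = x \<longleftrightarrow> k \<in> stab G H X x" if k: "k \<in> N" for k
      using k sub \<open>x \<in> ?A\<close> act_eq_iff_stab[OF assms(1), of x "fst k" "snd k"] by (cases k) auto
    then show ?thesis by (auto simp: A.stabilizes_def)
  qed
  have "(\<Sum>k\<in>N. card {x \<in> points X. insert k Z \<subseteq> stab G H X x}) =
      (\<Sum>k\<in>N. card {x \<in> ?A. k \<in> stab G H X x})"
    by (intro sum.cong arg_cong[where f = card]) auto
  also have "\<dots> = (\<Sum>k\<in>N. \<Sum>x\<in>?A. if k \<in> stab G H X x then 1 else 0)"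
    using A.finite_E by (intro sum.cong) (auto simp: sum.If_cases Int_def)
  also have "\<dots> = (\<Sum>x\<in>?A. \<Sum>k\<in>N. if k \<in> stab G H X x then 1 else 0)" by (rule sum.swap)
  also have "\<dots> = (\<Sum>x\<in>?A. card (A.stabilizes x))"
    using finN st by (intro sum.cong) (auto simp: sum.If_cases Int_def)
  finally show ?thesis using A.card_dvd_sum_stabilizes by simp
qed

text \<open>The normalizer of \<open>D\<close> acts on the points with stabilizer exactly \<open>D\<close>, and every point of this set has
  isotropy group \<open>D\<close>.\<close>

lemma card_normalizer_dvd:
  assumes "is_biset G H X" "subgroup D (H \<times>\<times> G)"
  shows "card (set_normalizer (H \<times>\<times> G) D) dvd card D * stab_count G H X D"
proof -
  let ?A = "{x \<in> points X. stab G H X x = D}" and ?N = "set_normalizer (H \<times>\<times> G) D"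
  have Dsub: "D \<subseteq> carrier (H \<times>\<times> G)" using assms(2) by (rule subgroup.subset)
  have N: "subgroup ?N (H \<times>\<times> G)" by (rule HG.set_normalizer_subgroup[OF Dsub])
  have DN: "D \<subseteq> ?N" by (rule HG.subgroup_normalizes_self[OF assms(2)])
  interpret X: finite_action "H \<times>\<times> G" "points X" "biset_act G X" by (rule biset_action[OF assms(1)])
  interpret A: finite_action "(H \<times>\<times> G)\<lparr>carrier := ?N\<rparr>" ?A "biset_act G X"
  proof (rule finite_action_subgroup[OF biset_action[OF assms(1)] N])
    fix z x assume "z \<in> ?N" "x \<in> ?A"
    then show "biset_act G X z x \<in> ?A"
      using stab_act_conj[OF assms(1)] X.act_closed by (auto simp: set_normalizer_def)
  qed auto
  have "A.stabilizes x = D" if "x \<in> ?A" for x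
  proof -
    have "biset_act G X k x = x \<longleftrightarrow> k \<in> D" if k: "k \<in> ?N" for k
      using k \<open>x \<in> ?A\<close> act_eq_iff_stab[OF assms(1), of x "fst k" "snd k"]
      by (cases k) (auto simp: set_normalizer_def)
    then show ?thesis using DN by (auto simp: A.stabilizes_def)
  qed
  then have "(\<Sum>x\<in>?A. card (A.stabilizes x)) = card D * stab_count G H X D"
    by (simp add: stab_count_def)
  then show ?thesis using A.card_dvd_sum_stabilizes by simp
qed

lemma sum_transitive:
  fixes w :: "('h \<times> 'g) set \<Rightarrow> rat"
  assumes "transitive G H X" "x \<in> points X"
  shows "of_nat (card (stab G H X x)) * (\<Sum>y\<in>points X. w (stab G H X y)) =
    (\<Sum>z\<in>carrier (H \<times>\<times> G). w (cset z (stab G H X x)))"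
proof -
  have X: "is_biset G H X" using assms by (simp add: transitive_def)
  interpret X: finite_action "H \<times>\<times> G" "points X" "biset_act G X" by (rule biset_action[OF X])
  have "points X = X.orb x" using transitive_from[OF assms] by (simp add: X.orb_def)
  then show ?thesis
    using X.sum_over_group[OF assms(2), of "\<lambda>y. w (stab G H X y)"] stab_act_conj[OF X assms(2)]
    by (simp add: stab_eq_stabilizes[OF X assms(2)] del: carrier_DirProd)
qed

text \<open>The base point is the trivial coset, which is the subgroup itself.\<close>

lemma transitive_biset_props:
  assumes "subgroup (graph_subgroup U \<phi>) (H \<times>\<times> G)"
  shows "transitive G H (transitive_biset G H U \<phi>)"
    "graph_subgroup U \<phi> \<in> points (transitive_biset G H U \<phi>)"
    "stab G H (transitive_biset G H U \<phi>) (graph_subgroup U \<phi>) = graph_subgroup U \<phi>"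
proof -
  let ?D = "graph_subgroup U \<phi>" and ?X = "transitive_biset G H U \<phi>" and ?K = "H \<times>\<times> G"
  interpret D: subgroup ?D ?K by fact
  have assoc: "g <#\<^bsub>?K\<^esub> (h <#\<^bsub>?K\<^esub> C) = (g \<otimes>\<^bsub>?K\<^esub> h) <#\<^bsub>?K\<^esub> C"
    if "g \<in> carrier ?K" "h \<in> carrier ?K" "C \<subseteq> carrier ?K" for g h C
    using that by (intro HG.lcos_m_assoc) auto
  have one: "\<one>\<^bsub>?K\<^esub> <#\<^bsub>?K\<^esub> C = C" if "C \<subseteq> carrier ?K" for C
    using HG.lcos_mult_one[OF that] .
  have pts: "points ?X = (\<lambda>z. z <#\<^bsub>?K\<^esub> ?D) ` carrier ?K"
    by (auto simp: transitive_biset_def LCOSETS_def)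
  have sub: "C \<subseteq> carrier ?K" if "C \<in> points ?X" for C
    using that HG.l_coset_subset_G[OF D.subset] unfolding pts by blast
  have cl: "z <#\<^bsub>?K\<^esub> C \<in> points ?X" if "z \<in> carrier ?K" "C \<in> points ?X" for z C
  proof -
    obtain w where w: "w \<in> carrier ?K" "C = w <#\<^bsub>?K\<^esub> ?D" using \<open>C \<in> points ?X\<close> unfolding pts by blast
    then have "z <#\<^bsub>?K\<^esub> C = (z \<otimes>\<^bsub>?K\<^esub> w) <#\<^bsub>?K\<^esub> ?D" using assoc[OF that(1) _ D.subset] by simp
    then show ?thesis using w that HG.m_closed unfolding pts by blast
  qed
  have bs: "is_biset G H ?X"
    unfolding is_biset_def
  proof (intro conjI ballI)
    show "finite (points ?X)" using fin_HG by (simp add: pts)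
    fix C assume C: "C \<in> points ?X"
    note S = sub[OF C]
    show "lact ?X h C \<in> points ?X" if "h \<in> carrier H" for h
      using cl[OF _ C, of "(h, \<one>\<^bsub>G\<^esub>)"] that by (simp add: transitive_biset_def)
    show "ract ?X C g \<in> points ?X" if "g \<in> carrier G" for g
      using cl[OF _ C, of "(\<one>\<^bsub>H\<^esub>, inv\<^bsub>G\<^esub> g)"] that by (simp add: transitive_biset_def)
    show "lact ?X \<one>\<^bsub>H\<^esub> C = C" "ract ?X C \<one>\<^bsub>G\<^esub> = C"
      using one[OF S] by (simp_all add: transitive_biset_def)
    show "lact ?X (h \<otimes>\<^bsub>H\<^esub> h') C = lact ?X h (lact ?X h' C)" if "h \<in> carrier H" "h' \<in> carrier H" for h h'
      using that S by (simp add: transitive_biset_def assoc)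
    show "ract ?X C (g \<otimes>\<^bsub>G\<^esub> g') = ract ?X (ract ?X C g) g'" if "g \<in> carrier G" "g' \<in> carrier G" for g g'
      using that S by (simp add: transitive_biset_def assoc G.inv_mult_group)
    show "ract ?X (lact ?X h C) g = lact ?X h (ract ?X C g)" if "h \<in> carrier H" "g \<in> carrier G" for h g
      using that S by (simp add: transitive_biset_def assoc)
  qed
  have act: "biset_act G ?X z C = z <#\<^bsub>?K\<^esub> C" if "z \<in> carrier ?K" "C \<subseteq> carrier ?K" for z C
  proof -
    obtain h g where z: "z = (h, g)" "h \<in> carrier H" "g \<in> carrier G" using \<open>z \<in> carrier ?K\<close> by auto
    have "biset_act G ?X z C = (h, \<one>\<^bsub>G\<^esub>) <#\<^bsub>?K\<^esub> ((\<one>\<^bsub>H\<^esub>, inv\<^bsub>G\<^esub> (inv\<^bsub>G\<^esub> g)) <#\<^bsub>?K\<^esub> C)"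
      by (simp add: biset_act_def transitive_biset_def z)
    also have "\<dots> = ((h, \<one>\<^bsub>G\<^esub>) \<otimes>\<^bsub>?K\<^esub> (\<one>\<^bsub>H\<^esub>, inv\<^bsub>G\<^esub> (inv\<^bsub>G\<^esub> g))) <#\<^bsub>?K\<^esub> C"
      by (rule assoc) (use z that in auto)
    finally show ?thesis using z by simp
  qed
  show DX: "?D \<in> points ?X"
    unfolding pts using one[OF D.subset] HG.one_closed by (metis image_eqI)
  have "(\<lambda>z. biset_act G ?X z ?D) ` carrier ?K = points ?X"
    unfolding pts by (rule image_cong[OF refl act[OF _ D.subset]])
  then show "transitive G H ?X" unfolding transitive_def using bs DX by auto
  show "stab G H ?X ?D = ?D"
  proof -
    have "z \<in> stab G H ?X ?D \<longleftrightarrow> z \<in> ?D" if "z \<in> carrier ?K" for z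
    proof -
      have "fst z \<in> carrier H" "snd z \<in> carrier G" using that by auto
      from act_eq_iff_stab[OF bs DX this]
      have "z \<in> stab G H ?X ?D \<longleftrightarrow> z <#\<^bsub>?K\<^esub> ?D = ?D"
        by (simp only: prod.collapse act[OF that D.subset])
      also have "\<dots> \<longleftrightarrow> z \<in> ?D"
      proof
        assume "z <#\<^bsub>?K\<^esub> ?D = ?D"
        moreover have "z \<otimes>\<^bsub>?K\<^esub> \<one>\<^bsub>?K\<^esub> \<in> z <#\<^bsub>?K\<^esub> ?D"
          using D.one_closed by (auto simp: l_coset_def simp del: one_DirProd)
        ultimately show "z \<in> ?D" using HG.r_one[OF that] by (simp only:)
      next
        assume "z \<in> ?D"
        then show "z <#\<^bsub>?K\<^esub> ?D = ?D" by (rule HG.coset_join3[OF that assms])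
      qed
      finally show ?thesis .
    qed
    then show ?thesis
      by (meson D.subset stab_subset subsetD subsetI subset_antisym)
  qed
qed

lemma class_count_formal_class:
  assumes "f \<in> formal_bisets p G H"
  shows "class_count G H (formal_class p G H f) = formal_count G H f"
proof -
  have "f \<in> formal_class p G H f" using assms by (simp add: formal_class_eq)
  from someI[of "\<lambda>x. x \<in> formal_class p G H f", OF this] show ?thesis
    unfolding class_count_def by (simp add: formal_class_eq[OF assms])
qed

lemma class_rep:
  assumes "a \<in> burnside_carrier p G H"
  obtains f where "f \<in> formal_bisets p G H" "a = formal_class p G H f" "class_count G H a = formal_count G H f"
proof -
  obtain f where "f \<in> formal_bisets p G H" "a = formal_class p G H f"
    using assms by (auto simp: burnside_carrier_def)
  then show thesis using that class_count_formal_class by blast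
qed

lemma formal_class_closed: "f \<in> formal_bisets p G H \<Longrightarrow> formal_class p G H f \<in> burnside_carrier p G H"
  by (simp add: burnside_carrier_def)

lemma formal_class_cong:
  "f \<in> formal_bisets p G H \<Longrightarrow> g \<in> formal_bisets p G H \<Longrightarrow>
    formal_class p G H f = formal_class p G H g \<longleftrightarrow> formal_count G H f = formal_count G H g"
  using class_count_formal_class[of f] class_count_formal_class[of g] formal_class_eq by auto

lemma class_eqI:
  assumes "a \<in> burnside_carrier p G H" "b \<in> burnside_carrier p G H"
    "\<And>D. D \<subseteq> carrier H \<times> carrier G \<Longrightarrow> class_count G H a D = class_count G H b D"
  shows "a = b"
proof -
  obtain f where f: "f \<in> formal_bisets p G H" "a = formal_class p G H f" "class_count G H a = formal_count G H f"
    using class_rep[OF assms(1)] .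
  obtain g where g: "g \<in> formal_bisets p G H" "b = formal_class p G H g" "class_count G H b = formal_count G H g"
    using class_rep[OF assms(2)] .
  have "formal_count G H f D = formal_count G H g D" for D
  proof (cases "subgroup D (H \<times>\<times> G)")
    case True
    then show ?thesis using subgroup.subset[OF True] assms(3)[of D] f g by simp
  qed (simp add: formal_count_outside f(1) g(1))
  then have "formal_count G H f = formal_count G H g" by blast
  then show ?thesis using f g formal_class_cong by blast
qed

lemma class_count_outside:
  "a \<in> burnside_carrier p G H \<Longrightarrow> \<not> subgroup D (H \<times>\<times> G) \<Longrightarrow> class_count G H a D = 0"
  by (erule class_rep) (simp add: formal_count_outside)

lemma UNION_const: "A \<noteq> {} \<Longrightarrow> (\<And>x. x \<in> A \<Longrightarrow> f x = c) \<Longrightarrow> (\<Union>x\<in>A. f x) = c"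
  by auto

lemma burnside_add_class:
  assumes "f \<in> formal_bisets p G H" "g \<in> formal_bisets p G H"
  shows "burnside_add p G H (formal_class p G H f) (formal_class p G H g) = formal_class p G H (f + g)"
  unfolding burnside_add_def
proof (intro UNION_const)
  fix f' g' assume "f' \<in> formal_class p G H f" "g' \<in> formal_class p G H g"
  then show "formal_class p G H (f' + g') = formal_class p G H (f + g)"
    using assms formal_bisets_add
    by (subst formal_class_cong) (auto simp: formal_class_eq formal_count_add fun_eq_iff)
qed (use assms in \<open>auto simp: formal_class_eq\<close>)

lemma burnside_smult_class:
  assumes "f \<in> formal_bisets p G H" "c \<in> carrier (Z_loc p)"
  shows "burnside_smult p G H c (formal_class p G H f) = formal_class p G H (formal_scale c f)"
  unfolding burnside_smult_def
proof (intro UNION_const)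
  fix f' assume "f' \<in> formal_class p G H f"
  then show "formal_class p G H (formal_scale c f') = formal_class p G H (formal_scale c f)"
    using assms formal_bisets_scale
    by (subst formal_class_cong) (auto simp: formal_class_eq formal_count_scale fun_eq_iff)
qed (use assms in \<open>auto simp: formal_class_eq\<close>)

lemma burnside_add_closed:
  "a \<in> burnside_carrier p G H \<Longrightarrow> b \<in> burnside_carrier p G H \<Longrightarrow> burnside_add p G H a b \<in> burnside_carrier p G H"
  by (elim class_rep) (simp add: burnside_add_class formal_class_closed formal_bisets_add)

lemma burnside_smult_closed:
  "a \<in> burnside_carrier p G H \<Longrightarrow> c \<in> carrier (Z_loc p) \<Longrightarrow> burnside_smult p G H c a \<in> burnside_carrier p G H"
  by (elim class_rep) (simp add: burnside_smult_class formal_class_closed formal_bisets_scale)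

lemma class_count_add:
  assumes "a \<in> burnside_carrier p G H" "b \<in> burnside_carrier p G H"
  shows "class_count G H (burnside_add p G H a b) D = class_count G H a D + class_count G H b D"
  by (rule class_rep[OF assms(1)], rule class_rep[OF assms(2)])
    (simp add: burnside_add_class class_count_formal_class formal_bisets_add formal_count_add)

lemma class_count_smult:
  assumes "a \<in> burnside_carrier p G H" "c \<in> carrier (Z_loc p)"
  shows "class_count G H (burnside_smult p G H c a) D = c * class_count G H a D"
  by (rule class_rep[OF assms(1)])
    (simp add: burnside_smult_class assms class_count_formal_class formal_bisets_scale formal_count_scale)

lemma biset_class_closed: "is_biset G H X \<Longrightarrow> biset_class p G H X \<in> burnside_carrier p G H"
  unfolding biset_class_def by (intro formal_class_closed formal_gen_closed)

lemma class_count_biset: "is_biset G H X \<Longrightarrow> class_count G H (biset_class p G H X) D = of_nat (stab_count G H X D)"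
  unfolding biset_class_def by (simp add: class_count_formal_class formal_gen_closed formal_count_gen)

lemma zero_class_closed: "formal_class p G H 0 \<in> burnside_carrier p G H"
  by (intro formal_class_closed formal_bisets_zero)

lemma class_count_zero: "class_count G H (formal_class p G H 0) D = 0"
  by (simp add: class_count_formal_class formal_bisets_zero formal_count_zero)

lemma class_count_expand:
  assumes "a \<in> burnside_carrier p G H"
  obtains f where "f \<in> formal_bisets p G H"
    "\<forall>D. class_count G H a D = (\<Sum>X\<in>Poly_Mapping.keys f. Poly_Mapping.lookup f X * of_nat (stab_count G H X D))"
proof -
  obtain f where f: "f \<in> formal_bisets p G H" "a = formal_class p G H f" "class_count G H a = formal_count G H f"
    using class_rep[OF assms(1)] .
  show thesis by (rule that[OF f(1)]) (unfold f(3) formal_count_def, blast)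
qed

lemma mark_expand:
  assumes "a \<in> burnside_carrier p G H"
  obtains f where "f \<in> formal_bisets p G H"
    "\<forall>Z. mark G H a Z = (\<Sum>X\<in>Poly_Mapping.keys f. Poly_Mapping.lookup f X * of_nat (card {x \<in> points X. Z \<subseteq> stab G H X x}))"
proof -
  obtain f where f: "f \<in> formal_bisets p G H"
    "\<forall>D. class_count G H a D = (\<Sum>X\<in>Poly_Mapping.keys f. Poly_Mapping.lookup f X * of_nat (stab_count G H X D))"
    using class_count_expand[OF assms(1)] .
  have "mark G H a Z = (\<Sum>X\<in>Poly_Mapping.keys f. Poly_Mapping.lookup f X * of_nat (card {x \<in> points X. Z \<subseteq> stab G H X x}))" for Z
  proof -
    have "mark G H a Z = (\<Sum>X\<in>Poly_Mapping.keys f. \<Sum>D | D \<subseteq> carrier H \<times> carrier G \<and> Z \<subseteq> D. Poly_Mapping.lookup f X * of_nat (stab_count G H X D))"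
      unfolding mark_def f(2)[rule_format] by (rule sum.swap)
    also have "\<dots> = (\<Sum>X\<in>Poly_Mapping.keys f. Poly_Mapping.lookup f X * of_nat (card {x \<in> points X. Z \<subseteq> stab G H X x}))"
      using f(1) by (intro sum.cong) (auto simp: formal_bisets_def card_fixed sum_distrib_left)
    finally show ?thesis .
  qed
  then show thesis using that f(1) by blast
qed

lemma mark_conj:
  assumes "a \<in> burnside_carrier p G H" "z \<in> carrier (H \<times>\<times> G)" "Z \<subseteq> carrier (H \<times>\<times> G)"
  shows "mark G H a (cset z Z) = mark G H a Z"
proof -
  obtain f where f: "f \<in> formal_bisets p G H" "\<forall>Z. mark G H a Z = (\<Sum>X\<in>Poly_Mapping.keys f. Poly_Mapping.lookup f X * of_nat (card {x \<in> points X. Z \<subseteq> stab G H X x}))"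
    using mark_expand[OF assms(1)] .
  show ?thesis unfolding f(2)[rule_format]
    using f(1) card_fixed_conj[OF _ assms(2,3)] by (intro sum.cong) (auto simp: formal_bisets_def)
qed

lemma burnside_congruence:
  assumes "a \<in> burnside_carrier p G H" "subgroup N (H \<times>\<times> G)" "Z \<subseteq> carrier (H \<times>\<times> G)" "\<And>k. k \<in> N \<Longrightarrow> cset k Z = Z"
  shows "(\<Sum>k\<in>N. mark G H a (insert k Z)) / of_nat (card N) \<in> carrier (Z_loc p)"
proof -
  obtain f where f: "f \<in> formal_bisets p G H" "\<forall>Z. mark G H a Z = (\<Sum>X\<in>Poly_Mapping.keys f. Poly_Mapping.lookup f X * of_nat (card {x \<in> points X. Z \<subseteq> stab G H X x}))"
    using mark_expand[OF assms(1)] .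
  have "(\<Sum>k\<in>N. mark G H a (insert k Z)) / of_nat (card N) =
      (\<Sum>X\<in>Poly_Mapping.keys f. Poly_Mapping.lookup f X *
        (of_nat (\<Sum>k\<in>N. card {x \<in> points X. insert k Z \<subseteq> stab G H X x}) / of_nat (card N)))"
    unfolding f(2)[rule_format] by (subst sum.swap) (simp add: sum_divide_distrib sum_distrib_left)
  also have "\<dots> \<in> carrier (Z_loc p)"
  proof (intro Z_loc_sum[OF prime_p] Z_loc_mult[OF prime_p])
    fix X assume X: "X \<in> Poly_Mapping.keys f"
    then show "Poly_Mapping.lookup f X \<in> carrier (Z_loc p)" using f(1) by (auto simp: formal_bisets_def)
    have "is_biset G H X" using X f(1) by (auto simp: formal_bisets_def)
    from card_dvd_sum_fixed[OF this assms(2-4)] obtain k where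
      k: "(\<Sum>k\<in>N. card {x \<in> points X. insert k Z \<subseteq> stab G H X x}) = card N * k" by (auto elim: dvdE)
    have "of_nat (card N * k) / (of_nat (card N) :: rat) = (if card N = 0 then 0 else of_nat k)" by simp
    then show "of_nat (\<Sum>k\<in>N. card {x \<in> points X. insert k Z \<subseteq> stab G H X x}) / (of_nat (card N) :: rat) \<in> carrier (Z_loc p)"
      unfolding k using Z_loc_of_nat[OF prime_p] Z_loc_0[OF prime_p] by presburger
  qed
  finally show ?thesis .
qed

lemma class_count_divisible:
  assumes "a \<in> burnside_carrier p G H" "subgroup D (H \<times>\<times> G)"
  shows "of_nat (card D) * class_count G H a D / of_nat (card (set_normalizer (H \<times>\<times> G) D)) \<in> carrier (Z_loc p)"
proof -
  let ?N = "card (set_normalizer (H \<times>\<times> G) D)"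
  obtain f where f: "f \<in> formal_bisets p G H" "\<forall>D. class_count G H a D = (\<Sum>X\<in>Poly_Mapping.keys f. Poly_Mapping.lookup f X * of_nat (stab_count G H X D))"
    using class_count_expand[OF assms(1)] .
  have "of_nat (card D) * class_count G H a D / of_nat ?N =
      (\<Sum>X\<in>Poly_Mapping.keys f. Poly_Mapping.lookup f X * (of_nat (card D * stab_count G H X D) / of_nat ?N))"
    unfolding f(2)[rule_format] by (simp add: sum_divide_distrib sum_distrib_left mult_ac)
  also have "\<dots> \<in> carrier (Z_loc p)"
  proof (intro Z_loc_sum[OF prime_p] Z_loc_mult[OF prime_p])
    fix X assume X: "X \<in> Poly_Mapping.keys f"
    then show "Poly_Mapping.lookup f X \<in> carrier (Z_loc p)" using f(1) by (auto simp: formal_bisets_def)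
    have "is_biset G H X" using X f(1) by (auto simp: formal_bisets_def)
    from card_normalizer_dvd[OF this assms(2)] obtain k where
      k: "card D * stab_count G H X D = ?N * k" by (auto elim: dvdE)
    have "of_nat (?N * k) / (of_nat ?N :: rat) = (if ?N = 0 then 0 else of_nat k)" by simp
    then show "of_nat (card D * stab_count G H X D) / (of_nat ?N :: rat) \<in> carrier (Z_loc p)"
      unfolding k using Z_loc_of_nat[OF prime_p] Z_loc_0[OF prime_p] by presburger
  qed
  finally show ?thesis .
qed

text \<open>The passage from counts to marks is unitriangular with respect to inclusion, so it is inverted by
  downward induction on the size of \<open>Z\<close>.\<close>

lemma class_count_zero_of_mark:
  fixes n :: "('h \<times> 'g) set \<Rightarrow> rat"
  assumes "\<And>Z. Z \<subseteq> carrier H \<times> carrier G \<Longrightarrow> (\<Sum>D | D \<subseteq> carrier H \<times> carrier G \<and> Z \<subseteq> D. n D) = 0"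
  shows "Z \<subseteq> carrier H \<times> carrier G \<Longrightarrow> n Z = 0"
proof (induction "card (carrier H \<times> carrier G) - card Z" arbitrary: Z rule: less_induct)
  case less
  let ?U = "carrier H \<times> carrier G"
  have finU: "finite ?U" using fin_G fin_H by simp
  have "(\<Sum>D | D \<subseteq> ?U \<and> Z \<subseteq> D. n D) = n Z + (\<Sum>D\<in>{D. D \<subseteq> ?U \<and> Z \<subseteq> D} - {Z}. n D)"
    using less finU by (intro sum.remove) auto
  also have "(\<Sum>D\<in>{D. D \<subseteq> ?U \<and> Z \<subseteq> D} - {Z}. n D) = 0"
  proof (rule sum.neutral, rule ballI)
    fix D assume D: "D \<in> {D. D \<subseteq> ?U \<and> Z \<subseteq> D} - {Z}"
    then have "Z \<subset> D" "finite D" using finU finite_subset by auto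
    then have "card Z < card D" "card D \<le> card ?U" using D finU by (auto intro: psubset_card_mono card_mono)
    then show "n D = 0" using less(1)[of D] D by auto
  qed
  finally show ?case using assms[OF less(2)] by simp
qed

lemma class_eq_of_marks:
  assumes "a \<in> burnside_carrier p G H" "b \<in> burnside_carrier p G H"
    "\<And>Z. Z \<subseteq> carrier H \<times> carrier G \<Longrightarrow> mark G H a Z = mark G H b Z"
  shows "a = b"
proof (rule class_eqI[OF assms(1,2)])
  fix D assume "D \<subseteq> carrier H \<times> carrier G"
  then have "class_count G H a D - class_count G H b D = 0"
    by (intro class_count_zero_of_mark[where n = "\<lambda>D. class_count G H a D - class_count G H b D"])
      (use assms(3) in \<open>auto simp: mark_def sum_subtractf\<close>)
  then show "class_count G H a D = class_count G H b D" by simp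
qed

end


section \<open>Stabilizer counts of a composite\<close>

text \<open>If \<open>A\<close> and \<open>B\<close> are the stabilizers of \<open>y\<close> and \<open>x\<close>, this is the isotropy group of \<open>(y,x)\<close> for the
  action of \<open>H\<close> whose orbits are the points of the tensor product.\<close>

definition isotropy ::
  "('g, 'm) monoid_scheme \<Rightarrow> ('h, 'n) monoid_scheme \<Rightarrow> ('k, 'l) monoid_scheme \<Rightarrow>
    ('k \<times> 'h) set \<Rightarrow> ('h \<times> 'g) set \<Rightarrow> 'h set"
  where "isotropy G H K A B = {h \<in> carrier H. (\<one>\<^bsub>K\<^esub>, h) \<in> A \<and> (h, \<one>\<^bsub>G\<^esub>) \<in> B}"

locale three_groups = GH: two_groups p G H + HK: two_groups p H K
  for p :: nat and G :: "('g, 'm) monoid_scheme" and H :: "('h, 'n) monoid_scheme"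
    and K :: "('k, 'l) monoid_scheme"
begin

sublocale GK: two_groups p G K
  by unfold_locales (rule GH.prime_p GH.fin_G HK.fin_H)+

definition tensor_act ::
  "('y, 'h, 'k) biset \<Rightarrow> ('x, 'g, 'h) biset \<Rightarrow> 'h \<Rightarrow> 'y \<times> 'x \<Rightarrow> 'y \<times> 'x"
  where "tensor_act Y X h z = (ract Y (fst z) (inv\<^bsub>H\<^esub> h), lact X h (snd z))"

text \<open>A point of the tensor product is an \<open>H\<close>-orbit of pairs, hence a pair accounts for this fraction of a
  point.\<close>

abbreviation weight :: "('k \<times> 'h) set \<Rightarrow> ('h \<times> 'g) set \<Rightarrow> rat"
  where "weight A B \<equiv> of_nat (card (isotropy G H K A B)) / of_nat (card (carrier H))"

context
  fixes Y :: "('y, 'h, 'k) biset" and X :: "('x, 'g, 'h) biset"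
  assumes Y: "is_biset H K Y" and X: "is_biset G H X"
begin

lemma tensor_action: "finite_action H (points Y \<times> points X) (tensor_act Y X)"
proof
  show "finite (points Y \<times> points X)" using X Y by (simp add: is_biset_def)
next
  fix h h' z assume h: "h \<in> carrier H" "h' \<in> carrier H" and z: "z \<in> points Y \<times> points X"
  obtain y x where [simp]: "z = (y, x)" and yx: "y \<in> points Y" "x \<in> points X" using z by auto
  have "ract Y y (inv\<^bsub>H\<^esub> h' \<otimes>\<^bsub>H\<^esub> inv\<^bsub>H\<^esub> h) = ract Y (ract Y y (inv\<^bsub>H\<^esub> h')) (inv\<^bsub>H\<^esub> h)"
    using Y yx h by (simp add: is_biset_def)
  then show "tensor_act Y X (h \<otimes>\<^bsub>H\<^esub> h') z = tensor_act Y X h (tensor_act Y X h' z)"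
    using X yx h by (simp add: tensor_act_def is_biset_def GH.H.inv_mult_group)
qed (use X Y GH.fin_H in \<open>auto simp: is_biset_def tensor_act_def\<close>)

interpretation T: finite_action H "points Y \<times> points X" "tensor_act Y X" by (rule tensor_action)

abbreviation (input) "T \<equiv> biset_tensor H Y X"

lemma ract_ract_inv: "y \<in> points Y \<Longrightarrow> h \<in> carrier H \<Longrightarrow> ract Y (ract Y y h) (inv\<^bsub>H\<^esub> h) = y"
  using Y GH.H.inv_closed GH.H.r_inv unfolding is_biset_def by metis

lemma ract_inv_ract: "y \<in> points Y \<Longrightarrow> h \<in> carrier H \<Longrightarrow> ract Y (ract Y y (inv\<^bsub>H\<^esub> h)) h = y"
  using Y GH.H.inv_closed GH.H.l_inv unfolding is_biset_def by metis

lemma tensor_rel_image: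
  assumes "y \<in> points Y" "x \<in> points X"
  shows "tensor_rel H Y X `` {(y, x)} = T.orb (y, x)"
proof
  show "tensor_rel H Y X `` {(y, x)} \<subseteq> T.orb (y, x)"
  proof
    fix z assume "z \<in> tensor_rel H Y X `` {(y, x)}"
    then obtain y' h where h: "h \<in> carrier H" "y' \<in> points Y" "y = ract Y y' h" "z = (y', lact X h x)"
      by (auto simp: tensor_rel_def)
    then have "z = tensor_act Y X h (y, x)" by (simp add: tensor_act_def ract_ract_inv)
    then show "z \<in> T.orb (y, x)" using h by (simp add: T.orb_def)
  qed
  show "T.orb (y, x) \<subseteq> tensor_rel H Y X `` {(y, x)}"
  proof
    fix z assume "z \<in> T.orb (y, x)"
    then obtain h where h: "h \<in> carrier H" "z = (ract Y y (inv\<^bsub>H\<^esub> h), lact X h x)"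
      by (auto simp: T.orb_def tensor_act_def)
    have "ract Y y (inv\<^bsub>H\<^esub> h) \<in> points Y" using Y assms h by (simp add: is_biset_def)
    then have "((ract Y (ract Y y (inv\<^bsub>H\<^esub> h)) h, x), (ract Y y (inv\<^bsub>H\<^esub> h), lact X h x)) \<in> tensor_rel H Y X"
      using h assms unfolding tensor_rel_def by blast
    then show "z \<in> tensor_rel H Y X `` {(y, x)}" using h assms by (simp add: ract_inv_ract)
  qed
qed

lemma tensor_points: "points T = T.orb ` (points Y \<times> points X)"
  unfolding biset_tensor_def quotient_def using tensor_rel_image by auto

lemma tensor_lact:
  assumes "y \<in> points Y" "x \<in> points X" "k \<in> carrier K"
  shows "lact T k (T.orb (y, x)) = T.orb (lact Y k y, x)"
  unfolding T.orb_def biset_tensor_def using assms Y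
  by (auto simp: image_image tensor_act_def is_biset_def)

lemma tensor_ract:
  assumes "y \<in> points Y" "x \<in> points X" "g \<in> carrier G"
  shows "ract T (T.orb (y, x)) g = T.orb (y, ract X x g)"
  unfolding T.orb_def biset_tensor_def using assms X
  by (auto simp: image_image tensor_act_def is_biset_def)

lemma tensor_biset: "is_biset G K T"
proof -
  have fin: "finite (points T)" unfolding tensor_points using T.finite_E by simp
  have Yc: "\<And>y k. y \<in> points Y \<Longrightarrow> k \<in> carrier K \<Longrightarrow> lact Y k y \<in> points Y"
    and Xc: "\<And>x g. x \<in> points X \<Longrightarrow> g \<in> carrier G \<Longrightarrow> ract X x g \<in> points X"
    using X Y by (auto simp: is_biset_def)
  show ?thesis
    unfolding is_biset_def
  proof (intro conjI ballI)
    fix C assume "C \<in> points T"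
    then obtain y x where C: "C = T.orb (y, x)" and yx: "y \<in> points Y" "x \<in> points X"
      unfolding tensor_points by auto
    note simps = tensor_lact tensor_ract C yx Yc Xc
    show "lact T k C \<in> points T" if "k \<in> carrier K" for k
      using that unfolding tensor_points by (simp add: simps)
    show "ract T C g \<in> points T" if "g \<in> carrier G" for g
      using that unfolding tensor_points by (simp add: simps)
    show "lact T \<one>\<^bsub>K\<^esub> C = C" using Y by (simp add: simps is_biset_def)
    show "ract T C \<one>\<^bsub>G\<^esub> = C" using X by (simp add: simps is_biset_def)
    show "lact T (k \<otimes>\<^bsub>K\<^esub> k') C = lact T k (lact T k' C)" if "k \<in> carrier K" "k' \<in> carrier K" for k k'
      using that Y by (simp add: simps) (simp add: is_biset_def yx)
    show "ract T C (k \<otimes>\<^bsub>G\<^esub> k') = ract T (ract T C k) k'" if "k \<in> carrier G" "k' \<in> carrier G" for k k'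
      using that X by (simp add: simps) (simp add: is_biset_def yx)
    show "ract T (lact T k C) g = lact T k (ract T C g)" if "k \<in> carrier K" "g \<in> carrier G" for k g
      using that by (simp add: simps)
  qed (rule fin)
qed

text \<open>\<open>(k,g)\<close> fixes the orbit of \<open>(y,x)\<close> iff some \<open>h\<close> in \<open>H\<close> satisfies \<open>k y = y h\<close> and \<open>h x = x g\<close>.\<close>

lemma tensor_stab:
  assumes "y \<in> points Y" "x \<in> points X"
  shows "stab G K T (T.orb (y, x)) = stab H K Y y O stab G H X x"
proof -
  have "lact T k (T.orb (y, x)) = ract T (T.orb (y, x)) g \<longleftrightarrow>
      (\<exists>h\<in>carrier H. lact Y k y = ract Y y h \<and> lact X h x = ract X x g)"
    if k: "k \<in> carrier K" and g: "g \<in> carrier G" for k g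
  proof -
    have c: "lact Y k y \<in> points Y" "ract X x g \<in> points X" using X Y assms k g by (auto simp: is_biset_def)
    have "lact T k (T.orb (y, x)) = ract T (T.orb (y, x)) g \<longleftrightarrow> T.orb (y, ract X x g) = T.orb (lact Y k y, x)"
      by (simp add: tensor_lact tensor_ract assms k g eq_commute)
    also have "\<dots> \<longleftrightarrow> (y, ract X x g) \<in> T.orb (lact Y k y, x)"
      using assms c by (intro T.orb_eq_iff) auto
    also have "\<dots> \<longleftrightarrow> (\<exists>h\<in>carrier H. y = ract Y (lact Y k y) (inv\<^bsub>H\<^esub> h) \<and> ract X x g = lact X h x)"
      by (auto simp: T.orb_def tensor_act_def)
    also have "\<dots> \<longleftrightarrow> (\<exists>h\<in>carrier H. lact Y k y = ract Y y h \<and> lact X h x = ract X x g)"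
      using ract_inv_ract[OF c(1)] ract_ract_inv[OF assms(1)] by (metis (no_types))
    finally show ?thesis .
  qed
  then show ?thesis by (auto simp: stab_def)
qed

lemma tensor_isotropy:
  assumes "y \<in> points Y" "x \<in> points X"
  shows "T.stabilizes (y, x) = isotropy G H K (stab H K Y y) (stab G H X x)"
proof -
  have "ract Y y (inv\<^bsub>H\<^esub> h) = y \<longleftrightarrow> y = ract Y y h" if h: "h \<in> carrier H" for h
    using ract_inv_ract[OF assms(1) h] ract_ract_inv[OF assms(1) h] by metis
  then show ?thesis
    using X Y assms by (auto simp: T.stabilizes_def isotropy_def tensor_act_def stab_def is_biset_def)
qed

text \<open>Sum over pairs \<open>(y,x)\<close> instead of orbits, weighting each pair by its share of the orbit.\<close>

lemma tensor_count:
  "of_nat (stab_count G K T D) =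
    (\<Sum>A\<in>Pow (carrier K \<times> carrier H). \<Sum>B\<in>Pow (carrier H \<times> carrier G).
      of_nat (stab_count H K Y A) * of_nat (stab_count G H X B) *
        (if A O B = D then weight A B else 0))"
proof -
  let ?w = "\<lambda>A B. if A O B = D then weight A B else 0"
  have "of_nat (stab_count G K T D) = (\<Sum>C\<in>T.orb ` (points Y \<times> points X). if stab G K T C = D then 1 else (0::rat))"
    using T.finite_E by (simp add: stab_count_def tensor_points sum.If_cases Int_def)
  also have "\<dots> = (\<Sum>z\<in>points Y \<times> points X. (if stab G K T (T.orb z) = D then 1 else 0) *
      (of_nat (card (T.stabilizes z)) / of_nat (card (carrier H))))"
    by (rule T.sum_over_orbits[symmetric])
  also have "\<dots> = (\<Sum>(y, x)\<in>points Y \<times> points X. ?w (stab H K Y y) (stab G H X x))"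
  proof (rule sum.cong[OF refl])
    fix z assume "z \<in> points Y \<times> points X"
    then obtain y x where "z = (y, x)" "y \<in> points Y" "x \<in> points X" by auto
    then show "(if stab G K T (T.orb z) = D then 1 else 0) * (of_nat (card (T.stabilizes z)) / of_nat (card (carrier H))) =
        (case z of (y, x) \<Rightarrow> ?w (stab H K Y y) (stab G H X x))"
      by (simp add: tensor_stab tensor_isotropy)
  qed
  also have "\<dots> = (\<Sum>y\<in>points Y. \<Sum>x\<in>points X. ?w (stab H K Y y) (stab G H X x))"
    by (rule sum.cartesian_product[symmetric])
  also have "\<dots> = (\<Sum>y\<in>points Y. \<Sum>B\<in>Pow (carrier H \<times> carrier G). of_nat (stab_count G H X B) * ?w (stab H K Y y) B)"
    by (rule sum.cong[OF refl], rule GH.sum_points[OF X])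
  also have "\<dots> = (\<Sum>A\<in>Pow (carrier K \<times> carrier H). of_nat (stab_count H K Y A) *
      (\<Sum>B\<in>Pow (carrier H \<times> carrier G). of_nat (stab_count G H X B) * ?w A B))"
    by (rule HK.sum_points[OF Y])
  finally show ?thesis by (simp add: sum_distrib_left mult.assoc)
qed

end

lemma formal_comp_closed:
  assumes "f \<in> formal_bisets p H K" "g \<in> formal_bisets p G H"
  shows "formal_comp G H K f g \<in> formal_bisets p G K"
  unfolding formal_comp_def using assms
  by (intro GK.formal_bisets_sum GK.formal_bisets_scale GK.formal_gen_closed tensor_biset
      Z_loc_mult[OF GH.prime_p]) (auto simp: formal_bisets_def)

lemma formal_count_comp:
  assumes "f \<in> formal_bisets p H K" "g \<in> formal_bisets p G H"
  shows "formal_count G K (formal_comp G H K f g) D =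
    (\<Sum>A\<in>Pow (carrier K \<times> carrier H). \<Sum>B\<in>Pow (carrier H \<times> carrier G).
      formal_count H K f A * formal_count G H g B * (if A O B = D then weight A B else 0))"
proof -
  let ?w = "\<lambda>A B. if A O B = D then weight A B else 0"
  let ?f = "Poly_Mapping.lookup f" and ?g = "Poly_Mapping.lookup g"
  let ?F = "Poly_Mapping.keys f" and ?G = "Poly_Mapping.keys g"
  let ?A = "Pow (carrier K \<times> carrier H)" and ?B = "Pow (carrier H \<times> carrier G)"
  have bY: "is_biset H K Y" if "Y \<in> ?F" for Y using that assms by (auto simp: formal_bisets_def)
  have bX: "is_biset G H X" if "X \<in> ?G" for X using that assms by (auto simp: formal_bisets_def)
  have "formal_count G K (formal_comp G H K f g) D =
      (\<Sum>Y\<in>?F. \<Sum>X\<in>?G. ?f Y * ?g X * (\<Sum>A\<in>?A. \<Sum>B\<in>?B.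
        of_nat (stab_count H K Y A) * of_nat (stab_count G H X B) * ?w A B))"
    unfolding formal_comp_def formal_count_sum formal_count_scale
    by (intro sum.cong refl) (simp add: formal_count_gen tensor_biset tensor_count bX bY)
  also have "\<dots> = (\<Sum>Y\<in>?F. \<Sum>X\<in>?G. \<Sum>A\<in>?A. \<Sum>B\<in>?B.
      ?f Y * of_nat (stab_count H K Y A) * (?g X * of_nat (stab_count G H X B)) * ?w A B)"
    by (simp add: sum_distrib_left mult_ac)
  also have "\<dots> = (\<Sum>Y\<in>?F. \<Sum>A\<in>?A. \<Sum>X\<in>?G. \<Sum>B\<in>?B.
      ?f Y * of_nat (stab_count H K Y A) * (?g X * of_nat (stab_count G H X B)) * ?w A B)"
    by (rule sum.cong[OF refl], rule sum.swap)
  also have "\<dots> = (\<Sum>A\<in>?A. \<Sum>Y\<in>?F. \<Sum>X\<in>?G. \<Sum>B\<in>?B.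
      ?f Y * of_nat (stab_count H K Y A) * (?g X * of_nat (stab_count G H X B)) * ?w A B)"
    by (rule sum.swap)
  also have "\<dots> = (\<Sum>A\<in>?A. \<Sum>Y\<in>?F. \<Sum>B\<in>?B. \<Sum>X\<in>?G.
      ?f Y * of_nat (stab_count H K Y A) * (?g X * of_nat (stab_count G H X B)) * ?w A B)"
    by (rule sum.cong[OF refl], rule sum.cong[OF refl], rule sum.swap)
  also have "\<dots> = (\<Sum>A\<in>?A. \<Sum>B\<in>?B. \<Sum>Y\<in>?F. \<Sum>X\<in>?G.
      ?f Y * of_nat (stab_count H K Y A) * (?g X * of_nat (stab_count G H X B)) * ?w A B)"
    by (rule sum.cong[OF refl], rule sum.swap)
  also have "\<dots> = (\<Sum>A\<in>?A. \<Sum>B\<in>?B. formal_count H K f A * formal_count G H g B * ?w A B)"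
    unfolding formal_count_def by (intro sum.cong refl) (simp only: sum_distrib_left sum_distrib_right, rule sum.swap)
  finally show ?thesis .
qed

lemma burnside_comp_class:
  assumes "f \<in> formal_bisets p H K" "g \<in> formal_bisets p G H"
  shows "burnside_comp p G H K (formal_class p H K f) (formal_class p G H g) =
    formal_class p G K (formal_comp G H K f g)"
  unfolding burnside_comp_def
proof (intro GK.UNION_const)
  fix f' g' assume "f' \<in> formal_class p H K f" "g' \<in> formal_class p G H g"
  then have *: "f' \<in> formal_bisets p H K" "g' \<in> formal_bisets p G H"
      "formal_count H K f' = formal_count H K f" "formal_count G H g' = formal_count G H g"
    using assms by (auto simp: HK.formal_class_eq GH.formal_class_eq)
  then have "formal_count G K (formal_comp G H K f' g') = formal_count G K (formal_comp G H K f g)"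
    using assms by (intro ext) (simp add: formal_count_comp)
  then show "formal_class p G K (formal_comp G H K f' g') = formal_class p G K (formal_comp G H K f g)"
    using assms * by (subst GK.formal_class_cong) (auto simp: formal_comp_closed)
qed (use assms in \<open>auto simp: HK.formal_class_eq GH.formal_class_eq\<close>)

lemma burnside_comp_closed:
  assumes "b \<in> burnside_carrier p H K" "a \<in> burnside_carrier p G H"
  shows "burnside_comp p G H K b a \<in> burnside_carrier p G K"
  by (rule HK.class_rep[OF assms(1)], rule GH.class_rep[OF assms(2)])
    (simp add: burnside_comp_class formal_comp_closed GK.formal_class_closed)

lemma class_count_comp:
  assumes "b \<in> burnside_carrier p H K" "a \<in> burnside_carrier p G H"
  shows "class_count G K (burnside_comp p G H K b a) D =
    (\<Sum>A\<in>Pow (carrier K \<times> carrier H). \<Sum>B\<in>Pow (carrier H \<times> carrier G).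
      class_count H K b A * class_count G H a B * (if A O B = D then weight A B else 0))"
proof -
  obtain f where f: "f \<in> formal_bisets p H K" "b = formal_class p H K f" "class_count H K b = formal_count H K f"
    using HK.class_rep[OF assms(1)] .
  obtain g where g: "g \<in> formal_bisets p G H" "a = formal_class p G H g" "class_count G H a = formal_count G H g"
    using GH.class_rep[OF assms(2)] .
  have "burnside_comp p G H K b a = formal_class p G K (formal_comp G H K f g)"
    using burnside_comp_class[OF f(1) g(1)] f(2) g(2) by simp
  then have "class_count G K (burnside_comp p G H K b a) D = formal_count G K (formal_comp G H K f g) D"
    by (simp only: GK.class_count_formal_class[OF formal_comp_closed[OF f(1) g(1)]])
  also have "\<dots> = (\<Sum>A\<in>Pow (carrier K \<times> carrier H). \<Sum>B\<in>Pow (carrier H \<times> carrier G).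
      formal_count H K f A * formal_count G H g B * (if A O B = D then weight A B else 0))"
    by (rule formal_count_comp[OF f(1) g(1)])
  finally show ?thesis by (simp only: f(3) g(3))
qed

lemma mark_comp:
  assumes "b \<in> burnside_carrier p H K" "a \<in> burnside_carrier p G H"
  shows "mark G K (burnside_comp p G H K b a) Z =
    (\<Sum>A\<in>Pow (carrier K \<times> carrier H). \<Sum>B\<in>Pow (carrier H \<times> carrier G).
      class_count H K b A * class_count G H a B * (if Z \<subseteq> A O B then weight A B else 0))"
proof -
  let ?P = "{D. D \<subseteq> carrier K \<times> carrier G \<and> Z \<subseteq> D}"
  let ?A = "Pow (carrier K \<times> carrier H)" and ?B = "Pow (carrier H \<times> carrier G)"
  have finP: "finite ?P" by (rule finite_subset[of _ "Pow (carrier K \<times> carrier G)"]) (use GK.fin_G GK.fin_H in auto)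
  have "mark G K (burnside_comp p G H K b a) Z = (\<Sum>D\<in>?P. \<Sum>A\<in>?A. \<Sum>B\<in>?B.
      class_count H K b A * class_count G H a B * (if A O B = D then weight A B else 0))"
    by (simp add: mark_def class_count_comp[OF assms])
  also have "\<dots> = (\<Sum>A\<in>?A. \<Sum>D\<in>?P. \<Sum>B\<in>?B.
      class_count H K b A * class_count G H a B * (if A O B = D then weight A B else 0))"
    by (rule sum.swap)
  also have "\<dots> = (\<Sum>A\<in>?A. \<Sum>B\<in>?B. \<Sum>D\<in>?P.
      class_count H K b A * class_count G H a B * (if A O B = D then weight A B else 0))"
    by (rule sum.cong[OF refl], rule sum.swap)
  also have "\<dots> = (\<Sum>A\<in>?A. \<Sum>B\<in>?B.
      class_count H K b A * class_count G H a B * (if Z \<subseteq> A O B then weight A B else 0))"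
  proof (intro sum.cong refl)
    fix A B assume AB: "A \<in> ?A" "B \<in> ?B"
    have "A O B \<subseteq> carrier K \<times> carrier G" using AB by auto
    then have "(\<Sum>D\<in>?P. if A O B = D then weight A B else 0) = (if Z \<subseteq> A O B then weight A B else 0)"
      using finP by (simp add: sum.delta)
    then show "(\<Sum>D\<in>?P. class_count H K b A * class_count G H a B * (if A O B = D then weight A B else 0)) =
        class_count H K b A * class_count G H a B * (if Z \<subseteq> A O B then weight A B else 0)"
      by (simp add: sum_distrib_left[symmetric])
  qed
  finally show ?thesis .
qed

end


section \<open>Composition with a homomorphism\<close>

lemma graph_mem: "(h, g) \<in> graph_subgroup U \<phi> \<longleftrightarrow> g \<in> U \<and> h = \<phi> g"
  by (auto simp: graph_subgroup_def)

lemma graph_card: "card (graph_subgroup U \<phi>) = card U"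
  unfolding graph_subgroup_def by (rule card_image) (auto simp: inj_on_def)

context two_groups
begin

lemma graph_subgroup_hom:
  assumes "\<phi> \<in> hom G H"
  shows "subgroup (graph_subgroup (carrier G) \<phi>) (H \<times>\<times> G)"
proof -
  interpret \<phi>: group_hom G H \<phi> by unfold_locales (rule assms)
  show ?thesis
    by (rule HG.subgroupI) (auto simp: graph_subgroup_def image_iff)
qed

text \<open>Conjugating the graph of a homomorphism in \<open>H \<times> G\<close> amounts to composing the homomorphism with an inner
  automorphism of \<open>H\<close>.\<close>

lemma conj_graph:
  assumes "\<phi> \<in> hom G H" "h0 \<in> carrier H" "g0 \<in> carrier G"
  shows "cset (h0, g0) (graph_subgroup (carrier G) \<phi>) =
    graph_subgroup (carrier G)
      (\<lambda>g. (h0 \<otimes>\<^bsub>H\<^esub> inv\<^bsub>H\<^esub> \<phi> g0) \<otimes>\<^bsub>H\<^esub> \<phi> g \<otimes>\<^bsub>H\<^esub> inv\<^bsub>H\<^esub> (h0 \<otimes>\<^bsub>H\<^esub> inv\<^bsub>H\<^esub> \<phi> g0))"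
    (is "?L = graph_subgroup _ ?\<psi>")
proof -
  interpret \<phi>: group_hom G H \<phi> by unfold_locales (rule assms)
  have cancel: "inv\<^bsub>H\<^esub> \<phi> g0 \<otimes>\<^bsub>H\<^esub> (\<phi> g0 \<otimes>\<^bsub>H\<^esub> y) = y" if "y \<in> carrier H" for y
    using that assms by (simp add: H.m_assoc[symmetric])
  have cancelG: "g0 \<otimes>\<^bsub>G\<^esub> (inv\<^bsub>G\<^esub> g0 \<otimes>\<^bsub>G\<^esub> y) = y" if "y \<in> carrier G" for y
    using that assms by (simp add: G.m_assoc[symmetric])
  have eq: "?\<psi> (g0 \<otimes>\<^bsub>G\<^esub> g \<otimes>\<^bsub>G\<^esub> inv\<^bsub>G\<^esub> g0) = h0 \<otimes>\<^bsub>H\<^esub> \<phi> g \<otimes>\<^bsub>H\<^esub> inv\<^bsub>H\<^esub> h0" if "g \<in> carrier G" for g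
    using that assms by (simp add: H.m_assoc H.inv_mult_group cancel)
  show ?thesis
  proof
    show "?L \<subseteq> graph_subgroup (carrier G) ?\<psi>"
      using assms eq by (auto simp: conj_set_def graph_subgroup_def image_iff)
    show "graph_subgroup (carrier G) ?\<psi> \<subseteq> ?L"
    proof
      fix z assume "z \<in> graph_subgroup (carrier G) ?\<psi>"
      then obtain g where g: "g \<in> carrier G" "z = (?\<psi> g, g)" by (auto simp: graph_subgroup_def)
      let ?g = "inv\<^bsub>G\<^esub> g0 \<otimes>\<^bsub>G\<^esub> g \<otimes>\<^bsub>G\<^esub> g0"
      have gg: "g = g0 \<otimes>\<^bsub>G\<^esub> ?g \<otimes>\<^bsub>G\<^esub> inv\<^bsub>G\<^esub> g0"
        using g assms by (simp add: G.m_assoc cancelG)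
      have "z = (h0 \<otimes>\<^bsub>H\<^esub> \<phi> ?g \<otimes>\<^bsub>H\<^esub> inv\<^bsub>H\<^esub> h0, g0 \<otimes>\<^bsub>G\<^esub> ?g \<otimes>\<^bsub>G\<^esub> inv\<^bsub>G\<^esub> g0)"
        using g(2) eq[of ?g] gg assms g(1) by simp
      then show "z \<in> ?L"
        using g assms by (auto simp: conj_set_def graph_subgroup_def image_iff intro!: bexI[of _ ?g])
    qed
  qed
qed

text \<open>Averaging over the whole group enumerates the points of a transitive biset with multiplicity the order
  of the stabilizer.\<close>

lemma sum_stab_transitive:
  fixes w :: "('h \<times> 'g) set \<Rightarrow> rat"
  assumes "subgroup (graph_subgroup U \<phi>) (H \<times>\<times> G)"
  shows "(\<Sum>B\<in>Pow (carrier H \<times> carrier G). class_count G H (transitive_class p G H U \<phi>) B * w B) =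
    (\<Sum>z\<in>carrier (H \<times>\<times> G). w (cset z (graph_subgroup U \<phi>))) / of_nat (card U)"
proof -
  let ?X = "transitive_biset G H U \<phi>" and ?D = "graph_subgroup U \<phi>"
  note X = transitive_biset_props[OF assms]
  have bX: "is_biset G H ?X" using X(1) by (simp add: transitive_def)
  have "finite ?D" using subgroup.subset[OF assms] fin_HG by (rule finite_subset)
  then have D0: "card ?D \<noteq> 0" using subgroup.one_closed[OF assms] by auto
  have "(\<Sum>B\<in>Pow (carrier H \<times> carrier G). class_count G H (transitive_class p G H U \<phi>) B * w B) =
      (\<Sum>y\<in>points ?X. w (stab G H ?X y))"
    by (simp add: transitive_class_def class_count_biset[OF bX] sum_points[OF bX])
  also have "\<dots> = (\<Sum>z\<in>carrier (H \<times>\<times> G). w (cset z ?D)) / of_nat (card ?D)"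
    using sum_transitive[OF X(1,2), of w] D0 by (simp add: X(3) field_simps)
  finally show ?thesis by (simp add: graph_card)
qed

lemma transitive_class_closed:
  "subgroup (graph_subgroup U \<phi>) (H \<times>\<times> G) \<Longrightarrow> transitive_class p G H U \<phi> \<in> burnside_carrier p G H"
  unfolding transitive_class_def using transitive_biset_props(1)[of U \<phi>]
  by (intro biset_class_closed) (simp add: transitive_def)

end

context three_groups
begin

lemma sum_if_superset:
  fixes c :: rat
  shows "(\<Sum>A\<in>Pow (carrier K \<times> carrier H). class_count H K b A * (if C \<subseteq> A then c else 0)) =
    c * mark H K b C"
proof -
  have "(\<Sum>A\<in>Pow (carrier K \<times> carrier H). class_count H K b A * (if C \<subseteq> A then c else 0)) =
      (\<Sum>A | A \<subseteq> carrier K \<times> carrier H \<and> C \<subseteq> A. c * class_count H K b A)"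
    by (rule sum.mono_neutral_cong_right) (use GH.fin_H HK.fin_H in auto)
  then show ?thesis by (simp add: mark_def sum_distrib_left)
qed

text \<open>Composing with \<open>[G,\<phi>]\<close> on the right restricts the right action along \<open>\<phi>\<close>. In the restricted biset
  \<open>(k,g)\<close> fixes a point iff \<open>(k,\<phi> g)\<close> does in the original one, and
  \<open>Z O converse (graph \<phi>)\<close> is the set of these pairs.\<close>

lemma mark_comp_right_graph:
  assumes b: "b \<in> burnside_carrier p H K" and \<phi>: "\<phi> \<in> hom G H"
    and Z: "Z \<subseteq> carrier K \<times> carrier G"
  shows "mark G K (burnside_comp p G H K b (transitive_class p G H (carrier G) \<phi>)) Z =
    mark H K b (Z O converse (graph_subgroup (carrier G) \<phi>))"
proof -
  let ?D = "graph_subgroup (carrier G) \<phi>" and ?Z = "Z O converse (graph_subgroup (carrier G) \<phi>)"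
  let ?h = "of_nat (card (carrier H)) :: rat" and ?g = "of_nat (card (carrier G)) :: rat"
  interpret \<phi>: group_hom G H \<phi> by unfold_locales (rule \<phi>)
  have D: "subgroup ?D (H \<times>\<times> G)" by (rule GH.graph_subgroup_hom[OF \<phi>])
  define c where "c z = fst z \<otimes>\<^bsub>H\<^esub> inv\<^bsub>H\<^esub> \<phi> (snd z)" for z
  have c: "c z \<in> carrier H" if "z \<in> carrier (H \<times>\<times> G)" for z using that by (auto simp: c_def)
  have Zsub: "?Z \<subseteq> carrier (K \<times>\<times> H)" using Z by (auto simp: graph_mem)
  have w: "(if Z \<subseteq> A O GH.cset z ?D then weight A (GH.cset z ?D) else 0) =
      (if HK.cset (\<one>\<^bsub>K\<^esub>, c z) ?Z \<subseteq> A then 1 / ?h else 0)"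
    if z: "z \<in> carrier (H \<times>\<times> G)" and A: "subgroup A (K \<times>\<times> H)" for z A
  proof -
    obtain h0 g0 where hg: "z = (h0, g0)" "h0 \<in> carrier H" "g0 \<in> carrier G" using z by auto
    have B: "(h, g) \<in> GH.cset z ?D \<longleftrightarrow> g \<in> carrier G \<and> h = c z \<otimes>\<^bsub>H\<^esub> \<phi> g \<otimes>\<^bsub>H\<^esub> inv\<^bsub>H\<^esub> c z" for h g
      using GH.conj_graph[OF \<phi> hg(2,3)] by (simp add: hg(1) c_def graph_mem)
    have "isotropy G H K A (GH.cset z ?D) = {\<one>\<^bsub>H\<^esub>}"
      using subgroup.one_closed[OF A] c[OF z] by (auto simp: isotropy_def B)
    moreover have "Z \<subseteq> A O GH.cset z ?D \<longleftrightarrow> HK.cset (\<one>\<^bsub>K\<^esub>, c z) ?Z \<subseteq> A"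
    proof -
      have "HK.cset (\<one>\<^bsub>K\<^esub>, c z) ?Z = (\<lambda>(k, g). (k, c z \<otimes>\<^bsub>H\<^esub> \<phi> g \<otimes>\<^bsub>H\<^esub> inv\<^bsub>H\<^esub> c z)) ` Z"
      proof -
        have "?Z = (\<lambda>(k, g). (k, \<phi> g)) ` Z" using Z by (force simp: graph_mem)
        then show ?thesis unfolding conj_set_def using c[OF z] Z
          by (auto simp: image_image split_beta subset_iff intro!: image_cong)
      qed
      moreover have "Z \<subseteq> A O GH.cset z ?D \<longleftrightarrow>
          (\<forall>(k, g)\<in>Z. (k, c z \<otimes>\<^bsub>H\<^esub> \<phi> g \<otimes>\<^bsub>H\<^esub> inv\<^bsub>H\<^esub> c z) \<in> A)"
        using Z by (auto simp: B relcomp_unfold subset_iff)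
      ultimately show ?thesis by auto
    qed
    ultimately show ?thesis by simp
  qed
  have "mark G K (burnside_comp p G H K b (transitive_class p G H (carrier G) \<phi>)) Z =
      (\<Sum>A\<in>Pow (carrier K \<times> carrier H). class_count H K b A *
        (\<Sum>B\<in>Pow (carrier H \<times> carrier G). class_count G H (transitive_class p G H (carrier G) \<phi>) B *
          (if Z \<subseteq> A O B then weight A B else 0)))"
    by (simp add: mark_comp[OF b GH.transitive_class_closed[OF D]] sum_distrib_left mult.assoc)
  also have "\<dots> = (\<Sum>A\<in>Pow (carrier K \<times> carrier H). class_count H K b A *
        ((\<Sum>z\<in>carrier (H \<times>\<times> G). if Z \<subseteq> A O GH.cset z ?D then weight A (GH.cset z ?D) else 0) / ?g))"
    by (simp only: GH.sum_stab_transitive[OF D])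
  also have "\<dots> = (\<Sum>A\<in>Pow (carrier K \<times> carrier H). class_count H K b A *
        ((\<Sum>z\<in>carrier (H \<times>\<times> G). if HK.cset (\<one>\<^bsub>K\<^esub>, c z) ?Z \<subseteq> A then 1 / ?h else 0) / ?g))"
  proof (rule sum.cong[OF refl])
    fix A
    show "class_count H K b A * ((\<Sum>z\<in>carrier (H \<times>\<times> G). if Z \<subseteq> A O GH.cset z ?D then weight A (GH.cset z ?D) else 0) / ?g) =
        class_count H K b A * ((\<Sum>z\<in>carrier (H \<times>\<times> G). if HK.cset (\<one>\<^bsub>K\<^esub>, c z) ?Z \<subseteq> A then 1 / ?h else 0) / ?g)"
    proof (cases "subgroup A (K \<times>\<times> H)")
      case True
      show ?thesis by (simp only: w[OF _ True] cong: sum.cong)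
    qed (simp add: HK.class_count_outside[OF b])
  qed
  also have "\<dots> = (\<Sum>z\<in>carrier (H \<times>\<times> G). \<Sum>A\<in>Pow (carrier K \<times> carrier H).
       class_count H K b A * (if HK.cset (\<one>\<^bsub>K\<^esub>, c z) ?Z \<subseteq> A then 1 / ?h else 0)) / ?g"
    by (subst sum.swap) (simp only: sum_distrib_left sum_divide_distrib times_divide_eq_right)
  also have "\<dots> = (\<Sum>z\<in>carrier (H \<times>\<times> G). 1 / ?h * mark H K b ?Z) / ?g"
    by (simp only: sum_if_superset)
      (use HK.mark_conj[OF b _ Zsub] c in \<open>auto intro!: sum.cong arg_cong[where f = "\<lambda>x. x / ?g"]\<close>)
  also have "\<dots> = mark H K b ?Z"
    using GH.fin_H GH.fin_G GH.H.one_closed GH.G.one_closed by (auto simp: card_cartesian_product)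
  finally show ?thesis .
qed

text \<open>The mirror image: composing on the left with the class of the inverse of an injective \<open>\<phi>\<close> restricts
  the left action along \<open>\<phi>\<close>.\<close>

lemma mark_comp_left_graph:
  assumes a: "a \<in> burnside_carrier p G H" and \<phi>: "\<phi> \<in> hom K H"
    and \<psi>: "graph_subgroup U \<psi> = converse (graph_subgroup (carrier K) \<phi>)"
    and Z: "Z \<subseteq> carrier K \<times> carrier G"
  shows "mark G K (burnside_comp p G H K (transitive_class p H K U \<psi>) a) Z =
    mark G H a (graph_subgroup (carrier K) \<phi> O Z)"
proof -
  let ?E = "graph_subgroup U \<psi>" and ?D = "graph_subgroup (carrier K) \<phi>"
  let ?Z = "?D O Z"
  let ?h = "of_nat (card (carrier H)) :: rat" and ?k = "of_nat (card (carrier K)) :: rat"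
  interpret \<phi>: group_hom K H \<phi> by unfold_locales (rule \<phi>)
  interpret KH: two_groups p K H by unfold_locales (rule GH.prime_p HK.fin_H GH.fin_H)+
  have D: "subgroup ?D (H \<times>\<times> K)" by (rule KH.graph_subgroup_hom[OF \<phi>])
  have E: "subgroup ?E (K \<times>\<times> H)"
    unfolding \<psi> by (rule HK.HG.subgroupI) (auto simp: graph_subgroup_def image_iff)
  have "card U = card ?D" using graph_card[of U \<psi>] by (simp add: \<psi>)
  then have cU: "card U = card (carrier K)" by (simp add: graph_card)
  define c where "c z = snd z \<otimes>\<^bsub>H\<^esub> inv\<^bsub>H\<^esub> \<phi> (fst z)" for z
  have c: "c z \<in> carrier H" if "z \<in> carrier (K \<times>\<times> H)" for z using that by (auto simp: c_def)
  have Zsub: "?Z \<subseteq> carrier (H \<times>\<times> G)" using Z by (auto simp: graph_mem)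
  have w: "(if Z \<subseteq> HK.cset z ?E O B then weight (HK.cset z ?E) B else 0) =
      (if GH.cset (c z, \<one>\<^bsub>G\<^esub>) ?Z \<subseteq> B then 1 / ?h else 0)"
    if z: "z \<in> carrier (K \<times>\<times> H)" and B: "subgroup B (H \<times>\<times> G)" for z B
  proof -
    obtain k0 h0 where hk: "z = (k0, h0)" "k0 \<in> carrier K" "h0 \<in> carrier H" using z by auto
    have "HK.cset z ?E = converse (KH.cset (h0, k0) ?D)"
      unfolding \<psi> conj_set_def using hk by (force simp: graph_subgroup_def image_iff)
    then have A: "(k, h) \<in> HK.cset z ?E \<longleftrightarrow> k \<in> carrier K \<and> h = c z \<otimes>\<^bsub>H\<^esub> \<phi> k \<otimes>\<^bsub>H\<^esub> inv\<^bsub>H\<^esub> c z" for k h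
      using KH.conj_graph[OF \<phi> hk(3,2)] by (simp add: hk(1) c_def graph_mem)
    have "isotropy G H K (HK.cset z ?E) B = {\<one>\<^bsub>H\<^esub>}"
      using subgroup.one_closed[OF B] c[OF z] by (auto simp: isotropy_def A)
    moreover have "Z \<subseteq> HK.cset z ?E O B \<longleftrightarrow> GH.cset (c z, \<one>\<^bsub>G\<^esub>) ?Z \<subseteq> B"
    proof -
      have "GH.cset (c z, \<one>\<^bsub>G\<^esub>) ?Z = (\<lambda>(k, g). (c z \<otimes>\<^bsub>H\<^esub> \<phi> k \<otimes>\<^bsub>H\<^esub> inv\<^bsub>H\<^esub> c z, g)) ` Z"
      proof -
        have "?Z = (\<lambda>(k, g). (\<phi> k, g)) ` Z" using Z by (force simp: graph_mem)
        then show ?thesis unfolding conj_set_def using c[OF z] Z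
          by (auto simp: image_image split_beta subset_iff intro!: image_cong)
      qed
      moreover have "Z \<subseteq> HK.cset z ?E O B \<longleftrightarrow>
          (\<forall>(k, g)\<in>Z. (c z \<otimes>\<^bsub>H\<^esub> \<phi> k \<otimes>\<^bsub>H\<^esub> inv\<^bsub>H\<^esub> c z, g) \<in> B)"
        using Z by (auto simp: A relcomp_unfold subset_iff)
      ultimately show ?thesis by auto
    qed
    ultimately show ?thesis by simp
  qed
  have "mark G K (burnside_comp p G H K (transitive_class p H K U \<psi>) a) Z =
      (\<Sum>B\<in>Pow (carrier H \<times> carrier G). class_count G H a B *
        (\<Sum>A\<in>Pow (carrier K \<times> carrier H). class_count H K (transitive_class p H K U \<psi>) A *
          (if Z \<subseteq> A O B then weight A B else 0)))"
    by (subst mark_comp[OF HK.transitive_class_closed[OF E] a], subst sum.swap)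
      (simp only: sum_distrib_left mult_ac)
  also have "\<dots> = (\<Sum>B\<in>Pow (carrier H \<times> carrier G). class_count G H a B *
        ((\<Sum>z\<in>carrier (K \<times>\<times> H). if Z \<subseteq> HK.cset z ?E O B then weight (HK.cset z ?E) B else 0) / ?k))"
    by (simp only: HK.sum_stab_transitive[OF E] cU)
  also have "\<dots> = (\<Sum>B\<in>Pow (carrier H \<times> carrier G). class_count G H a B *
        ((\<Sum>z\<in>carrier (K \<times>\<times> H). if GH.cset (c z, \<one>\<^bsub>G\<^esub>) ?Z \<subseteq> B then 1 / ?h else 0) / ?k))"
  proof (rule sum.cong[OF refl])
    fix B
    show "class_count G H a B * ((\<Sum>z\<in>carrier (K \<times>\<times> H). if Z \<subseteq> HK.cset z ?E O B then weight (HK.cset z ?E) B else 0) / ?k) =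
        class_count G H a B * ((\<Sum>z\<in>carrier (K \<times>\<times> H). if GH.cset (c z, \<one>\<^bsub>G\<^esub>) ?Z \<subseteq> B then 1 / ?h else 0) / ?k)"
    proof (cases "subgroup B (H \<times>\<times> G)")
      case True
      show ?thesis by (simp only: w[OF _ True] cong: sum.cong)
    qed (simp add: GH.class_count_outside[OF a])
  qed
  also have "\<dots> = (\<Sum>z\<in>carrier (K \<times>\<times> H). \<Sum>B\<in>Pow (carrier H \<times> carrier G).
       class_count G H a B * (if GH.cset (c z, \<one>\<^bsub>G\<^esub>) ?Z \<subseteq> B then 1 / ?h else 0)) / ?k"
    by (subst sum.swap) (simp only: sum_distrib_left sum_divide_distrib times_divide_eq_right)
  also have "\<dots> = (\<Sum>z\<in>carrier (K \<times>\<times> H). 1 / ?h * mark G H a ?Z) / ?k"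
  proof -
    have "(\<Sum>B\<in>Pow (carrier H \<times> carrier G). class_count G H a B * (if C \<subseteq> B then 1 / ?h else 0)) =
        1 / ?h * mark G H a C" for C
    proof -
      have "(\<Sum>B\<in>Pow (carrier H \<times> carrier G). class_count G H a B * (if C \<subseteq> B then 1 / ?h else 0)) =
          (\<Sum>B | B \<subseteq> carrier H \<times> carrier G \<and> C \<subseteq> B. 1 / ?h * class_count G H a B)"
        by (rule sum.mono_neutral_cong_right) (use GH.fin_H GH.fin_G in auto)
      then show ?thesis by (simp only: mark_def sum_distrib_left)
    qed
    then show ?thesis
      by (simp only:)
        (use GH.mark_conj[OF a _ Zsub] c in \<open>auto intro!: sum.cong arg_cong[where f = "\<lambda>x. x / ?k"]\<close>)
  qed
  also have "\<dots> = mark G H a ?Z"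
    using GH.fin_H HK.fin_H GH.H.one_closed HK.H.one_closed by (auto simp: card_cartesian_product)
  finally show ?thesis .
qed

end


section \<open>A fusion system as a set of graphs\<close>

text \<open>Working with graphs instead of functions makes composition, inversion and restriction of morphisms
  relational operations, and lets morphisms be compared directly with point stabilizers. The elements of a
  graph are the pairs \<open>(\<phi> u, u)\<close>: its \<open>Range\<close> is the source of the morphism, its \<open>Domain\<close> the image, and
  \<open>A O B\<close> is the composite \<open>A \<circ> B\<close>.\<close>

definition fusion_graphs ::
  "('a, 'm) monoid_scheme \<Rightarrow> ('a set \<Rightarrow> 'a set \<Rightarrow> ('a \<Rightarrow> 'a) set) \<Rightarrow> ('a \<times> 'a) set set"
  where "fusion_graphs S F =
    {graph_subgroup P \<phi> | P \<phi>. subgroup P S \<and> \<phi> \<in> F P (carrier S)}"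

lemma Range_graph: "Range (graph_subgroup P \<phi>) = P"
  and Domain_graph: "Domain (graph_subgroup P \<phi>) = \<phi> ` P"
  by (auto simp: graph_subgroup_def)

locale finite_fusion_system = fusion_system S F
  for S :: "('a, 'm) monoid_scheme" (structure) and F :: "'a set \<Rightarrow> 'a set \<Rightarrow> ('a \<Rightarrow> 'a) set" +
  fixes p :: nat
  assumes prime_p: "prime p" and p_group: "finite_p_group p S"
begin

sublocale group S by (rule is_group)

lemma finite_S: "finite (carrier S)" using p_group by (simp add: finite_p_group_def)

sublocale SS: three_groups p S S S
  by unfold_locales (rule prime_p finite_S)+

abbreviation \<G> where "\<G> \<equiv> fusion_graphs S F"

lemma morphismD:
  assumes "subgroup P S" "subgroup Q S" "\<phi> \<in> F P Q"
  shows "\<phi> \<in> hom (S\<lparr>carrier := P\<rparr>) (S\<lparr>carrier := Q\<rparr>)" "inj_on \<phi> P" "\<phi> \<in> extensional P"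
    "\<phi> ` P \<subseteq> Q" "\<And>x y. x \<in> P \<Longrightarrow> y \<in> P \<Longrightarrow> \<phi> (x \<otimes> y) = \<phi> x \<otimes> \<phi> y"
  using morphism[OF assms] by (auto simp: mon_def hom_def)

lemma morphism_image_subgroup:
  assumes "subgroup P S" "subgroup Q S" "\<phi> \<in> F P Q"
  shows "subgroup (\<phi> ` P) S"
proof -
  interpret P: group "S\<lparr>carrier := P\<rparr>" by (rule subgroup.subgroup_is_group[OF assms(1) is_group])
  interpret Q: group "S\<lparr>carrier := Q\<rparr>" by (rule subgroup.subgroup_is_group[OF assms(2) is_group])
  interpret group_hom "S\<lparr>carrier := P\<rparr>" "S\<lparr>carrier := Q\<rparr>" \<phi>
    by unfold_locales (rule morphismD(1)[OF assms])
  have "subgroup (\<phi> ` P) (S\<lparr>carrier := Q\<rparr>)" using img_is_subgroup by simp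
  then show ?thesis using incl_subgroup[OF assms(2)] by blast
qed

lemma inclusion:
  assumes "subgroup P S" "subgroup Q S" "P \<subseteq> Q"
  shows "(\<lambda>x\<in>P. x) \<in> F P Q"
proof -
  have eq: "conj_map S \<one> P = (\<lambda>x\<in>P. x)"
    using subgroup.subset[OF assms(1)] by (auto simp: conj_map_def fun_eq_iff restrict_def)
  have "(\<lambda>x\<in>P. x) ` P \<subseteq> Q" using assms(3) by auto
  then show ?thesis using conj_closed[OF assms(1,2) one_closed] by (simp add: eq)
qed

lemma change_codomain:
  assumes "subgroup P S" "subgroup Q S" "subgroup R S" "\<phi> \<in> F P Q" "\<phi> ` P \<subseteq> R"
  shows "\<phi> \<in> F P R"
proof -
  have sub: "subgroup (\<phi> ` P) S" by (rule morphism_image_subgroup[OF assms(1,2,4)])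
  have "compose P (\<lambda>x\<in>\<phi> ` P. x) \<phi> \<in> F P R"
    using assms sub corestrict inclusion[OF sub] by (intro comp_closed[of P "\<phi> ` P" R]) auto
  moreover have "compose P (\<lambda>x\<in>\<phi> ` P. x) \<phi> = \<phi>"
    using morphismD(3)[OF assms(1,2,4)] by (auto simp: compose_def fun_eq_iff extensional_def)
  ultimately show ?thesis by simp
qed

lemma carrier_sub: "subgroup (carrier S) S" by (rule subgroup_self)

lemma graphI: "subgroup P S \<Longrightarrow> \<phi> \<in> F P (carrier S) \<Longrightarrow> graph_subgroup P \<phi> \<in> \<G>"
  unfolding fusion_graphs_def by blast

lemma graphI': "subgroup P S \<Longrightarrow> subgroup Q S \<Longrightarrow> \<phi> \<in> F P Q \<Longrightarrow> graph_subgroup P \<phi> \<in> \<G>"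
  using change_codomain[of P Q "carrier S" \<phi>] morphism_image_subgroup[of P Q \<phi>] subgroup.subset graphI carrier_sub
  by blast

lemma graphE:
  assumes "D \<in> \<G>"
  obtains \<phi> where "subgroup (Range D) S" "\<phi> \<in> F (Range D) (carrier S)" "D = graph_subgroup (Range D) \<phi>"
    "Domain D = \<phi> ` Range D"
  using assms unfolding fusion_graphs_def by (auto simp: Range_graph Domain_graph)

lemma graph_eq_sub: "subgroup P S \<Longrightarrow> \<phi> \<in> F P (carrier S) \<Longrightarrow> subgroup (graph_subgroup P \<phi>) (S \<times>\<times> S)"
proof -
  assume P: "subgroup P S" and \<phi>: "\<phi> \<in> F P (carrier S)"
  note m = morphismD[OF P carrier_sub \<phi>]
  interpret P: group "S\<lparr>carrier := P\<rparr>" by (rule subgroup.subgroup_is_group[OF P is_group])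
  interpret SP: two_groups p "S\<lparr>carrier := P\<rparr>" S
    using finite_subset[OF subgroup.subset[OF P] finite_S] by unfold_locales (auto simp: prime_p finite_S)
  have "\<phi> \<in> hom (S\<lparr>carrier := P\<rparr>) S" using m(1) by (simp add: hom_def)
  from SP.graph_subgroup_hom[OF this] have "subgroup (graph_subgroup P \<phi>) (S \<times>\<times> S\<lparr>carrier := P\<rparr>)" by simp
  moreover have "S \<times>\<times> S\<lparr>carrier := P\<rparr> = (S \<times>\<times> S)\<lparr>carrier := carrier S \<times> P\<rparr>" by (simp add: DirProd_def)
  moreover have "subgroup (carrier S \<times> P) (S \<times>\<times> S)" by (rule DirProd_subgroups[OF is_group carrier_sub is_group P])
  ultimately show ?thesis using SS.GH.HG.incl_subgroup by metis
qed

lemma graph_sub: "D \<in> \<G> \<Longrightarrow> subgroup D (S \<times>\<times> S)"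
  by (erule graphE) (metis graph_eq_sub)

lemma graph_subset: "D \<in> \<G> \<Longrightarrow> D \<subseteq> carrier S \<times> carrier S"
  using graph_sub subgroup.subset by fastforce

lemma finite_graphs: "finite \<G>"
  by (rule finite_subset[of _ "Pow (carrier S \<times> carrier S)"]) (use graph_subset finite_S in auto)

lemma finite_graph: "D \<in> \<G> \<Longrightarrow> finite D"
  by (rule finite_subset[OF graph_subset]) (use finite_S in auto)

lemma graph_fun: "D \<in> \<G> \<Longrightarrow> (a, x) \<in> D \<Longrightarrow> (b, x) \<in> D \<Longrightarrow> a = b"
  by (erule graphE) (metis graph_mem)

lemma graph_inj:
  assumes "D \<in> \<G>" "(a, x) \<in> D" "(a, y) \<in> D" shows "x = y"
proof -
  obtain \<phi> where "subgroup (Range D) S" "\<phi> \<in> F (Range D) (carrier S)" and D: "D = graph_subgroup (Range D) \<phi>"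
    using graphE[OF assms(1)] by metis
  then have "inj_on \<phi> (Range D)" using morphismD(2) carrier_sub by blast
  moreover have "x \<in> Range D" "y \<in> Range D" "\<phi> x = \<phi> y"
    using assms(2,3) D graph_mem[of _ _ "Range D" \<phi>] by auto
  ultimately show ?thesis by (auto simp: inj_on_def)
qed

lemma Range_sub: "D \<in> \<G> \<Longrightarrow> subgroup (Range D) S"
  by (erule graphE)

lemma card_graph: assumes "D \<in> \<G>" shows "card D = card (Range D)"
proof -
  obtain \<phi> where "D = graph_subgroup (Range D) \<phi>" using graphE[OF assms] by metis
  then show ?thesis by (metis graph_card)
qed

lemma conj_graph_mem:
  assumes "subgroup P S" "s \<in> carrier S"
  shows "{(s \<otimes> x \<otimes> inv s, x) | x. x \<in> P} \<in> \<G>"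
proof -
  have "conj_map S s P \<in> F P (carrier S)"
    using assms subgroup.subset[OF assms(1)] by (intro conj_closed carrier_sub) (auto simp: conj_map_def subset_iff)
  moreover have "graph_subgroup P (conj_map S s P) = {(s \<otimes> x \<otimes> inv s, x) | x. x \<in> P}"
    by (auto simp: graph_subgroup_def conj_map_def image_iff)
  ultimately show ?thesis using graphI[OF assms(1)] by metis
qed

lemma Id_on_graph: assumes "subgroup P S" shows "Id_on P \<in> \<G>"
proof -
  have "graph_subgroup P (\<lambda>x\<in>P. x) = Id_on P" by (auto simp: graph_subgroup_def Id_on_def)
  then show ?thesis using graphI'[OF assms assms inclusion[OF assms assms]] by simp
qed

lemma converse_graph_inv_map:
  assumes "subgroup P S" "\<phi> \<in> F P (carrier S)"
  shows "graph_subgroup (\<phi> ` P) (inv_map P \<phi>) = converse (graph_subgroup P \<phi>)"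
  using morphismD(2)[OF assms(1) carrier_sub assms(2)]
  by (auto simp: graph_subgroup_def inv_map_def image_iff)

lemma graph_converse: assumes "D \<in> \<G>" shows "converse D \<in> \<G>"
proof -
  obtain \<phi> where \<phi>: "subgroup (Range D) S" "\<phi> \<in> F (Range D) (carrier S)" "D = graph_subgroup (Range D) \<phi>"
    using graphE[OF assms] by metis
  let ?P = "Range D"
  have sub: "subgroup (\<phi> ` ?P) S" by (rule morphism_image_subgroup[OF \<phi>(1) carrier_sub \<phi>(2)])
  have "inv_map ?P \<phi> \<in> F (\<phi> ` ?P) ?P" by (rule inverse[OF \<phi>(1) carrier_sub \<phi>(2)])
  from graphI'[OF sub \<phi>(1) this] have "graph_subgroup (\<phi> ` ?P) (inv_map ?P \<phi>) \<in> \<G>" .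
  then show ?thesis using converse_graph_inv_map[OF \<phi>(1,2)] \<phi>(3) by simp
qed

lemma Domain_sub: "D \<in> \<G> \<Longrightarrow> subgroup (Domain D) S"
  using Range_sub[OF graph_converse] by simp

lemma graph_comp: assumes "A \<in> \<G>" "B \<in> \<G>" shows "A O B \<in> \<G>"
proof -
  obtain \<phi> where \<phi>: "subgroup (Range A) S" "\<phi> \<in> F (Range A) (carrier S)" "A = graph_subgroup (Range A) \<phi>"
    using graphE[OF assms(1)] by metis
  obtain \<psi> where \<psi>: "subgroup (Range B) S" "\<psi> \<in> F (Range B) (carrier S)" "B = graph_subgroup (Range B) \<psi>"
    using graphE[OF assms(2)] by metis
  let ?P = "Range A" and ?Q = "Range B"
  define R where "R = {v \<in> ?Q. \<psi> v \<in> ?P}"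
  note m\<phi> = morphismD[OF \<phi>(1) carrier_sub \<phi>(2)] and m\<psi> = morphismD[OF \<psi>(1) carrier_sub \<psi>(2)]
  interpret P: subgroup ?P S by (rule \<phi>(1))
  interpret Q: subgroup ?Q S by (rule \<psi>(1))
  interpret gQ: group "S\<lparr>carrier := ?Q\<rparr>" by (rule Q.subgroup_is_group[OF is_group])
  interpret h\<psi>: group_hom "S\<lparr>carrier := ?Q\<rparr>" S \<psi>
    using m\<psi>(1) by unfold_locales (simp add: hom_def)
  have inv\<psi>: "\<psi> (inv v) = inv \<psi> v" if "v \<in> ?Q" for v
    using h\<psi>.hom_inv[of v] that m_inv_consistent[OF \<psi>(1) that] by simp
  have R: "subgroup R S"
  proof (rule subgroupI)
    show "R \<subseteq> carrier S" using Q.subset by (auto simp: R_def)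
    have "\<one> \<in> R" using h\<psi>.hom_one by (simp add: R_def)
    then show "R \<noteq> {}" by blast
  qed (auto simp: R_def inv\<psi> m\<psi>(5))
  have RQ: "R \<subseteq> ?Q" by (auto simp: R_def)
  let ?r = "compose R \<psi> (\<lambda>x\<in>R. x)"
  have r1: "?r \<in> F R (carrier S)"
    by (rule comp_closed[OF R \<psi>(1) carrier_sub inclusion[OF R \<psi>(1) RQ] \<psi>(2)])
  have "?r ` R \<subseteq> ?P" by (auto simp: compose_def R_def)
  from change_codomain[OF R carrier_sub \<phi>(1) r1 this] have r2: "?r \<in> F R ?P" .
  have "compose R \<phi> ?r \<in> F R (carrier S)" by (rule comp_closed[OF R \<phi>(1) carrier_sub r2 \<phi>(2)])
  from graphI[OF R this] have "graph_subgroup R (compose R \<phi> ?r) \<in> \<G>" .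
  moreover have "graph_subgroup R (compose R \<phi> ?r) = graph_subgroup ?P \<phi> O graph_subgroup ?Q \<psi>"
    by (auto simp: graph_subgroup_def compose_def R_def image_iff relcomp_unfold)
  ultimately show ?thesis using \<phi>(3) \<psi>(3) by simp
qed

lemma graph_restrict: "D \<in> \<G> \<Longrightarrow> subgroup Q S \<Longrightarrow> D O Id_on Q \<in> \<G>"
  by (intro graph_comp Id_on_graph)

lemma Range_subgroup: assumes "subgroup D (S \<times>\<times> S)" shows "subgroup (Range D) S"
proof -
  interpret D: subgroup D "S \<times>\<times> S" by fact
  show ?thesis
  proof (rule subgroupI)
    show "Range D \<subseteq> carrier S" using D.subset by auto
    show "Range D \<noteq> {}" using D.one_closed by auto
    show "inv a \<in> Range D" if a: "a \<in> Range D" for a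
    proof -
      obtain b where b: "(b, a) \<in> D" using a by blast
      then have "b \<in> carrier S" "a \<in> carrier S" using D.subset by auto
      then have "(inv b, inv a) \<in> D" using D.m_inv_closed[OF b] inv_DirProd[OF is_group is_group] by simp
      then show ?thesis by blast
    qed
    show "a \<otimes> a' \<in> Range D" if a: "a \<in> Range D" "a' \<in> Range D" for a a'
    proof -
      obtain b b' where "(b, a) \<in> D" "(b', a') \<in> D" using a by blast
      then show ?thesis using D.m_closed by fastforce
    qed
  qed
qed

text \<open>A subgroup of a graph is the graph of a restriction.\<close>

lemma graph_smaller:
  assumes "D \<in> \<G>" "D' \<subseteq> D" "subgroup D' (S \<times>\<times> S)"
  shows "D' \<in> \<G>"
proof -
  have "D' = D O Id_on (Range D')"
    using assms(2) graph_fun[OF assms(1)] by (auto simp: Id_on_def)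
  then show ?thesis using graph_restrict[OF assms(1) Range_subgroup[OF assms(3)]] by simp
qed

text \<open>Conjugation in \<open>S \<times> S\<close> is composition with inner automorphisms on both sides.\<close>

lemma conj_set_relcomp:
  assumes "s \<in> carrier S" "t \<in> carrier S" "D \<subseteq> carrier S \<times> carrier S"
  shows "conj_set (S \<times>\<times> S) (s, t) D =
    {(s \<otimes> x \<otimes> inv s, x) | x. x \<in> carrier S} O D O converse {(t \<otimes> x \<otimes> inv t, x) | x. x \<in> carrier S}"
  unfolding conj_set_def using assms by (force simp: image_iff relcomp_unfold)

lemma graph_conj:
  assumes "D \<in> \<G>" "z \<in> carrier (S \<times>\<times> S)" shows "conj_set (S \<times>\<times> S) z D \<in> \<G>"
proof -
  obtain s t where z: "z = (s, t)" "s \<in> carrier S" "t \<in> carrier S" using assms(2) by auto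
  show ?thesis unfolding z(1) conj_set_relcomp[OF z(2,3) graph_subset[OF assms(1)]]
    by (intro graph_comp graph_converse conj_graph_mem carrier_sub assms(1) z)
qed

lemma graph_converse_comp: "A \<in> \<G> \<Longrightarrow> converse A O A = Id_on (Range A)"
  using graph_inj[of A] by blast

lemma graph_comp_converse: "A \<in> \<G> \<Longrightarrow> A O converse A = Id_on (Domain A)"
  using graph_fun[of A] by blast

lemma Id_on_comp: "Domain A \<subseteq> P \<Longrightarrow> Id_on P O A = A" and comp_Id_on: "Range A \<subseteq> P \<Longrightarrow> A O Id_on P = A"
  by (auto simp: Id_on_def)

subsection \<open>Conjugacy in the fusion system\<close>

text \<open>Being isomorphic in the fusion system.\<close>

definition conjugate :: "'a set \<Rightarrow> 'a set \<Rightarrow> bool"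
  where "conjugate P Q \<longleftrightarrow> (\<exists>E\<in>\<G>. Range E = P \<and> Domain E = Q)"

text \<open>The graphs of the morphisms \<open>Q \<rightarrow> S\<close>.\<close>

definition homs :: "'a set \<Rightarrow> ('a \<times> 'a) set set"
  where "homs Q = {E \<in> \<G>. Range E = Q}"

lemma conjugate_refl: "subgroup P S \<Longrightarrow> conjugate P P"
  unfolding conjugate_def by (intro bexI[of _ "Id_on P"] Id_on_graph) simp_all

lemma conjugate_sym: "conjugate P Q \<Longrightarrow> conjugate Q P"
  unfolding conjugate_def by (metis Domain_converse Range_converse graph_converse)

lemma Range_comp:
  assumes "Domain B \<subseteq> Range A" shows "Range (A O B) = Range B"
proof
  show "Range B \<subseteq> Range (A O B)"
  proof
    fix z assume "z \<in> Range B"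
    then obtain y where y: "(y, z) \<in> B" by (rule RangeE)
    then have "y \<in> Range A" using assms by (intro subsetD[OF assms] DomainI)
    then obtain x where "(x, y) \<in> A" by (rule RangeE)
    then show "z \<in> Range (A O B)" using y by (intro RangeI relcompI)
  qed
qed auto

lemma Domain_comp:
  assumes "Range A \<subseteq> Domain B" shows "Domain (A O B) = Domain A"
proof
  show "Domain A \<subseteq> Domain (A O B)"
  proof
    fix x assume "x \<in> Domain A"
    then obtain y where y: "(x, y) \<in> A" by (rule DomainE)
    then have "y \<in> Domain B" by (intro subsetD[OF assms] RangeI)
    then obtain z where "(y, z) \<in> B" by (rule DomainE)
    then show "x \<in> Domain (A O B)" using y by (intro DomainI relcompI)
  qed
qed auto

lemma conjugate_trans: "conjugate P Q \<Longrightarrow> conjugate Q R \<Longrightarrow> conjugate P R"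
  unfolding conjugate_def
proof (elim bexE conjE)
  fix E E' assume "E \<in> \<G>" "Range E = P" "Domain E = Q" "E' \<in> \<G>" "Range E' = Q" "Domain E' = R"
  then show "\<exists>E\<in>\<G>. Range E = P \<and> Domain E = R"
    using Range_comp[of E E'] Domain_comp[of E' E] graph_comp[of E' E]
    by (intro bexI[of _ "E' O E"]) simp_all
qed

lemma conjugate_subgroup: "conjugate P Q \<Longrightarrow> subgroup P S" "conjugate P Q \<Longrightarrow> subgroup Q S"
  unfolding conjugate_def using Range_sub Domain_sub by auto

lemma conjugate_card: "conjugate P Q \<Longrightarrow> card P = card Q"
  unfolding conjugate_def
proof (elim bexE conjE)
  fix E assume E: "E \<in> \<G>" "Range E = P" "Domain E = Q"
  show "card P = card Q"
    using card_graph[OF E(1)] card_graph[OF graph_converse[OF E(1)]] E by simp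
qed

lemma graph_conjugate: "E \<in> \<G> \<Longrightarrow> conjugate (Range E) (Domain E)"
  unfolding conjugate_def by blast

lemma finite_homs: "finite (homs Q)" unfolding homs_def using finite_graphs by simp

lemma homs_pos: "subgroup Q S \<Longrightarrow> card (homs Q) > 0"
  using Id_on_graph[of Q] finite_homs[of Q] by (auto simp: homs_def card_gt_0_iff)

text \<open>Precomposition with an isomorphism; the inverse is precomposition with the converse graph.\<close>

lemma homs_conjugate_bij:
  assumes "E \<in> \<G>"
  shows "bij_betw (\<lambda>E'. E' O E) (homs (Domain E)) (homs (Range E))"
proof (rule bij_betw_byWitness[where f' = "\<lambda>E'. E' O converse E"])
  show "\<forall>A\<in>homs (Domain E). (A O E) O converse E = A"
    by (simp add: homs_def O_assoc graph_comp_converse[OF assms] comp_Id_on)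
  show "\<forall>A\<in>homs (Range E). (A O converse E) O E = A"
    by (simp add: homs_def O_assoc graph_converse_comp[OF assms] comp_Id_on)
  show "(\<lambda>E'. E' O E) ` homs (Domain E) \<subseteq> homs (Range E)"
    using assms by (intro image_subsetI) (simp add: homs_def graph_comp Range_comp)
  show "(\<lambda>E'. E' O converse E) ` homs (Range E) \<subseteq> homs (Domain E)"
    using assms by (intro image_subsetI) (simp add: homs_def graph_comp graph_converse Range_comp)
qed

lemma homs_conjugate: "conjugate P Q \<Longrightarrow> card (homs P) = card (homs Q)"
  unfolding conjugate_def using bij_betw_same_card[OF homs_conjugate_bij] by fastforce

lemma F_conjugates_iff:
  assumes "subgroup P S"
  shows "Q \<in> F_conjugates S F P \<longleftrightarrow> conjugate P Q"
proof
  assume "Q \<in> F_conjugates S F P"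
  then obtain \<phi> \<psi> where Q: "subgroup Q S" and \<phi>: "\<phi> \<in> F P Q" and \<psi>: "\<psi> \<in> F Q P"
    and eq: "compose Q \<phi> \<psi> = (\<lambda>x\<in>Q. x)" by (auto simp: F_conjugates_def)
  have "\<phi> ` P = Q"
  proof
    show "\<phi> ` P \<subseteq> Q" by (rule morphismD(4)[OF assms Q \<phi>])
    show "Q \<subseteq> \<phi> ` P"
    proof
      fix x assume x: "x \<in> Q"
      then have "\<phi> (\<psi> x) = x" using fun_cong[OF eq, of x] by (simp add: compose_def)
      moreover have "\<psi> x \<in> P" using x morphismD(4)[OF Q assms \<psi>] by blast
      ultimately show "x \<in> \<phi> ` P" by force
    qed
  qed
  then show "conjugate P Q" unfolding conjugate_def
    using graphI'[OF assms Q \<phi>] by (intro bexI[of _ "graph_subgroup P \<phi>"]) (auto simp: Range_graph Domain_graph)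
next
  assume "conjugate P Q"
  then obtain E where E: "E \<in> \<G>" "Range E = P" "Domain E = Q" by (auto simp: conjugate_def)
  then obtain \<phi> where \<phi>: "\<phi> \<in> F P (carrier S)" "Q = \<phi> ` P" using graphE[OF E(1)] by metis
  note m = morphismD[OF assms carrier_sub \<phi>(1)]
  have "compose P (inv_map P \<phi>) \<phi> = (\<lambda>x\<in>P. x)" "compose Q \<phi> (inv_map P \<phi>) = (\<lambda>x\<in>Q. x)"
    using m(2) by (auto simp: compose_def inv_map_def fun_eq_iff \<phi>(2) restrict_def)
  moreover have "\<phi> \<in> F P Q" "inv_map P \<phi> \<in> F Q P"
    using corestrict[OF assms carrier_sub \<phi>(1)] inverse[OF assms carrier_sub \<phi>(1)] \<phi>(2) by auto
  moreover have "subgroup Q S" using Domain_sub E by blast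
  ultimately show "Q \<in> F_conjugates S F P" unfolding F_conjugates_def by blast
qed

end


section \<open>Elements generated by the fusion system\<close>

context two_groups
begin

lemma stab_count_conj:
  assumes "is_biset G H X" "z \<in> carrier (H \<times>\<times> G)" "D \<subseteq> carrier (H \<times>\<times> G)"
  shows "stab_count G H X (cset z D) = stab_count G H X D"
proof -
  interpret finite_action "H \<times>\<times> G" "points X" "biset_act G X" by (rule biset_action[OF assms(1)])
  have iff: "cset z D = stab G H X (biset_act G X z x) \<longleftrightarrow> D = stab G H X x" if "x \<in> points X" for x
    by (simp only: stab_act_conj[OF assms(1) that assms(2)] set_eq_subset
      HG.conj_set_subset_iff[OF assms(2,3) stab_subset] HG.conj_set_subset_iff[OF assms(2) stab_subset assms(3)])
  have "bij_betw (biset_act G X z) {x \<in> points X. stab G H X x = D} {x \<in> points X. stab G H X x = cset z D}"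
  proof (rule bij_betw_byWitness[where f' = "biset_act G X (inv\<^bsub>H \<times>\<times> G\<^esub> z)"])
    show "biset_act G X z ` {x \<in> points X. stab G H X x = D} \<subseteq> {x \<in> points X. stab G H X x = cset z D}"
      using iff act_closed[OF assms(2)] by auto
    show "biset_act G X (inv\<^bsub>H \<times>\<times> G\<^esub> z) ` {x \<in> points X. stab G H X x = cset z D} \<subseteq> {x \<in> points X. stab G H X x = D}"
    proof
      fix y assume "y \<in> biset_act G X (inv\<^bsub>H \<times>\<times> G\<^esub> z) ` {x \<in> points X. stab G H X x = cset z D}"
      then obtain x where x: "x \<in> points X" "stab G H X x = cset z D" "y = biset_act G X (inv\<^bsub>H \<times>\<times> G\<^esub> z) x"
        by blast
      have y: "y \<in> points X" using x act_closed assms(2) HG.inv_closed by blast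
      have "biset_act G X z y = x" using x act_inv' assms(2) by simp
      then show "y \<in> {x \<in> points X. stab G H X x = D}" using y x iff[OF y] by simp
    qed
  qed (use assms(2) act_inv act_inv' in auto)
  then show ?thesis unfolding stab_count_def by (rule bij_betw_same_card[symmetric])
qed

lemma class_count_conj:
  assumes "a \<in> burnside_carrier p G H" "z \<in> carrier (H \<times>\<times> G)" "D \<subseteq> carrier (H \<times>\<times> G)"
  shows "class_count G H a (cset z D) = class_count G H a D"
proof -
  obtain f where f: "f \<in> formal_bisets p G H"
    "\<forall>D. class_count G H a D = (\<Sum>X\<in>Poly_Mapping.keys f. Poly_Mapping.lookup f X * of_nat (stab_count G H X D))"
    using class_count_expand[OF assms(1)] .
  show ?thesis unfolding f(2)[rule_format]
    using f(1) stab_count_conj[OF _ assms(2,3)] by (intro sum.cong) (auto simp: formal_bisets_def)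
qed

end

lemma (in group) card_transporter:
  assumes "finite (carrier G)" "w \<in> carrier G" "D \<subseteq> carrier G"
  shows "card {z \<in> carrier G. conj_set G z D = conj_set G w D} = card (set_normalizer G D)"
proof -
  have "bij_betw (\<lambda>z. w \<otimes> z) (set_normalizer G D) {z \<in> carrier G. conj_set G z D = conj_set G w D}"
  proof (rule bij_betw_byWitness[where f' = "\<lambda>z. inv w \<otimes> z"])
    show "(\<lambda>z. inv w \<otimes> z) ` {z \<in> carrier G. conj_set G z D = conj_set G w D} \<subseteq> set_normalizer G D"
    proof (rule image_subsetI)
      fix z assume "z \<in> {z \<in> carrier G. conj_set G z D = conj_set G w D}"
      then show "inv w \<otimes> z \<in> set_normalizer G D"
        using assms conj_set_mult[of "inv w" z D] conj_set_inv[of w D] by (simp add: set_normalizer_def)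
    qed
  qed (use assms in \<open>auto simp: set_normalizer_def conj_set_mult m_assoc[symmetric]\<close>)
  then show ?thesis by (rule bij_betw_same_card[symmetric])
qed

lemma (in group) card_transporter_conj:
  assumes "w \<in> carrier G" "D \<subseteq> carrier G"
  shows "card {z \<in> carrier G. conj_set G z (conj_set G w D) = E} = card {z \<in> carrier G. conj_set G z D = E}"
proof -
  have "bij_betw (\<lambda>z. z \<otimes> w) {z \<in> carrier G. conj_set G z (conj_set G w D) = E} {z \<in> carrier G. conj_set G z D = E}"
  proof (rule bij_betw_byWitness[where f' = "\<lambda>z. z \<otimes> inv w"])
    show "(\<lambda>z. z \<otimes> inv w) ` {z \<in> carrier G. conj_set G z D = E} \<subseteq> {z \<in> carrier G. conj_set G z (conj_set G w D) = E}"
    proof (rule image_subsetI)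
      fix z assume z: "z \<in> {z \<in> carrier G. conj_set G z D = E}"
      have "conj_set G (z \<otimes> inv w) (conj_set G w D) = conj_set G (z \<otimes> inv w \<otimes> w) D"
        using z assms by (intro conj_set_mult[symmetric]) auto
      also have "z \<otimes> inv w \<otimes> w = z" using z assms by (simp add: m_assoc)
      finally show "z \<otimes> inv w \<in> {z \<in> carrier G. conj_set G z (conj_set G w D) = E}" using z assms by simp
    qed
  qed (use assms in \<open>auto simp: conj_set_mult m_assoc\<close>)
  then show ?thesis by (rule bij_betw_same_card)
qed

context finite_fusion_system
begin

abbreviation "M \<equiv> burnside_ring p S"
abbreviation "cc \<equiv> class_count S S"
abbreviation "mk \<equiv> mark S S"
abbreviation "R \<equiv> carrier (Z_loc p)"
abbreviation "cs \<equiv> conj_set (S \<times>\<times> S)"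
abbreviation "Nrm \<equiv> set_normalizer (S \<times>\<times> S)"

lemma carrier_M: "carrier M = burnside_carrier p S S"
  and mult_M: "x \<otimes>\<^bsub>M\<^esub> y = burnside_comp p S S S x y"
  and zero_M: "\<zero>\<^bsub>M\<^esub> = formal_class p S S 0"
  and add_M: "x \<oplus>\<^bsub>M\<^esub> y = burnside_add p S S x y"
  and smult_M: "c \<odot>\<^bsub>M\<^esub> x = burnside_smult p S S c x"
  by (simp_all add: burnside_ring_def)

lemma cc_add: "x \<in> carrier M \<Longrightarrow> y \<in> carrier M \<Longrightarrow> cc (x \<oplus>\<^bsub>M\<^esub> y) D = cc x D + cc y D"
  and cc_smult: "x \<in> carrier M \<Longrightarrow> c \<in> R \<Longrightarrow> cc (c \<odot>\<^bsub>M\<^esub> x) D = c * cc x D"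
  and cc_zero: "cc \<zero>\<^bsub>M\<^esub> D = 0"
  and add_closed: "x \<in> carrier M \<Longrightarrow> y \<in> carrier M \<Longrightarrow> x \<oplus>\<^bsub>M\<^esub> y \<in> carrier M"
  and smult_closed: "x \<in> carrier M \<Longrightarrow> c \<in> R \<Longrightarrow> c \<odot>\<^bsub>M\<^esub> x \<in> carrier M"
  and zero_closed: "\<zero>\<^bsub>M\<^esub> \<in> carrier M"
  and mult_closed: "x \<in> carrier M \<Longrightarrow> y \<in> carrier M \<Longrightarrow> x \<otimes>\<^bsub>M\<^esub> y \<in> carrier M"
  by (simp_all add: carrier_M add_M smult_M zero_M mult_M SS.GH.class_count_add SS.GH.class_count_smult
      SS.GH.class_count_zero SS.GH.burnside_add_closed SS.GH.burnside_smult_closed SS.GH.zero_class_closed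
      SS.burnside_comp_closed)

lemma M_eqI:
  assumes "x \<in> carrier M" "y \<in> carrier M" "\<And>D. cc x D = cc y D" shows "x = y"
  using SS.GH.class_eqI[of x y] assms by (simp add: carrier_M)

lemma M_eqI_mark:
  assumes "x \<in> carrier M" "y \<in> carrier M" "\<And>Z. Z \<subseteq> carrier S \<times> carrier S \<Longrightarrow> mk x Z = mk y Z" shows "x = y"
  using SS.GH.class_eq_of_marks[of x y] assms by (simp add: carrier_M)

lemma M_abelian_group: "abelian_group M"
proof (rule abelian_groupI)
  fix x assume x: "x \<in> carrier M"
  have m1: "- 1 \<in> R" using Z_loc_of_int[OF prime_p, of "-1"] by simp
  show "\<exists>y\<in>carrier M. y \<oplus>\<^bsub>M\<^esub> x = \<zero>\<^bsub>M\<^esub>"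
    by (rule bexI[of _ "(- 1) \<odot>\<^bsub>M\<^esub> x"], rule M_eqI)
      (auto simp: x m1 smult_closed add_closed zero_closed cc_add cc_smult cc_zero)
qed (simp_all add: add_closed zero_closed, (rule M_eqI; simp add: add_closed zero_closed cc_add cc_zero)+)

sublocale M: abelian_group M by (rule M_abelian_group)

lemma cc_finsum:
  assumes "f \<in> B \<rightarrow> carrier M" "finite B"
  shows "cc (finsum M f B) D = (\<Sum>b\<in>B. cc (f b) D)"
  using assms(2,1)
proof (induction B rule: finite_induct)
  case empty
  then show ?case by (simp add: cc_zero)
next
  case (insert b B)
  then have "finsum M f (insert b B) = f b \<oplus>\<^bsub>M\<^esub> finsum M f B" by (intro M.finsum_insert) auto
  moreover have "f b \<in> carrier M" "finsum M f B \<in> carrier M" using insert by (auto intro!: M.finsum_closed)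
  ultimately show ?case using insert by (simp add: cc_add)
qed

lemma mk_add: "x \<in> carrier M \<Longrightarrow> y \<in> carrier M \<Longrightarrow> mk (x \<oplus>\<^bsub>M\<^esub> y) Z = mk x Z + mk y Z"
  by (simp add: mark_def cc_add sum.distrib)

lemma mk_smult: "x \<in> carrier M \<Longrightarrow> c \<in> R \<Longrightarrow> mk (c \<odot>\<^bsub>M\<^esub> x) Z = c * mk x Z"
  by (simp add: mark_def cc_smult sum_distrib_left)

lemma mk_zero: "mk \<zero>\<^bsub>M\<^esub> Z = 0"
  by (simp add: mark_def cc_zero)

lemma mk_finsum:
  assumes "f \<in> B \<rightarrow> carrier M" "finite B" shows "mk (finsum M f B) Z = (\<Sum>b\<in>B. mk (f b) Z)"
  unfolding mark_def cc_finsum[OF assms] by (rule sum.swap)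

text \<open>The class of \<open>[P,\<phi>]\<close>, indexed by the graph of \<open>\<phi>\<close>; the description operator recovers \<open>\<phi>\<close> from its
  graph.\<close>

definition tclass :: "('a \<times> 'a) set \<Rightarrow> ('a, 'a) formal set"
  where "tclass D = transitive_class p S S (Range D) (\<lambda>x. THE y. (y, x) \<in> D)"

lemma graph_the: assumes "D \<in> \<G>" shows "graph_subgroup (Range D) (\<lambda>x. THE y. (y, x) \<in> D) = D"
proof -
  have "(THE y. (y, x) \<in> D) = a" if "(a, x) \<in> D" for a x
    using that graph_fun[OF assms] by blast
  then show ?thesis by (auto simp: graph_subgroup_def image_iff)
qed

lemma transitive_class_eq:
  assumes "subgroup P S" "\<phi> \<in> F P (carrier S)"
  shows "transitive_class p S S P \<phi> = tclass (graph_subgroup P \<phi>)"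
  unfolding tclass_def transitive_class_def transitive_biset_def graph_the[OF graphI[OF assms]] ..

lemma generators_eq: "{transitive_class p S S P \<phi> | P \<phi>. subgroup P S \<and> \<phi> \<in> F P (carrier S)} = tclass ` \<G>"
  unfolding fusion_graphs_def using transitive_class_eq by (auto simp: image_iff) metis+

lemma tclass_closed: "D \<in> \<G> \<Longrightarrow> tclass D \<in> carrier M"
  unfolding tclass_def carrier_M by (rule SS.GH.transitive_class_closed) (simp add: graph_the graph_sub)

lemma sum_tclass:
  assumes "D \<in> \<G>"
  shows "(\<Sum>B\<in>Pow (carrier S \<times> carrier S). cc (tclass D) B * w B) =
    (\<Sum>z\<in>carrier (S \<times>\<times> S). w (cs z D)) / of_nat (card D)"
  unfolding tclass_def using SS.GH.sum_stab_transitive[of "Range D" "\<lambda>x. THE y. (y, x) \<in> D" w] assms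
  by (simp only: graph_the graph_sub card_graph)

lemma cc_tclass:
  assumes "D \<in> \<G>"
  shows "cc (tclass D) E = of_nat (card {z \<in> carrier (S \<times>\<times> S). cs z D = E}) / of_nat (card D)"
proof (cases "subgroup E (S \<times>\<times> S)")
  case True
  have E: "E \<in> Pow (carrier S \<times> carrier S)" using subgroup.subset[OF True] by simp
  have fin: "finite (Pow (carrier S \<times> carrier S))" using finite_S by simp
  have "cc (tclass D) E = (\<Sum>B\<in>Pow (carrier S \<times> carrier S). cc (tclass D) B * (if B = E then 1 else 0))"
    by (subst sum.remove[OF fin E]) (auto intro!: sum.neutral)
  also have "\<dots> = (\<Sum>z\<in>carrier (S \<times>\<times> S). if cs z D = E then 1 else 0) / of_nat (card D)"
    by (rule sum_tclass[OF assms])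
  finally show ?thesis using SS.GH.fin_HG by (simp add: sum.If_cases Int_def)
next
  case False
  have "cs z D \<noteq> E" if "z \<in> carrier (S \<times>\<times> S)" for z
    using False graph_sub[OF graph_conj[OF assms that]] by blast
  then have "{z \<in> carrier (S \<times>\<times> S). cs z D = E} = {}" by blast
  moreover have "cc (tclass D) E = 0"
    using SS.GH.class_count_outside[OF _ False] tclass_closed[OF assms] by (simp add: carrier_M)
  ultimately show ?thesis by (simp only: card.empty)
qed

text \<open>All points of a transitive biset have conjugate stabilizers, and each conjugate of \<open>D\<close> occurs
  \<open>|N(D)| / |D|\<close> times.\<close>

lemma cc_tclass_conj:
  assumes "D \<in> \<G>" "w \<in> carrier (S \<times>\<times> S)"
  shows "cc (tclass D) (cs w D) = of_nat (card (Nrm D)) / of_nat (card D)"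
    "tclass (cs w D) = tclass D"
proof -
  have sub: "D \<subseteq> carrier (S \<times>\<times> S)" using graph_subset[OF assms(1)] by simp
  show "cc (tclass D) (cs w D) = of_nat (card (Nrm D)) / of_nat (card D)"
    by (simp only: cc_tclass[OF assms(1)] SS.GH.HG.card_transporter[OF SS.GH.fin_HG assms(2) sub])
  have "cc (tclass (cs w D)) E = cc (tclass D) E" for E
    by (simp only: cc_tclass[OF assms(1)] cc_tclass[OF graph_conj[OF assms]]
        SS.GH.HG.card_transporter_conj[OF assms(2) sub] SS.GH.HG.card_conj_set[OF assms(2) sub])
  then show "tclass (cs w D) = tclass D"
    by (intro M_eqI tclass_closed graph_conj assms)
qed

lemma card_graph_pos: "D \<in> \<G> \<Longrightarrow> card D > 0"
  using subgroup.one_closed[OF graph_sub] finite_graph by (auto simp: card_gt_0_iff)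

lemma card_Nrm_pos: "D \<in> \<G> \<Longrightarrow> card (Nrm D) > 0"
proof -
  assume "D \<in> \<G>"
  then have sub: "subgroup (Nrm D) (S \<times>\<times> S)"
    using graph_subset by (intro SS.GH.HG.set_normalizer_subgroup) simp
  then show ?thesis
    using subgroup.one_closed[OF sub] finite_subset[OF subgroup.subset[OF sub] SS.GH.fin_HG]
    by (auto simp: card_gt_0_iff)
qed

lemma cc_tclass_eq_0:
  assumes "D \<in> \<G>" "\<And>z. z \<in> carrier (S \<times>\<times> S) \<Longrightarrow> cs z D \<noteq> E"
  shows "cc (tclass D) E = 0"
proof -
  have "{z \<in> carrier (S \<times>\<times> S). cs z D = E} = {}" using assms(2) by blast
  then show ?thesis by (simp only: cc_tclass[OF assms(1)] card.empty)
qed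

text \<open>The counts of \<open>tclass D\<close> are \<open>|N(D)| / |D|\<close> on the conjugacy class of \<open>D\<close> and zero elsewhere, so \<open>n\<close> is
  the combination of these functions with coefficients \<open>|D| n(D) / |N(D)|\<close>, one for each class.\<close>

lemma exists_with_counts:
  fixes n :: "('a \<times> 'a) set \<Rightarrow> rat"
  assumes zero: "\<And>D. D \<notin> \<G> \<Longrightarrow> n D = 0"
    and inv: "\<And>D z. D \<in> \<G> \<Longrightarrow> z \<in> carrier (S \<times>\<times> S) \<Longrightarrow> n (cs z D) = n D"
    and dvd: "\<And>D. D \<in> \<G> \<Longrightarrow> of_nat (card D) * n D / of_nat (card (Nrm D)) \<in> R"
  shows "\<exists>X\<in>mod_span (Z_loc p) M (tclass ` \<G>). X \<in> carrier M \<and> (\<forall>D. cc X D = n D)"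
proof -
  define rep where "rep b = (SOME D. D \<in> \<G> \<and> tclass D = b)" for b
  have rep: "rep b \<in> \<G>" "tclass (rep b) = b" if "b \<in> tclass ` \<G>" for b
  proof -
    have "\<exists>D. D \<in> \<G> \<and> tclass D = b" using that by blast
    from someI_ex[OF this] show "rep b \<in> \<G>" "tclass (rep b) = b" by (auto simp: rep_def)
  qed
  define c where "c b = of_nat (card (rep b)) * n (rep b) / of_nat (card (Nrm (rep b)))" for b
  have c: "c b \<in> R" if "b \<in> tclass ` \<G>" for b unfolding c_def using rep that by (intro dvd) blast
  let ?X = "finsum M (\<lambda>b. c b \<odot>\<^bsub>M\<^esub> b) (tclass ` \<G>)"
  have fin: "finite (tclass ` \<G>)" using finite_graphs by simp
  have cl: "(\<lambda>b. c b \<odot>\<^bsub>M\<^esub> b) \<in> tclass ` \<G> \<rightarrow> carrier M" using c by (auto intro!: smult_closed tclass_closed)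
  have 1: "?X \<in> mod_span (Z_loc p) M (tclass ` \<G>)" unfolding mod_span_def using fin c by blast
  have 2: "?X \<in> carrier M" using cl by (rule M.finsum_closed)
  have "cc ?X E = n E" for E
  proof -
    have "cc ?X E = (\<Sum>b\<in>tclass ` \<G>. c b * cc b E)"
      using c by (simp add: cc_finsum[OF cl fin]) (auto intro!: sum.cong cc_smult tclass_closed)
    also have "\<dots> = n E"
    proof (cases "E \<in> \<G>")
      case False
      have "cc b E = 0" if b: "b \<in> tclass ` \<G>" for b
      proof -
        obtain D where D: "D \<in> \<G>" "b = tclass D" using b by blast
        then show ?thesis using False graph_conj cc_tclass_eq_0[OF D(1), of E] by blast
      qed
      then show ?thesis using zero[OF False] by (simp add: sum.neutral)
    next
      case True
      have b0: "tclass E \<in> tclass ` \<G>" using True by blast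
      have only: "c b * cc b E = 0" if b: "b \<in> tclass ` \<G>" "b \<noteq> tclass E" for b
      proof (rule ccontr)
        assume "c b * cc b E \<noteq> 0"
        obtain D where D: "D \<in> \<G>" "b = tclass D" using b by blast
        have "{z \<in> carrier (S \<times>\<times> S). cs z D = E} \<noteq> {}"
        proof
          assume "{z \<in> carrier (S \<times>\<times> S). cs z D = E} = {}"
          then have "cc b E = 0" by (simp only: D(2) cc_tclass[OF D(1)]) simp
          then show False using \<open>c b * cc b E \<noteq> 0\<close> by simp
        qed
        then show False using cc_tclass_conj(2)[OF D(1)] b(2) D(2) by blast
      qed
      let ?D = "rep (tclass E)"
      have D: "?D \<in> \<G>" "tclass ?D = tclass E" using rep[OF b0] by auto
      have ne: "cc (tclass E) E \<noteq> 0"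
      proof -
        have "cs \<one>\<^bsub>S \<times>\<times> S\<^esub> E = E" using graph_subset[OF True] by (intro SS.GH.HG.conj_set_one) simp
        then show ?thesis
          using cc_tclass_conj(1)[OF True SS.GH.HG.one_closed] card_graph_pos[OF True] card_Nrm_pos[OF True] by simp
      qed
      have "\<exists>z\<in>carrier (S \<times>\<times> S). cs z ?D = E"
      proof (rule ccontr)
        assume "\<not> (\<exists>z\<in>carrier (S \<times>\<times> S). cs z ?D = E)"
        then have "cc (tclass ?D) E = 0" by (intro cc_tclass_eq_0[OF D(1)]) blast
        then show False using ne D(2) by simp
      qed
      then obtain z where z: "z \<in> carrier (S \<times>\<times> S)" "E = cs z ?D" by blast
      have "cc (tclass E) E = of_nat (card (Nrm ?D)) / of_nat (card ?D)"
        using cc_tclass_conj(1)[OF D(1) z(1)] z(2) D(2) by simp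
      moreover have "n ?D = n E" using inv[OF D(1) z(1)] z(2) by simp
      ultimately have "c (tclass E) * cc (tclass E) E = n E"
        using card_graph_pos[OF D(1)] card_Nrm_pos[OF D(1)] by (simp add: c_def)
      moreover have "(\<Sum>b\<in>tclass ` \<G> - {tclass E}. c b * cc b E) = 0"
        using only by (intro sum.neutral) blast
      ultimately show ?thesis by (simp only: sum.remove[OF fin b0] add_0_right)
    qed
    finally show ?thesis .
  qed
  then show ?thesis using 1 2 by blast
qed

text \<open>Counts of generators vanish outside the graphs. Conversely, the divisibility by which
  \<open>exists_with_counts\<close> produces a combination of generators holds for the counts of every element
  (\<open>class_count_divisible\<close>).\<close>

lemma F_generated_iff:
  "F_generated p S F X \<longleftrightarrow> X \<in> carrier M \<and> (\<forall>D. D \<notin> \<G> \<longrightarrow> cc X D = 0)"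
proof
  assume "F_generated p S F X"
  then obtain c B0 where B0: "finite B0" "B0 \<subseteq> tclass ` \<G>" "c \<in> B0 \<rightarrow> R"
    and X: "X = finsum M (\<lambda>b. c b \<odot>\<^bsub>M\<^esub> b) B0"
    unfolding F_generated_def generators_eq mod_span_def by blast
  have cl: "(\<lambda>b. c b \<odot>\<^bsub>M\<^esub> b) \<in> B0 \<rightarrow> carrier M" using B0 by (auto intro!: smult_closed tclass_closed)
  have "X \<in> carrier M" unfolding X using cl by (rule M.finsum_closed)
  moreover have "cc X D = 0" if D: "D \<notin> \<G>" for D
  proof -
    have "cc (c b \<odot>\<^bsub>M\<^esub> b) D = 0" if b: "b \<in> B0" for b
    proof -
      obtain E where E: "E \<in> \<G>" "b = tclass E" using b B0 by blast
      then have "cc b D = 0" using D graph_conj cc_tclass_eq_0[OF E(1), of D] by blast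
      then show ?thesis using E B0 b by (simp add: cc_smult tclass_closed Pi_iff)
    qed
    then show ?thesis unfolding X by (simp add: cc_finsum[OF cl B0(1)])
  qed
  ultimately show "X \<in> carrier M \<and> (\<forall>D. D \<notin> \<G> \<longrightarrow> cc X D = 0)" by blast
next
  assume X: "X \<in> carrier M \<and> (\<forall>D. D \<notin> \<G> \<longrightarrow> cc X D = 0)"
  then have A: "X \<in> burnside_carrier p S S" by (simp add: carrier_M)
  have "\<exists>Y\<in>mod_span (Z_loc p) M (tclass ` \<G>). Y \<in> carrier M \<and> (\<forall>D. cc Y D = cc X D)"
  proof (rule exists_with_counts)
    fix D z assume D: "D \<in> \<G>" and z: "z \<in> carrier (S \<times>\<times> S)"
    show "cc X (cs z D) = cc X D"
      by (rule SS.GH.class_count_conj[OF A z]) (use graph_subset[OF D] in simp)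
  next
    fix D assume D: "D \<in> \<G>"
    show "of_nat (card D) * cc X D / of_nat (card (Nrm D)) \<in> R"
      by (rule SS.GH.class_count_divisible[OF A graph_sub[OF D]])
  qed (use X in blast)
  then obtain Y where "Y \<in> mod_span (Z_loc p) M (tclass ` \<G>)" "Y \<in> carrier M" "\<forall>D. cc Y D = cc X D" by blast
  moreover then have "Y = X" using X by (intro M_eqI) auto
  ultimately show "F_generated p S F X" unfolding F_generated_def generators_eq by simp
qed

lemma exists_generated_with_counts:
  fixes n :: "('a \<times> 'a) set \<Rightarrow> rat"
  assumes zero: "\<And>D. D \<notin> \<G> \<Longrightarrow> n D = 0"
    and inv: "\<And>D z. D \<in> \<G> \<Longrightarrow> z \<in> carrier (S \<times>\<times> S) \<Longrightarrow> n (cs z D) = n D"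
    and dvd: "\<And>D. D \<in> \<G> \<Longrightarrow> of_nat (card D) * n D / of_nat (card (Nrm D)) \<in> R"
  obtains X where "F_generated p S F X" "\<forall>D. cc X D = n D"
proof -
  obtain X where X: "X \<in> mod_span (Z_loc p) M (tclass ` \<G>)" "\<forall>D. cc X D = n D"
    using exists_with_counts[OF assms] by blast
  show thesis by (rule that[OF _ X(2)]) (simp add: F_generated_def generators_eq X(1))
qed

abbreviation "gen \<equiv> F_generated p S F"

lemma gen_closed: "gen X \<Longrightarrow> X \<in> carrier M" and gen_cc: "gen X \<Longrightarrow> D \<notin> \<G> \<Longrightarrow> cc X D = 0"
  by (auto simp: F_generated_iff)

lemma tclass_gen: assumes "D \<in> \<G>" shows "gen (tclass D)"
proof -
  have "cc (tclass D) E = 0" if E: "E \<notin> \<G>" for E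
    using E graph_conj[OF assms] cc_tclass_eq_0[OF assms, of E] by blast
  then show ?thesis by (simp add: F_generated_iff tclass_closed assms)
qed

lemma sum_gen:
  fixes w :: "('a \<times> 'a) set \<Rightarrow> rat"
  assumes "gen X"
  shows "(\<Sum>A\<in>Pow (carrier S \<times> carrier S). cc X A * w A) = (\<Sum>A\<in>\<G>. cc X A * w A)"
  by (rule sum.mono_neutral_right) (use finite_S graph_subset gen_cc[OF assms] in auto)

lemma mk_gen:
  assumes "gen X" shows "mk X Z = (\<Sum>D\<in>\<G>. cc X D * (if Z \<subseteq> D then 1 else 0))"
proof -
  have "mk X Z = (\<Sum>D\<in>Pow (carrier S \<times> carrier S). cc X D * (if Z \<subseteq> D then 1 else 0))"
    unfolding mark_def by (rule sum.mono_neutral_cong_left) (use finite_S in auto)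
  then show ?thesis by (simp only: sum_gen[OF assms])
qed

lemma mk_gen_cong:
  assumes "gen X" "\<And>D. D \<in> \<G> \<Longrightarrow> Z \<subseteq> D \<longleftrightarrow> Z' \<subseteq> D" shows "mk X Z = mk X Z'"
  unfolding mk_gen[OF assms(1)] using assms(2) by (intro sum.cong) auto

lemma mk_gen_zero:
  assumes "gen X" "\<And>D. D \<in> \<G> \<Longrightarrow> \<not> Z \<subseteq> D" shows "mk X Z = 0"
  unfolding mk_gen[OF assms(1)] using assms(2) by (intro sum.neutral) auto

text \<open>The graphs are subgroups, so one that contains \<open>Z\<close> contains the subgroup generated by \<open>Z\<close>.\<close>

lemma generate_in_graph:
  assumes "Z \<subseteq> D" "D \<in> \<G>"
  shows "generate (S \<times>\<times> S) Z \<in> \<G>" "generate (S \<times>\<times> S) Z \<subseteq> D"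
proof -
  show sub: "generate (S \<times>\<times> S) Z \<subseteq> D" by (rule SS.GH.HG.generate_subgroup_incl[OF assms(1) graph_sub[OF assms(2)]])
  have "Z \<subseteq> carrier (S \<times>\<times> S)" using assms graph_subset by fastforce
  then show "generate (S \<times>\<times> S) Z \<in> \<G>"
    by (intro graph_smaller[OF assms(2) sub] SS.GH.HG.generate_is_subgroup)
qed

lemma mk_generate:
  assumes "gen X" shows "mk X (generate (S \<times>\<times> S) Z) = mk X Z"
proof (rule mk_gen_cong[OF assms])
  fix D assume "D \<in> \<G>"
  then show "generate (S \<times>\<times> S) Z \<subseteq> D \<longleftrightarrow> Z \<subseteq> D"
    using generate_in_graph(2)[of Z D] generate.incl[of _ Z "S \<times>\<times> S"] by auto
qed

text \<open>Two graphs of injective maps have trivial isotropy group: generated elements are free on both sides.\<close>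

lemma weight_graph: "A \<in> \<G> \<Longrightarrow> B \<in> \<G> \<Longrightarrow> SS.weight A B = 1 / of_nat (card (carrier S))"
proof -
  assume "A \<in> \<G>" "B \<in> \<G>"
  then have "(\<one>, \<one>) \<in> A" "(\<one>, \<one>) \<in> B" using subgroup.one_closed[OF graph_sub] by auto
  then have "isotropy S S S A B = {\<one>}"
    using graph_fun[OF \<open>B \<in> \<G>\<close>] by (auto simp: isotropy_def)
  then show ?thesis by simp
qed

lemma mk_mult_gen:
  assumes "gen a" "gen b"
  shows "mk (a \<otimes>\<^bsub>M\<^esub> b) Z =
    (\<Sum>A\<in>\<G>. \<Sum>B\<in>\<G>. cc a A * cc b B * (if Z \<subseteq> A O B then 1 else 0)) / of_nat (card (carrier S))"
proof -
  have "mk (a \<otimes>\<^bsub>M\<^esub> b) Z = (\<Sum>A\<in>Pow (carrier S \<times> carrier S). cc a A * (\<Sum>B\<in>Pow (carrier S \<times> carrier S).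
      cc b B * (if Z \<subseteq> A O B then SS.weight A B else 0)))"
    using SS.mark_comp[of a b Z] gen_closed[OF assms(1)] gen_closed[OF assms(2)]
    by (simp add: carrier_M mult_M sum_distrib_left mult.assoc)
  also have "\<dots> = (\<Sum>A\<in>\<G>. cc a A * (\<Sum>B\<in>\<G>. cc b B * (if Z \<subseteq> A O B then SS.weight A B else 0)))"
    by (simp only: sum_gen[OF assms(1)] sum_gen[OF assms(2)])
  also have "\<dots> = (\<Sum>A\<in>\<G>. cc a A * (\<Sum>B\<in>\<G>. cc b B * ((if Z \<subseteq> A O B then 1 else 0) / of_nat (card (carrier S)))))"
    by (intro sum.cong refl arg_cong[where f = "\<lambda>x. _ * x"]) (simp add: weight_graph)
  finally show ?thesis by (simp add: sum_distrib_left sum_divide_distrib mult.assoc)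
qed

lemma gen_mult:
  assumes "gen a" "gen b" shows "gen (a \<otimes>\<^bsub>M\<^esub> b)"
proof -
  have cl: "a \<otimes>\<^bsub>M\<^esub> b \<in> carrier M" using assms gen_closed mult_closed by blast
  have "cc (a \<otimes>\<^bsub>M\<^esub> b) D = 0" if D: "D \<notin> \<G>" for D
  proof -
    have "cc (a \<otimes>\<^bsub>M\<^esub> b) D = (\<Sum>A\<in>Pow (carrier S \<times> carrier S). cc a A * (\<Sum>B\<in>Pow (carrier S \<times> carrier S).
        cc b B * (if A O B = D then SS.weight A B else 0)))"
      using SS.class_count_comp[of a b D] gen_closed[OF assms(1)] gen_closed[OF assms(2)]
      by (simp add: carrier_M mult_M sum_distrib_left mult.assoc)
    also have "\<dots> = (\<Sum>A\<in>\<G>. cc a A * (\<Sum>B\<in>\<G>. cc b B * (if A O B = D then SS.weight A B else 0)))"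
      by (simp only: sum_gen[OF assms(1)] sum_gen[OF assms(2)])
    also have "\<dots> = 0" using D graph_comp by (intro sum.neutral ballI) (auto intro!: sum.neutral)
    finally show ?thesis .
  qed
  then show ?thesis using cl by (simp add: F_generated_iff)
qed

text \<open>If \<open>D\<close> is contained in \<open>A O B\<close>, then the second factor of the factorization is the restriction of \<open>B\<close>
  to the source of \<open>D\<close>, and it determines the first one. So exactly one \<open>E\<close> contributes to the sum.\<close>

lemma factor_through_graph:
  assumes "A \<in> \<G>" "B \<in> \<G>" "D \<in> \<G>"
  shows "(if D \<subseteq> A O B then 1 else 0 :: rat) =
    (\<Sum>E\<in>homs (Range D). (if D O converse E \<subseteq> A then 1 else 0) * (if E \<subseteq> B then 1 else 0))"
proof -
  let ?E = "{E \<in> homs (Range D). D O converse E \<subseteq> A \<and> E \<subseteq> B}"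
  let ?B = "B O Id_on (Range D)"
  have "(\<Sum>E\<in>homs (Range D). (if D O converse E \<subseteq> A then 1 else 0) * (if E \<subseteq> B then 1 else 0 :: rat)) =
      (\<Sum>E\<in>homs (Range D). if D O converse E \<subseteq> A \<and> E \<subseteq> B then 1 else 0)"
    by (intro sum.cong) auto
  also have "\<dots> = of_nat (card ?E)" using finite_homs by (simp add: sum.If_cases Int_def)
  also have "?E = (if D \<subseteq> A O B then {?B} else {})"
  proof -
    have uniq: "E = ?B" if E: "E \<in> ?E" for E
    proof
      have EG: "E \<in> \<G>" "Range E = Range D" "E \<subseteq> B" using E by (auto simp: homs_def)
      show "E \<subseteq> ?B"
      proof
        fix z assume z: "z \<in> E"
        obtain e q where eq: "z = (e, q)" by (cases z)
        then have "q \<in> Range D" using EG(2) z RangeI[of e q E] by simp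
        then show "z \<in> ?B" using z EG(3) eq by auto
      qed
      show "?B \<subseteq> E"
      proof
        fix z assume "z \<in> ?B"
        then obtain e q where z: "z = (e, q)" "(e, q) \<in> B" "q \<in> Range D" by auto
        then have "q \<in> Range E" using EG(2) by simp
        then obtain e' where e': "(e', q) \<in> E" by (rule RangeE)
        then have "e' = e" using EG(3) z(2) graph_fun[OF assms(2)] by blast
        then show "z \<in> E" using e' z by simp
      qed
    qed
    have imp: "D \<subseteq> A O B" if E: "E \<in> ?E" for E
    proof
      fix z assume "z \<in> D"
      then obtain a q where z: "z = (a, q)" "(a, q) \<in> D" by (cases z) auto
      then have "q \<in> Range E" using E RangeI[of a q D] by (simp add: homs_def)
      then obtain e where e: "(e, q) \<in> E" by (rule RangeE)
      then have "(a, e) \<in> D O converse E" using z by blast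
      then show "z \<in> A O B" using E e z by blast
    qed
    have ex: "?B \<in> ?E" if sub: "D \<subseteq> A O B"
    proof -
      have "Range ?B = Range D"
      proof
        show "Range D \<subseteq> Range ?B"
        proof
          fix q assume q: "q \<in> Range D"
          then obtain a where "(a, q) \<in> D" by (rule RangeE)
          then obtain e where "(e, q) \<in> B" using sub by blast
          then show "q \<in> Range ?B" using q by blast
        qed
      qed auto
      moreover have "D O converse ?B \<subseteq> A"
      proof
        fix z assume "z \<in> D O converse ?B"
        then obtain a q e where z: "z = (a, e)" "(a, q) \<in> D" "(e, q) \<in> B" by auto
        then obtain e' where "(a, e') \<in> A" "(e', q) \<in> B" using sub by blast
        then show "z \<in> A" using z graph_fun[OF assms(2)] by blast
      qed
      moreover have "?B \<in> \<G>" by (intro graph_restrict assms Range_sub)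
      ultimately show ?thesis by (simp add: homs_def) blast
    qed
    show ?thesis
    proof (cases "D \<subseteq> A O B")
      case True
      have "?E = {?B}" using ex[OF True] uniq by blast
      then show ?thesis using True by (simp only: if_True)
    next
      case False
      have "?E = {}" using imp False by blast
      then show ?thesis using False by (simp only: if_False)
    qed
  qed
  finally show ?thesis by simp
qed

text \<open>A point of the composite is fixed by \<open>D\<close> iff it comes from points fixed by the two factors of a
  factorization of \<open>D\<close> through a morphism \<open>E\<close>.\<close>

lemma mark_mult:
  assumes "gen a" "gen b" "D \<in> \<G>"
  shows "mk (a \<otimes>\<^bsub>M\<^esub> b) D =
    (\<Sum>E\<in>homs (Range D). mk a (D O converse E) * mk b E) / of_nat (card (carrier S))"
proof -
  have "(\<Sum>A\<in>\<G>. \<Sum>B\<in>\<G>. cc a A * cc b B * (if D \<subseteq> A O B then 1 else 0)) =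
      (\<Sum>A\<in>\<G>. \<Sum>B\<in>\<G>. \<Sum>E\<in>homs (Range D).
        (cc a A * (if D O converse E \<subseteq> A then 1 else 0)) * (cc b B * (if E \<subseteq> B then 1 else 0)))"
  proof (intro sum.cong refl)
    fix A B assume AB: "A \<in> \<G>" "B \<in> \<G>"
    show "cc a A * cc b B * (if D \<subseteq> A O B then 1 else 0) = (\<Sum>E\<in>homs (Range D).
        (cc a A * (if D O converse E \<subseteq> A then 1 else 0)) * (cc b B * (if E \<subseteq> B then 1 else 0)))"
      unfolding factor_through_graph[OF AB assms(3)] sum_distrib_left by (simp only: mult_ac)
  qed
  also have "\<dots> = (\<Sum>A\<in>\<G>. \<Sum>E\<in>homs (Range D). \<Sum>B\<in>\<G>.
        (cc a A * (if D O converse E \<subseteq> A then 1 else 0)) * (cc b B * (if E \<subseteq> B then 1 else 0)))"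
    by (rule sum.cong[OF refl], rule sum.swap)
  also have "\<dots> = (\<Sum>E\<in>homs (Range D). \<Sum>A\<in>\<G>. \<Sum>B\<in>\<G>.
        (cc a A * (if D O converse E \<subseteq> A then 1 else 0)) * (cc b B * (if E \<subseteq> B then 1 else 0)))"
    by (rule sum.swap)
  also have "\<dots> = (\<Sum>E\<in>homs (Range D). mk a (D O converse E) * mk b E)"
    by (simp only: mk_gen[OF assms(1)] mk_gen[OF assms(2)] sum_product)
  finally show ?thesis by (simp only: mk_mult_gen[OF assms(1,2)])
qed

end


section \<open>Stability in terms of marks\<close>

context finite_fusion_system
begin

text \<open>Stability restricted to graphs with more than \<open>n\<close> elements; it is achieved by downward induction on
  \<open>n\<close>.\<close>

definition stable_above :: "nat \<Rightarrow> ('a, 'a) formal set \<Rightarrow> bool"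
  where "stable_above n X \<longleftrightarrow> (\<forall>D\<in>\<G>. \<forall>D'\<in>\<G>. n < card D \<and> conjugate (Range D) (Range D') \<longrightarrow> mk X D = mk X D')"

lemma conjugate_by_graphs_iff:
  assumes "\<alpha> \<in> \<G>" "\<beta> \<in> \<G>" "Z \<subseteq> Range \<beta> \<times> Range \<alpha>"
  shows "\<beta> O Z O converse \<alpha> \<subseteq> C \<longleftrightarrow> Z \<subseteq> converse \<beta> O C O \<alpha>"
proof
  assume L: "\<beta> O Z O converse \<alpha> \<subseteq> C"
  show "Z \<subseteq> converse \<beta> O C O \<alpha>"
  proof
    fix z assume z: "z \<in> Z"
    obtain b a where ba: "z = (b, a)" by (cases z)
    then have "b \<in> Range \<beta>" "a \<in> Range \<alpha>" using z assms(3) by auto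
    then obtain b' a' where "(b', b) \<in> \<beta>" "(a', a) \<in> \<alpha>" by (elim RangeE)
    then show "z \<in> converse \<beta> O C O \<alpha>" using L z ba by blast
  qed
next
  assume Rr: "Z \<subseteq> converse \<beta> O C O \<alpha>"
  show "\<beta> O Z O converse \<alpha> \<subseteq> C"
  proof
    fix z assume "z \<in> \<beta> O Z O converse \<alpha>"
    then obtain b' b a a' where z: "z = (b', a')" "(b', b) \<in> \<beta>" "(b, a) \<in> Z" "(a', a) \<in> \<alpha>" by auto
    then obtain b'' a'' where "(b'', b) \<in> \<beta>" "(b'', a'') \<in> C" "(a'', a) \<in> \<alpha>" using Rr by blast
    then show "z \<in> C" using z graph_fun[OF assms(1)] graph_fun[OF assms(2)] by blast
  qed
qed

text \<open>Up to the subgroup generated by it, \<open>Z\<close> is a graph (or else both marks vanish), and transporting it by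
  \<open>\<alpha>\<close> and \<open>\<beta>\<close> does not change the \<open>F\<close>-class of its source. Arbitrary sets \<open>Z\<close> are needed because stability
  is compared through marks of restricted bisets, and in the Cauchy--Frobenius sums.\<close>

lemma mark_transport:
  assumes X: "gen X" "stable_above n X" and ab: "\<alpha> \<in> \<G>" "\<beta> \<in> \<G>" and Z: "Z \<subseteq> Range \<beta> \<times> Range \<alpha>"
    and n: "\<And>D. D \<in> \<G> \<Longrightarrow> Z \<subseteq> D \<Longrightarrow> n < card D"
  shows "mk X (\<beta> O Z O converse \<alpha>) = mk X Z"
proof (cases "\<exists>D\<in>\<G>. Z \<subseteq> D")
  case True
  then obtain D where D: "D \<in> \<G>" "Z \<subseteq> D" by blast
  let ?A = "generate (S \<times>\<times> S) Z"
  let ?B = "\<beta> O ?A O converse \<alpha>"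
  have A: "?A \<in> \<G>" by (rule generate_in_graph(1)[OF D(2,1)])
  have ZA: "Z \<subseteq> ?A" using generate.incl[of _ Z "S \<times>\<times> S"] by blast
  have A2: "?A \<subseteq> Range \<beta> \<times> Range \<alpha>"
    by (rule SS.GH.HG.generate_subgroup_incl[OF Z DirProd_subgroups[OF is_group Range_sub[OF ab(2)] is_group Range_sub[OF ab(1)]]])
  have B: "?B \<in> \<G>" by (intro graph_comp graph_converse ab A)
  have "mk X (\<beta> O Z O converse \<alpha>) = mk X ?B"
  proof (rule mk_gen_cong[OF X(1)])
    fix C assume C: "C \<in> \<G>"
    then have C': "converse \<beta> O C O \<alpha> \<in> \<G>" by (intro graph_comp graph_converse ab)
    have "Z \<subseteq> converse \<beta> O C O \<alpha> \<longleftrightarrow> ?A \<subseteq> converse \<beta> O C O \<alpha>"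
      using generate_in_graph(2)[OF _ C', of Z] ZA by blast
    then show "\<beta> O Z O converse \<alpha> \<subseteq> C \<longleftrightarrow> ?B \<subseteq> C"
      by (simp only: conjugate_by_graphs_iff[OF ab Z] conjugate_by_graphs_iff[OF ab A2])
  qed
  also have "mk X ?B = mk X ?A"
  proof -
    let ?E = "\<alpha> O Id_on (Range ?A)"
    have E: "?E \<in> \<G>" by (intro graph_restrict ab Range_sub A)
    have "Range ?E = Range ?A" using A2 by (subst Range_comp) auto
    moreover have "Domain ?E = Range ?B"
    proof
      show "Domain ?E \<subseteq> Range ?B"
      proof
        fix x assume "x \<in> Domain ?E"
        then obtain a where a: "(x, a) \<in> \<alpha>" "a \<in> Range ?A" by auto
        then obtain b where b: "(b, a) \<in> ?A" by (elim RangeE)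
        then have "b \<in> Range \<beta>" using A2 by auto
        then obtain b' where "(b', b) \<in> \<beta>" by (elim RangeE)
        then show "x \<in> Range ?B" using a(1) b by (intro RangeI[of b' x]) blast
      qed
      show "Range ?B \<subseteq> Domain ?E"
      proof
        fix x assume "x \<in> Range ?B"
        then obtain b a where "(b, a) \<in> ?A" "(x, a) \<in> \<alpha>" by auto
        then show "x \<in> Domain ?E" by (intro DomainI[of x a] relcompI) auto
      qed
    qed
    ultimately have "conjugate (Range ?A) (Range ?B)" using graph_conjugate[OF E] by simp
    then show ?thesis using X(2) A B n[OF A ZA] unfolding stable_above_def by metis
  qed
  finally show ?thesis by (simp only: mk_generate[OF X(1)])
next
  case False
  have "\<not> \<beta> O Z O converse \<alpha> \<subseteq> C" if C: "C \<in> \<G>" for C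
  proof
    assume "\<beta> O Z O converse \<alpha> \<subseteq> C"
    then have "Z \<subseteq> converse \<beta> O C O \<alpha>" by (simp only: conjugate_by_graphs_iff[OF ab Z])
    moreover have "converse \<beta> O C O \<alpha> \<in> \<G>" by (intro graph_comp graph_converse ab C)
    ultimately show False using False by blast
  qed
  then have "mk X (\<beta> O Z O converse \<alpha>) = 0" by (rule mk_gen_zero[OF X(1)])
  moreover have "mk X Z = 0" using False by (intro mk_gen_zero[OF X(1)]) blast
  ultimately show ?thesis by simp
qed

lemma subgroup_as_group:
  assumes "subgroup P S" shows "three_groups p (S\<lparr>carrier := P\<rparr>) S S" "three_groups p S S (S\<lparr>carrier := P\<rparr>)"
proof -
  interpret P: group "S\<lparr>carrier := P\<rparr>" by (rule subgroup.subgroup_is_group[OF assms is_group])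
  show "three_groups p (S\<lparr>carrier := P\<rparr>) S S" "three_groups p S S (S\<lparr>carrier := P\<rparr>)"
    using finite_subset[OF subgroup.subset[OF assms] finite_S] by (unfold_locales, auto simp: prime_p finite_S)
qed

lemma morphism_hom: "subgroup P S \<Longrightarrow> \<phi> \<in> F P (carrier S) \<Longrightarrow> \<phi> \<in> hom (S\<lparr>carrier := P\<rparr>) S"
  using morphismD(1)[OF _ carrier_sub, of P \<phi>] by (simp add: hom_def)

lemma identity_morphism: "subgroup P S \<Longrightarrow> (\<lambda>x\<in>P. x) \<in> F P (carrier S)"
  using inclusion[OF _ carrier_sub, of P] subgroup.subset[of P S] by blast

lemma graph_identity: "graph_subgroup P (\<lambda>x\<in>P. x) = Id_on P"
  by (auto simp: graph_subgroup_def Id_on_def)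

lemma mark_restrict_right:
  assumes "X \<in> carrier M" "subgroup P S" "\<phi> \<in> F P (carrier S)" "Z \<subseteq> carrier S \<times> P"
  shows "mark (S\<lparr>carrier := P\<rparr>) S (burnside_comp p (S\<lparr>carrier := P\<rparr>) S S X (transitive_class p (S\<lparr>carrier := P\<rparr>) S P \<phi>)) Z =
    mk X (Z O converse (graph_subgroup P \<phi>))"
proof -
  interpret T: three_groups p "S\<lparr>carrier := P\<rparr>" S S by (rule subgroup_as_group[OF assms(2)])
  show ?thesis using T.mark_comp_right_graph[of X \<phi> Z] assms morphism_hom[OF assms(2,3)]
    by (simp add: carrier_M)
qed

lemma mark_restrict_left:
  assumes "X \<in> carrier M" "subgroup P S" "\<phi> \<in> F P (carrier S)" "Z \<subseteq> P \<times> carrier S"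
    and "graph_subgroup U \<psi> = converse (graph_subgroup P \<phi>)"
  shows "mark S (S\<lparr>carrier := P\<rparr>) (burnside_comp p S S (S\<lparr>carrier := P\<rparr>) (transitive_class p S (S\<lparr>carrier := P\<rparr>) U \<psi>) X) Z =
    mk X (graph_subgroup P \<phi> O Z)"
proof -
  interpret T: three_groups p S S "S\<lparr>carrier := P\<rparr>" by (rule subgroup_as_group[OF assms(2)])
  show ?thesis using T.mark_comp_left_graph[of X \<phi> U \<psi> Z] assms morphism_hom[OF assms(2,3)]
    by (simp add: carrier_M)
qed

text \<open>Both sides are restrictions of \<open>X\<close>, hence are compared through their marks.\<close>

lemma right_class_eq_iff:
  assumes "X \<in> carrier M" "subgroup P S" "\<phi> \<in> F P (carrier S)"
  shows "burnside_comp p (S\<lparr>carrier := P\<rparr>) S S X (transitive_class p (S\<lparr>carrier := P\<rparr>) S P \<phi>) =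
      burnside_comp p (S\<lparr>carrier := P\<rparr>) S S X (transitive_class p (S\<lparr>carrier := P\<rparr>) S P (\<lambda>x\<in>P. x)) \<longleftrightarrow>
    (\<forall>Z. Z \<subseteq> carrier S \<times> P \<longrightarrow> mk X (Z O converse (graph_subgroup P \<phi>)) = mk X Z)"
    (is "?a = ?b \<longleftrightarrow> ?R")
proof -
  interpret T: three_groups p "S\<lparr>carrier := P\<rparr>" S S by (rule subgroup_as_group[OF assms(2)])
  have tc: "transitive_class p (S\<lparr>carrier := P\<rparr>) S P \<psi> \<in> burnside_carrier p (S\<lparr>carrier := P\<rparr>) S"
    if "\<psi> \<in> F P (carrier S)" for \<psi>
    using T.GH.graph_subgroup_hom[OF morphism_hom[OF assms(2) that]] by (intro T.GH.transitive_class_closed) simp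
  note id = identity_morphism[OF assms(2)]
  have cl: "?a \<in> burnside_carrier p (S\<lparr>carrier := P\<rparr>) S" "?b \<in> burnside_carrier p (S\<lparr>carrier := P\<rparr>) S"
    using assms tc id by (auto intro!: T.burnside_comp_closed simp: carrier_M)
  have a: "mark (S\<lparr>carrier := P\<rparr>) S ?a Z = mk X (Z O converse (graph_subgroup P \<phi>))"
    and b: "mark (S\<lparr>carrier := P\<rparr>) S ?b Z = mk X Z" if "Z \<subseteq> carrier S \<times> P" for Z
  proof -
    show "mark (S\<lparr>carrier := P\<rparr>) S ?a Z = mk X (Z O converse (graph_subgroup P \<phi>))"
      by (rule mark_restrict_right[OF assms that])
    have "Z O converse (Id_on P) = Z" using that by auto
    then show "mark (S\<lparr>carrier := P\<rparr>) S ?b Z = mk X Z"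
      using mark_restrict_right[OF assms(1,2) id that] by (simp add: graph_identity)
  qed
  show ?thesis
  proof
    assume eq: "?a = ?b"
    show ?R using a b eq by metis
  next
    assume R: ?R
    show "?a = ?b"
      by (rule T.GH.class_eq_of_marks[OF cl]) (use a b R in simp)
  qed
qed

lemma left_class_eq_iff:
  assumes "X \<in> carrier M" "subgroup P S" "\<phi> \<in> F P (carrier S)"
  shows "burnside_comp p S S (S\<lparr>carrier := P\<rparr>) (transitive_class p S (S\<lparr>carrier := P\<rparr>) (\<phi> ` P) (inv_map P \<phi>)) X =
      burnside_comp p S S (S\<lparr>carrier := P\<rparr>) (transitive_class p S (S\<lparr>carrier := P\<rparr>) P (\<lambda>x\<in>P. x)) X \<longleftrightarrow>
    (\<forall>Z. Z \<subseteq> P \<times> carrier S \<longrightarrow> mk X (graph_subgroup P \<phi> O Z) = mk X Z)"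
    (is "?a = ?b \<longleftrightarrow> ?R")
proof -
  interpret T: three_groups p S S "S\<lparr>carrier := P\<rparr>" by (rule subgroup_as_group[OF assms(2)])
  interpret T': three_groups p "S\<lparr>carrier := P\<rparr>" S S by (rule subgroup_as_group[OF assms(2)])
  note conv = converse_graph_inv_map[OF assms(2,3)]
  have idc: "graph_subgroup P (\<lambda>x\<in>P. x) = converse (graph_subgroup P (\<lambda>x\<in>P. x))" by (simp add: graph_identity)
  have tc: "transitive_class p S (S\<lparr>carrier := P\<rparr>) U \<psi> \<in> burnside_carrier p S (S\<lparr>carrier := P\<rparr>)"
    if "\<chi> \<in> F P (carrier S)" "graph_subgroup U \<psi> = converse (graph_subgroup P \<chi>)" for \<chi> U \<psi>
  proof (rule T.HK.transitive_class_closed)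
    have sub: "subgroup (graph_subgroup P \<chi>) (S \<times>\<times> S\<lparr>carrier := P\<rparr>)"
      using T'.GH.graph_subgroup_hom[OF morphism_hom[OF assms(2) that(1)]] by simp
    have grp: "group (S\<lparr>carrier := P\<rparr>)" by (rule subgroup.subgroup_is_group[OF assms(2) is_group])
    interpret hom: group_hom "S\<lparr>carrier := P\<rparr>" S \<chi>
      by unfold_locales (rule morphism_hom[OF assms(2) that(1)])
    have one: "\<chi> \<one> = \<one>" using hom.hom_one by simp
    have conv_eq: "converse (graph_subgroup P \<chi>) = (\<lambda>u. (u, \<chi> u)) ` P" by (auto simp: graph_subgroup_def)
    have inv: "inv\<^bsub>S\<lparr>carrier := P\<rparr>\<^esub> x \<in> P" "\<chi> (inv\<^bsub>S\<lparr>carrier := P\<rparr>\<^esub> x) = inv \<chi> x" if "x \<in> P" for x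
      using hom.hom_inv[of x] group.inv_closed[OF grp, of x] that by simp_all
    show "subgroup (graph_subgroup U \<psi>) (S\<lparr>carrier := P\<rparr> \<times>\<times> S)"
      unfolding that(2) conv_eq
      by (rule T.HK.HG.subgroupI)
        (use hom.hom_closed hom.hom_mult subgroup.m_closed[OF assms(2)] subgroup.one_closed[OF assms(2)] inv one in
          \<open>auto simp: graph_subgroup_def image_iff\<close>)
  qed
  note id = identity_morphism[OF assms(2)]
  have cl: "?a \<in> burnside_carrier p S (S\<lparr>carrier := P\<rparr>)" "?b \<in> burnside_carrier p S (S\<lparr>carrier := P\<rparr>)"
    using assms tc[OF assms(3) conv] tc[OF id idc] by (auto intro!: T.burnside_comp_closed simp: carrier_M)
  have a: "mark S (S\<lparr>carrier := P\<rparr>) ?a Z = mk X (graph_subgroup P \<phi> O Z)"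
    and b: "mark S (S\<lparr>carrier := P\<rparr>) ?b Z = mk X Z" if "Z \<subseteq> P \<times> carrier S" for Z
  proof -
    show "mark S (S\<lparr>carrier := P\<rparr>) ?a Z = mk X (graph_subgroup P \<phi> O Z)"
      by (rule mark_restrict_left[OF assms that conv])
    have "Id_on P O Z = Z" using that by auto
    then show "mark S (S\<lparr>carrier := P\<rparr>) ?b Z = mk X Z"
      using mark_restrict_left[OF assms(1,2) id that idc] by (simp add: graph_identity)
  qed
  show ?thesis
  proof
    assume eq: "?a = ?b"
    show ?R using a b eq by metis
  next
    assume R: ?R
    show "?a = ?b"
      by (rule T.HK.class_eq_of_marks[OF cl]) (use a b R in simp)
  qed
qed

lemma F_stable_iff_marks:
  assumes "X \<in> carrier M"
  shows "F_stable p S F X \<longleftrightarrow>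
    (\<forall>A\<in>\<G>. \<forall>Z. (Z \<subseteq> carrier S \<times> Range A \<longrightarrow> mk X (Z O converse A) = mk X Z) \<and>
      (Z \<subseteq> Range A \<times> carrier S \<longrightarrow> mk X (A O Z) = mk X Z))" (is "_ \<longleftrightarrow> ?R")
proof -
  have "right_F_stable p S F X \<longleftrightarrow> (\<forall>P \<phi>. subgroup P S \<and> \<phi> \<in> F P (carrier S) \<longrightarrow>
      (\<forall>Z. Z \<subseteq> carrier S \<times> P \<longrightarrow> mk X (Z O converse (graph_subgroup P \<phi>)) = mk X Z))"
    unfolding right_F_stable_def Let_def
    by (intro iff_allI imp_cong refl, elim conjE, rule right_class_eq_iff[OF assms])
  moreover have "left_F_stable p S F X \<longleftrightarrow> (\<forall>P \<phi>. subgroup P S \<and> \<phi> \<in> F P (carrier S) \<longrightarrow>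
      (\<forall>Z. Z \<subseteq> P \<times> carrier S \<longrightarrow> mk X (graph_subgroup P \<phi> O Z) = mk X Z))"
    unfolding left_F_stable_def Let_def
    by (intro iff_allI imp_cong refl, elim conjE, rule left_class_eq_iff[OF assms])
  moreover have "?R \<longleftrightarrow> (\<forall>P \<phi>. subgroup P S \<and> \<phi> \<in> F P (carrier S) \<longrightarrow>
      (\<forall>Z. (Z \<subseteq> carrier S \<times> P \<longrightarrow> mk X (Z O converse (graph_subgroup P \<phi>)) = mk X Z) \<and>
        (Z \<subseteq> P \<times> carrier S \<longrightarrow> mk X (graph_subgroup P \<phi> O Z) = mk X Z)))" (is "_ \<longleftrightarrow> ?R'")
  proof
    assume R: ?R
    show ?R'
    proof (intro allI impI)
      fix P \<phi> Z assume "subgroup P S \<and> \<phi> \<in> F P (carrier S)"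
      then have "graph_subgroup P \<phi> \<in> \<G>" using graphI by blast
      from R[rule_format, OF this] show "(Z \<subseteq> carrier S \<times> P \<longrightarrow> mk X (Z O converse (graph_subgroup P \<phi>)) = mk X Z) \<and>
        (Z \<subseteq> P \<times> carrier S \<longrightarrow> mk X (graph_subgroup P \<phi> O Z) = mk X Z)" by (simp add: Range_graph)
    qed
  next
    assume R: ?R'
    show ?R
    proof (intro ballI allI)
      fix A Z assume "A \<in> \<G>"
      then obtain \<phi> where \<phi>: "subgroup (Range A) S" "\<phi> \<in> F (Range A) (carrier S)" and A: "A = graph_subgroup (Range A) \<phi>"
        by (rule graphE)
      from R[rule_format, OF conjI[OF \<phi>], of Z]
      show "(Z \<subseteq> carrier S \<times> Range A \<longrightarrow> mk X (Z O converse A) = mk X Z) \<and>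
          (Z \<subseteq> Range A \<times> carrier S \<longrightarrow> mk X (A O Z) = mk X Z)" by (simp only: A[symmetric])
    qed
  qed
  ultimately show ?thesis unfolding F_stable_def by (simp only: imp_conjR all_conj_distrib)
qed

text \<open>Taking for \<open>Z\<close> the graphs themselves shows that stability forces the marks to depend only on the class
  of the source; the converse is \<open>mark_transport\<close>.\<close>

lemma F_stable_iff:
  assumes "gen X"
  shows "F_stable p S F X \<longleftrightarrow> stable_above 0 X"
  unfolding F_stable_iff_marks[OF gen_closed[OF assms]]
proof
  assume st: "\<forall>A\<in>\<G>. \<forall>Z. (Z \<subseteq> carrier S \<times> Range A \<longrightarrow> mk X (Z O converse A) = mk X Z) \<and>
      (Z \<subseteq> Range A \<times> carrier S \<longrightarrow> mk X (A O Z) = mk X Z)"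
  have right: "mk X (Z O converse A) = mk X Z" if "A \<in> \<G>" "Z \<subseteq> carrier S \<times> Range A" for A Z using st that by blast
  have left: "mk X (A O Z) = mk X Z" if "A \<in> \<G>" "Z \<subseteq> Range A \<times> carrier S" for A Z using st that by blast
  have 1: "mk X D = mk X (Id_on (Range D))" if D: "D \<in> \<G>" for D
  proof -
    have "D \<subseteq> Range (converse D) \<times> carrier S"
    proof
      fix z assume z: "z \<in> D"
      obtain a b where "z = (a, b)" by (cases z)
      then show "z \<in> Range (converse D) \<times> carrier S" using z graph_subset[OF D] by auto
    qed
    from left[OF graph_converse[OF D] this] show ?thesis by (simp only: graph_converse_comp[OF D])
  qed
  have 2: "mk X (Id_on (Range E)) = mk X (Id_on (Domain E))" if E: "E \<in> \<G>" for E
  proof -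
    have "Id_on (Range E) \<subseteq> carrier S \<times> Range E" using subgroup.subset[OF Range_sub[OF E]] by auto
    from right[OF E this] have "mk X (Id_on (Range E)) = mk X (converse E)"
      by (simp add: Id_on_comp)
    then show ?thesis using 1[OF graph_converse[OF E]] by simp
  qed
  show "stable_above 0 X" unfolding stable_above_def
  proof (intro ballI impI)
    fix D D' assume D: "D \<in> \<G>" "D' \<in> \<G>" and "0 < card D \<and> conjugate (Range D) (Range D')"
    then obtain E where E: "E \<in> \<G>" "Range E = Range D" "Domain E = Range D'" by (auto simp: conjugate_def)
    show "mk X D = mk X D'" using 1[OF D(1)] 1[OF D(2)] 2[OF E(1)] E by simp
  qed
next
  assume st: "stable_above 0 X"
  have idS: "Id_on (carrier S) \<in> \<G>" by (rule Id_on_graph[OF carrier_sub])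
  show "\<forall>A\<in>\<G>. \<forall>Z. (Z \<subseteq> carrier S \<times> Range A \<longrightarrow> mk X (Z O converse A) = mk X Z) \<and>
      (Z \<subseteq> Range A \<times> carrier S \<longrightarrow> mk X (A O Z) = mk X Z)"
  proof (intro ballI allI conjI impI)
    fix A Z assume A: "A \<in> \<G>" and Z: "Z \<subseteq> carrier S \<times> Range A"
    have "Id_on (carrier S) O Z O converse A = Z O converse A"
      using Z by (intro Id_on_comp) auto
    then show "mk X (Z O converse A) = mk X Z"
      using mark_transport[OF assms st A idS, of Z] Z card_graph_pos by simp
  next
    fix A Z assume A: "A \<in> \<G>" and Z: "Z \<subseteq> Range A \<times> carrier S"
    have "Z O converse (Id_on (carrier S)) = Z" using Z by (simp, intro comp_Id_on) auto
    then show "mk X (A O Z) = mk X Z"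
      using mark_transport[OF assms st idS A, of Z] Z card_graph_pos by simp
  qed
qed

section \<open>Prescribing marks level by level\<close>

text \<open>Add to the counts of \<open>X\<close> the missing amount on the graphs of order \<open>n\<close>. This leaves the marks on larger
  graphs unchanged, and at order \<open>n\<close> a graph lies in no other graph of order \<open>n\<close>, so its mark changes by
  exactly that amount.\<close>

lemma adjust_level:
  fixes w :: "('a \<times> 'a) set \<Rightarrow> rat"
  assumes X: "gen X"
    and inv: "\<And>D z. D \<in> \<G> \<Longrightarrow> z \<in> carrier (S \<times>\<times> S) \<Longrightarrow> w (cs z D) = w D"
    and dvd: "\<And>D. D \<in> \<G> \<Longrightarrow> card D = n \<Longrightarrow> of_nat (card D) * (w D - mk X D) / of_nat (card (Nrm D)) \<in> R"
  obtains Y where "gen Y" "\<forall>D\<in>\<G>. n < card D \<longrightarrow> mk Y D = mk X D" "\<forall>D\<in>\<G>. card D = n \<longrightarrow> mk Y D = w D"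
proof -
  define e where "e D = (if D \<in> \<G> \<and> card D = n then w D - mk X D else 0)" for D
  have Xc: "X \<in> burnside_carrier p S S" using gen_closed[OF X] by (simp add: carrier_M)
  have sub: "D \<subseteq> carrier (S \<times>\<times> S)" if "D \<in> \<G>" for D using graph_subset[OF that] by simp
  have e1: "cc X D + e D = 0" if "D \<notin> \<G>" for D using that gen_cc[OF X] by (simp add: e_def)
  have e2: "cc X (cs z D) + e (cs z D) = cc X D + e D" if D: "D \<in> \<G>" and z: "z \<in> carrier (S \<times>\<times> S)" for D z
  proof -
    have 1: "cs z D \<in> \<G>" by (rule graph_conj[OF D z])
    have 2: "card (cs z D) = card D" by (rule SS.GH.HG.card_conj_set[OF z sub[OF D]])
    have 3: "mk X (cs z D) = mk X D" by (rule SS.GH.mark_conj[OF Xc z sub[OF D]])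
    have 4: "cc X (cs z D) = cc X D" by (rule SS.GH.class_count_conj[OF Xc z sub[OF D]])
    show ?thesis unfolding e_def 2 3 4 inv[OF D z] using 1 D by simp
  qed
  have e3: "of_nat (card D) * (cc X D + e D) / of_nat (card (Nrm D)) \<in> R" if D: "D \<in> \<G>" for D
  proof -
    have 5: "of_nat (card D) * e D / of_nat (card (Nrm D)) \<in> R"
    proof (cases "card D = n")
      case True
      then show ?thesis using dvd[OF D True] D by (simp add: e_def)
    next
      case False
      then show ?thesis using Z_loc_0[OF prime_p] by (simp add: e_def)
    qed
    have "of_nat (card D) * (cc X D + e D) / of_nat (card (Nrm D)) =
        of_nat (card D) * cc X D / of_nat (card (Nrm D)) + of_nat (card D) * e D / of_nat (card (Nrm D))"
      by (simp only: distrib_left add_divide_distrib)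
    then show ?thesis
      using Z_loc_add[OF prime_p SS.GH.class_count_divisible[OF Xc graph_sub[OF D]] 5] by (simp only:)
  qed
  obtain Y where Y: "gen Y" "\<forall>D. cc Y D = cc X D + e D"
    using exists_generated_with_counts[of "\<lambda>D. cc X D + e D", OF e1 e2 e3] .
  have mkY: "mk Y D = mk X D + (\<Sum>E\<in>\<G>. e E * (if D \<subseteq> E then 1 else 0))" for D
    by (simp add: mk_gen[OF Y(1)] mk_gen[OF X] Y(2) distrib_right sum.distrib)
  have e0: "e E * (if D \<subseteq> E then 1 else 0) = 0" if "D \<in> \<G>" "E \<in> \<G>" "n \<le> card D" "E \<noteq> D" for D E
  proof (cases "D \<subseteq> E")
    case True
    then have "card D < card E" using that finite_graph by (intro psubset_card_mono) auto
    then show ?thesis using that by (simp add: e_def)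
  qed simp
  have "mk Y D = mk X D + e D" if D: "D \<in> \<G>" "n \<le> card D" for D
  proof -
    have "(\<Sum>E\<in>\<G>. e E * (if D \<subseteq> E then 1 else 0)) = e D + (\<Sum>E\<in>\<G> - {D}. e E * (if D \<subseteq> E then 1 else 0))"
      using sum.remove[OF finite_graphs D(1), of "\<lambda>E. e E * (if D \<subseteq> E then 1 else 0)"] by simp
    also have "(\<Sum>E\<in>\<G> - {D}. e E * (if D \<subseteq> E then 1 else 0)) = 0"
      using e0[OF D(1) _ D(2)] by (intro sum.neutral) blast
    finally show ?thesis by (simp add: mkY)
  qed
  then have "mk Y D = mk X D" if "D \<in> \<G>" "n < card D" for D using that by (simp add: e_def)
  moreover have "mk Y D = w D" if "D \<in> \<G>" "card D = n" for D
    using that \<open>\<And>D. D \<in> \<G> \<Longrightarrow> n \<le> card D \<Longrightarrow> mk Y D = mk X D + e D\<close>[of D] by (simp add: e_def)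
  ultimately show thesis by (intro that[OF Y(1)]) blast+
qed

text \<open>For \<open>k\<close> in \<open>D\<close> the set \<open>insert k D\<close> is \<open>D\<close> itself.\<close>

lemma normalizer_sum_split:
  assumes "D \<in> \<G>"
  shows "(\<Sum>k\<in>Nrm D. f (insert k D)) = of_nat (card D) * f D + (\<Sum>k\<in>Nrm D - D. f (insert k D) :: rat)"
proof -
  have sub: "D \<subseteq> Nrm D" by (rule SS.GH.HG.subgroup_normalizes_self[OF graph_sub[OF assms]])
  have fin: "finite (Nrm D)" by (rule finite_subset[OF _ SS.GH.fin_HG]) (auto simp: set_normalizer_def)
  have "(\<Sum>k\<in>D. f (insert k D)) = (\<Sum>k\<in>D. f D)" by (rule sum.cong) (auto simp: insert_absorb)
  then have "(\<Sum>k\<in>D. f (insert k D)) = of_nat (card D) * f D" by simp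
  then show ?thesis using sum.subset_diff[OF sub fin, of "\<lambda>k. f (insert k D)"] by simp
qed

lemma Range_conj:
  assumes "D \<in> \<G>" "s \<in> carrier S" "t \<in> carrier S"
  shows "Range (cs (s, t) D) = (\<lambda>x. t \<otimes> x \<otimes> inv t) ` Range D"
proof -
  have "cs (s, t) D = (\<lambda>z. (s \<otimes> fst z \<otimes> inv s, t \<otimes> snd z \<otimes> inv t)) ` D"
    unfolding conj_set_def by (rule image_cong) (use assms(2,3) in auto)
  then show ?thesis by (simp add: snd_eq_Range[symmetric] image_image)
qed

lemma conjugate_translate:
  assumes "subgroup P S" "t \<in> carrier S"
  shows "conjugate P ((\<lambda>x. t \<otimes> x \<otimes> inv t) ` P)"
proof -
  have "{(t \<otimes> x \<otimes> inv t, x) | x. x \<in> P} = (\<lambda>x. (t \<otimes> x \<otimes> inv t, x)) ` P" by blast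
  from conj_graph_mem[OF assms, unfolded this] show ?thesis
    using graph_conjugate[of "(\<lambda>x. (t \<otimes> x \<otimes> inv t, x)) ` P"]
    by (simp add: snd_eq_Range[symmetric] fst_eq_Domain[symmetric] image_image)
qed

text \<open>Values divisible by \<open>|S|\<^sup>2\<close>, a multiple of the order of every normalizer in \<open>S \<times> S\<close>, satisfy all
  congruences that marks have to satisfy, so they can be prescribed level by level.\<close>

lemma exists_stable_with_marks:
  fixes v :: "'a set \<Rightarrow> rat"
  assumes inv: "\<And>P Q. conjugate P Q \<Longrightarrow> v P = v Q"
    and dvd: "\<And>P. subgroup P S \<Longrightarrow> v P / of_nat (card (carrier S) * card (carrier S)) \<in> R"
  obtains X where "gen X" "\<forall>D\<in>\<G>. mk X D = v (Range D)"
proof -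
  let ?s = "card (carrier S)"
  have s0: "?s > 0" using finite_S by (auto simp: card_gt_0_iff)
  have div: "v P / of_nat (card (Nrm D)) \<in> R" if "D \<in> \<G>" "subgroup P S" for D P
  proof -
    have "subgroup (Nrm D) (S \<times>\<times> S)" using graph_subset[OF that(1)] by (intro SS.GH.HG.set_normalizer_subgroup) simp
    then have "card (Nrm D) dvd order (S \<times>\<times> S)" by (metis SS.GH.HG.lagrange dvd_triv_right)
    then obtain k where k: "?s * ?s = card (Nrm D) * k" by (auto simp: order_def card_cartesian_product elim: dvdE)
    then have "0 < card (Nrm D) * k" using s0 by (metis nat_0_less_mult_iff)
    then have k0: "k \<noteq> 0" "card (Nrm D) \<noteq> 0" by simp_all
    have "v P / of_nat (card (Nrm D)) = v P / of_nat (?s * ?s) * of_nat k"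
      unfolding k using k0 by simp
    then show ?thesis using Z_loc_mult[OF prime_p dvd[OF that(2)] Z_loc_of_nat[OF prime_p, of k]] by simp
  qed
  have "\<exists>X. gen X \<and> (\<forall>D\<in>\<G>. n < card D \<longrightarrow> mk X D = v (Range D))" for n
  proof (induction "?s - n" arbitrary: n rule: less_induct)
    case less
    show ?case
    proof (cases "n < ?s")
      case False
      have "\<not> n < card D" if "D \<in> \<G>" for D
        using card_graph[OF that] card_mono[OF finite_S subgroup.subset[OF Range_sub[OF that]]] False by simp
      moreover have "gen \<zero>\<^bsub>M\<^esub>" by (simp add: F_generated_iff zero_closed cc_zero)
      ultimately show ?thesis by blast
    next
      case True
      then have "?s - Suc n < ?s - n" by simp
      from less[OF this] obtain X where X: "gen X" "\<forall>D\<in>\<G>. Suc n < card D \<longrightarrow> mk X D = v (Range D)" by blast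
      have Xc: "X \<in> burnside_carrier p S S" using gen_closed[OF X(1)] by (simp add: carrier_M)
      obtain Y where Y: "gen Y" "\<forall>D\<in>\<G>. Suc n < card D \<longrightarrow> mk Y D = mk X D" "\<forall>D\<in>\<G>. card D = Suc n \<longrightarrow> mk Y D = v (Range D)"
      proof (rule adjust_level[OF X(1), of "\<lambda>D. v (Range D)" "Suc n"])
        fix D z assume D: "D \<in> \<G>" and z: "z \<in> carrier (S \<times>\<times> S)"
        obtain s t where st: "z = (s, t)" "s \<in> carrier S" "t \<in> carrier S" using z by auto
        show "v (Range (cs z D)) = v (Range D)"
          unfolding st(1) Range_conj[OF D st(2,3)]
          by (rule inv[OF conjugate_translate[OF Range_sub[OF D] st(3)], symmetric])
      next
        fix D assume D: "D \<in> \<G>" "card D = Suc n"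
        let ?N = "of_nat (card (Nrm D)) :: rat"
        have Nsub: "subgroup (Nrm D) (S \<times>\<times> S)" using graph_subset[OF D(1)] by (intro SS.GH.HG.set_normalizer_subgroup) simp
        \<comment> \<open>All terms of the Cauchy--Frobenius sum but those at \<open>D\<close> are marks at larger graphs, hence already
  have prescribed values.\<close>
        have "(\<Sum>k\<in>Nrm D. mk X (insert k D)) / ?N \<in> R"
          by (rule SS.GH.burnside_congruence[OF Xc Nsub]) (use graph_subset[OF D(1)] in \<open>simp_all add: set_normalizer_def\<close>)
        moreover have "(\<Sum>k\<in>Nrm D - D. mk X (insert k D)) / ?N \<in> R"
          unfolding sum_divide_distrib
        proof (intro Z_loc_sum[OF prime_p])
          fix k assume k: "k \<in> Nrm D - D"
          show "mk X (insert k D) / ?N \<in> R"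
          proof (cases "\<exists>E\<in>\<G>. insert k D \<subseteq> E")
            case False
            then have "mk X (insert k D) = 0" using mk_gen_zero[OF X(1)] by blast
            then show ?thesis using Z_loc_0[OF prime_p] by simp
          next
            case True
            then obtain E where E: "E \<in> \<G>" "insert k D \<subseteq> E" by blast
            let ?A = "generate (S \<times>\<times> S) (insert k D)"
            have A: "?A \<in> \<G>" by (rule generate_in_graph(1)[OF E(2,1)])
            have "insert k D \<subseteq> ?A" using generate.incl[of _ "insert k D" "S \<times>\<times> S"] by blast
            then have "D \<subset> ?A" using k by blast
            then have "card D < card ?A" using finite_graph[OF A] by (intro psubset_card_mono)
            then have "mk X ?A = v (Range ?A)" using X(2) A D by simp
            then show ?thesis using div[OF D(1) Range_sub[OF A]] mk_generate[OF X(1), of "insert k D"] by simp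
          qed
        qed
        ultimately have "of_nat (card D) * mk X D / ?N \<in> R"
        proof -
          assume A: "(\<Sum>k\<in>Nrm D. mk X (insert k D)) / ?N \<in> R" "(\<Sum>k\<in>Nrm D - D. mk X (insert k D)) / ?N \<in> R"
          have "of_nat (card D) * mk X D / ?N =
              (\<Sum>k\<in>Nrm D. mk X (insert k D)) / ?N - (\<Sum>k\<in>Nrm D - D. mk X (insert k D)) / ?N"
            by (simp add: normalizer_sum_split[OF D(1)] add_divide_distrib)
          then show ?thesis using Z_loc_diff[OF prime_p A] by simp
        qed
        moreover have "of_nat (card D) * (v (Range D) / ?N) \<in> R"
          by (intro Z_loc_mult[OF prime_p] Z_loc_of_nat[OF prime_p] div D(1) Range_sub)
        ultimately show "of_nat (card D) * (v (Range D) - mk X D) / ?N \<in> R"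
        proof -
          assume A: "of_nat (card D) * mk X D / ?N \<in> R" "of_nat (card D) * (v (Range D) / ?N) \<in> R"
          show ?thesis using Z_loc_diff[OF prime_p A(2,1)] by (simp add: right_diff_distrib diff_divide_distrib)
        qed
      qed
      have "mk Y D = v (Range D)" if D: "D \<in> \<G>" "n < card D" for D
      proof (cases "card D = Suc n")
        case True
        then show ?thesis using Y(3) D(1) by blast
      next
        case False
        then have "Suc n < card D" using D(2) by simp
        then show ?thesis using X(2) Y(2) D(1) by simp
      qed
      then show ?thesis using Y(1) by blast
    qed
  qed
  from this[of 0] obtain X where X: "gen X" "\<forall>D\<in>\<G>. 0 < card D \<longrightarrow> mk X D = v (Range D)" by blast
  show thesis by (rule that[OF X(1)]) (use X(2) card_graph_pos in simp)
qed

end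


section \<open>Consequences of saturation\<close>

text \<open>\<open>L\<close> acts on the right cosets of \<open>T\<close> by right translation through \<open>\<theta>\<close>. The coset of \<open>g\<close> is fixed iff
  \<open>g\<close> conjugates the image of \<open>\<theta>\<close> into \<open>T\<close>, and a \<open>p\<close>-group acting on a finite set has as many fixed
  points, modulo \<open>p\<close>, as there are points.\<close>

lemma card_conjugators:
  assumes "group A" "finite (carrier A)" "subgroup T A" "prime p"
    and "group L" "card (carrier L) = p ^ n" "\<theta> \<in> hom L A"
  obtains k where "card {g \<in> carrier A. \<forall>a\<in>carrier L. g \<otimes>\<^bsub>A\<^esub> \<theta> a \<otimes>\<^bsub>A\<^esub> inv\<^bsub>A\<^esub> g \<in> T} = card T * k"
    "[card (rcosets\<^bsub>A\<^esub> T) = k] (mod p)"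
proof -
  interpret A: group A by fact
  interpret L: group L by fact
  interpret \<theta>: group_hom L A \<theta> by unfold_locales (rule assms(7))
  have Tsub: "T \<subseteq> carrier A" by (rule subgroup.subset[OF assms(3)])
  let ?E = "rcosets\<^bsub>A\<^esub> T"
  have E: "?E = (\<lambda>g. T #>\<^bsub>A\<^esub> g) ` carrier A" by (auto simp: RCOSETS_def)
  have Esub: "C \<subseteq> carrier A" if "C \<in> ?E" for C using that A.r_coset_subset_G[OF Tsub] unfolding E by blast
  have finL: "finite (carrier L)" using assms(6) prime_gt_0_nat[OF assms(4)] by (intro card_ge_0_finite) simp
  let ?act = "\<lambda>a C. C #>\<^bsub>A\<^esub> inv\<^bsub>A\<^esub> (\<theta> a)"
  interpret act: finite_action L ?E ?act
  proof
    show "finite ?E" unfolding E using assms(2) by simp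
  next
    fix a C assume a: "a \<in> carrier L" and C: "C \<in> ?E"
    then obtain g where g: "g \<in> carrier A" "C = T #>\<^bsub>A\<^esub> g" unfolding E by blast
    have ia: "inv\<^bsub>A\<^esub> (\<theta> a) \<in> carrier A" using a by simp
    have "?act a C = T #>\<^bsub>A\<^esub> (g \<otimes>\<^bsub>A\<^esub> inv\<^bsub>A\<^esub> (\<theta> a))"
      unfolding g(2) by (rule A.coset_mult_assoc[OF Tsub g(1) ia])
    then show "?act a C \<in> ?E" unfolding E using A.m_closed[OF g(1) ia] by (intro image_eqI)
  next
    fix C assume "C \<in> ?E"
    from A.coset_mult_one[OF Esub[OF this]] show "?act \<one>\<^bsub>L\<^esub> C = C" by simp
  next
    fix a b C assume ab: "a \<in> carrier L" "b \<in> carrier L" and C: "C \<in> ?E"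
    have "?act a (?act b C) = C #>\<^bsub>A\<^esub> (inv\<^bsub>A\<^esub> (\<theta> b) \<otimes>\<^bsub>A\<^esub> inv\<^bsub>A\<^esub> (\<theta> a))"
      by (rule A.coset_mult_assoc[OF Esub[OF C]]) (use ab in simp_all)
    then show "?act (a \<otimes>\<^bsub>L\<^esub> b) C = ?act a (?act b C)" using ab by (simp add: A.inv_mult_group)
  qed (rule finL)
  let ?F = "{C \<in> ?E. \<forall>a\<in>carrier L. ?act a C = C}"
  have fixed: "T #>\<^bsub>A\<^esub> g \<in> ?F \<longleftrightarrow> (\<forall>a\<in>carrier L. g \<otimes>\<^bsub>A\<^esub> \<theta> a \<otimes>\<^bsub>A\<^esub> inv\<^bsub>A\<^esub> g \<in> T)"
    if g: "g \<in> carrier A" for g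
  proof -
    have 1: "?act a (T #>\<^bsub>A\<^esub> g) = T #>\<^bsub>A\<^esub> g \<longleftrightarrow> g \<otimes>\<^bsub>A\<^esub> \<theta> (inv\<^bsub>L\<^esub> a) \<otimes>\<^bsub>A\<^esub> inv\<^bsub>A\<^esub> g \<in> T"
      if a: "a \<in> carrier L" for a
    proof -
      let ?x = "g \<otimes>\<^bsub>A\<^esub> \<theta> (inv\<^bsub>L\<^esub> a)"
      have x: "?x \<in> carrier A" using g a by simp
      have "?act a (T #>\<^bsub>A\<^esub> g) = T #>\<^bsub>A\<^esub> ?x"
        using A.coset_mult_assoc[OF Tsub g, of "inv\<^bsub>A\<^esub> (\<theta> a)"] a by simp
      moreover have "T #>\<^bsub>A\<^esub> ?x = T #>\<^bsub>A\<^esub> g \<longleftrightarrow> ?x \<in> T #>\<^bsub>A\<^esub> g"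
        using A.rcos_self[OF x assms(3)] A.repr_independence[OF _ g assms(3), of ?x] by auto
      moreover have "?x \<in> T #>\<^bsub>A\<^esub> g \<longleftrightarrow> ?x \<otimes>\<^bsub>A\<^esub> inv\<^bsub>A\<^esub> g \<in> T"
      proof
        assume "?x \<in> T #>\<^bsub>A\<^esub> g"
        then obtain t where t: "t \<in> T" "?x = t \<otimes>\<^bsub>A\<^esub> g" by (auto simp: r_coset_def)
        then have "?x \<otimes>\<^bsub>A\<^esub> inv\<^bsub>A\<^esub> g = t" using g Tsub by (simp add: A.m_assoc subset_iff)
        then show "?x \<otimes>\<^bsub>A\<^esub> inv\<^bsub>A\<^esub> g \<in> T" using t by simp
      next
        assume t: "?x \<otimes>\<^bsub>A\<^esub> inv\<^bsub>A\<^esub> g \<in> T"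
        have "?x = ?x \<otimes>\<^bsub>A\<^esub> inv\<^bsub>A\<^esub> g \<otimes>\<^bsub>A\<^esub> g" using x g by (simp add: A.m_assoc)
        then show "?x \<in> T #>\<^bsub>A\<^esub> g" using t unfolding r_coset_def by blast
      qed
      ultimately show ?thesis by simp
    qed
    have "T #>\<^bsub>A\<^esub> g \<in> ?E" using g unfolding E by blast
    then have "T #>\<^bsub>A\<^esub> g \<in> ?F \<longleftrightarrow> (\<forall>a\<in>carrier L. g \<otimes>\<^bsub>A\<^esub> \<theta> (inv\<^bsub>L\<^esub> a) \<otimes>\<^bsub>A\<^esub> inv\<^bsub>A\<^esub> g \<in> T)" using 1 by simp
    also have "\<dots> \<longleftrightarrow> (\<forall>a\<in>carrier L. g \<otimes>\<^bsub>A\<^esub> \<theta> a \<otimes>\<^bsub>A\<^esub> inv\<^bsub>A\<^esub> g \<in> T)"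
      using L.inv_closed L.inv_inv by metis
    finally show ?thesis .
  qed
  have fibre: "{g \<in> carrier A. T #>\<^bsub>A\<^esub> g = C} = C" if C: "C \<in> ?E" for C
  proof -
    obtain g where g: "g \<in> carrier A" "C = T #>\<^bsub>A\<^esub> g" using C unfolding E by blast
    show ?thesis
      using Esub[OF C] A.rcos_self[OF _ assms(3)] A.repr_independence[OF _ g(1) assms(3)] g(2) by auto
  qed
  have finF: "finite ?F" using act.finite_E by simp
  have "card {g \<in> carrier A. \<forall>a\<in>carrier L. g \<otimes>\<^bsub>A\<^esub> \<theta> a \<otimes>\<^bsub>A\<^esub> inv\<^bsub>A\<^esub> g \<in> T} =
      card (\<Union>C\<in>?F. {g \<in> carrier A. T #>\<^bsub>A\<^esub> g = C})"
    using fixed by (intro arg_cong[where f = card]) blast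
  also have "\<dots> = (\<Sum>C\<in>?F. card {g \<in> carrier A. T #>\<^bsub>A\<^esub> g = C})"
    using finF assms(2) by (intro card_UN_disjoint) auto
  also have "\<dots> = (\<Sum>C\<in>?F. card T)"
    using fibre A.card_rcosets_equal[OF _ Tsub] by (intro sum.cong) auto
  finally have "card {g \<in> carrier A. \<forall>a\<in>carrier L. g \<otimes>\<^bsub>A\<^esub> \<theta> a \<otimes>\<^bsub>A\<^esub> inv\<^bsub>A\<^esub> g \<in> T} = card T * card ?F"
    by simp
  moreover have "[card ?E = card ?F] (mod p)" by (rule act.fixed_points_cong[OF assms(4,6)])
  ultimately show thesis using that by blast
qed

text \<open>Sylow's conjugation theorem for the image of a \<open>p\<close>-group: the index of \<open>T\<close> is prime to \<open>p\<close>, so there is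
  a fixed coset.\<close>

lemma sylow_conjugation:
  assumes "group A" "finite (carrier A)" "subgroup T A" "card T = p ^ multiplicity p (order A)" "prime p"
    and "group L" "card (carrier L) = p ^ n" "\<theta> \<in> hom L A"
  obtains g where "g \<in> carrier A" "\<forall>a\<in>carrier L. g \<otimes>\<^bsub>A\<^esub> \<theta> a \<otimes>\<^bsub>A\<^esub> inv\<^bsub>A\<^esub> g \<in> T"
proof -
  interpret A: group A by fact
  let ?G = "{g \<in> carrier A. \<forall>a\<in>carrier L. g \<otimes>\<^bsub>A\<^esub> \<theta> a \<otimes>\<^bsub>A\<^esub> inv\<^bsub>A\<^esub> g \<in> T}"
  let ?E = "rcosets\<^bsub>A\<^esub> T"
  obtain k where k: "card ?G = card T * k" "[card ?E = k] (mod p)"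
    using card_conjugators[OF assms(1-3,5-8)] .
  have lag: "card ?E * card T = order A" by (rule A.lagrange[OF assms(3)])
  have "\<not> p dvd card ?E"
  proof
    assume "p dvd card ?E"
    then have "p * card T dvd card ?E * card T" by (intro mult_dvd_mono dvd_refl)
    then have 1: "p ^ Suc (multiplicity p (order A)) dvd order A" by (simp add: lag) (simp add: assms(4))
    have 2: "order A \<noteq> 0" using assms(2) A.one_closed by (auto simp: order_def)
    have 3: "\<not> is_unit p" using assms(5) by auto
    have "Suc (multiplicity p (order A)) \<le> multiplicity p (order A)" by (rule multiplicity_geI[OF 2 3 1])
    then show False by simp
  qed
  then have "k \<noteq> 0" using k(2) by (intro notI) (simp add: cong_def dvd_eq_mod_eq_0)
  moreover have "card T \<noteq> 0" using prime_gt_0_nat[OF assms(5)] by (simp add: assms(4))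
  ultimately have "card ?G \<noteq> 0" using k(1) by simp
  then have "?G \<noteq> {}" by (rule contrapos_nn) (simp only: card.empty)
  then show thesis using that by blast
qed

context finite_fusion_system
begin

abbreviation conj_on :: "'a \<Rightarrow> 'a set \<Rightarrow> ('a \<times> 'a) set"
  where "conj_on s P \<equiv> (\<lambda>x. (s \<otimes> x \<otimes> inv s, x)) ` P"

lemma conj_on_graph: "subgroup P S \<Longrightarrow> s \<in> carrier S \<Longrightarrow> conj_on s P \<in> \<G>"
proof -
  assume a: "subgroup P S" "s \<in> carrier S"
  have "conj_on s P = {(s \<otimes> x \<otimes> inv s, x) | x. x \<in> P}" by blast
  then show ?thesis using conj_graph_mem[OF a] by (simp only:)
qed

lemma Range_conj_on: "Range (conj_on s P) = P" and Domain_conj_on: "Domain (conj_on s P) = (\<lambda>x. s \<otimes> x \<otimes> inv s) ` P"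
  by (simp_all add: snd_eq_Range[symmetric] fst_eq_Domain[symmetric] image_image)

lemma conj_on_mult:
  assumes "s \<in> carrier S" "t \<in> carrier S" "P \<subseteq> carrier S" "(\<lambda>x. t \<otimes> x \<otimes> inv t) ` P \<subseteq> Q"
  shows "conj_on s Q O conj_on t P = conj_on (s \<otimes> t) P"
proof -
  have "s \<otimes> (t \<otimes> x \<otimes> inv t) \<otimes> inv s = s \<otimes> t \<otimes> x \<otimes> inv (s \<otimes> t)" if "x \<in> P" for x
    using that assms by (simp add: m_assoc inv_mult_group subset_iff)
  then show ?thesis using assms(4) by (auto simp: relcomp_unfold image_iff)
qed

lemma normalizer_eq:
  assumes "P \<subseteq> carrier S"
  shows "normalizer S P = {s \<in> carrier S. (\<lambda>x. s \<otimes> x \<otimes> inv s) ` P = P}"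
proof -
  have "s <# P #> inv s = (\<lambda>x. s \<otimes> x \<otimes> inv s) ` P" for s
    by (auto simp: l_coset_def r_coset_def)
  then show ?thesis using assms by (simp add: normalizer_def stabilizer_def)
qed

text \<open>\<open>Aut\<^sub>F(P)\<close> as a group of graphs under relational composition.\<close>

definition aut_graphs :: "'a set \<Rightarrow> ('a \<times> 'a) set monoid"
  where "aut_graphs P = \<lparr>carrier = {E \<in> \<G>. Range E = P \<and> Domain E = P}, monoid.mult = (O), one = Id_on P\<rparr>"

lemma aut_graphs_group: assumes "subgroup P S" shows "group (aut_graphs P)"
proof (rule groupI)
  fix E assume E: "E \<in> carrier (aut_graphs P)"
  then show "\<exists>E'\<in>carrier (aut_graphs P). E' \<otimes>\<^bsub>aut_graphs P\<^esub> E = \<one>\<^bsub>aut_graphs P\<^esub>"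
    using graph_converse graph_converse_comp[of E] by (intro bexI[of _ "converse E"]) (simp_all add: aut_graphs_def)
qed (use Id_on_graph[OF assms] in \<open>simp_all add: aut_graphs_def graph_comp Range_comp Domain_comp O_assoc Id_on_comp\<close>)

lemma aut_graphs_inv:
  assumes "subgroup P S" "E \<in> carrier (aut_graphs P)"
  shows "inv\<^bsub>aut_graphs P\<^esub> E = converse E"
proof -
  interpret group "aut_graphs P" by (rule aut_graphs_group[OF assms(1)])
  show ?thesis
    by (rule inv_equality) (use assms(2) graph_converse graph_converse_comp[of E] in \<open>simp_all add: aut_graphs_def\<close>)
qed

lemma inj_graph_extensional: "inj_on (graph_subgroup P) (extensional P)"
proof (rule inj_onI)
  fix \<phi> \<psi> assume "\<phi> \<in> extensional P" "\<psi> \<in> extensional P" and eq: "graph_subgroup P \<phi> = graph_subgroup P \<psi>"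
  moreover have "\<phi> x = \<psi> x" if "x \<in> P" for x
    using that eq graph_mem[of "\<phi> x" x P \<phi>] graph_mem[of "\<phi> x" x P \<psi>] by simp
  ultimately show "\<phi> = \<psi>" by (intro extensionalityI)
qed

lemma order_aut_graphs: assumes "subgroup P S" shows "order (aut_graphs P) = card (F P P)"
proof -
  have ext: "F P P \<subseteq> extensional P" using morphismD(3)[OF assms assms] by blast
  have "graph_subgroup P ` F P P = carrier (aut_graphs P)"
  proof
    show "graph_subgroup P ` F P P \<subseteq> carrier (aut_graphs P)"
    proof (rule image_subsetI)
      fix \<phi> assume \<phi>: "\<phi> \<in> F P P"
      have "\<phi> ` P = P"
        using morphismD(2,4)[OF assms assms \<phi>] finite_subset[OF subgroup.subset[OF assms] finite_S]
        by (intro endo_inj_surj) auto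
      then show "graph_subgroup P \<phi> \<in> carrier (aut_graphs P)"
        using graphI'[OF assms assms \<phi>] by (simp add: aut_graphs_def Range_graph Domain_graph)
    qed
    show "carrier (aut_graphs P) \<subseteq> graph_subgroup P ` F P P"
    proof
      fix E assume "E \<in> carrier (aut_graphs P)"
      then have E: "E \<in> \<G>" "Range E = P" "Domain E = P" by (auto simp: aut_graphs_def)
      obtain \<phi> where \<phi>: "subgroup (Range E) S" "\<phi> \<in> F (Range E) (carrier S)" "E = graph_subgroup (Range E) \<phi>" "Domain E = \<phi> ` Range E"
        using E(1) by (rule graphE)
      have "\<phi> \<in> F P P" using change_codomain[OF assms carrier_sub assms, of \<phi>] \<phi> E by simp
      then show "E \<in> graph_subgroup P ` F P P" using \<phi>(3) E(2) by simp
    qed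
  qed
  moreover have "card (graph_subgroup P ` F P P) = card (F P P)"
    by (rule card_image[OF inj_on_subset[OF inj_graph_extensional ext]])
  ultimately show ?thesis by (simp add: order_def)
qed

lemma graph_conj_map: "graph_subgroup P (conj_map S s P) = conj_on s P"
  by (auto simp: graph_subgroup_def conj_map_def image_iff)

text \<open>\<open>Aut\<^sub>S(P)\<close> inside \<open>Aut\<^sub>F(P)\<close>.\<close>

lemma conj_auts_subgroup:
  assumes "subgroup P S"
  shows "subgroup ((\<lambda>s. conj_on s P) ` normalizer S P) (aut_graphs P)"
    "card ((\<lambda>s. conj_on s P) ` normalizer S P) = card (Aut_S S P)"
proof -
  interpret A: group "aut_graphs P" by (rule aut_graphs_group[OF assms])
  have Psub: "P \<subseteq> carrier S" by (rule subgroup.subset[OF assms])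
  have N: "s \<in> carrier S" "(\<lambda>x. s \<otimes> x \<otimes> inv s) ` P = P" if "s \<in> normalizer S P" for s
    using that by (auto simp: normalizer_eq[OF Psub])
  have mem: "conj_on s P \<in> carrier (aut_graphs P)" if "s \<in> normalizer S P" for s
    using N[OF that] conj_on_graph[OF assms] by (simp add: aut_graphs_def Range_conj_on Domain_conj_on)
  have sg: "subgroup (normalizer S P) S" by (rule normalizer_imp_subgroup[OF Psub])
  have mult: "conj_on s P O conj_on t P = conj_on (s \<otimes> t) P" if "s \<in> normalizer S P" "t \<in> normalizer S P" for s t
    using N[OF that(1)] N[OF that(2)] Psub by (intro conj_on_mult) auto
  have one: "conj_on \<one> P = Id_on P" using Psub by (auto simp: Id_on_def image_iff subset_iff)
  show "subgroup ((\<lambda>s. conj_on s P) ` normalizer S P) (aut_graphs P)"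
  proof (rule A.subgroupI)
    show "(\<lambda>s. conj_on s P) ` normalizer S P \<noteq> {}" using subgroup.one_closed[OF sg] by blast
    fix E assume "E \<in> (\<lambda>s. conj_on s P) ` normalizer S P"
    then obtain s where s: "s \<in> normalizer S P" "E = conj_on s P" by blast
    have isN: "inv s \<in> normalizer S P" by (rule subgroup.m_inv_closed[OF sg s(1)])
    have "inv\<^bsub>aut_graphs P\<^esub> E = conj_on (inv s) P"
    proof (rule A.inv_equality)
      show "conj_on (inv s) P \<otimes>\<^bsub>aut_graphs P\<^esub> E = \<one>\<^bsub>aut_graphs P\<^esub>"
      proof -
        have "conj_on (inv s) P O E = Id_on P"
          unfolding s(2) mult[OF isN s(1)] l_inv[OF N(1)[OF s(1)]] by (rule one)
        then show ?thesis by (simp add: aut_graphs_def)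
      qed
    qed (use mem isN s in auto)
    then show "inv\<^bsub>aut_graphs P\<^esub> E \<in> (\<lambda>s. conj_on s P) ` normalizer S P" using isN by blast
    fix E' assume "E' \<in> (\<lambda>s. conj_on s P) ` normalizer S P"
    then obtain t where t: "t \<in> normalizer S P" "E' = conj_on t P" by blast
    show "E \<otimes>\<^bsub>aut_graphs P\<^esub> E' \<in> (\<lambda>s. conj_on s P) ` normalizer S P"
      using mult[OF s(1) t(1)] subgroup.m_closed[OF sg s(1) t(1)] by (simp add: aut_graphs_def s(2) t(2))
  qed (use mem in blast)
  have "(\<lambda>s. conj_on s P) ` normalizer S P = graph_subgroup P ` Aut_S S P"
    by (simp add: Aut_S_def image_image graph_conj_map)
  moreover have "Aut_S S P \<subseteq> extensional P" by (auto simp: Aut_S_def conj_map_def)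
  ultimately show "card ((\<lambda>s. conj_on s P) ` normalizer S P) = card (Aut_S S P)"
    by (simp add: card_image[OF inj_on_subset[OF inj_graph_extensional]])
qed

lemma N_phi_subgroup:
  assumes "subgroup P S" "\<phi> \<in> F P (carrier S)"
  shows "subgroup (N_phi S P \<phi>) S"
proof -
  have Psub: "P \<subseteq> carrier S" by (rule subgroup.subset[OF assms(1)])
  have sg: "subgroup (normalizer S P) S" by (rule normalizer_imp_subgroup[OF Psub])
  have N: "s \<in> carrier S" "\<And>x. x \<in> P \<Longrightarrow> s \<otimes> x \<otimes> inv s \<in> P" if "s \<in> normalizer S P" for s
    using that by (auto simp: normalizer_eq[OF Psub])
  have \<phi>: "\<phi> u \<in> carrier S" if "u \<in> P" for u using morphismD(4)[OF assms(1) carrier_sub assms(2)] that by blast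
  show ?thesis
  proof (rule subgroupI)
    show "N_phi S P \<phi> \<subseteq> carrier S" using N by (auto simp: N_phi_def)
    have "\<one> \<in> N_phi S P \<phi>" unfolding N_phi_def
      using subgroup.one_closed[OF sg] Psub \<phi> by (auto intro!: bexI[of _ \<one>] simp: subset_iff)
    then show "N_phi S P \<phi> \<noteq> {}" by blast
  next
    fix x assume x: "x \<in> N_phi S P \<phi>"
    then obtain y where y: "y \<in> carrier S" "\<forall>u\<in>P. \<phi> (x \<otimes> u \<otimes> inv x) = y \<otimes> \<phi> u \<otimes> inv y" and xN: "x \<in> normalizer S P"
      by (auto simp: N_phi_def)
    have ix: "inv x \<in> normalizer S P" by (rule subgroup.m_inv_closed[OF sg xN])
    have "\<phi> (inv x \<otimes> u \<otimes> inv (inv x)) = inv y \<otimes> \<phi> u \<otimes> inv (inv y)" if u: "u \<in> P" for u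
    proof -
      let ?v = "inv x \<otimes> u \<otimes> inv (inv x)"
      have v: "?v \<in> P" by (rule N(2)[OF ix u])
      have "x \<otimes> ?v \<otimes> inv x = u"
        using N(1)[OF xN] u Psub by (simp add: m_assoc subset_iff) (simp add: m_assoc[symmetric])
      then have "\<phi> u = y \<otimes> \<phi> ?v \<otimes> inv y" using y(2) v by metis
      then have "inv y \<otimes> \<phi> u \<otimes> inv (inv y) = inv y \<otimes> (y \<otimes> \<phi> ?v \<otimes> inv y) \<otimes> y" using y(1) by simp
      also have "\<dots> = \<phi> ?v"
        using y(1) \<phi>[OF v] by (simp add: m_assoc) (simp add: m_assoc[symmetric])
      finally show ?thesis by simp
    qed
    then show "inv x \<in> N_phi S P \<phi>" unfolding N_phi_def using ix y(1) by blast
    fix x' assume x': "x' \<in> N_phi S P \<phi>"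
    then obtain y' where y': "y' \<in> carrier S" "\<forall>u\<in>P. \<phi> (x' \<otimes> u \<otimes> inv x') = y' \<otimes> \<phi> u \<otimes> inv y'" and xN': "x' \<in> normalizer S P"
      by (auto simp: N_phi_def)
    have "\<phi> (x \<otimes> x' \<otimes> u \<otimes> inv (x \<otimes> x')) = y \<otimes> y' \<otimes> \<phi> u \<otimes> inv (y \<otimes> y')" if u: "u \<in> P" for u
    proof -
      have "x \<otimes> x' \<otimes> u \<otimes> inv (x \<otimes> x') = x \<otimes> (x' \<otimes> u \<otimes> inv x') \<otimes> inv x"
        using N(1)[OF xN] N(1)[OF xN'] u Psub by (simp add: m_assoc inv_mult_group subset_iff)
      then have "\<phi> (x \<otimes> x' \<otimes> u \<otimes> inv (x \<otimes> x')) = y \<otimes> (y' \<otimes> \<phi> u \<otimes> inv y') \<otimes> inv y"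
        using y(2) y'(2) N(2)[OF xN' u] u by simp
      then show ?thesis using y(1) y'(1) \<phi>[OF u] by (simp add: m_assoc inv_mult_group)
    qed
    then show "x \<otimes> x' \<in> N_phi S P \<phi>"
      unfolding N_phi_def using subgroup.m_closed[OF sg xN xN'] y(1) y'(1) by blast
  qed
qed

end

locale saturated_fusion_system = finite_fusion_system +
  assumes saturated: "saturated p S F"
begin

text \<open>The extension axiom in terms of graphs. The hypothesis on the elements of \<open>L\<close> says that they lie in
  \<open>N\<^sub>\<phi>\<close>, where \<open>\<phi>\<close> is the morphism with graph \<open>\<alpha>\<close>.\<close>

lemma extend_graph:
  assumes "\<alpha> \<in> \<G>" "fully_centralized S F (Domain \<alpha>)" "L \<subseteq> normalizer S (Range \<alpha>)"
    and ex: "\<And>a. a \<in> L \<Longrightarrow> \<exists>y\<in>carrier S. \<forall>w u. (w, u) \<in> \<alpha> \<longrightarrow> (y \<otimes> w \<otimes> inv y, a \<otimes> u \<otimes> inv a) \<in> \<alpha>"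
  shows "\<exists>\<beta>\<in>\<G>. \<alpha> \<subseteq> \<beta> \<and> L \<subseteq> Range \<beta>"
proof -
  let ?Q = "Range \<alpha>"
  obtain \<phi> where \<phi>: "subgroup ?Q S" "\<phi> \<in> F ?Q (carrier S)" "\<alpha> = graph_subgroup ?Q \<phi>" "Domain \<alpha> = \<phi> ` ?Q"
    using assms(1) by (rule graphE)
  have m: "(w, u) \<in> \<alpha> \<longleftrightarrow> u \<in> ?Q \<and> w = \<phi> u" for w u using \<phi>(3) graph_mem[of w u ?Q \<phi>] by simp
  obtain \<psi> where \<psi>: "\<psi> \<in> F (N_phi S ?Q \<phi>) (carrier S)" "\<forall>u\<in>?Q. \<psi> u = \<phi> u"
    using saturated \<phi>(1,2,4) assms(2) unfolding saturated_def by (metis (no_types, lifting))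
  let ?b = "graph_subgroup (N_phi S ?Q \<phi>) \<psi>"
  have b: "?b \<in> \<G>" by (rule graphI[OF N_phi_subgroup[OF \<phi>(1,2)] \<psi>(1)])
  have L: "L \<subseteq> N_phi S ?Q \<phi>"
  proof
    fix a assume a: "a \<in> L"
    obtain y where y: "y \<in> carrier S" "\<forall>w u. (w, u) \<in> \<alpha> \<longrightarrow> (y \<otimes> w \<otimes> inv y, a \<otimes> u \<otimes> inv a) \<in> \<alpha>"
      using ex[OF a] by blast
    have "\<phi> (a \<otimes> u \<otimes> inv a) = y \<otimes> \<phi> u \<otimes> inv y" if u: "u \<in> ?Q" for u
      using y(2)[rule_format, of "\<phi> u" u] u m[of "\<phi> u" u] m[of "y \<otimes> \<phi> u \<otimes> inv y" "a \<otimes> u \<otimes> inv a"] by metis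
    then show "a \<in> N_phi S ?Q \<phi>" unfolding N_phi_def using assms(3) a y(1) by blast
  qed
  have QN: "?Q \<subseteq> N_phi S ?Q \<phi>"
  proof
    fix a assume a: "a \<in> ?Q"
    have Qsub: "?Q \<subseteq> carrier S" by (rule subgroup.subset[OF \<phi>(1)])
    interpret Q: subgroup ?Q S by (rule \<phi>(1))
    note hom = morphismD(5)[OF \<phi>(1) carrier_sub \<phi>(2)]
    have \<phi>c: "\<phi> u \<in> carrier S" if "u \<in> ?Q" for u using morphismD(4)[OF \<phi>(1) carrier_sub \<phi>(2)] that by blast
    have "group_hom (S\<lparr>carrier := ?Q\<rparr>) S \<phi>"
      using subgroup.subgroup_is_group[OF \<phi>(1) is_group] morphism_hom[OF \<phi>(1,2)]
      by (simp add: group_hom_def group_hom_axioms_def is_group)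
    then have inv: "\<phi> (inv a) = inv \<phi> a" using group_hom.hom_inv[of "S\<lparr>carrier := ?Q\<rparr>" S \<phi> a] a m_inv_consistent[OF \<phi>(1) a] by simp
    have eq: "\<phi> (a \<otimes> u \<otimes> inv a) = \<phi> a \<otimes> \<phi> u \<otimes> inv \<phi> a" if "u \<in> ?Q" for u
      using that a hom[of "a \<otimes> u" "inv a"] hom[of a u] inv Q.m_closed Q.m_inv_closed by simp
    have "a \<in> normalizer S ?Q"
    proof -
      have "(\<lambda>x. a \<otimes> x \<otimes> inv a) ` ?Q = ?Q"
      proof
        show "(\<lambda>x. a \<otimes> x \<otimes> inv a) ` ?Q \<subseteq> ?Q" using a by (auto simp: image_subset_iff)
        show "?Q \<subseteq> (\<lambda>x. a \<otimes> x \<otimes> inv a) ` ?Q"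
        proof
          fix x assume x: "x \<in> ?Q"
          have "x = a \<otimes> (inv a \<otimes> x \<otimes> a) \<otimes> inv a"
            using x a Qsub by (simp add: m_assoc subset_iff) (simp add: m_assoc[symmetric])
          moreover have "inv a \<otimes> x \<otimes> a \<in> ?Q" using x a by (intro Q.m_closed Q.m_inv_closed)
          ultimately show "x \<in> (\<lambda>x. a \<otimes> x \<otimes> inv a) ` ?Q" by blast
        qed
      qed
      then show ?thesis using a Qsub by (simp add: normalizer_eq[OF Qsub] subset_iff)
    qed
    then show "a \<in> N_phi S ?Q \<phi>" unfolding N_phi_def using eq \<phi>c[OF a] by blast
  qed
  have "\<alpha> \<subseteq> ?b"
  proof
    fix z assume z: "z \<in> \<alpha>"
    obtain w u where "z = (w, u)" by (cases z)
    then show "z \<in> ?b" using z m[of w u] QN \<psi>(2) by (auto simp: graph_mem)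
  qed
  then show ?thesis using b L by (intro bexI[of _ ?b]) (auto simp: Range_graph)
qed

lemma normalizer_conj:
  assumes "D \<in> \<G>" "(b, a) \<in> Nrm D"
  shows "b \<in> carrier S" "a \<in> carrier S" "\<And>w u. (w, u) \<in> D \<Longrightarrow> (b \<otimes> w \<otimes> inv b, a \<otimes> u \<otimes> inv a) \<in> D"
    "a \<in> normalizer S (Range D)" "b \<in> normalizer S (Domain D)"
proof -
  show ba: "b \<in> carrier S" "a \<in> carrier S" using assms(2) by (auto simp: set_normalizer_def)
  have eq: "(\<lambda>z. (b \<otimes> fst z \<otimes> inv b, a \<otimes> snd z \<otimes> inv a)) ` D = D"
  proof -
    have "cs (b, a) D = (\<lambda>z. (b \<otimes> fst z \<otimes> inv b, a \<otimes> snd z \<otimes> inv a)) ` D"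
      unfolding conj_set_def by (rule image_cong) (use ba in auto)
    then show ?thesis using assms(2) by (simp add: set_normalizer_def)
  qed
  show "(b \<otimes> w \<otimes> inv b, a \<otimes> u \<otimes> inv a) \<in> D" if wu: "(w, u) \<in> D" for w u
    using imageI[OF wu, of "\<lambda>z. (b \<otimes> fst z \<otimes> inv b, a \<otimes> snd z \<otimes> inv a)"] eq by simp
  have "(\<lambda>x. a \<otimes> x \<otimes> inv a) ` snd ` D = snd ` D"
    using arg_cong[OF eq, of "image snd"] by (simp only: image_image snd_conv)
  then show "a \<in> normalizer S (Range D)"
    using ba subgroup.subset[OF Range_sub[OF assms(1)]] by (simp add: normalizer_eq snd_eq_Range)
  have "(\<lambda>x. b \<otimes> x \<otimes> inv b) ` fst ` D = fst ` D"
    using arg_cong[OF eq, of "image fst"] by (simp only: image_image fst_conv)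
  then show "b \<in> normalizer S (Domain D)"
    using ba subgroup.subset[OF Domain_sub[OF assms(1)]] by (simp add: normalizer_eq fst_eq_Domain)
qed

lemma p_subgroup_card:
  assumes "subgroup L S" shows "\<exists>n. card L = p ^ n"
proof -
  obtain m where "order S = p ^ m" using p_group by (auto simp: finite_p_group_def)
  then have "card L dvd p ^ m" using lagrange[OF assms] by (metis dvd_triv_right)
  then show ?thesis using divides_primepow_nat[OF prime_p] by blast
qed

text \<open>The projections of the normalizer of \<open>D\<close> to the two factors normalize the source \<open>Q\<close> and the image of
  \<open>D\<close>. Choose an isomorphism from \<open>Q\<close> to \<open>P\<close>. It turns the action of the second projection on \<open>Q\<close> into a
  \<open>p\<close>-group of automorphisms of \<open>P\<close>, and after composing with an automorphism of \<open>P\<close> this group lies in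
  \<open>Aut\<^sub>S(P)\<close>, by Sylow's theorem. Then the isomorphism extends to the second projection; for the image of
  \<open>D\<close> the isomorphism is the same one composed with the inverse of \<open>D\<close>, and it extends to the first projection
  for the same reason.\<close>

lemma move_to_fully_normalized:
  assumes D: "D \<in> \<G>" and P: "fully_normalized S F P" and conj: "conjugate (Range D) P"
  shows "\<exists>\<alpha>\<in>\<G>. \<exists>\<beta>\<in>\<G>. Nrm D \<subseteq> Range \<beta> \<times> Range \<alpha> \<and> \<beta> O D O converse \<alpha> = Id_on P"
proof -
  let ?Q = "Range D"
  have Psub: "subgroup P S" by (rule conjugate_subgroup(2)[OF conj])
  have sat: "fully_centralized S F P" "sylow_subgroup p (Aut_S S P) (Aut_F F P)"
    using saturated P Psub unfolding saturated_def by auto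
  obtain \<alpha>0 where \<alpha>0: "\<alpha>0 \<in> \<G>" "Range \<alpha>0 = ?Q" "Domain \<alpha>0 = P" using conj by (auto simp: conjugate_def)
  let ?A = "aut_graphs P"
  interpret A: group ?A by (rule aut_graphs_group[OF Psub])
  let ?T = "(\<lambda>s. conj_on s P) ` normalizer S P"
  have cardT: "card ?T = p ^ multiplicity p (order ?A)"
    using sat(2) conj_auts_subgroup(2)[OF Psub] order_aut_graphs[OF Psub]
    by (simp add: sylow_subgroup_def Aut_F_def order_def)
  let ?L = "Range (Nrm D)"
  have Nsub: "subgroup (Nrm D) (S \<times>\<times> S)" using graph_subset[OF D] by (intro SS.GH.HG.set_normalizer_subgroup) simp
  have Lsub: "subgroup ?L S" by (rule Range_subgroup[OF Nsub])
  have Qsub: "?Q \<subseteq> carrier S" by (rule subgroup.subset[OF Range_sub[OF D]])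
  have L: "a \<in> carrier S" "(\<lambda>x. a \<otimes> x \<otimes> inv a) ` ?Q = ?Q" if a: "a \<in> ?L" for a
  proof -
    obtain b where "(b, a) \<in> Nrm D" using a by (rule RangeE)
    from normalizer_conj(4)[OF D this] show "a \<in> carrier S" "(\<lambda>x. a \<otimes> x \<otimes> inv a) ` ?Q = ?Q"
      by (simp_all add: normalizer_eq[OF Qsub])
  qed
  define \<theta> where "\<theta> a = \<alpha>0 O conj_on a ?Q O converse \<alpha>0" for a
  have \<theta>mem: "\<theta> a \<in> carrier ?A" if a: "a \<in> ?L" for a
  proof -
    have c: "Range (conj_on a ?Q) = ?Q" "Domain (conj_on a ?Q) = ?Q"
      using L(2)[OF a] by (simp_all only: Range_conj_on Domain_conj_on)
    have "conj_on a ?Q O converse \<alpha>0 \<in> \<G>" "\<theta> a \<in> \<G>"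
      unfolding \<theta>_def using \<alpha>0(1) conj_on_graph[OF Range_sub[OF D] L(1)[OF a]] by (auto intro!: graph_comp graph_converse)
    moreover have r1: "Range (conj_on a ?Q O converse \<alpha>0) = P"
      using \<alpha>0 c by (subst Range_comp) simp_all
    moreover have d1: "Domain (conj_on a ?Q O converse \<alpha>0) = ?Q"
      using \<alpha>0 c by (subst Domain_comp) simp_all
    moreover have "Range (\<theta> a) = P" unfolding \<theta>_def by (subst Range_comp) (simp_all only: r1 d1 \<alpha>0 order_refl)
    moreover have "Domain (\<theta> a) = P" unfolding \<theta>_def by (subst Domain_comp) (simp_all only: r1 d1 \<alpha>0 order_refl)
    ultimately show ?thesis by (simp add: aut_graphs_def)
  qed
  have \<theta>mult: "\<theta> (a \<otimes> a') = \<theta> a O \<theta> a'" if a: "a \<in> ?L" "a' \<in> ?L" for a a'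
  proof -
    have r: "converse \<alpha>0 O \<alpha>0 O R = R" if "Domain R \<subseteq> ?Q" for R :: "('a \<times> 'a) set"
      using graph_converse_comp[OF \<alpha>0(1)] Id_on_comp[OF that] by (simp add: O_assoc[symmetric] \<alpha>0(2))
    have "Domain (conj_on a' ?Q O converse \<alpha>0) \<subseteq> ?Q"
      by (subst Domain_comp)
        (simp_all only: Range_conj_on Domain_conj_on L(2)[OF a(2)] Domain_converse \<alpha>0(2) order_refl)
    then have "\<theta> a O \<theta> a' = \<alpha>0 O conj_on a ?Q O (conj_on a' ?Q O converse \<alpha>0)"
      unfolding \<theta>_def by (simp only: O_assoc r)
    also have "\<dots> = \<alpha>0 O (conj_on a ?Q O conj_on a' ?Q) O converse \<alpha>0" by (simp only: O_assoc)
    also have "conj_on a ?Q O conj_on a' ?Q = conj_on (a \<otimes> a') ?Q"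
      using L[OF a(1)] L[OF a(2)] Qsub by (intro conj_on_mult) auto
    finally show ?thesis by (simp only: \<theta>_def)
  qed
  obtain n where n: "card ?L = p ^ n" using p_subgroup_card[OF Lsub] by blast
  have finA: "finite (carrier ?A)" using finite_graphs by (simp add: aut_graphs_def)
  have \<theta>hom: "\<theta> \<in> hom (S\<lparr>carrier := ?L\<rparr>) ?A"
    using \<theta>mem \<theta>mult by (simp add: hom_def Pi_iff) (simp add: aut_graphs_def)
  have n': "card (carrier (S\<lparr>carrier := ?L\<rparr>)) = p ^ n" using n by simp
  obtain \<gamma> where \<gamma>0: "\<gamma> \<in> carrier ?A"
    "\<forall>a\<in>carrier (S\<lparr>carrier := ?L\<rparr>). \<gamma> \<otimes>\<^bsub>?A\<^esub> \<theta> a \<otimes>\<^bsub>?A\<^esub> inv\<^bsub>?A\<^esub> \<gamma> \<in> ?T"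
    using sylow_conjugation[OF A.is_group finA conj_auts_subgroup(1)[OF Psub] cardT prime_p
        subgroup.subgroup_is_group[OF Lsub is_group] n' \<theta>hom] .
  then have \<gamma>: "\<gamma> \<in> carrier ?A" "\<forall>a\<in>?L. \<gamma> \<otimes>\<^bsub>?A\<^esub> \<theta> a \<otimes>\<^bsub>?A\<^esub> inv\<^bsub>?A\<^esub> \<gamma> \<in> ?T"
    by simp_all
  have \<gamma>G: "\<gamma> \<in> \<G>" "Range \<gamma> = P" "Domain \<gamma> = P" using \<gamma>(1) by (auto simp: aut_graphs_def)
  define \<alpha>1 where "\<alpha>1 = \<gamma> O \<alpha>0"
  have \<alpha>1: "\<alpha>1 \<in> \<G>" "Range \<alpha>1 = ?Q" "Domain \<alpha>1 = P"
    unfolding \<alpha>1_def using \<gamma>G \<alpha>0 by (simp_all add: graph_comp Range_comp Domain_comp)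
  have y: "\<exists>y\<in>carrier S. \<forall>w u. (w, u) \<in> \<alpha>1 \<longrightarrow> (y \<otimes> w \<otimes> inv y, a \<otimes> u \<otimes> inv a) \<in> \<alpha>1" if a: "a \<in> ?L" for a
  proof -
    have "\<gamma> \<otimes>\<^bsub>?A\<^esub> \<theta> a \<otimes>\<^bsub>?A\<^esub> inv\<^bsub>?A\<^esub> \<gamma> = \<gamma> O \<theta> a O converse \<gamma>"
      unfolding aut_graphs_inv[OF Psub \<gamma>(1)] by (simp add: aut_graphs_def O_assoc)
    then have "\<gamma> O \<theta> a O converse \<gamma> \<in> ?T" using \<gamma>(2)[rule_format, OF a] by (simp only:)
    then obtain y where y: "\<gamma> O \<theta> a O converse \<gamma> = conj_on y P" "y \<in> normalizer S P" by (rule imageE)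
    have "y \<in> carrier S" using y(2) by (simp add: normalizer_eq[OF subgroup.subset[OF Psub]])
    moreover have "(y \<otimes> w \<otimes> inv y, a \<otimes> u \<otimes> inv a) \<in> \<alpha>1" if wu: "(w, u) \<in> \<alpha>1" for w u
    proof -
      have "w \<in> P" using DomainI[OF wu] by (simp only: \<alpha>1(3))
      then have "(y \<otimes> w \<otimes> inv y, w) \<in> \<gamma> O \<theta> a O converse \<gamma>"
        unfolding y(1) by (rule image_eqI[OF refl])
      then obtain r r' where r: "(y \<otimes> w \<otimes> inv y, r) \<in> \<gamma>" "(r, r') \<in> \<theta> a" "(w, r') \<in> \<gamma>"
        by (meson converseD relcompEpair)
      obtain q q' where q: "(r, q) \<in> \<alpha>0" "(q, q') \<in> conj_on a ?Q" "(r', q') \<in> \<alpha>0"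
        using r(2) unfolding \<theta>_def by (meson converseD relcompEpair)
      have 1: "(y \<otimes> w \<otimes> inv y, q) \<in> \<alpha>1" "(w, q') \<in> \<alpha>1"
        unfolding \<alpha>1_def using r q by (blast intro: relcompI)+
      have "q' = u" by (rule graph_inj[OF \<alpha>1(1) 1(2) wu])
      moreover have "q = a \<otimes> q' \<otimes> inv a" using q(2) by (elim imageE) simp
      ultimately show ?thesis using 1(1) by simp
    qed
    ultimately show ?thesis by blast
  qed
  have LN: "?L \<subseteq> normalizer S (Range \<alpha>1)" unfolding \<alpha>1(2) normalizer_eq[OF Qsub]
    using L by (intro subsetI CollectI conjI)
  have fc: "fully_centralized S F (Domain \<alpha>1)" using sat(1) \<alpha>1(3) by simp
  obtain \<alpha> where \<alpha>: "\<alpha> \<in> \<G>" "\<alpha>1 \<subseteq> \<alpha>" "?L \<subseteq> Range \<alpha>" using extend_graph[OF \<alpha>1(1) fc LN y] by blast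
  define \<beta>1 where "\<beta>1 = \<alpha>1 O converse D"
  have \<beta>1: "\<beta>1 \<in> \<G>" "Range \<beta>1 = Domain D" "Domain \<beta>1 = P"
    unfolding \<beta>1_def using \<alpha>1 D by (simp_all add: graph_comp graph_converse Range_comp Domain_comp)
  let ?L' = "Domain (Nrm D)"
  have y': "\<exists>y\<in>carrier S. \<forall>w u. (w, u) \<in> \<beta>1 \<longrightarrow> (y \<otimes> w \<otimes> inv y, b \<otimes> u \<otimes> inv b) \<in> \<beta>1" if b: "b \<in> ?L'" for b
  proof -
    obtain a where ba: "(b, a) \<in> Nrm D" using b by (rule DomainE)
    then have aL: "a \<in> ?L" by (rule RangeI)
    obtain y where yy: "y \<in> carrier S" "\<forall>w u. (w, u) \<in> \<alpha>1 \<longrightarrow> (y \<otimes> w \<otimes> inv y, a \<otimes> u \<otimes> inv a) \<in> \<alpha>1"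
      using y[OF aL] by blast
    have "(y \<otimes> w \<otimes> inv y, b \<otimes> u \<otimes> inv b) \<in> \<beta>1" if wu: "(w, u) \<in> \<beta>1" for w u
    proof -
      obtain v where v: "(w, v) \<in> \<alpha>1" "(u, v) \<in> D" using wu unfolding \<beta>1_def by blast
      then show ?thesis using yy(2) normalizer_conj(3)[OF D ba v(2)] unfolding \<beta>1_def by blast
    qed
    then show ?thesis using yy(1) by blast
  qed
  have LN': "?L' \<subseteq> normalizer S (Range \<beta>1)"
  proof
    fix b assume "b \<in> ?L'"
    then obtain a where "(b, a) \<in> Nrm D" by (rule DomainE)
    from normalizer_conj(5)[OF D this] show "b \<in> normalizer S (Range \<beta>1)" by (simp only: \<beta>1(2))
  qed
  have fc': "fully_centralized S F (Domain \<beta>1)" using sat(1) \<beta>1(3) by simp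
  obtain \<beta> where \<beta>: "\<beta> \<in> \<G>" "\<beta>1 \<subseteq> \<beta>" "?L' \<subseteq> Range \<beta>" using extend_graph[OF \<beta>1(1) fc' LN' y'] by blast
  have "\<beta> O D O converse \<alpha> = \<beta>1 O D O converse \<alpha>1"
  proof
    show "\<beta>1 O D O converse \<alpha>1 \<subseteq> \<beta> O D O converse \<alpha>" using \<alpha>(2) \<beta>(2) by blast
    show "\<beta> O D O converse \<alpha> \<subseteq> \<beta>1 O D O converse \<alpha>1"
    proof
      fix z assume "z \<in> \<beta> O D O converse \<alpha>"
      then obtain x b a x' where z: "z = (x, x')" "(x, b) \<in> \<beta>" "(b, a) \<in> D" "(x', a) \<in> \<alpha>" by auto
      have "b \<in> Range \<beta>1" using z(3) \<beta>1(2) by (simp add: DomainI)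
      then obtain x1 where x1: "(x1, b) \<in> \<beta>1" by (rule RangeE)
      have "a \<in> Range \<alpha>1" using z(3) \<alpha>1(2) by (simp add: RangeI)
      then obtain x2 where x2: "(x2, a) \<in> \<alpha>1" by (rule RangeE)
      have "x1 = x" "x2 = x'" using x1 x2 z \<alpha>(2) \<beta>(2) graph_fun[OF \<alpha>(1)] graph_fun[OF \<beta>(1)] by blast+
      then show "z \<in> \<beta>1 O D O converse \<alpha>1" using z x1 x2 by blast
    qed
  qed
  also have "\<dots> = \<alpha>1 O (converse D O D) O converse \<alpha>1" by (simp only: \<beta>1_def O_assoc)
  also have "\<dots> = \<alpha>1 O converse \<alpha>1"
    using graph_converse_comp[OF D] Id_on_comp[of "converse \<alpha>1" ?Q] \<alpha>1(2) by simp
  also have "\<dots> = Id_on P" using graph_comp_converse[OF \<alpha>1(1)] \<alpha>1(3) by simp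
  finally have eq: "\<beta> O D O converse \<alpha> = Id_on P" .
  have "Nrm D \<subseteq> Range \<beta> \<times> Range \<alpha>"
  proof
    fix z assume z: "z \<in> Nrm D"
    obtain b a where "z = (b, a)" by (cases z)
    then show "z \<in> Range \<beta> \<times> Range \<alpha>"
      using z \<alpha>(3) \<beta>(3) DomainI[of b a "Nrm D"] RangeI[of b a "Nrm D"] by blast
  qed
  then show ?thesis using eq \<alpha>(1) \<beta>(1) by blast
qed

end


section \<open>Characteristic elements exist\<close>

context saturated_fusion_system
begin

definition representative :: "'a set \<Rightarrow> 'a set"
  where "representative Q = (SOME P. conjugate Q P \<and> fully_normalized S F P)"

lemma representative:
  assumes "subgroup Q S"
  shows "conjugate Q (representative Q)" "fully_normalized S F (representative Q)"
proof -
  let ?C = "{P. conjugate Q P}"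
  have "?C \<subseteq> Pow (carrier S)" using conjugate_subgroup(2) subgroup.subset by blast
  then have fin: "finite ?C" using finite_S by (meson finite_Pow_iff finite_subset)
  have ne: "?C \<noteq> {}" using conjugate_refl[OF assms] by blast
  let ?m = "Max ((\<lambda>P. card (normalizer S P)) ` ?C)"
  have "?m \<in> (\<lambda>P. card (normalizer S P)) ` ?C" using fin ne by (intro Max_in) auto
  then obtain P where P: "?m = card (normalizer S P)" "conjugate Q P" by blast
  have "fully_normalized S F P" unfolding fully_normalized_def
  proof
    fix P' assume "P' \<in> F_conjugates S F P"
    then have "conjugate Q P'"
      using F_conjugates_iff[OF conjugate_subgroup(2)[OF P(2)]] conjugate_trans[OF P(2)] by blast
    then have "card (normalizer S P') \<le> ?m" using fin by (intro Max_ge) auto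
    then show "card (normalizer S P') \<le> card (normalizer S P)" using P(1) by simp
  qed
  then have "conjugate Q (representative Q) \<and> fully_normalized S F (representative Q)"
    unfolding representative_def using P(2) by (intro someI[of "\<lambda>P. conjugate Q P \<and> fully_normalized S F P" P]) simp
  then show "conjugate Q (representative Q)" "fully_normalized S F (representative Q)" by auto
qed

lemma representative_cong:
  assumes "conjugate Q Q'" shows "representative Q = representative Q'"
proof -
  have "conjugate Q P \<longleftrightarrow> conjugate Q' P" for P
    using assms conjugate_sym conjugate_trans by blast
  then show ?thesis by (simp add: representative_def)
qed

text \<open>The isomorphisms that carry \<open>D\<close> to the identity of \<open>P\<close> carry its normalizer to a group \<open>K\<close> of the same
  order that normalizes the identity of \<open>P\<close>. In the Cauchy--Frobenius sums for the two groups, terms that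
  correspond agree by stability, except for those at \<open>D\<close> and at the identity of \<open>P\<close>. The difference of the
  sums is \<open>|D|\<close> times the difference of these two marks.\<close>

lemma mark_congruence_fully_normalized:
  assumes X: "gen X" "stable_above n X" and D: "D \<in> \<G>" "card D = n"
    and P: "fully_normalized S F P" "conjugate (Range D) P"
  shows "of_nat (card D) * (mk X (Id_on P) - mk X D) / of_nat (card (Nrm D)) \<in> R"
proof -
  let ?N = "of_nat (card (Nrm D)) :: rat"
  have Xc: "X \<in> burnside_carrier p S S" using gen_closed[OF X(1)] by (simp add: carrier_M)
  have Nsub: "subgroup (Nrm D) (S \<times>\<times> S)" using graph_subset[OF D(1)] by (intro SS.GH.HG.set_normalizer_subgroup) simp
  have Dsub: "D \<subseteq> carrier (S \<times>\<times> S)" using graph_subset[OF D(1)] by simp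
  have DN: "D \<subseteq> Nrm D" by (rule SS.GH.HG.subgroup_normalizes_self[OF graph_sub[OF D(1)]])
  obtain \<alpha> \<beta> where ab: "\<alpha> \<in> \<G>" "\<beta> \<in> \<G>" "Nrm D \<subseteq> Range \<beta> \<times> Range \<alpha>" "\<beta> O D O converse \<alpha> = Id_on P"
    using move_to_fully_normalized[OF D(1) P] by blast
  obtain f where f: "subgroup (Range \<alpha>) S" "f \<in> F (Range \<alpha>) (carrier S)" "\<alpha> = graph_subgroup (Range \<alpha>) f"
    using graphE[OF ab(1)] .
  obtain g where g: "subgroup (Range \<beta>) S" "g \<in> F (Range \<beta>) (carrier S)" "\<beta> = graph_subgroup (Range \<beta>) g"
    using graphE[OF ab(2)] .
  note mf = morphismD[OF f(1) carrier_sub f(2)] and mg = morphismD[OF g(1) carrier_sub g(2)]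
  \<comment> \<open>Transport of relations along \<open>\<alpha>\<close> and \<open>\<beta>\<close> is the image under an injective homomorphism defined on the
  normalizer.\<close>
  define \<chi> where "\<chi> z = (g (fst z), f (snd z))" for z
  have \<chi>_image: "\<beta> O Z O converse \<alpha> = \<chi> ` Z" if Z: "Z \<subseteq> Range \<beta> \<times> Range \<alpha>" for Z
  proof -
    have a: "(x, y) \<in> \<alpha> \<longleftrightarrow> y \<in> Range \<alpha> \<and> x = f y" for x y using f(3) graph_mem[of x y "Range \<alpha>" f] by simp
    have b: "(x, y) \<in> \<beta> \<longleftrightarrow> y \<in> Range \<beta> \<and> x = g y" for x y using g(3) graph_mem[of x y "Range \<beta>" g] by simp
    show ?thesis
    proof
      show "\<beta> O Z O converse \<alpha> \<subseteq> \<chi> ` Z"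
      proof
        fix z assume "z \<in> \<beta> O Z O converse \<alpha>"
        then obtain x u v y where z: "z = (x, y)" "(x, u) \<in> \<beta>" "(u, v) \<in> Z" "(y, v) \<in> \<alpha>" by auto
        then have "z = \<chi> (u, v)" using a b by (simp add: \<chi>_def)
        then show "z \<in> \<chi> ` Z" using z(3) by blast
      qed
      show "\<chi> ` Z \<subseteq> \<beta> O Z O converse \<alpha>"
      proof (rule image_subsetI)
        fix z assume z: "z \<in> Z"
        then have "z \<in> Range \<beta> \<times> Range \<alpha>" using Z by blast
        then have "fst z \<in> Range \<beta>" "snd z \<in> Range \<alpha>" by (simp_all only: mem_Times_iff)
        then have "(g (fst z), fst z) \<in> \<beta>" "(f (snd z), snd z) \<in> \<alpha>" using a b by blast+
        moreover have "(fst z, snd z) \<in> Z" using z by simp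
        ultimately show "\<chi> z \<in> \<beta> O Z O converse \<alpha>" unfolding \<chi>_def by (intro relcompI) auto
      qed
    qed
  qed
  have in_dom: "fst z \<in> Range \<beta>" "snd z \<in> Range \<alpha>" if "z \<in> Nrm D" for z
    using subsetD[OF ab(3) that] by (simp_all only: mem_Times_iff)
  have \<chi>_closed: "\<chi> z \<in> carrier (S \<times>\<times> S)" if "z \<in> Nrm D" for z
    using imageI[OF in_dom(1)[OF that], of g] imageI[OF in_dom(2)[OF that], of f] mf(4) mg(4)
    by (simp add: \<chi>_def subset_iff)
  have \<chi>_mult: "\<chi> (z \<otimes>\<^bsub>S \<times>\<times> S\<^esub> w) = \<chi> z \<otimes>\<^bsub>S \<times>\<times> S\<^esub> \<chi> w" if zw: "z \<in> Nrm D" "w \<in> Nrm D" for z w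
  proof -
    obtain z1 z2 where zz: "z = (z1, z2)" by (cases z)
    obtain w1 w2 where ww: "w = (w1, w2)" by (cases w)
    show ?thesis using in_dom[OF zw(1)] in_dom[OF zw(2)] mf(5) mg(5) by (simp add: \<chi>_def zz ww)
  qed
  have \<chi>_inj: "inj_on \<chi> (Nrm D)"
  proof (rule inj_onI)
    fix z w assume zw: "z \<in> Nrm D" "w \<in> Nrm D" "\<chi> z = \<chi> w"
    then have "fst z = fst w" "snd z = snd w"
      using in_dom[OF zw(1)] in_dom[OF zw(2)] mf(2) mg(2) by (auto simp: \<chi>_def inj_on_def)
    then show "z = w" by (rule prod_eqI)
  qed
  have \<chi>_hom: "group_hom ((S \<times>\<times> S)\<lparr>carrier := Nrm D\<rparr>) (S \<times>\<times> S) \<chi>"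
    unfolding group_hom_def group_hom_axioms_def
    using subgroup.subgroup_is_group[OF Nsub SS.GH.HG.is_group] SS.GH.HG.is_group \<chi>_closed \<chi>_mult by (simp add: hom_def)
  let ?K = "\<chi> ` Nrm D"
  have Ksub: "subgroup ?K (S \<times>\<times> S)" using group_hom.img_is_subgroup[OF \<chi>_hom] by simp
  have IdP: "Id_on P = \<chi> ` D" using \<chi>_image[OF subset_trans[OF DN ab(3)]] ab(4) by (simp only:)
  have IdPsub: "Id_on P \<subseteq> carrier (S \<times>\<times> S)" unfolding IdP using \<chi>_closed DN by blast
  have \<chi>_inv: "inv\<^bsub>S \<times>\<times> S\<^esub> \<chi> z = \<chi> (inv\<^bsub>S \<times>\<times> S\<^esub> z)" if z: "z \<in> Nrm D" for z
    using group_hom.hom_inv[OF \<chi>_hom, of z] z SS.GH.HG.m_inv_consistent[OF Nsub z] by simp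
  have Kconj: "cs k (Id_on P) = Id_on P" if k: "k \<in> ?K" for k
  proof -
    obtain z where z: "z \<in> Nrm D" "k = \<chi> z" using k by blast
    have zi: "inv\<^bsub>S \<times>\<times> S\<^esub> z \<in> Nrm D" by (rule subgroup.m_inv_closed[OF Nsub z(1)])
    have "cs k (Id_on P) = (\<lambda>d. \<chi> (z \<otimes>\<^bsub>S \<times>\<times> S\<^esub> d \<otimes>\<^bsub>S \<times>\<times> S\<^esub> inv\<^bsub>S \<times>\<times> S\<^esub> z)) ` D"
      unfolding conj_set_def IdP image_image z(2) \<chi>_inv[OF z(1)]
    proof (rule image_cong[OF refl])
      fix d assume "d \<in> D"
      then have d: "d \<in> Nrm D" using DN by blast
      show "\<chi> z \<otimes>\<^bsub>S \<times>\<times> S\<^esub> \<chi> d \<otimes>\<^bsub>S \<times>\<times> S\<^esub> \<chi> (inv\<^bsub>S \<times>\<times> S\<^esub> z) = \<chi> (z \<otimes>\<^bsub>S \<times>\<times> S\<^esub> d \<otimes>\<^bsub>S \<times>\<times> S\<^esub> inv\<^bsub>S \<times>\<times> S\<^esub> z)"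
        by (simp only: \<chi>_mult[OF z(1) d] \<chi>_mult[OF subgroup.m_closed[OF Nsub z(1) d] zi])
    qed
    also have "\<dots> = \<chi> ` cs z D" by (simp only: conj_set_def image_image)
    also have "cs z D = D" using z(1) by (simp add: set_normalizer_def)
    finally show ?thesis by (simp only: IdP)
  qed
  have 1: "(\<Sum>k\<in>Nrm D. mk X (insert k D)) / ?N \<in> R"
    by (rule SS.GH.burnside_congruence[OF Xc Nsub Dsub]) (simp add: set_normalizer_def)
  have "(\<Sum>k\<in>?K. mk X (insert k (Id_on P))) / of_nat (card ?K) \<in> R"
    by (rule SS.GH.burnside_congruence[OF Xc Ksub IdPsub Kconj])
  moreover have "(\<Sum>k\<in>?K. mk X (insert k (Id_on P))) = (\<Sum>k\<in>Nrm D. mk X (\<chi> ` insert k D))"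
    by (subst sum.reindex[OF \<chi>_inj]) (simp add: IdP)
  moreover have "card ?K = card (Nrm D)" by (rule card_image[OF \<chi>_inj])
  ultimately have 2: "(\<Sum>k\<in>Nrm D. mk X (\<chi> ` insert k D)) / ?N \<in> R" by simp
  \<comment> \<open>A graph that contains \<open>D\<close> and \<open>k\<close> is larger than \<open>D\<close>, so stability above \<open>n\<close> applies to it.\<close>
  have 3: "mk X (\<chi> ` insert k D) = mk X (insert k D)" if k: "k \<in> Nrm D - D" for k
  proof -
    have sub: "insert k D \<subseteq> Range \<beta> \<times> Range \<alpha>" using k DN ab(3) by blast
    have "n < card E" if E: "E \<in> \<G>" "insert k D \<subseteq> E" for E
    proof -
      have "D \<subset> E" using E(2) k by blast
      then show ?thesis using psubset_card_mono[OF finite_graph[OF E(1)]] D(2) by blast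
    qed
    then show ?thesis using mark_transport[OF X ab(1,2) sub] \<chi>_image[OF sub] by simp
  qed
  have "of_nat (card D) * (mk X (Id_on P) - mk X D) / ?N =
      (\<Sum>k\<in>Nrm D. mk X (\<chi> ` insert k D)) / ?N - (\<Sum>k\<in>Nrm D. mk X (insert k D)) / ?N"
  proof -
    have "(\<Sum>k\<in>Nrm D - D. mk X (\<chi> ` insert k D)) = (\<Sum>k\<in>Nrm D - D. mk X (insert k D))"
      using 3 by (rule sum.cong[OF refl])
    then show ?thesis
      using normalizer_sum_split[OF D(1), of "mk X"] normalizer_sum_split[OF D(1), of "\<lambda>Z. mk X (\<chi> ` Z)"]
      by (simp add: IdP right_diff_distrib diff_divide_distrib add_divide_distrib)
  qed
  then show ?thesis using Z_loc_diff[OF prime_p 2 1] by simp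
qed

lemma representative_conj:
  assumes "D \<in> \<G>" "z \<in> carrier (S \<times>\<times> S)"
  shows "representative (Range (cs z D)) = representative (Range D)"
proof -
  obtain s t where st: "z = (s, t)" "s \<in> carrier S" "t \<in> carrier S" using assms(2) by auto
  show ?thesis unfolding st(1) Range_conj[OF assms(1) st(2,3)]
    by (rule representative_cong[OF conjugate_translate[OF Range_sub[OF assms(1)] st(3)], symmetric])
qed

lemma stabilize_level:
  assumes X: "gen X" "stable_above (Suc n) X"
  obtains Y where "gen Y" "stable_above n Y" "\<forall>D\<in>\<G>. Suc n < card D \<longrightarrow> mk Y D = mk X D"
    "\<forall>D\<in>\<G>. card D = Suc n \<longrightarrow> mk Y D = mk X (Id_on (representative (Range D)))"
proof -
  let ?w = "\<lambda>D. mk X (Id_on (representative (Range D)))"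
  have inv: "?w (cs z D) = ?w D" if "D \<in> \<G>" "z \<in> carrier (S \<times>\<times> S)" for D z
    by (simp only: representative_conj[OF that])
  have dvd: "of_nat (card D) * (?w D - mk X D) / of_nat (card (Nrm D)) \<in> R" if D: "D \<in> \<G>" "card D = Suc n" for D
    by (rule mark_congruence_fully_normalized[OF X D representative(2)[OF Range_sub[OF D(1)]] representative(1)[OF Range_sub[OF D(1)]]])
  obtain Y where Y: "gen Y" "\<forall>D\<in>\<G>. Suc n < card D \<longrightarrow> mk Y D = mk X D" "\<forall>D\<in>\<G>. card D = Suc n \<longrightarrow> mk Y D = ?w D"
    using adjust_level[OF X(1), of ?w "Suc n", OF inv dvd] .
  have "stable_above n Y" unfolding stable_above_def
  proof (intro ballI impI)
    fix D D' assume D: "D \<in> \<G>" "D' \<in> \<G>" and c: "n < card D \<and> conjugate (Range D) (Range D')"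
    then have eq: "card D' = card D"
      using conjugate_card[of "Range D" "Range D'"] card_graph[OF D(1)] card_graph[OF D(2)] by simp
    show "mk Y D = mk Y D'"
    proof (cases "card D = Suc n")
      case True
      then have "mk Y D = ?w D" "mk Y D' = ?w D'" using Y(3) D eq by simp_all
      then show ?thesis using representative_cong[of "Range D" "Range D'"] c by simp
    next
      case False
      then have "Suc n < card D" using c by simp
      then have "mk Y D = mk X D" "mk Y D' = mk X D'" "mk X D = mk X D'"
        using Y(2) D eq X(2) c unfolding stable_above_def by simp_all
      then show ?thesis by simp
    qed
  qed
  then show thesis by (intro that[OF Y(1) _ Y(2,3)])
qed

lemma stabilize:
  "gen X \<Longrightarrow> stable_above n X \<Longrightarrow> \<exists>Y. gen Y \<and> stable_above 0 Y \<and> (\<forall>D\<in>\<G>. n < card D \<longrightarrow> mk Y D = mk X D)"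
proof (induction n arbitrary: X)
  case 0
  then show ?case by blast
next
  case (Suc n)
  obtain Y where Y: "gen Y" "stable_above n Y" "\<forall>D\<in>\<G>. Suc n < card D \<longrightarrow> mk Y D = mk X D"
    "\<forall>D\<in>\<G>. card D = Suc n \<longrightarrow> mk Y D = mk X (Id_on (representative (Range D)))"
    using stabilize_level[OF Suc.prems] .
  obtain W where W: "gen W" "stable_above 0 W" "\<forall>D\<in>\<G>. n < card D \<longrightarrow> mk W D = mk Y D"
    using Suc.IH[OF Y(1,2)] by blast
  have "mk W D = mk X D" if "D \<in> \<G>" "Suc n < card D" for D
    using that Y(3) W(3) by simp
  then show ?case using W(1,2) by blast
qed

text \<open>A point of a transitive biset is fixed by \<open>Z\<close> iff the corresponding conjugate of \<open>D\<close> contains \<open>Z\<close>.\<close>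

lemma mk_tclass:
  assumes "D \<in> \<G>"
  shows "mk (tclass D) Z = of_nat (card {z \<in> carrier (S \<times>\<times> S). Z \<subseteq> cs z D}) / of_nat (card D)"
proof -
  have "mk (tclass D) Z = (\<Sum>B\<in>Pow (carrier S \<times> carrier S). cc (tclass D) B * (if Z \<subseteq> B then 1 else 0))"
    unfolding mark_def by (rule sum.mono_neutral_cong_left) (use finite_S in auto)
  also have "\<dots> = (\<Sum>z\<in>carrier (S \<times>\<times> S). if Z \<subseteq> cs z D then 1 else 0) / of_nat (card D)"
    by (rule sum_tclass[OF assms])
  finally show ?thesis using SS.GH.fin_HG by (simp add: sum.If_cases Int_def)
qed

text \<open>For a biset \<open>X\<close> that is free on the left, this is the number of left orbits fixed by \<open>Q\<close>, in other words
  the marks of the right \<open>S\<close>-set of left \<open>S\<close>-orbits: if \<open>S x\<close> is fixed, then the elements \<open>h\<close> with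
  \<open>x q = h x\<close> define the unique homomorphism on \<open>Q\<close> whose graph is contained in the stabilizer of \<open>x\<close>, and a
  left orbit has \<open>|S|\<close> points.\<close>

definition m :: "('a, 'a) formal set \<Rightarrow> 'a set \<Rightarrow> rat"
  where "m X Q = (\<Sum>E\<in>homs Q. mk X E) / of_nat (card (carrier S))"

definition conjugators :: "'a set \<Rightarrow> 'a set \<Rightarrow> 'a set"
  where "conjugators Q P = {t \<in> carrier S. \<forall>q\<in>Q. t \<otimes> q \<otimes> inv t \<in> P}"

lemma unique_restriction:
  assumes "A \<in> \<G>" "subgroup Q S"
  shows "card {E \<in> homs Q. E \<subseteq> A} = (if Q \<subseteq> Range A then 1 else 0)"
proof -
  have r: "Range (A O Id_on Q) = Q" if "Q \<subseteq> Range A" using that by (subst Range_comp) auto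
  have "{E \<in> homs Q. E \<subseteq> A} = (if Q \<subseteq> Range A then {A O Id_on Q} else {})"
  proof (cases "Q \<subseteq> Range A")
    case True
    have "E = A O Id_on Q" if E: "E \<in> homs Q" "E \<subseteq> A" for E
    proof
      have EG: "E \<in> \<G>" "Range E = Q" using E by (auto simp: homs_def)
      show "E \<subseteq> A O Id_on Q"
      proof
        fix z assume z: "z \<in> E"
        obtain e q where eq: "z = (e, q)" by (cases z)
        then have "q \<in> Q" using RangeI[of e q E] z EG(2) by simp
        then show "z \<in> A O Id_on Q" using z E(2) eq by auto
      qed
      show "A O Id_on Q \<subseteq> E"
      proof
        fix z assume "z \<in> A O Id_on Q"
        then obtain e q where z: "z = (e, q)" "(e, q) \<in> A" "q \<in> Q" by auto
        then have "q \<in> Range E" using EG(2) by simp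
        then obtain e' where e': "(e', q) \<in> E" by (rule RangeE)
        then have "e' = e" using graph_fun[OF assms(1)] E(2) z(2) by blast
        then show "z \<in> E" using e' z(1) by simp
      qed
    qed
    moreover have "A O Id_on Q \<in> homs Q" using graph_restrict[OF assms] r[OF True] by (simp add: homs_def)
    moreover have "A O Id_on Q \<subseteq> A" by auto
    ultimately have "{E \<in> homs Q. E \<subseteq> A} = {A O Id_on Q}" by blast
    then show ?thesis using True by (simp only: if_True)
  next
    case False
    have "{E \<in> homs Q. E \<subseteq> A} = {}"
    proof (rule ccontr)
      assume "{E \<in> homs Q. E \<subseteq> A} \<noteq> {}"
      then obtain E where "Range E = Q" "E \<subseteq> A" by (auto simp: homs_def)
      then show False using False Range_mono[of E A] by simp
    qed
    then show ?thesis using False by (simp only: if_False)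
  qed
  then show ?thesis by simp
qed

text \<open>The left orbits of \<open>[P,\<phi>]\<close> form the right \<open>S\<close>-set of the right cosets of \<open>P\<close>.\<close>

lemma m_tclass:
  assumes "D \<in> \<G>" "subgroup Q S"
  shows "m (tclass D) Q = of_nat (card (conjugators Q (Range D))) / of_nat (card (Range D))"
proof -
  let ?s = "of_nat (card (carrier S)) :: rat" and ?C = "carrier (S \<times>\<times> S)"
  have Qsub: "Q \<subseteq> carrier S" by (rule subgroup.subset[OF assms(2)])
  have Rsub: "Range D \<subseteq> carrier S" by (rule subgroup.subset[OF Range_sub[OF assms(1)]])
  have "(\<Sum>E\<in>homs Q. mk (tclass D) E) =
      (\<Sum>E\<in>homs Q. \<Sum>z\<in>?C. if E \<subseteq> cs z D then 1 else 0) / of_nat (card D)"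
    using SS.GH.fin_HG by (simp add: mk_tclass[OF assms(1)] sum.If_cases Int_def sum_divide_distrib del: carrier_DirProd)
  also have "(\<Sum>E\<in>homs Q. \<Sum>z\<in>?C. if E \<subseteq> cs z D then 1 else 0 :: rat) =
      (\<Sum>z\<in>?C. \<Sum>E\<in>homs Q. if E \<subseteq> cs z D then 1 else 0)" by (rule sum.swap)
  also have "\<dots> = (\<Sum>z\<in>?C. if snd z \<in> m_inv S ` conjugators Q (Range D) \<inter> carrier S then 1 else 0)"
  proof (rule sum.cong[OF refl])
    fix z assume z: "z \<in> ?C"
    then obtain s t where st: "z = (s, t)" "s \<in> carrier S" "t \<in> carrier S" by auto
    have "(\<Sum>E\<in>homs Q. if E \<subseteq> cs z D then 1 else 0 :: rat) = of_nat (card {E \<in> homs Q. E \<subseteq> cs z D})"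
      using finite_homs by (simp add: sum.If_cases Int_def)
    also have "\<dots> = (if Q \<subseteq> Range (cs z D) then 1 else 0)"
      by (simp add: unique_restriction[OF graph_conj[OF assms(1) z] assms(2)])
    also have "Q \<subseteq> Range (cs z D) \<longleftrightarrow> inv t \<in> conjugators Q (Range D)"
    proof -
      have "q \<in> (\<lambda>x. t \<otimes> x \<otimes> inv t) ` Range D \<longleftrightarrow> inv t \<otimes> q \<otimes> inv (inv t) \<in> Range D" if q: "q \<in> Q" for q
      proof
        assume "q \<in> (\<lambda>x. t \<otimes> x \<otimes> inv t) ` Range D"
        then obtain x where x: "x \<in> Range D" "q = t \<otimes> x \<otimes> inv t" by blast
        then have "inv t \<otimes> q \<otimes> inv (inv t) = x"
          using st Rsub by (simp add: m_assoc subset_iff) (simp add: m_assoc[symmetric])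
        then show "inv t \<otimes> q \<otimes> inv (inv t) \<in> Range D" using x by simp
      next
        assume r: "inv t \<otimes> q \<otimes> inv (inv t) \<in> Range D"
        have "q = t \<otimes> (inv t \<otimes> q \<otimes> inv (inv t)) \<otimes> inv t"
          using st q Qsub by (simp add: m_assoc subset_iff) (simp add: m_assoc[symmetric])
        then show "q \<in> (\<lambda>x. t \<otimes> x \<otimes> inv t) ` Range D" using r by blast
      qed
      then have "Q \<subseteq> (\<lambda>x. t \<otimes> x \<otimes> inv t) ` Range D \<longleftrightarrow> (\<forall>q\<in>Q. inv t \<otimes> q \<otimes> inv (inv t) \<in> Range D)"
        by blast
      then show ?thesis
        unfolding st(1) Range_conj[OF assms(1) st(2,3)] conjugators_def
        by (simp only: mem_Collect_eq inv_closed[OF st(3)] simp_thms)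
    qed
    also have "inv t \<in> conjugators Q (Range D) \<longleftrightarrow> snd z \<in> m_inv S ` conjugators Q (Range D) \<inter> carrier S"
      using st by (auto simp: conjugators_def image_iff)
    finally show "(\<Sum>E\<in>homs Q. if E \<subseteq> cs z D then 1 else 0 :: rat) =
        (if snd z \<in> m_inv S ` conjugators Q (Range D) \<inter> carrier S then 1 else 0)" by (simp only:)
  qed
  also have "\<dots> = ?s * of_nat (card (conjugators Q (Range D)))"
  proof -
    have "{z \<in> ?C. snd z \<in> m_inv S ` conjugators Q (Range D) \<inter> carrier S} = carrier S \<times> m_inv S ` conjugators Q (Range D)"
      by (auto simp: conjugators_def)
    moreover have "card (m_inv S ` conjugators Q (Range D)) = card (conjugators Q (Range D))"
      by (rule card_image) (auto simp: conjugators_def inj_on_def)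
    moreover have "(\<Sum>z\<in>?C. if snd z \<in> m_inv S ` conjugators Q (Range D) \<inter> carrier S then 1 else 0 :: rat) =
        of_nat (card {z \<in> ?C. snd z \<in> m_inv S ` conjugators Q (Range D) \<inter> carrier S})"
      using SS.GH.fin_HG by (simp add: sum.If_cases Int_def del: carrier_DirProd)
    ultimately show ?thesis by (simp add: card_cartesian_product del: carrier_DirProd)
  qed
  finally show ?thesis
    using finite_S one_closed by (auto simp: m_def card_graph[OF assms(1)])
qed

text \<open>Fixed points of the \<open>p\<close>-group \<open>Q\<close> on the cosets of \<open>P\<close>: their number is congruent to the index of \<open>P\<close>,
  a power of \<open>p\<close>.\<close>

lemma conjugators_cong:
  assumes "subgroup P S" "subgroup Q S"
  shows "\<exists>k. card (conjugators Q P) = card P * k \<and> [k = (if P = carrier S then 1 else 0)] (mod p)"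
proof -
  have Qsub: "Q \<subseteq> carrier S" by (rule subgroup.subset[OF assms(2)])
  obtain n where n: "card (carrier (S\<lparr>carrier := Q\<rparr>)) = p ^ n" using p_subgroup_card[OF assms(2)] by auto
  have id: "(\<lambda>x. x) \<in> hom (S\<lparr>carrier := Q\<rparr>) S" using Qsub by (auto simp: hom_def)
  obtain k where k: "card {g \<in> carrier S. \<forall>a\<in>carrier (S\<lparr>carrier := Q\<rparr>). g \<otimes> a \<otimes> inv g \<in> P} = card P * k"
    "[card (rcosets P) = k] (mod p)"
    using card_conjugators[OF is_group finite_S assms(1) prime_p subgroup.subgroup_is_group[OF assms(2) is_group] n id] .
  have lag: "card (rcosets P) * card P = card (carrier S)" using lagrange[OF assms(1)] by (simp add: order_def)
  have P0: "card P > 0" using subgroup.one_closed[OF assms(1)] finite_subset[OF subgroup.subset[OF assms(1)] finite_S]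
    by (auto simp: card_gt_0_iff)
  have "[card (rcosets P) = (if P = carrier S then 1 else 0)] (mod p)"
  proof (cases "P = carrier S")
    case True
    then have "card (rcosets P) = 1" using lag P0 by simp
    then show ?thesis using True by simp
  next
    case False
    obtain e where "order S = p ^ e" using p_group by (auto simp: finite_p_group_def)
    then have "card (rcosets P) dvd p ^ e" using lag by (metis dvd_triv_left order_def)
    then obtain j where j: "card (rcosets P) = p ^ j" using divides_primepow_nat[OF prime_p] by blast
    have "j \<noteq> 0"
    proof
      assume "j = 0"
      then have "card P = card (carrier S)" using lag j by simp
      then have "P = carrier S" by (rule card_subset_eq[OF finite_S subgroup.subset[OF assms(1)]])
      then show False using False by blast
    qed
    then have "p dvd card (rcosets P)" using j by simp
    then show ?thesis using False by (simp add: cong_def dvd_eq_mod_eq_0)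
  qed
  then have "[k = (if P = carrier S then 1 else 0)] (mod p)" using k(2) cong_sym cong_trans by blast
  moreover have "card (conjugators Q P) = card P * k" using k(1) by (simp add: conjugators_def)
  ultimately show ?thesis by blast
qed

lemma m_tclass_cong:
  assumes "D \<in> \<G>" "subgroup Q S"
  shows "m (tclass D) Q \<in> R" "(m (tclass D) Q - m (tclass D) (carrier S)) / of_nat p \<in> R"
proof -
  let ?P = "Range D"
  have P: "subgroup ?P S" by (rule Range_sub[OF assms(1)])
  have P0: "card ?P > 0" using card_graph_pos[OF assms(1)] card_graph[OF assms(1)] by simp
  have val: "\<exists>k. m (tclass D) Q = of_nat k \<and> [k = (if ?P = carrier S then 1 else 0)] (mod p)" if Q: "subgroup Q S" for Q
  proof -
    obtain k where k: "card (conjugators Q ?P) = card ?P * k" "[k = (if ?P = carrier S then 1 else 0)] (mod p)"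
      using conjugators_cong[OF P Q] by blast
    have "m (tclass D) Q = of_nat k" using m_tclass[OF assms(1) Q] k(1) P0 by simp
    then show ?thesis using k(2) by blast
  qed
  obtain k where k: "m (tclass D) Q = of_nat k" "[k = (if ?P = carrier S then 1 else 0)] (mod p)"
    using val[OF assms(2)] by blast
  obtain k' where k': "m (tclass D) (carrier S) = of_nat k'" "[k' = (if ?P = carrier S then 1 else 0)] (mod p)"
    using val[OF carrier_sub] by blast
  show "m (tclass D) Q \<in> R" using Z_loc_of_nat[OF prime_p, of k] k(1) by simp
  have "[k = k'] (mod p)" using cong_trans[OF k(2) cong_sym[OF k'(2)]] .
  then have "[int k = int k'] (mod int p)" by (simp add: cong_int_iff)
  then obtain j where j: "int k - int k' = int p * j" by (auto simp: cong_iff_dvd_diff elim: dvdE)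
  have "m (tclass D) Q - m (tclass D) (carrier S) = of_int (int k - int k')" using k(1) k'(1) by simp
  also have "\<dots> = of_nat p * of_int j" unfolding j by simp
  finally have "(m (tclass D) Q - m (tclass D) (carrier S)) / of_nat p = of_int j"
    using prime_gt_0_nat[OF prime_p] by simp
  then show "(m (tclass D) Q - m (tclass D) (carrier S)) / of_nat p \<in> R" using Z_loc_of_int[OF prime_p] by simp
qed

lemma gen_expand:
  assumes "gen X"
  obtains B c where "finite B" "B \<subseteq> tclass ` \<G>" "c \<in> B \<rightarrow> R" "X = finsum M (\<lambda>b. c b \<odot>\<^bsub>M\<^esub> b) B"
    "\<forall>Z. mk X Z = (\<Sum>b\<in>B. c b * mk b Z)"
proof -
  obtain c B where B: "finite B" "B \<subseteq> tclass ` \<G>" "c \<in> B \<rightarrow> R" "X = finsum M (\<lambda>b. c b \<odot>\<^bsub>M\<^esub> b) B"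
    using assms unfolding F_generated_def generators_eq mod_span_def by blast
  have bM: "b \<in> carrier M" if "b \<in> B" for b using that B(2) tclass_closed by blast
  have cl: "(\<lambda>b. c b \<odot>\<^bsub>M\<^esub> b) \<in> B \<rightarrow> carrier M" using B(3) bM by (auto intro!: smult_closed)
  have "mk X Z = (\<Sum>b\<in>B. c b * mk b Z)" for Z
    unfolding B(4) mk_finsum[OF cl B(1)] using B(3) bM by (intro sum.cong refl mk_smult) auto
  then show thesis using that B by blast
qed

lemma m_expand:
  assumes "\<forall>Z. mk X Z = (\<Sum>b\<in>B. c b * mk b Z)"
  shows "m X Q = (\<Sum>b\<in>B. c b * m b Q)"
proof -
  have "(\<Sum>E\<in>homs Q. mk X E) = (\<Sum>b\<in>B. c b * (\<Sum>E\<in>homs Q. mk b E))"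
    unfolding assms[rule_format] sum_distrib_left by (rule sum.swap)
  then show ?thesis by (simp only: m_def times_divide_eq_right sum_divide_distrib[symmetric])
qed

text \<open>By linearity it suffices to consider generators.\<close>

lemma m_cong:
  assumes "gen X" "subgroup Q S"
  shows "m X Q \<in> R" "(m X Q - m X (carrier S)) / of_nat p \<in> R"
proof -
  obtain B c where B0: "finite B" "B \<subseteq> tclass ` \<G>" "c \<in> B \<rightarrow> R" "X = finsum M (\<lambda>b. c b \<odot>\<^bsub>M\<^esub> b) B"
    "\<forall>Z. mk X Z = (\<Sum>b\<in>B. c b * mk b Z)"
    using gen_expand[OF assms(1)] .
  note B = B0(2,3,5)
  have b: "m b Q \<in> R" "(m b Q - m b (carrier S)) / of_nat p \<in> R" if "b \<in> B" for b
  proof -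
    obtain D where D: "D \<in> \<G>" "b = tclass D" using \<open>b \<in> B\<close> B(1) by blast
    show "m b Q \<in> R" "(m b Q - m b (carrier S)) / of_nat p \<in> R"
      unfolding D(2) by (rule m_tclass_cong[OF D(1) assms(2)])+
  qed
  have c: "c b \<in> R" if "b \<in> B" for b using that B(2) by blast
  show "m X Q \<in> R" unfolding m_expand[OF B(3)]
    by (intro Z_loc_sum[OF prime_p] Z_loc_mult[OF prime_p] b c)
  have "(m X Q - m X (carrier S)) / of_nat p = (\<Sum>b\<in>B. c b * ((m b Q - m b (carrier S)) / of_nat p))"
    unfolding m_expand[OF B(3)] by (simp add: sum_subtractf sum_divide_distrib right_diff_distrib diff_divide_distrib)
  also have "\<dots> \<in> R" by (intro Z_loc_sum[OF prime_p] Z_loc_mult[OF prime_p] b c)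
  finally show "(m X Q - m X (carrier S)) / of_nat p \<in> R" .
qed

lemma stable_markD:
  assumes "stable_above 0 X" "D \<in> \<G>" "D' \<in> \<G>" "conjugate (Range D) (Range D')"
  shows "mk X D = mk X D'"
  using assms(1) card_graph_pos[OF assms(2)] assms(2-4) unfolding stable_above_def by simp

text \<open>The marks of a stable element at all graphs with source \<open>Q\<close> are equal, so they are recovered from their
  sum.\<close>

lemma stable_mark:
  assumes "stable_above 0 X" "D \<in> \<G>"
  shows "mk X D = of_nat (card (carrier S)) / of_nat (card (homs (Range D))) * m X (Range D)"
proof -
  have "mk X E = mk X D" if E: "E \<in> homs (Range D)" for E
  proof -
    have EG: "E \<in> \<G>" "Range E = Range D" using E by (simp_all add: homs_def)
    show ?thesis
      by (rule stable_markD[OF assms(1) EG(1) assms(2)]) (simp only: EG(2) conjugate_refl[OF Range_sub[OF assms(2)]])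
  qed
  then have "(\<Sum>E\<in>homs (Range D). mk X E) = of_nat (card (homs (Range D))) * mk X D" by simp
  moreover have "card (carrier S) > 0" using finite_S one_closed by (auto simp: card_gt_0_iff)
  ultimately show ?thesis using homs_pos[OF Range_sub[OF assms(2)]] by (simp add: m_def)
qed

lemma m_stable:
  assumes "subgroup Q S" "\<And>D. D \<in> \<G> \<Longrightarrow> Range D = Q \<Longrightarrow> mk X D = c"
  shows "m X Q = of_nat (card (homs Q)) / of_nat (card (carrier S)) * c"
proof -
  have "(\<Sum>E\<in>homs Q. mk X E) = (\<Sum>E\<in>homs Q. c)" using assms(2) by (intro sum.cong) (auto simp: homs_def)
  then show ?thesis by (simp add: m_def)
qed

lemma m_conjugate:
  assumes "stable_above 0 X" "conjugate P Q" shows "m X P = m X Q"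
proof -
  have P: "subgroup P S" and Q: "subgroup Q S" using conjugate_subgroup[OF assms(2)] by auto
  have "mk X (Id_on P) = mk X (Id_on Q)"
    by (rule stable_markD[OF assms(1) Id_on_graph[OF P] Id_on_graph[OF Q]]) (simp add: assms(2))
  then show ?thesis
    using stable_mark[OF assms(1) Id_on_graph[OF P]] stable_mark[OF assms(1) Id_on_graph[OF Q]]
      homs_conjugate[OF assms(2)] homs_pos[OF Q] finite_S one_closed by (auto simp: card_gt_0_iff)
qed

text \<open>In the sum over factorizations of \<open>D\<close> the first factor has a source conjugate to that of \<open>D\<close>, so by
  stability its mark can be taken out of the sum.\<close>

lemma mark_mult_stable:
  assumes "gen a" "stable_above 0 a" "gen b" "D \<in> \<G>"
  shows "mk (a \<otimes>\<^bsub>M\<^esub> b) D = mk a D * m b (Range D)"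
proof -
  have "mk a (D O converse E) = mk a D" if E: "E \<in> homs (Range D)" for E
  proof -
    have EG: "E \<in> \<G>" "Range E = Range D" using E by (auto simp: homs_def)
    have G: "D O converse E \<in> \<G>" by (intro graph_comp graph_converse assms(4) EG(1))
    have "Range (D O converse E) = Domain E"
    proof -
      have "Range (D O converse E) = Domain (converse (D O converse E))" by simp
      also have "converse (D O converse E) = E O converse D" by (simp only: converse_relcomp converse_converse)
      also have "Domain (E O converse D) = Domain E" using EG(2) by (subst Domain_comp) auto
      finally show ?thesis .
    qed
    then have "conjugate (Range D) (Range (D O converse E))" using graph_conjugate[OF EG(1)] EG(2) by simp
    from stable_markD[OF assms(2,4) G this] show ?thesis by simp
  qed
  then have "(\<Sum>E\<in>homs (Range D). mk a (D O converse E) * mk b E) = mk a D * (\<Sum>E\<in>homs (Range D). mk b E)"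
    by (simp add: sum_distrib_left)
  then show ?thesis by (simp add: mark_mult[OF assms(1,3,4)] m_def)
qed

lemma m_mult:
  assumes "gen a" "stable_above 0 a" "gen b"
  shows "m (a \<otimes>\<^bsub>M\<^esub> b) Q = m a Q * m b Q"
proof -
  have "(\<Sum>E\<in>homs Q. mk (a \<otimes>\<^bsub>M\<^esub> b) E) = (\<Sum>E\<in>homs Q. mk a E * m b Q)"
    using mark_mult_stable[OF assms] by (intro sum.cong) (auto simp: homs_def)
  also have "\<dots> = (\<Sum>E\<in>homs Q. mk a E) * m b Q" by (simp only: sum_distrib_right)
  finally show ?thesis by (simp add: m_def[of "a \<otimes>\<^bsub>M\<^esub> b"] m_def[of a])
qed

lemma stable_mult:
  assumes "gen a" "stable_above 0 a" "gen b" "stable_above 0 b"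
  shows "stable_above 0 (a \<otimes>\<^bsub>M\<^esub> b)"
  unfolding stable_above_def
proof (intro ballI impI)
  fix D D' assume D: "D \<in> \<G>" "D' \<in> \<G>" and c: "0 < card D \<and> conjugate (Range D) (Range D')"
  have "mk a D = mk a D'" using stable_markD[OF assms(2) D] c by blast
  moreover have "m b (Range D) = m b (Range D')" using m_conjugate[OF assms(4)] c by blast
  ultimately show "mk (a \<otimes>\<^bsub>M\<^esub> b) D = mk (a \<otimes>\<^bsub>M\<^esub> b) D'"
    using mark_mult_stable[OF assms(1-3)] D by simp
qed

end


section \<open>The characteristic idempotent\<close>

lemma not_in_Z_loc: assumes "prime p" shows "1 / of_nat p \<notin> carrier (Z_loc p)"
proof
  assume "1 / of_nat p \<in> carrier (Z_loc p)"
  then obtain a b where ab: "1 / of_nat p = (of_int a / of_int b :: rat)" "\<not> int p dvd b"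
    by (auto simp: Z_loc_iff)
  have p0: "(of_nat p :: rat) \<noteq> 0" using prime_gt_0_nat[OF assms] by simp
  have "b \<noteq> 0" using ab(2) by auto
  then have "(of_int b :: rat) = of_int (int p * a)" using ab(1) p0 by (simp add: field_simps)
  then have "b = int p * a" by (simp only: of_int_eq_iff)
  then show False using ab(2) by simp
qed

lemma Units_Z_loc_iff:
  assumes "prime p" "x \<in> carrier (Z_loc p)"
  shows "x \<in> Units (Z_loc p) \<longleftrightarrow> x / of_nat p \<notin> carrier (Z_loc p)"
proof -
  have U: "x \<in> Units (Z_loc p) \<longleftrightarrow> (\<exists>y\<in>carrier (Z_loc p). y * x = 1)"
    using assms(2) by (auto simp: Units_def Z_loc_def mult.commute)
  have p0: "(of_nat p :: rat) \<noteq> 0" using prime_gt_0_nat[OF assms(1)] by simp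
  show ?thesis
  proof
    assume "x \<in> Units (Z_loc p)"
    then obtain y where y: "y \<in> carrier (Z_loc p)" "y * x = 1" using U by blast
    show "x / of_nat p \<notin> carrier (Z_loc p)"
    proof
      assume "x / of_nat p \<in> carrier (Z_loc p)"
      from Z_loc_mult[OF assms(1) y(1) this] have "1 / of_nat p \<in> carrier (Z_loc p)" using y(2) by simp
      then show False using not_in_Z_loc[OF assms(1)] by blast
    qed
  next
    assume n: "x / of_nat p \<notin> carrier (Z_loc p)"
    obtain a b where ab: "x = of_int a / of_int b" "\<not> int p dvd b" using assms(2) by (auto simp: Z_loc_iff)
    have b0: "b \<noteq> 0" using ab(2) by auto
    have na: "\<not> int p dvd a"
    proof
      assume "int p dvd a"
      then obtain k where "a = int p * k" by (rule dvdE)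
      then have "x / of_nat p = of_int k / of_int b" using ab(1) p0 by simp
      then show False using n ab(2) unfolding Z_loc_iff by blast
    qed
    then have "a \<noteq> 0" by auto
    then have "of_int b / of_int a * x = 1" using ab(1) b0 by simp
    moreover have "of_int b / of_int a \<in> carrier (Z_loc p)" using na unfolding Z_loc_iff by blast
    ultimately show "x \<in> Units (Z_loc p)" using U by blast
  qed
qed

lemma Units_Z_loc_cong:
  assumes "prime p" "x \<in> carrier (Z_loc p)" "y \<in> carrier (Z_loc p)" "(x - y) / of_nat p \<in> carrier (Z_loc p)"
  shows "x \<in> Units (Z_loc p) \<longleftrightarrow> y \<in> Units (Z_loc p)"
proof -
  have 1: "x / of_nat p \<in> carrier (Z_loc p)" if "y / of_nat p \<in> carrier (Z_loc p)"
    using Z_loc_add[OF assms(1) assms(4) that] by (simp add: add_divide_distrib[symmetric])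
  have 2: "y / of_nat p \<in> carrier (Z_loc p)" if "x / of_nat p \<in> carrier (Z_loc p)"
    using Z_loc_diff[OF assms(1) that assms(4)] by (simp add: diff_divide_distrib[symmetric])
  show ?thesis using 1 2 by (auto simp: Units_Z_loc_iff[OF assms(1)] assms(2,3))
qed

text \<open>The \<open>p\<close>-adic valuation of \<open>n\<close> is less than \<open>n\<close>, as \<open>p\<^sup>a > a\<close>.\<close>

lemma power_div_in_Z_loc:
  assumes "prime p" "0 < n" "n \<le> k"
  shows "of_nat (p ^ k) / of_nat n \<in> carrier (Z_loc p)"
proof -
  have n0: "n \<noteq> 0" using assms(2) by simp
  have np: "\<not> is_unit p" using prime_gt_1_nat[OF assms(1)] by simp
  obtain u where u: "n = p ^ multiplicity p n * u" "\<not> p dvd u"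
    using multiplicity_decompose'[of n p] n0 np by metis
  let ?a = "multiplicity p n"
  have u0: "u \<noteq> 0" using u assms(2) by (metis mult_0_right less_irrefl)
  have p1: "1 < p" using prime_gt_1_nat[OF assms(1)] .
  have "?a < p ^ ?a" using power_gt_expt[of p ?a] p1 by simp
  also have "p ^ ?a \<le> n" using u assms(2) by (metis dvd_imp_le dvd_triv_left)
  finally have ak: "?a \<le> k" using assms(3) by simp
  have "p ^ k = p ^ ?a * p ^ (k - ?a)" using ak by (simp add: power_add[symmetric])
  then have "(of_nat (p ^ k) / of_nat n :: rat) = of_int (int (p ^ (k - ?a))) / of_int (int u)"
    using u(1) u0 p1 by (metis (no_types, lifting) mult_divide_mult_cancel_left of_int_of_nat_eq of_nat_eq_0_iff of_nat_mult power_not_zero not_one_less_zero)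
  moreover have "\<not> int p dvd int u" using u(2) by (simp add: int_dvd_int_iff)
  ultimately show ?thesis unfolding Z_loc_iff by blast
qed

context saturated_fusion_system
begin

abbreviation ch :: "('a, 'a) formal set \<Rightarrow> bool"
  where "ch X \<equiv> gen X \<and> stable_above 0 X"

lemma A_char_iff: "X \<in> A_char p S F \<longleftrightarrow> ch X"
  using gen_closed F_stable_iff by (auto simp: A_char_def)

lemma gen_eqI:
  assumes "gen X" "gen Y" "\<And>D. D \<in> \<G> \<Longrightarrow> mk X D = mk Y D" shows "X = Y"
proof (rule M_eqI_mark[OF gen_closed[OF assms(1)] gen_closed[OF assms(2)]])
  fix Z
  show "mk X Z = mk Y Z"
  proof (cases "\<exists>D\<in>\<G>. Z \<subseteq> D")
    case True
    then have "generate (S \<times>\<times> S) Z \<in> \<G>" using generate_in_graph(1) by blast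
    from assms(3)[OF this] show ?thesis by (simp only: mk_generate[OF assms(1)] mk_generate[OF assms(2)])
  next
    case False
    then have "mk X Z = 0" "mk Y Z = 0" using mk_gen_zero[OF assms(1), of Z] mk_gen_zero[OF assms(2), of Z] by blast+
    then show ?thesis by simp
  qed
qed

lemma ch_eqI:
  assumes "ch X" "ch Y" "\<And>Q. subgroup Q S \<Longrightarrow> m X Q = m Y Q" shows "X = Y"
proof (rule gen_eqI)
  fix D assume D: "D \<in> \<G>"
  show "mk X D = mk Y D"
    using stable_mark[of X D] stable_mark[of Y D] assms(1,2) D assms(3)[OF Range_sub[OF D]] by simp
qed (use assms in auto)

lemma gen_add: assumes "gen X" "gen Y" shows "gen (X \<oplus>\<^bsub>M\<^esub> Y)"
  using assms by (simp add: F_generated_iff add_closed cc_add)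

lemma gen_smult: assumes "gen X" "c \<in> R" shows "gen (c \<odot>\<^bsub>M\<^esub> X)"
  using assms by (simp add: F_generated_iff smult_closed cc_smult)

lemma m_add: "X \<in> carrier M \<Longrightarrow> Y \<in> carrier M \<Longrightarrow> m (X \<oplus>\<^bsub>M\<^esub> Y) Q = m X Q + m Y Q"
  by (simp add: m_def mk_add sum.distrib add_divide_distrib)

lemma m_smult: "X \<in> carrier M \<Longrightarrow> c \<in> R \<Longrightarrow> m (c \<odot>\<^bsub>M\<^esub> X) Q = c * m X Q"
  by (simp add: m_def mk_smult sum_distrib_left[symmetric])

lemma ch_add: "ch X \<Longrightarrow> ch Y \<Longrightarrow> ch (X \<oplus>\<^bsub>M\<^esub> Y)"
  using gen_add[of X Y] gen_closed by (auto simp: stable_above_def mk_add)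

lemma ch_smult: "ch X \<Longrightarrow> c \<in> R \<Longrightarrow> ch (c \<odot>\<^bsub>M\<^esub> X)"
  using gen_smult[of X c] gen_closed by (auto simp: stable_above_def mk_smult)

lemma ch_mult: "ch X \<Longrightarrow> ch Y \<Longrightarrow> ch (X \<otimes>\<^bsub>M\<^esub> Y)"
  using gen_mult stable_mult by blast

lemma ch_zero: "ch \<zero>\<^bsub>M\<^esub>"
  by (simp add: F_generated_iff zero_closed cc_zero stable_above_def mk_zero)

lemma m_zero: "m \<zero>\<^bsub>M\<^esub> Q = 0" by (simp add: m_def mk_zero)

lemma minus_one: "- 1 \<in> R" using Z_loc_of_int[OF prime_p, of "-1"] by simp

lemma conjugate_S: "conjugate (carrier S) P \<longleftrightarrow> P = carrier S"
proof
  assume c: "conjugate (carrier S) P"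
  have "card P = card (carrier S)" using conjugate_card[OF c] by simp
  then show "P = carrier S" using card_subset_eq[OF finite_S subgroup.subset[OF conjugate_subgroup(2)[OF c]]] by blast
qed (simp add: conjugate_refl[OF carrier_sub])

lemma homs_S: "homs (carrier S) = carrier (aut_graphs (carrier S))"
proof -
  have "Domain E = carrier S" if "E \<in> \<G>" "Range E = carrier S" for E
    using graph_conjugate[OF that(1)] that(2) conjugate_S by simp
  then show ?thesis by (auto simp: homs_def aut_graphs_def)
qed

lemma card_S_pos: "card (carrier S) > 0" using finite_S one_closed by (auto simp: card_gt_0_iff)

text \<open>The marks of \<open>[S,id]\<close> at automorphisms of \<open>S\<close> vanish outside \<open>Aut\<^sub>S(S)\<close> and are equal on it. Their sum
  is \<open>|S|\<close>, since \<open>m\<close> of \<open>[S,id]\<close> at \<open>S\<close> is \<open>1\<close>.\<close>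

lemma mark_identity_S:
  "mk (tclass (Id_on (carrier S))) (Id_on (carrier S)) * of_nat (card (Aut_S S (carrier S))) = of_nat (card (carrier S))"
proof -
  let ?S = "carrier S" and ?I = "Id_on (carrier S)"
  let ?T = "(\<lambda>s. conj_on s ?S) ` normalizer S ?S"
  have IG: "?I \<in> \<G>" by (rule Id_on_graph[OF carrier_sub])
  have Isub: "?I \<subseteq> carrier (S \<times>\<times> S)" using graph_subset[OF IG] by simp
  have Ic: "tclass ?I \<in> burnside_carrier p S S" using tclass_closed[OF IG] by (simp add: carrier_M)
  have norm: "normalizer S ?S = ?S"
  proof -
    have "(\<lambda>x. s \<otimes> x \<otimes> inv s) ` ?S = ?S" if s: "s \<in> ?S" for s
    proof
      show "?S \<subseteq> (\<lambda>x. s \<otimes> x \<otimes> inv s) ` ?S"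
      proof
        fix x assume x: "x \<in> ?S"
        have "x = s \<otimes> (inv s \<otimes> x \<otimes> s) \<otimes> inv s" using s x by (simp add: m_assoc) (simp add: m_assoc[symmetric])
        then show "x \<in> (\<lambda>x. s \<otimes> x \<otimes> inv s) ` ?S" using s x by blast
      qed
    qed (use s in auto)
    then show ?thesis by (auto simp: normalizer_eq)
  qed
  have cs_I: "cs (s, t) ?I = conj_on (s \<otimes> inv t) ?S" if st: "s \<in> ?S" "t \<in> ?S" for s t
  proof -
    have "cs (s, t) ?I = (\<lambda>x. (s \<otimes> x \<otimes> inv s, t \<otimes> x \<otimes> inv t)) ` ?S"
      unfolding conj_set_def Id_on_def using st by (auto simp: image_iff)
    also have "\<dots> = conj_on (s \<otimes> inv t) ?S"
    proof
      show "(\<lambda>x. (s \<otimes> x \<otimes> inv s, t \<otimes> x \<otimes> inv t)) ` ?S \<subseteq> conj_on (s \<otimes> inv t) ?S"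
      proof (rule image_subsetI)
        fix x assume x: "x \<in> ?S"
        have "s \<otimes> inv t \<otimes> (t \<otimes> x \<otimes> inv t) \<otimes> inv (s \<otimes> inv t) = s \<otimes> (inv t \<otimes> t) \<otimes> x \<otimes> (inv t \<otimes> t) \<otimes> inv s"
          using st x by (simp only: inv_mult_group inv_inv inv_closed m_assoc m_closed)
        then have "s \<otimes> x \<otimes> inv s = s \<otimes> inv t \<otimes> (t \<otimes> x \<otimes> inv t) \<otimes> inv (s \<otimes> inv t)" using st x by simp
        then show "(s \<otimes> x \<otimes> inv s, t \<otimes> x \<otimes> inv t) \<in> conj_on (s \<otimes> inv t) ?S"
          using st x by (intro image_eqI[of _ _ "t \<otimes> x \<otimes> inv t"]) auto
      qed
      show "conj_on (s \<otimes> inv t) ?S \<subseteq> (\<lambda>x. (s \<otimes> x \<otimes> inv s, t \<otimes> x \<otimes> inv t)) ` ?S"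
      proof (rule image_subsetI)
        fix x assume x: "x \<in> ?S"
        have "t \<otimes> (inv t \<otimes> x \<otimes> t) \<otimes> inv t = x" using st x by (simp add: m_assoc) (simp add: m_assoc[symmetric])
        moreover have "s \<otimes> (inv t \<otimes> x \<otimes> t) \<otimes> inv s = s \<otimes> inv t \<otimes> x \<otimes> inv (s \<otimes> inv t)"
          using st x by (simp add: m_assoc inv_mult_group)
        ultimately show "(s \<otimes> inv t \<otimes> x \<otimes> inv (s \<otimes> inv t), x) \<in> (\<lambda>x. (s \<otimes> x \<otimes> inv s, t \<otimes> x \<otimes> inv t)) ` ?S"
          using st x by (intro image_eqI[of _ _ "inv t \<otimes> x \<otimes> t"]) auto
      qed
    qed
    finally show ?thesis .
  qed
  have in_T: "mk (tclass ?I) E = mk (tclass ?I) ?I" if "E \<in> ?T" for E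
  proof -
    obtain s where s: "s \<in> ?S" "E = conj_on s ?S" using \<open>E \<in> ?T\<close> norm by blast
    have "E = cs (s, \<one>) ?I" using cs_I[OF s(1) one_closed] s by simp
    then show ?thesis using SS.GH.mark_conj[OF Ic _ Isub, of "(s, \<one>)"] s(1) by simp
  qed
  have out_T: "mk (tclass ?I) E = 0" if E: "E \<in> homs ?S - ?T" for E
  proof -
    have "\<not> E \<subseteq> cs z ?I" if z: "z \<in> carrier (S \<times>\<times> S)" for z
    proof
      assume sub: "E \<subseteq> cs z ?I"
      obtain s t where st: "z = (s, t)" "s \<in> ?S" "t \<in> ?S" using z by auto
      have EG: "E \<in> \<G>" "Range E = ?S" using E by (auto simp: homs_def)
      have cG: "conj_on (s \<otimes> inv t) ?S \<in> \<G>" using conj_on_graph[OF carrier_sub] st by simp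
      have sub': "E \<subseteq> conj_on (s \<otimes> inv t) ?S" using sub cs_I[OF st(2,3)] st(1) by simp
      have "card E = card (conj_on (s \<otimes> inv t) ?S)"
        using card_graph[OF EG(1)] card_graph[OF cG] by (simp only: EG(2) Range_conj_on)
      then have "E = conj_on (s \<otimes> inv t) ?S" by (rule card_subset_eq[OF finite_graph[OF cG] sub'])
      then show False using E st norm by blast
    qed
    then have "{z \<in> carrier (S \<times>\<times> S). E \<subseteq> cs z ?I} = {}" by blast
    then show ?thesis by (simp only: mk_tclass[OF IG] card.empty)
  qed
  have TS: "?T \<subseteq> homs ?S" unfolding homs_S using subgroup.subset[OF conj_auts_subgroup(1)[OF carrier_sub]] .
  have "conjugators ?S ?S = ?S" by (auto simp: conjugators_def)
  then have "m (tclass ?I) ?S = 1"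
    using m_tclass[OF IG carrier_sub] card_S_pos by simp
  then have "(\<Sum>E\<in>homs ?S. mk (tclass ?I) E) = of_nat (card ?S)" using card_S_pos by (simp add: m_def)
  moreover have "(\<Sum>E\<in>homs ?S. mk (tclass ?I) E) = (\<Sum>E\<in>?T. mk (tclass ?I) E)"
    by (rule sum.mono_neutral_right[OF finite_homs TS]) (use out_T in blast)
  moreover have "(\<Sum>E\<in>?T. mk (tclass ?I) E) = (\<Sum>E\<in>?T. mk (tclass ?I) ?I)"
    by (rule sum.cong[OF refl in_T])
  ultimately show ?thesis using conj_auts_subgroup(2)[OF carrier_sub] by (simp add: mult.commute)
qed

text \<open>Make the identity of \<open>S\<close> stable from the top down, the first step being at the graphs of order \<open>|S|\<close>.
  The mark at the identity of \<open>S\<close> is kept. So the value of \<open>m\<close> at \<open>S\<close> is the index of \<open>Aut\<^sub>S(S)\<close> in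
  \<open>Aut\<^sub>F(S)\<close>. It is prime to \<open>p\<close>, because \<open>S\<close> is fully normalized, and can be divided out.\<close>

lemma exists_normalized_characteristic:
  obtains X where "ch X" "m X (carrier S) = 1"
proof -
  let ?S = "carrier S" and ?I = "Id_on (carrier S)"
  have IG: "?I \<in> \<G>" by (rule Id_on_graph[OF carrier_sub])
  obtain n where n: "card ?S = Suc n" using card_S_pos by (metis gr0_implies_Suc)
  have cI: "card ?I = Suc n" using card_graph[OF IG] n by simp
  have le: "card D \<le> Suc n" if "D \<in> \<G>" for D
    using card_graph[OF that] card_mono[OF finite_S subgroup.subset[OF Range_sub[OF that]]] n by simp
  have "stable_above (Suc n) (tclass ?I)"
    unfolding stable_above_def using le by (meson leD)
  from stabilize_level[OF tclass_gen[OF IG] this] obtain Y where Y: "gen Y" "stable_above n Y"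
    "\<forall>D\<in>\<G>. Suc n < card D \<longrightarrow> mk Y D = mk (tclass ?I) D"
    "\<forall>D\<in>\<G>. card D = Suc n \<longrightarrow> mk Y D = mk (tclass ?I) (Id_on (representative (Range D)))" .
  obtain W where W: "gen W" "stable_above 0 W" "\<forall>D\<in>\<G>. n < card D \<longrightarrow> mk W D = mk Y D"
    using stabilize[OF Y(1,2)] by blast
  have rS: "representative ?S = ?S" using representative(1)[OF carrier_sub] conjugate_S by blast
  have "mk W ?I = mk Y ?I" using W(3) IG cI by simp
  also have "\<dots> = mk (tclass ?I) (Id_on (representative (Range ?I)))" using Y(4) IG cI by blast
  finally have WI: "mk W ?I = mk (tclass ?I) ?I" by (simp add: rS)
  let ?a = "card (Aut_S S ?S)" and ?h = "card (homs ?S)"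
  have fn: "fully_normalized S F ?S"
    unfolding fully_normalized_def using F_conjugates_iff[OF carrier_sub] conjugate_S by simp
  then have "sylow_subgroup p (Aut_S S ?S) (Aut_F F ?S)"
    using saturated carrier_sub unfolding saturated_def by blast
  then have a: "?a = p ^ multiplicity p ?h"
    using order_aut_graphs[OF carrier_sub] by (simp add: sylow_subgroup_def Aut_F_def order_def homs_S)
  have h0: "?h > 0" by (rule homs_pos[OF carrier_sub])
  have h1: "?h \<noteq> 0" using h0 by simp
  have np: "\<not> is_unit p" using prime_gt_1_nat[OF prime_p] by simp
  obtain u where u: "?h = p ^ multiplicity p ?h * u" "\<not> p dvd u"
    using multiplicity_decompose'[of ?h p] h1 np by metis
  have a0: "?a > 0" using a prime_gt_0_nat[OF prime_p] by simp
  have u0: "u > 0" using u(1) h0 by (metis mult_0_right gr0I less_irrefl)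
  have eq: "mk W ?I * of_nat ?a = of_nat (card ?S)" using mark_identity_S WI by simp
  have "mk W ?I = of_nat (card ?S) / of_nat ?h * m W ?S" using stable_mark[OF W(2) IG] by simp
  then have "m W ?S = mk W ?I * of_nat ?h / of_nat (card ?S)" using h0 card_S_pos by (simp add: field_simps)
  also have "of_nat ?h = (of_nat ?a * of_nat u :: rat)" using u(1) a by (metis of_nat_mult)
  also have "mk W ?I * (of_nat ?a * of_nat u) / of_nat (card ?S) = (mk W ?I * of_nat ?a) * of_nat u / of_nat (card ?S)"
    by (simp only: mult.assoc)
  also have "\<dots> = of_nat u" unfolding eq using card_S_pos by simp
  finally have mW: "m W ?S = of_nat u" .
  have "\<not> int p dvd int u" using u(2) by (simp add: int_dvd_int_iff)
  then have "of_int 1 / of_int (int u) \<in> R" unfolding Z_loc_iff by blast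
  then have c: "1 / of_nat u \<in> R" by simp
  show thesis
  proof (rule that[of "(1 / of_nat u) \<odot>\<^bsub>M\<^esub> W"])
    show "ch ((1 / of_nat u) \<odot>\<^bsub>M\<^esub> W)" using W(1,2) c by (intro ch_smult) auto
    show "m ((1 / of_nat u) \<odot>\<^bsub>M\<^esub> W) ?S = 1" using m_smult[OF gen_closed[OF W(1)] c] mW u0 by simp
  qed
qed

text \<open>Put \<open>y = 1 - m X\<close> with \<open>X\<close> normalized as before. It is divisible by \<open>p\<close>. The functions \<open>1 - y\<^sup>k\<close> and
  \<open>y\<^sup>k\<close> with \<open>k\<close> large both come from stable generated elements, the former by evaluating a polynomial at
  \<open>X\<close>, the latter by its divisibility; they sum to \<open>1\<close>.\<close>

lemma exists_identity:
  obtains w where "ch w" "\<And>Q. subgroup Q S \<Longrightarrow> m w Q = 1"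
proof -
  obtain X where X: "ch X" "m X (carrier S) = 1" using exists_normalized_characteristic .
  have XM: "X \<in> carrier M" using X gen_closed by blast
  define y where "y Q = 1 - m X Q" for Q
  have p0: "(of_nat p :: rat) \<noteq> 0" using prime_gt_0_nat[OF prime_p] by simp
  have y: "y Q / of_nat p \<in> R" if Q: "subgroup Q S" for Q
  proof -
    have "y Q / of_nat p = - ((m X Q - m X (carrier S)) / of_nat p)" by (simp add: y_def X(2) diff_divide_distrib)
    then show ?thesis using Z_loc_uminus[OF prime_p m_cong(2)[OF _ Q]] X(1) by simp
  qed
  \<comment> \<open>The polynomial \<open>1 - (1 - x)\<^sup>k\<close> has no constant term, so it can be evaluated in a ring without identity; the
  recursion is \<open>Y \<mapsto> Y + X - X Y\<close>.\<close>
  have pow: "\<exists>Y. ch Y \<and> (\<forall>Q. subgroup Q S \<longrightarrow> m Y Q = 1 - y Q ^ Suc k)" for k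
  proof (induction k)
    case 0
    then show ?case using X(1) by (intro exI[of _ X]) (simp add: y_def)
  next
    case (Suc k)
    then obtain Y where Y: "ch Y" "\<forall>Q. subgroup Q S \<longrightarrow> m Y Q = 1 - y Q ^ Suc k" by blast
    let ?P = "(- 1) \<odot>\<^bsub>M\<^esub> (X \<otimes>\<^bsub>M\<^esub> Y)"
    let ?W = "(Y \<oplus>\<^bsub>M\<^esub> X) \<oplus>\<^bsub>M\<^esub> ?P"
    have XY: "ch (X \<otimes>\<^bsub>M\<^esub> Y)" using X(1) Y(1) by (rule ch_mult)
    have c1: "ch (Y \<oplus>\<^bsub>M\<^esub> X)" using Y(1) X(1) by (rule ch_add)
    have c2: "ch ?P" using XY minus_one by (rule ch_smult)
    have W: "ch ?W" using c1 c2 by (rule ch_add)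
    have "m ?W Q = 1 - y Q ^ Suc (Suc k)" if Q: "subgroup Q S" for Q
    proof -
      have "m ?W Q = (m Y Q + m X Q) + (- 1) * (m X Q * m Y Q)"
        using c1 c2 XY X(1) Y(1) gen_closed by (simp add: m_add m_smult minus_one m_mult del: mult_minus1)
      also have "\<dots> = 1 - y Q ^ Suc (Suc k)"
      proof -
        have mY: "m Y Q = 1 - y Q ^ Suc k" using Y(2) Q by blast
        have mX: "m X Q = 1 - y Q" by (simp add: y_def)
        show ?thesis unfolding mY mX by (simp add: algebra_simps)
      qed
      finally show ?thesis .
    qed
    then show ?case using W by blast
  qed
  \<comment> \<open>The prescribed marks have denominators dividing \<open>|F(Q,S)| |S|\<close>, and \<open>k\<close> bounds this number, hence
  its \<open>p\<close>-adic valuation, for all \<open>Q\<close>.\<close>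
  define k where "k = card \<G> * card (carrier S)"
  let ?s = "of_nat (card (carrier S)) :: rat"
  define v where "v Q = ?s / of_nat (card (homs Q)) * y Q ^ Suc k" for Q
  have vc: "v P = v Q" if "conjugate P Q" for P Q
    using homs_conjugate[OF that] m_conjugate[OF _ that, of X] X(1) by (simp add: v_def y_def)
  have vR: "v Q / of_nat (card (carrier S) * card (carrier S)) \<in> R" if Q: "subgroup Q S" for Q
  proof -
    let ?n = "card (homs Q) * card (carrier S)"
    have "card (homs Q) \<le> card \<G>" by (rule card_mono[OF finite_graphs]) (auto simp: homs_def)
    then have nk: "?n \<le> Suc k" by (simp add: k_def le_SucI)
    have n0: "0 < ?n" using homs_pos[OF Q] card_S_pos by simp
    have "v Q / of_nat (card (carrier S) * card (carrier S)) = y Q ^ Suc k / of_nat ?n"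
      using homs_pos[OF Q] card_S_pos by (simp add: v_def)
    also have "\<dots> = (of_nat (p ^ Suc k) / of_nat ?n) * (y Q / of_nat p) ^ Suc k"
      using p0 by (simp add: power_divide)
    also have "\<dots> \<in> R"
      by (intro Z_loc_mult[OF prime_p] Z_loc_power[OF prime_p] y Q power_div_in_Z_loc[OF prime_p n0 nk])
    finally show ?thesis .
  qed
  obtain V where V: "gen V" "\<forall>D\<in>\<G>. mk V D = v (Range D)" using exists_stable_with_marks[of v, OF vc vR] .
  have chV: "ch V" using V vc by (auto simp: stable_above_def)
  have mV: "m V Q = y Q ^ Suc k" if Q: "subgroup Q S" for Q
  proof -
    have "m V Q = of_nat (card (homs Q)) / ?s * v Q" by (rule m_stable[OF Q]) (use V(2) in simp)
    then show ?thesis using homs_pos[OF Q] card_S_pos by (simp add: v_def)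
  qed
  obtain Y where Y: "ch Y" "\<forall>Q. subgroup Q S \<longrightarrow> m Y Q = 1 - y Q ^ Suc k" using pow by blast
  show thesis
  proof (rule that[of "Y \<oplus>\<^bsub>M\<^esub> V"])
    show "ch (Y \<oplus>\<^bsub>M\<^esub> V)" using Y(1) chV by (rule ch_add)
    show "m (Y \<oplus>\<^bsub>M\<^esub> V) Q = 1" if "subgroup Q S" for Q
      using m_add[of Y V Q] gen_closed Y chV mV that by simp
  qed
qed

lemma mk_empty: assumes "gen X" shows "mk X {} = mk X (Id_on {\<one>})"
proof (rule mk_gen_cong[OF assms])
  fix D assume "D \<in> \<G>"
  then have "(\<one>, \<one>) \<in> D" using subgroup.one_closed[OF graph_sub] by simp
  then show "{} \<subseteq> D \<longleftrightarrow> Id_on {\<one>} \<subseteq> D" by (simp add: Id_on_def)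
qed

lemma trivial_sub: "subgroup {\<one>} S" by (rule triv_subgroup)

lemma m_trivial: assumes "gen X" shows "m X {\<one>} = mk X {} / of_nat (card (carrier S))"
proof -
  have "homs {\<one>} = {Id_on {\<one>}}"
  proof -
    have "E = Id_on {\<one>}" if "E \<in> \<G>" "Range E = {\<one>}" for E
    proof -
      have o: "(\<one>, \<one>) \<in> E" using subgroup.one_closed[OF graph_sub[OF that(1)]] by simp
      have "card E = 1" using card_graph[OF that(1)] that(2) by simp
      then obtain z where "E = {z}" by (rule card_1_singletonE)
      then show ?thesis using o by (simp add: Id_on_def)
    qed
    moreover have "Id_on {\<one>} \<in> homs {\<one>}" using Id_on_graph[OF trivial_sub] by (simp add: homs_def)
    ultimately show ?thesis unfolding homs_def by blast
  qed
  then show ?thesis by (simp add: m_def mk_empty[OF assms])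
qed

text \<open>Summing the counts of a representative over all subgroups counts its points, so every representative of
  \<open>X\<close> yields the number of points over \<open>|S|\<close>, which is the value of \<open>m\<close> at the trivial subgroup. The
  definition asks for a representative by left-free bisets; the transitive bisets from an expansion of \<open>X\<close>
  form one, as their point stabilizers are graphs of functions.\<close>

lemma augmentation_eq:
  assumes "gen X" shows "augmentation S X = m X {\<one>}"
proof -
  let ?s = "of_nat (card (carrier S)) :: rat"
  have total: "(\<Sum>Y\<in>Poly_Mapping.keys f. Poly_Mapping.lookup f Y * (of_nat (card (points Y)) / of_nat (order S))) = m X {\<one>}"
    if f: "f \<in> X" for f
  proof -
    have XA: "X \<in> burnside_carrier p S S" using gen_closed[OF assms] by (simp add: carrier_M)
    obtain f0 where f0: "f0 \<in> formal_bisets p S S" "X = formal_class p S S f0" "cc X = formal_count S S f0"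
      using SS.GH.class_rep[OF XA] .
    have fb: "f \<in> formal_bisets p S S" "formal_count S S f = cc X"
      using f f0 SS.GH.formal_class_eq[OF f0(1)] by auto
    have "of_nat (card (points Y)) = (\<Sum>D\<in>Pow (carrier S \<times> carrier S). (of_nat (stab_count S S Y D) :: rat))"
      if "Y \<in> Poly_Mapping.keys f" for Y
      using SS.GH.sum_points[of Y "\<lambda>_. 1"] that fb(1) by (auto simp: formal_bisets_def)
    then have "(\<Sum>Y\<in>Poly_Mapping.keys f. Poly_Mapping.lookup f Y * of_nat (card (points Y))) =
        (\<Sum>Y\<in>Poly_Mapping.keys f. \<Sum>D\<in>Pow (carrier S \<times> carrier S). Poly_Mapping.lookup f Y * of_nat (stab_count S S Y D))"
      by (intro sum.cong refl) (simp add: sum_distrib_left)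
    also have "\<dots> = (\<Sum>D\<in>Pow (carrier S \<times> carrier S). formal_count S S f D)"
      unfolding formal_count_def by (rule sum.swap)
    also have "\<dots> = mk X {}" unfolding fb(2) mark_def by (rule sum.cong) auto
    finally show ?thesis
      by (simp add: m_trivial[OF assms] order_def sum_divide_distrib[symmetric])
  qed
  have ex: "\<exists>f\<in>X. \<forall>Y\<in>Poly_Mapping.keys f. left_free S Y"
  proof -
    obtain B c where B: "finite B" "B \<subseteq> tclass ` \<G>" "c \<in> B \<rightarrow> R" "X = finsum M (\<lambda>b. c b \<odot>\<^bsub>M\<^esub> b) B"
      "\<forall>Z. mk X Z = (\<Sum>b\<in>B. c b * mk b Z)" using gen_expand[OF assms] .
    define rep where "rep b = (SOME D. D \<in> \<G> \<and> tclass D = b)" for b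
    have rep: "rep b \<in> \<G>" "tclass (rep b) = b" if "b \<in> B" for b
    proof -
      have "\<exists>D. D \<in> \<G> \<and> tclass D = b" using that B(2) by blast
      from someI_ex[OF this] show "rep b \<in> \<G>" "tclass (rep b) = b" by (auto simp: rep_def)
    qed
    define tb where "tb D = transitive_biset S S (Range D) (\<lambda>x. THE y. (y, x) \<in> D)" for D :: "('a \<times> 'a) set"
    have tb: "is_biset S S (tb D)" "tclass D = biset_class p S S (tb D)" if D: "D \<in> \<G>" for D
      using SS.GH.transitive_biset_props(1)[of "Range D" "\<lambda>x. THE y. (y, x) \<in> D"] D
      by (simp_all add: tb_def graph_the graph_sub transitive_def tclass_def transitive_class_def)
    define f where "f = (\<Sum>b\<in>B. formal_scale (c b) (formal_gen S S (tb (rep b))))"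
    have bM: "b \<in> carrier M" if "b \<in> B" for b using that B(2) tclass_closed by blast
    have fb: "f \<in> formal_bisets p S S" unfolding f_def
      using B(3) tb(1)[OF rep(1)] by (intro SS.GH.formal_bisets_sum SS.GH.formal_bisets_scale SS.GH.formal_gen_closed) auto
    have cl: "(\<lambda>b. c b \<odot>\<^bsub>M\<^esub> b) \<in> B \<rightarrow> carrier M" using B(3) bM by (auto intro!: smult_closed)
    have cnt: "formal_count S S f D = cc X D" for D
    proof -
      have "cc X D = (\<Sum>b\<in>B. c b * cc b D)"
        unfolding B(4) cc_finsum[OF cl B(1)] using B(3) bM by (intro sum.cong refl cc_smult) auto
      also have "\<dots> = (\<Sum>b\<in>B. c b * of_nat (stab_count S S (tb (rep b)) D))"
        using SS.GH.class_count_biset[OF tb(1)[OF rep(1)]] tb(2)[OF rep(1)] rep(2) by (intro sum.cong refl) metis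
      also have "\<dots> = formal_count S S f D"
        unfolding f_def formal_count_sum formal_count_scale using formal_count_gen[OF tb(1)[OF rep(1)]]
        by (intro sum.cong refl) simp
      finally show ?thesis by simp
    qed
    have feq: "formal_class p S S f = X"
    proof (rule M_eqI)
      show "formal_class p S S f \<in> carrier M" unfolding carrier_M by (rule SS.GH.formal_class_closed[OF fb])
      show "X \<in> carrier M" by (rule gen_closed[OF assms])
      fix D show "cc (formal_class p S S f) D = cc X D"
        by (simp only: SS.GH.class_count_formal_class[OF fb] cnt)
    qed
    have fX: "f \<in> X" unfolding feq[symmetric] SS.GH.formal_class_eq[OF fb] using fb by simp
    have lf: "left_free S Y" if Y: "Y \<in> Poly_Mapping.keys f" for Y
    proof -
      obtain b where b: "b \<in> B" "Y \<in> Poly_Mapping.keys (formal_scale (c b) (formal_gen S S (tb (rep b))))"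
      proof -
        have "Poly_Mapping.keys f \<subseteq> (\<Union>b\<in>B. Poly_Mapping.keys (formal_scale (c b) (formal_gen S S (tb (rep b)))))"
          unfolding f_def by (rule Poly_Mapping.keys_sum)
        then have "Y \<in> (\<Union>b\<in>B. Poly_Mapping.keys (formal_scale (c b) (formal_gen S S (tb (rep b)))))"
          using Y by (rule subsetD)
        then show thesis by (rule UN_E) (rule that)
      qed
      obtain Y' :: "(nat, 'a, 'a) biset" where Y': "is_biset S S Y'" "biset_isomorphic S S (tb (rep b)) Y'"
        "formal_gen S S (tb (rep b)) = Poly_Mapping.single Y' 1"
        using formal_gen_nat[OF tb(1)[OF rep(1)[OF b(1)]]] .
      have "Y \<in> Poly_Mapping.keys (Poly_Mapping.single Y' (1::rat))"
        using b(2) keys_formal_scale[of "c b" "formal_gen S S (tb (rep b))"] Y'(3) by auto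
      then have YY': "Y = Y'" by (simp split: if_splits)
      have st: "stab S S Y y \<in> \<G>" if y: "y \<in> points Y" for y
      proof (rule ccontr)
        assume n: "stab S S Y y \<notin> \<G>"
        have "(of_nat (stab_count S S Y (stab S S Y y)) :: rat) = cc b (stab S S Y y)"
          using stab_count_isomorphic[OF Y'(2) tb(1)[OF rep(1)[OF b(1)]]]
            SS.GH.class_count_biset[OF tb(1)[OF rep(1)[OF b(1)]]]
          unfolding YY' tb(2)[OF rep(1)[OF b(1)], symmetric] rep(2)[OF b(1)] by simp
        also have "\<dots> = 0" using gen_cc[OF tclass_gen[OF rep(1)[OF b(1)]] n] rep(2)[OF b(1)] by simp
        finally have "stab_count S S Y (stab S S Y y) = 0" by simp
        moreover have "finite (points Y)" using Y'(1) YY' by (simp add: is_biset_def)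
        ultimately show False using y by (auto simp: stab_count_def)
      qed
      show ?thesis unfolding left_free_def
      proof (intro ballI impI)
        fix h y assume h: "h \<in> carrier S" and y: "y \<in> points Y" and hy: "lact Y h y = y"
        have "ract Y y \<one> = y" using Y'(1) YY' y by (simp add: is_biset_def)
        then have "(h, \<one>) \<in> stab S S Y y" using h hy by (simp add: stab_def)
        moreover have "(\<one>, \<one>) \<in> stab S S Y y" using subgroup.one_closed[OF graph_sub[OF st[OF y]]] by simp
        ultimately show "h = \<one>" using graph_fun[OF st[OF y]] by blast
      qed
    qed
    show ?thesis by (rule bexI[OF _ fX]) (rule ballI, rule lf)
  qed
  show ?thesis unfolding augmentation_def
  proof (rule the_equality)
    show "\<exists>f\<in>X. (\<forall>Y\<in>Poly_Mapping.keys f. left_free S Y) \<and>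
       m X {\<one>} = (\<Sum>Y\<in>Poly_Mapping.keys f. Poly_Mapping.lookup f Y * (of_nat (card (points Y)) / of_nat (order S)))"
    proof -
      obtain f where f: "f \<in> X" "\<forall>Y\<in>Poly_Mapping.keys f. left_free S Y" using ex by (rule bexE)
      show ?thesis by (rule bexI[OF _ f(1)]) (intro conjI f(2) total[OF f(1), symmetric])
    qed
  next
    fix r assume "\<exists>f\<in>X. (\<forall>Y\<in>Poly_Mapping.keys f. left_free S Y) \<and>
       r = (\<Sum>Y\<in>Poly_Mapping.keys f. Poly_Mapping.lookup f Y * (of_nat (card (points Y)) / of_nat (order S)))"
    then obtain f where f: "f \<in> X" "(\<forall>Y\<in>Poly_Mapping.keys f. left_free S Y) \<and>
       r = (\<Sum>Y\<in>Poly_Mapping.keys f. Poly_Mapping.lookup f Y * (of_nat (card (points Y)) / of_nat (order S)))" by (rule bexE)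
    show "r = m X {\<one>}" unfolding conjunct2[OF f(2)] by (rule total[OF f(1)])
  qed
qed

lemma characteristic_iff: "F_characteristic p S F X \<longleftrightarrow> ch X \<and> m X {\<one>} \<in> Units (Z_loc p)"
proof (cases "gen X")
  case True
  show ?thesis unfolding F_characteristic_def augmentation_eq[OF True]
    using F_stable_iff[OF True] True by blast
qed (simp add: F_characteristic_def)

text \<open>By the congruence modulo \<open>p\<close> the augmentation can be replaced by the value at \<open>S\<close>.\<close>

lemma characteristic_iff_S: "F_characteristic p S F X \<longleftrightarrow> ch X \<and> m X (carrier S) \<in> Units (Z_loc p)"
proof -
  have "m X {\<one>} \<in> Units (Z_loc p) \<longleftrightarrow> m X (carrier S) \<in> Units (Z_loc p)" if "gen X"
    by (rule Units_Z_loc_cong[OF prime_p m_cong(1)[OF that trivial_sub] m_cong(1)[OF that carrier_sub] m_cong(2)[OF that trivial_sub]])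
  then show ?thesis unfolding characteristic_iff by (intro conj_cong refl) blast
qed

abbreviation "\<omega> \<equiv> characteristic_idempotent p S F"

lemma one_unit: "1 \<in> Units (Z_loc p)"
  by (simp add: Units_Z_loc_iff[OF prime_p Z_loc_1[OF prime_p]] not_in_Z_loc[OF prime_p])

text \<open>The values of \<open>m\<close> at an idempotent are \<open>0\<close> or \<open>1\<close>, and at a characteristic idempotent they are units. So
  the element with \<open>m = 1\<close> is the only characteristic idempotent.\<close>

lemma omega: "ch \<omega>" "\<And>Q. subgroup Q S \<Longrightarrow> m \<omega> Q = 1"
proof -
  obtain w where w: "ch w" "\<And>Q. subgroup Q S \<Longrightarrow> m w Q = 1" using exists_identity by blast
  have "\<omega> = w" unfolding characteristic_idempotent_def
  proof (rule the_equality)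
    have ww: "ch (w \<otimes>\<^bsub>M\<^esub> w)" using w(1) by (intro ch_mult)
    have "w \<otimes>\<^bsub>M\<^esub> w = w"
      by (rule ch_eqI[OF ww w(1)]) (use w m_mult[of w w] in simp)
    then show "w \<in> carrier M \<and> w \<otimes>\<^bsub>M\<^esub> w = w \<and> F_characteristic p S F w"
      using w gen_closed one_unit trivial_sub by (simp add: characteristic_iff)
  next
    fix w' assume w': "w' \<in> carrier M \<and> w' \<otimes>\<^bsub>M\<^esub> w' = w' \<and> F_characteristic p S F w'"
    then have ch': "ch w'" and u: "m w' (carrier S) \<in> Units (Z_loc p)" using characteristic_iff_S by auto
    show "w' = w"
    proof (rule ch_eqI[OF ch' w(1)])
      fix Q assume Q: "subgroup Q S"
      have "m w' Q * m w' Q = m w' Q" using m_mult[of w' w' Q] ch' w' by simp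
      moreover have "m w' Q \<noteq> 0"
      proof
        assume z: "m w' Q = 0"
        have "m w' Q \<in> Units (Z_loc p)"
          using Units_Z_loc_cong[OF prime_p m_cong(1)[OF _ Q] m_cong(1)[OF _ carrier_sub] m_cong(2)[OF _ Q], of w'] ch' u by blast
        then show False using Units_Z_loc_iff[OF prime_p Z_loc_0[OF prime_p]] z Z_loc_0[OF prime_p] by simp
      qed
      ultimately show "m w' Q = m w Q" using w(2)[OF Q] by simp
    qed
  qed
  then show "ch \<omega>" "\<And>Q. subgroup Q S \<Longrightarrow> m \<omega> Q = 1" using w by auto
qed

end


section \<open>The basis\<close>

context saturated_fusion_system
begin

definition sandwich :: "('a, 'a) formal set \<Rightarrow> ('a, 'a) formal set"
  where "sandwich X = \<omega> \<otimes>\<^bsub>M\<^esub> X \<otimes>\<^bsub>M\<^esub> \<omega>"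

text \<open>A sum over all \<open>F\<close>-morphisms \<open>Q \<rightarrow> S\<close>; it still has to be divided by their number.\<close>

definition average :: "('a, 'a) formal set \<Rightarrow> 'a set \<Rightarrow> rat"
  where "average X Q = (\<Sum>E\<in>homs Q. m X (Domain E))"

text \<open>\<open>|F(Q,P)|\<close>\<close>

definition hom_count :: "'a set \<Rightarrow> 'a set \<Rightarrow> nat"
  where "hom_count Q P = card {E \<in> homs Q. Domain E \<subseteq> P}"

lemma sandwich_gen: "gen X \<Longrightarrow> gen (sandwich X)"
  unfolding sandwich_def using omega(1) by (intro gen_mult) auto

lemma omega_mark: "D \<in> \<G> \<Longrightarrow> mk \<omega> D = of_nat (card (carrier S)) / of_nat (card (homs (Range D)))"
  using stable_mark[of \<omega> D] omega(1) omega(2)[OF Range_sub] by simp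

text \<open>Multiplication by \<open>\<omega>\<close> on the left replaces the mark at a graph by a multiple of the value of \<open>m\<close> at its
  source. In the product with \<open>\<omega>\<close> on the right, the sources of the first factors in the factorizations of
  \<open>D\<close> are the images of the morphisms on the source of \<open>D\<close>.\<close>

lemma sandwich_mark:
  assumes X: "gen X" and D: "D \<in> \<G>"
  shows "mk (sandwich X) D = of_nat (card (carrier S)) / (of_nat (card (homs (Range D))))\<^sup>2 * average X (Range D)"
proof -
  let ?h = "of_nat (card (homs (Range D))) :: rat" and ?s = "of_nat (card (carrier S)) :: rat"
  have gX: "gen (\<omega> \<otimes>\<^bsub>M\<^esub> X)" using omega(1) X by (intro gen_mult) auto
  have w: "gen \<omega>" "stable_above 0 \<omega>" using omega(1) by auto
  have "mk (\<omega> \<otimes>\<^bsub>M\<^esub> X) (D O converse E) * mk \<omega> E = (?s / ?h * m X (Domain E)) * (?s / ?h)"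
    if E: "E \<in> homs (Range D)" for E
  proof -
    have EG: "E \<in> \<G>" "Range E = Range D" using E by (simp_all add: homs_def)
    have G: "D O converse E \<in> \<G>" by (intro graph_comp graph_converse D EG(1))
    have r: "Range (D O converse E) = Domain E"
    proof -
      have "Range (D O converse E) = Domain (converse (D O converse E))" by simp
      also have "converse (D O converse E) = E O converse D" by (simp only: converse_relcomp converse_converse)
      also have "Domain (E O converse D) = Domain E" using EG(2) by (subst Domain_comp) auto
      finally show ?thesis .
    qed
    have h: "card (homs (Domain E)) = card (homs (Range D))"
      using homs_conjugate[OF graph_conjugate[OF EG(1)]] EG(2) by simp
    have "mk (\<omega> \<otimes>\<^bsub>M\<^esub> X) (D O converse E) = ?s / ?h * m X (Domain E)"
      using mark_mult_stable[OF w X G] omega_mark[OF G] by (simp add: r h)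
    moreover have "mk \<omega> E = ?s / ?h" using omega_mark[OF EG(1)] EG(2) by simp
    ultimately show ?thesis by simp
  qed
  then have "(\<Sum>E\<in>homs (Range D). mk (\<omega> \<otimes>\<^bsub>M\<^esub> X) (D O converse E) * mk \<omega> E) =
      (\<Sum>E\<in>homs (Range D). (?s / ?h * m X (Domain E)) * (?s / ?h))"
    by (rule sum.cong[OF refl])
  also have "\<dots> = (?s / ?h) * average X (Range D) * (?s / ?h)"
    by (simp only: average_def sum_distrib_left sum_distrib_right)
  finally have "mk (sandwich X) D = (?s / ?h) * average X (Range D) * (?s / ?h) / ?s"
    by (simp only: sandwich_def mark_mult[OF gX w(1) D])
  then show ?thesis using card_S_pos by (simp add: power2_eq_square)
qed

lemma average_conjugate:
  assumes "conjugate P Q" shows "average X P = average X Q"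
proof -
  obtain E where E: "E \<in> \<G>" "Range E = P" "Domain E = Q" using assms by (auto simp: conjugate_def)
  have "average X (Domain E) = (\<Sum>E'\<in>homs (Domain E). m X (Domain (E' O E)))"
    unfolding average_def
  proof (rule sum.cong[OF refl])
    fix E' assume "E' \<in> homs (Domain E)"
    then have "Range E' = Domain E" by (simp add: homs_def)
    then show "m X (Domain E') = m X (Domain (E' O E))" by (subst Domain_comp) simp_all
  qed
  also have "\<dots> = average X (Range E)"
    unfolding average_def by (rule sum.reindex_bij_betw[OF homs_conjugate_bij[OF E(1)]])
  finally show ?thesis using E by simp
qed

lemma sandwich_ch: assumes "gen X" shows "ch (sandwich X)"
proof
  show "gen (sandwich X)" by (rule sandwich_gen[OF assms])
  show "stable_above 0 (sandwich X)" unfolding stable_above_def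
  proof (intro ballI impI)
    fix D D' assume D: "D \<in> \<G>" "D' \<in> \<G>" and "0 < card D \<and> conjugate (Range D) (Range D')"
    then have c: "conjugate (Range D) (Range D')" by blast
    show "mk (sandwich X) D = mk (sandwich X) D'"
      using sandwich_mark[OF assms D(1)] sandwich_mark[OF assms D(2)] homs_conjugate[OF c] average_conjugate[OF c]
      by simp
  qed
qed

lemma sandwich_m:
  assumes "gen X" "subgroup Q S"
  shows "m (sandwich X) Q = average X Q / of_nat (card (homs Q))"
proof -
  have "m (sandwich X) Q = of_nat (card (homs Q)) / of_nat (card (carrier S)) *
      (of_nat (card (carrier S)) / (of_nat (card (homs Q)))\<^sup>2 * average X Q)"
    by (rule m_stable[OF assms(2)]) (use sandwich_mark[OF assms(1)] in auto)
  then show ?thesis using card_S_pos homs_pos[OF assms(2)] by (simp add: power2_eq_square)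
qed

lemma average_stable:
  assumes "stable_above 0 X" shows "average X Q = of_nat (card (homs Q)) * m X Q"
proof -
  have "m X (Domain E) = m X Q" if "E \<in> homs Q" for E
    using that graph_conjugate[of E] m_conjugate[OF assms, of Q "Domain E"] by (simp add: homs_def)
  then show ?thesis by (simp add: average_def)
qed

text \<open>Count the pairs of a morphism \<open>E\<close> on \<open>Q\<close> and an element \<open>t\<close> that conjugates the image of \<open>E\<close> into \<open>P\<close>:
  for fixed \<open>t\<close>, composition with conjugation by \<open>t\<close> permutes the morphisms on \<open>Q\<close>.\<close>

lemma sum_conjugators:
  assumes "subgroup P S" "subgroup Q S"
  shows "(\<Sum>E\<in>homs Q. card (conjugators (Domain E) P)) = card (carrier S) * hom_count Q P"
proof -
  have "(\<Sum>E\<in>homs Q. card (conjugators (Domain E) P)) =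
      (\<Sum>E\<in>homs Q. \<Sum>t\<in>carrier S. if \<forall>q\<in>Domain E. t \<otimes> q \<otimes> inv t \<in> P then 1 else 0)"
    using finite_S by (simp add: conjugators_def sum.If_cases Int_def)
  also have "\<dots> = (\<Sum>t\<in>carrier S. \<Sum>E\<in>homs Q. if \<forall>q\<in>Domain E. t \<otimes> q \<otimes> inv t \<in> P then 1 else 0)"
    by (rule sum.swap)
  also have "\<dots> = (\<Sum>t\<in>carrier S. hom_count Q P)"
  proof (rule sum.cong[OF refl])
    fix t assume t: "t \<in> carrier S"
    let ?c = "conj_on t (carrier S)"
    have cG: "?c \<in> \<G>" by (rule conj_on_graph[OF carrier_sub t])
    have cR: "Range ?c = carrier S" by (rule Range_conj_on)
    have cD: "Domain ?c = carrier S"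
      using graph_conjugate[OF cG] by (simp only: cR conjugate_S)
    have dom: "Domain (?c O E) = (\<lambda>q. t \<otimes> q \<otimes> inv t) ` Domain E" if "E \<in> \<G>" for E
    proof -
      have sub: "Domain E \<subseteq> carrier S" by (rule subgroup.subset[OF Domain_sub[OF that]])
      show ?thesis
      proof
        show "Domain (?c O E) \<subseteq> (\<lambda>q. t \<otimes> q \<otimes> inv t) ` Domain E"
        proof
          fix x assume "x \<in> Domain (?c O E)"
          then obtain z where "(x, z) \<in> ?c O E" by (rule DomainE)
          then obtain q where q: "(x, q) \<in> ?c" "(q, z) \<in> E" by (rule relcompEpair)
          then show "x \<in> (\<lambda>q. t \<otimes> q \<otimes> inv t) ` Domain E" using DomainI[OF q(2)] by blast
        qed
        show "(\<lambda>q. t \<otimes> q \<otimes> inv t) ` Domain E \<subseteq> Domain (?c O E)"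
        proof (rule image_subsetI)
          fix q assume q: "q \<in> Domain E"
          then obtain z where z: "(q, z) \<in> E" by (rule DomainE)
          have "(t \<otimes> q \<otimes> inv t, q) \<in> ?c" using q sub by blast
          then show "t \<otimes> q \<otimes> inv t \<in> Domain (?c O E)" using z by (intro DomainI relcompI)
        qed
      qed
    qed
    have "bij_betw (\<lambda>E. ?c O E) {E \<in> homs Q. \<forall>q\<in>Domain E. t \<otimes> q \<otimes> inv t \<in> P} {E \<in> homs Q. Domain E \<subseteq> P}"
    proof (rule bij_betw_byWitness[where f' = "\<lambda>E. converse ?c O E"])
      have id1: "converse ?c O ?c O E = E" if "E \<in> \<G>" for E
        using graph_converse_comp[OF cG] Id_on_comp[of E "carrier S"] subgroup.subset[OF Domain_sub[OF that]]
        by (simp only: O_assoc[symmetric] cR)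
      have id2: "?c O converse ?c O E = E" if "E \<in> \<G>" for E
        using graph_comp_converse[OF cG] Id_on_comp[of E "carrier S"] subgroup.subset[OF Domain_sub[OF that]]
        by (simp only: O_assoc[symmetric] cD)
      show "\<forall>E\<in>{E \<in> homs Q. \<forall>q\<in>Domain E. t \<otimes> q \<otimes> inv t \<in> P}. converse ?c O ?c O E = E"
        using id1 by (simp add: homs_def)
      show "\<forall>E\<in>{E \<in> homs Q. Domain E \<subseteq> P}. ?c O converse ?c O E = E"
        using id2 by (simp add: homs_def)
      have r1: "Range (?c O E) = Range E" if "E \<in> \<G>" for E
        using subgroup.subset[OF Domain_sub[OF that]] by (intro Range_comp) (simp only: cR)
      have r2: "Range (converse ?c O E) = Range E" if "E \<in> \<G>" for E
        using subgroup.subset[OF Domain_sub[OF that]] by (intro Range_comp) (simp only: Range_converse cD)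
      show "(\<lambda>E. ?c O E) ` {E \<in> homs Q. \<forall>q\<in>Domain E. t \<otimes> q \<otimes> inv t \<in> P} \<subseteq> {E \<in> homs Q. Domain E \<subseteq> P}"
      proof (rule image_subsetI)
        fix E assume E: "E \<in> {E \<in> homs Q. \<forall>q\<in>Domain E. t \<otimes> q \<otimes> inv t \<in> P}"
        then have EG: "E \<in> \<G>" "Range E = Q" and q: "\<forall>q\<in>Domain E. t \<otimes> q \<otimes> inv t \<in> P" by (simp_all add: homs_def)
        have "Domain (?c O E) \<subseteq> P" unfolding dom[OF EG(1)] using q by (intro image_subsetI) blast
        then show "?c O E \<in> {E \<in> homs Q. Domain E \<subseteq> P}"
          using r1[OF EG(1)] graph_comp[OF cG EG(1)] EG(2) by (simp add: homs_def)
      qed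
      show "(\<lambda>E. converse ?c O E) ` {E \<in> homs Q. Domain E \<subseteq> P} \<subseteq> {E \<in> homs Q. \<forall>q\<in>Domain E. t \<otimes> q \<otimes> inv t \<in> P}"
      proof (rule image_subsetI)
        fix E assume E: "E \<in> {E \<in> homs Q. Domain E \<subseteq> P}"
        then have EG: "E \<in> \<G>" "Range E = Q" and sub: "Domain E \<subseteq> P" by (simp_all add: homs_def)
        have G: "converse ?c O E \<in> \<G>" by (intro graph_comp graph_converse cG EG(1))
        have "(\<lambda>q. t \<otimes> q \<otimes> inv t) ` Domain (converse ?c O E) \<subseteq> P"
          using dom[OF G] id2[OF EG(1)] sub by (simp only:)
        then have "\<forall>q\<in>Domain (converse ?c O E). t \<otimes> q \<otimes> inv t \<in> P" by (simp only: image_subset_iff)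
        then show "converse ?c O E \<in> {E \<in> homs Q. \<forall>q\<in>Domain E. t \<otimes> q \<otimes> inv t \<in> P}"
          using r2[OF EG(1)] G EG(2) by (simp add: homs_def)
      qed
    qed
    then have "card {E \<in> homs Q. \<forall>q\<in>Domain E. t \<otimes> q \<otimes> inv t \<in> P} = hom_count Q P"
      unfolding hom_count_def by (rule bij_betw_same_card)
    then show "(\<Sum>E\<in>homs Q. if \<forall>q\<in>Domain E. t \<otimes> q \<otimes> inv t \<in> P then 1 else 0) = hom_count Q P"
      using finite_homs by (simp add: sum.If_cases Int_def)
  qed
  finally show ?thesis by simp
qed

lemma average_tclass:
  assumes "D \<in> \<G>" "subgroup Q S"
  shows "average (tclass D) Q = of_nat (card (carrier S) * hom_count Q (Range D)) / of_nat (card (Range D))"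
proof -
  have "average (tclass D) Q = (\<Sum>E\<in>homs Q. of_nat (card (conjugators (Domain E) (Range D))) / of_nat (card (Range D)))"
    unfolding average_def
    by (rule sum.cong[OF refl], rule m_tclass[OF assms(1)]) (simp add: homs_def Domain_sub)
  then show ?thesis
    using sum_conjugators[OF Range_sub[OF assms(1)] assms(2)]
    by (simp only: sum_divide_distrib[symmetric] of_nat_sum[symmetric])
qed

lemma beta_eq_sandwich:
  assumes "subgroup P S" shows "beta p S F P = sandwich (tclass (Id_on P))"
  unfolding beta_def sandwich_def
  using transitive_class_eq[OF assms identity_morphism[OF assms]] by (simp only: graph_identity)

lemma beta_ch: "subgroup P S \<Longrightarrow> ch (beta p S F P)"
  using sandwich_ch[OF tclass_gen[OF Id_on_graph]] beta_eq_sandwich by simp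

text \<open>The averages of \<open>[P,\<phi>]\<close> do not involve \<open>\<phi>\<close>.\<close>

lemma sandwich_tclass: assumes "D \<in> \<G>" shows "sandwich (tclass D) = beta p S F (Range D)"
  unfolding beta_eq_sandwich[OF Range_sub[OF assms]]
proof (rule ch_eqI)
  have G: "Id_on (Range D) \<in> \<G>" by (rule Id_on_graph[OF Range_sub[OF assms]])
  show "ch (sandwich (tclass D))" "ch (sandwich (tclass (Id_on (Range D))))"
    by (rule sandwich_ch[OF tclass_gen[OF assms]], rule sandwich_ch[OF tclass_gen[OF G]])
  fix Q assume Q: "subgroup Q S"
  show "m (sandwich (tclass D)) Q = m (sandwich (tclass (Id_on (Range D)))) Q"
    using sandwich_m[OF tclass_gen[OF assms] Q] sandwich_m[OF tclass_gen[OF G] Q]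
      average_tclass[OF assms Q] average_tclass[OF G Q] by simp
qed

lemma m_beta:
  assumes "subgroup P S" "subgroup Q S"
  shows "m (beta p S F P) Q =
    of_nat (card (carrier S) * hom_count Q P) / (of_nat (card P) * of_nat (card (homs Q)))"
  using sandwich_m[OF tclass_gen[OF Id_on_graph[OF assms(1)]] assms(2)]
    average_tclass[OF Id_on_graph[OF assms(1)] assms(2)] beta_eq_sandwich[OF assms(1)] by simp

lemma hom_count_conjugate:
  assumes "conjugate P P'" shows "hom_count Q P = hom_count Q P'"
proof -
  have le: "hom_count Q A \<le> hom_count Q B" if c: "conjugate A B" for A B
  proof -
    obtain E where E: "E \<in> \<G>" "Range E = A" "Domain E = B" using c by (auto simp: conjugate_def)
    have inj: "inj_on (\<lambda>E'. E O E') {E' \<in> homs Q. Domain E' \<subseteq> A}"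
    proof (rule inj_on_inverseI[where g = "\<lambda>E'. converse E O E'"])
      fix E' assume "E' \<in> {E' \<in> homs Q. Domain E' \<subseteq> A}"
      then show "converse E O E O E' = E'"
        using graph_converse_comp[OF E(1)] Id_on_comp[of E' A] by (simp add: O_assoc[symmetric] E(2))
    qed
    moreover have "(\<lambda>E'. E O E') ` {E' \<in> homs Q. Domain E' \<subseteq> A} \<subseteq> {E' \<in> homs Q. Domain E' \<subseteq> B}"
    proof (rule image_subsetI)
      fix E' assume E': "E' \<in> {E' \<in> homs Q. Domain E' \<subseteq> A}"
      then have "Range (E O E') = Range E'" using E(2) by (intro Range_comp) simp
      moreover have "Domain (E O E') \<subseteq> B" using E(3) by auto
      ultimately show "E O E' \<in> {E' \<in> homs Q. Domain E' \<subseteq> B}"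
        using E' graph_comp[OF E(1)] by (simp add: homs_def)
    qed
    ultimately show ?thesis unfolding hom_count_def using finite_homs by (intro card_inj_on_le) auto
  qed
  show ?thesis using le[OF assms] le[OF conjugate_sym[OF assms]] by simp
qed

lemma hom_count_self: assumes "subgroup P S" shows "hom_count P P > 0"
proof -
  have "Id_on P \<in> {E \<in> homs P. Domain E \<subseteq> P}" using Id_on_graph[OF assms] by (simp add: homs_def)
  then show ?thesis unfolding hom_count_def using finite_homs by (auto simp: card_gt_0_iff)
qed

text \<open>A morphism from \<open>Q\<close> to \<open>P\<close> is an isomorphism onto its image.\<close>

lemma hom_count_pos:
  assumes "hom_count Q P > 0" "subgroup P S"
  shows "card Q \<le> card P" "card Q = card P \<Longrightarrow> conjugate Q P"
proof -
  have "{E \<in> homs Q. Domain E \<subseteq> P} \<noteq> {}" using assms(1) unfolding hom_count_def by (intro notI) simp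
  then obtain E where E: "E \<in> homs Q" "Domain E \<subseteq> P" by blast
  then have c: "conjugate Q (Domain E)" using graph_conjugate[of E] by (simp add: homs_def)
  have fin: "finite P" by (rule finite_subset[OF subgroup.subset[OF assms(2)] finite_S])
  show "card Q \<le> card P" using conjugate_card[OF c] card_mono[OF fin E(2)] by simp
  show "conjugate Q P" if "card Q = card P"
    using card_subset_eq[OF fin E(2)] conjugate_card[OF c] that c by simp
qed

lemma card_sub_pos: assumes "subgroup P S" shows "card P > 0"
  using subgroup.one_closed[OF assms] finite_subset[OF subgroup.subset[OF assms] finite_S] by (auto simp: card_gt_0_iff)

lemma m_beta_nonzero:
  assumes "subgroup P S" "subgroup Q S" "m (beta p S F P) Q \<noteq> 0" shows "hom_count Q P > 0"
proof (rule ccontr)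
  assume "\<not> hom_count Q P > 0"
  then show False using assms(3) m_beta[OF assms(1,2)] by simp
qed

lemma m_beta_self:
  assumes "subgroup P S" shows "m (beta p S F P) P \<noteq> 0"
  using m_beta[OF assms assms] hom_count_self[OF assms] card_sub_pos[OF assms] homs_pos[OF assms] card_S_pos by simp

text \<open>If the two elements coincide, then neither value of \<open>m\<close> at \<open>P\<close> and at \<open>Q\<close> vanishes, so that each of the
  two groups has a morphism to the other.\<close>

lemma beta_eq_iff:
  assumes "subgroup P S" "subgroup Q S"
  shows "beta p S F P = beta p S F Q \<longleftrightarrow> conjugate P Q"
proof
  assume c: "conjugate P Q"
  show "beta p S F P = beta p S F Q"
  proof (rule ch_eqI[OF beta_ch[OF assms(1)] beta_ch[OF assms(2)]])
    fix T assume T: "subgroup T S"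
    show "m (beta p S F P) T = m (beta p S F Q) T"
      using m_beta[OF assms(1) T] m_beta[OF assms(2) T] hom_count_conjugate[OF c, of T] conjugate_card[OF c] by simp
  qed
next
  assume eq: "beta p S F P = beta p S F Q"
  have 1: "hom_count P Q > 0"
    using m_beta_nonzero[OF assms(2,1)] m_beta_self[OF assms(1)] eq by simp
  have 2: "hom_count Q P > 0"
    using m_beta_nonzero[OF assms(1,2)] m_beta_self[OF assms(2)] eq by simp
  have "card P = card Q" using hom_count_pos(1)[OF 1 assms(2)] hom_count_pos(1)[OF 2 assms(1)] by simp
  then show "conjugate P Q" by (rule hom_count_pos(2)[OF 1 assms(2)])
qed

lemma beta_S: "beta p S F (carrier S) = \<omega>"
proof (rule ch_eqI[OF beta_ch[OF carrier_sub] omega(1)])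
  fix Q assume Q: "subgroup Q S"
  have "{E \<in> homs Q. Domain E \<subseteq> carrier S} = homs Q"
    using subgroup.subset[OF Domain_sub] by (auto simp: homs_def)
  then have "hom_count Q (carrier S) = card (homs Q)" by (simp only: hom_count_def)
  then show "m (beta p S F (carrier S)) Q = m \<omega> Q"
    using m_beta[OF carrier_sub Q] omega(2)[OF Q] card_S_pos homs_pos[OF Q] by simp
qed

text \<open>A proper subgroup of \<open>S\<close> contains no image of \<open>S\<close>.\<close>

lemma m_beta_S:
  assumes "subgroup P S"
  shows "m (beta p S F P) (carrier S) = (if P = carrier S then 1 else 0)"
proof (cases "P = carrier S")
  case True
  then show ?thesis using omega(2)[OF carrier_sub] by (simp add: beta_S)
next
  case False
  have "m (beta p S F P) (carrier S) = 0"
  proof (rule ccontr)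
    assume "m (beta p S F P) (carrier S) \<noteq> 0"
    from hom_count_pos(1)[OF m_beta_nonzero[OF assms carrier_sub this] assms]
    have "card (carrier S) \<le> card P" .
    then have "card P = card (carrier S)" using card_mono[OF finite_S subgroup.subset[OF assms]] by simp
    then show False using card_subset_eq[OF finite_S subgroup.subset[OF assms]] False by blast
  qed
  then show ?thesis using False by simp
qed

abbreviation "\<B> \<equiv> beta_basis p S F"

lemma basis_ch: "b \<in> \<B> \<Longrightarrow> ch b"
  unfolding beta_basis_def using beta_ch by blast

lemma finite_basis: "finite \<B>"
proof -
  have "{P. subgroup P S} \<subseteq> Pow (carrier S)" using subgroup.subset by blast
  then have "finite {P. subgroup P S}" using finite_S by (meson finite_Pow_iff finite_subset)
  moreover have "\<B> = beta p S F ` {P. subgroup P S}" unfolding beta_basis_def by blast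
  ultimately show ?thesis by simp
qed

lemma ch_finsum:
  assumes "finite B0" "B0 \<subseteq> \<B>" "c \<in> B0 \<rightarrow> R"
  shows "ch (finsum M (\<lambda>b. c b \<odot>\<^bsub>M\<^esub> b) B0)"
    "m (finsum M (\<lambda>b. c b \<odot>\<^bsub>M\<^esub> b) B0) Q = (\<Sum>b\<in>B0. c b * m b Q)"
proof -
  have "ch (finsum M (\<lambda>b. c b \<odot>\<^bsub>M\<^esub> b) B0) \<and> m (finsum M (\<lambda>b. c b \<odot>\<^bsub>M\<^esub> b) B0) Q = (\<Sum>b\<in>B0. c b * m b Q)"
    using assms
  proof (induction B0 rule: finite_induct)
    case empty
    then show ?case using ch_zero m_zero by simp
  next
    case (insert b B0)
    have b: "ch b" "c b \<in> R" using insert basis_ch by auto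
    have cb: "ch (c b \<odot>\<^bsub>M\<^esub> b)" using b by (rule ch_smult)
    have cl: "(\<lambda>b. c b \<odot>\<^bsub>M\<^esub> b) \<in> B0 \<rightarrow> carrier M"
      using insert.prems basis_ch gen_closed by (auto intro!: smult_closed)
    have IH: "ch (finsum M (\<lambda>b. c b \<odot>\<^bsub>M\<^esub> b) B0)" "m (finsum M (\<lambda>b. c b \<odot>\<^bsub>M\<^esub> b) B0) Q = (\<Sum>b\<in>B0. c b * m b Q)"
      using insert by auto
    have eq: "finsum M (\<lambda>b. c b \<odot>\<^bsub>M\<^esub> b) (insert b B0) = (c b \<odot>\<^bsub>M\<^esub> b) \<oplus>\<^bsub>M\<^esub> finsum M (\<lambda>b. c b \<odot>\<^bsub>M\<^esub> b) B0"
      using insert.hyps cl cb gen_closed by (intro M.finsum_insert) auto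
    have "ch ((c b \<odot>\<^bsub>M\<^esub> b) \<oplus>\<^bsub>M\<^esub> finsum M (\<lambda>b. c b \<odot>\<^bsub>M\<^esub> b) B0)" using cb IH(1) by (rule ch_add)
    moreover have "m ((c b \<odot>\<^bsub>M\<^esub> b) \<oplus>\<^bsub>M\<^esub> finsum M (\<lambda>b. c b \<odot>\<^bsub>M\<^esub> b) B0) Q = c b * m b Q + (\<Sum>b\<in>B0. c b * m b Q)"
      using m_add[of "c b \<odot>\<^bsub>M\<^esub> b" "finsum M (\<lambda>b. c b \<odot>\<^bsub>M\<^esub> b) B0" Q] cb IH b gen_closed m_smult[of b "c b" Q] by simp
    ultimately show ?case unfolding eq using insert.hyps by simp
  qed
  then show "ch (finsum M (\<lambda>b. c b \<odot>\<^bsub>M\<^esub> b) B0)"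
    "m (finsum M (\<lambda>b. c b \<odot>\<^bsub>M\<^esub> b) B0) Q = (\<Sum>b\<in>B0. c b * m b Q)" by auto
qed

text \<open>Expand \<open>X\<close> into generators and replace each of them by its product with \<open>\<omega>\<close> on both sides, which is an
  element \<open>\<beta> P\<close>. The result has the same values of \<open>m\<close> as \<open>X\<close>, because averaging leaves the values of a stable
  element unchanged.\<close>

lemma basis_expansion:
  assumes "ch X"
  obtains c where "c \<in> \<B> \<rightarrow> R" "X = finsum M (\<lambda>b. c b \<odot>\<^bsub>M\<^esub> b) \<B>"
proof -
  obtain B d where B: "finite B" "B \<subseteq> tclass ` \<G>" "d \<in> B \<rightarrow> R" "X = finsum M (\<lambda>b. d b \<odot>\<^bsub>M\<^esub> b) B"
    "\<forall>Z. mk X Z = (\<Sum>b\<in>B. d b * mk b Z)" using gen_expand[of X] assms by blast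
  have in_basis: "sandwich b \<in> \<B>" "gen b" if b: "b \<in> B" for b
  proof -
    obtain D where D: "D \<in> \<G>" "b = tclass D" using b B(2) by blast
    show "sandwich b \<in> \<B>" using sandwich_tclass[OF D(1)] Range_sub[OF D(1)] D(2) by (auto simp: beta_basis_def)
    show "gen b" using tclass_gen[OF D(1)] D(2) by simp
  qed
  \<comment> \<open>Different generators may lead to the same basis element.\<close>
  define c where "c \<beta> = (\<Sum>b\<in>{b\<in>B. sandwich b = \<beta>}. d b)" for \<beta>
  have c: "c \<in> \<B> \<rightarrow> R"
  proof
    fix \<beta> show "c \<beta> \<in> R" unfolding c_def using B(3) by (intro Z_loc_sum[OF prime_p]) auto
  qed
  have "X = finsum M (\<lambda>b. c b \<odot>\<^bsub>M\<^esub> b) \<B>"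
  proof (rule ch_eqI[OF assms ch_finsum(1)[OF finite_basis subset_refl c]])
    fix Q assume Q: "subgroup Q S"
    have "average X Q = (\<Sum>E\<in>homs Q. \<Sum>b\<in>B. d b * m b (Domain E))"
      unfolding average_def by (simp only: m_expand[OF B(5)])
    also have "\<dots> = (\<Sum>b\<in>B. d b * average b Q)"
      unfolding average_def sum_distrib_left by (rule sum.swap)
    also have "\<dots> = (\<Sum>b\<in>B. d b * (of_nat (card (homs Q)) * m (sandwich b) Q))"
      using sandwich_m[OF in_basis(2) Q] homs_pos[OF Q] by (intro sum.cong) auto
    also have "\<dots> = of_nat (card (homs Q)) * (\<Sum>b\<in>B. d b * m (sandwich b) Q)"
      by (simp add: sum_distrib_left mult_ac)
    also have "(\<Sum>b\<in>B. d b * m (sandwich b) Q) = (\<Sum>\<beta>\<in>\<B>. \<Sum>b\<in>{b\<in>B. sandwich b = \<beta>}. d b * m (sandwich b) Q)"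
      by (rule sum.group[symmetric]) (use B(1) finite_basis in_basis(1) in auto)
    also have "\<dots> = (\<Sum>\<beta>\<in>\<B>. c \<beta> * m \<beta> Q)"
      unfolding c_def sum_distrib_right by (intro sum.cong) auto
    finally have "of_nat (card (homs Q)) * m X Q = of_nat (card (homs Q)) * (\<Sum>\<beta>\<in>\<B>. c \<beta> * m \<beta> Q)"
      using average_stable[of X Q] assms by simp
    then show "m X Q = m (finsum M (\<lambda>b. c b \<odot>\<^bsub>M\<^esub> b) \<B>) Q"
      using homs_pos[OF Q] ch_finsum(2)[OF finite_basis subset_refl c, of Q] by simp
  qed
  then show thesis using that c by blast
qed

text \<open>Among the subgroups that occur with nonzero coefficient let \<open>Q\<close> be one of maximal order. The other basis
  elements of the relation have value \<open>0\<close> at \<open>Q\<close>, so the value of the relation at \<open>Q\<close> is a nonzero multiple of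
  the coefficient.\<close>

lemma basis_independent: "mod_independent (Z_loc p) M \<B>"
  unfolding mod_independent_def
proof (intro allI impI)
  fix B0 c assume "finite B0 \<and> B0 \<subseteq> \<B> \<and> c \<in> B0 \<rightarrow> R \<and> finsum M (\<lambda>b. c b \<odot>\<^bsub>M\<^esub> b) B0 = \<zero>\<^bsub>M\<^esub>"
  then have B: "finite B0" "B0 \<subseteq> \<B>" "c \<in> B0 \<rightarrow> R" and z: "finsum M (\<lambda>b. c b \<odot>\<^bsub>M\<^esub> b) B0 = \<zero>\<^bsub>M\<^esub>" by auto
  have sum0: "(\<Sum>b\<in>B0. c b * m b Q) = 0" for Q
    using ch_finsum(2)[OF B, of Q] z m_zero by simp
  define sub where "sub b = (SOME P. subgroup P S \<and> beta p S F P = b)" for b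
  have sub: "subgroup (sub b) S" "beta p S F (sub b) = b" if "b \<in> B0" for b
  proof -
    have "\<exists>P. subgroup P S \<and> beta p S F P = b" using that B(2) unfolding beta_basis_def by blast
    from someI_ex[OF this] show "subgroup (sub b) S" "beta p S F (sub b) = b" by (auto simp: sub_def)
  qed
  have "c b = 0" if b: "b \<in> B0" for b
  proof (rule ccontr)
    assume nz: "c b \<noteq> 0"
    let ?N = "{b \<in> B0. c b \<noteq> 0}"
    have finN: "finite ?N" using B(1) by simp
    let ?m = "Max ((\<lambda>b. card (sub b)) ` ?N)"
    have "?m \<in> (\<lambda>b. card (sub b)) ` ?N" using finN b nz by (intro Max_in) auto
    then obtain b1 where b1: "?m = card (sub b1)" "b1 \<in> B0" "c b1 \<noteq> 0" by auto
    let ?Q = "sub b1"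
    have other: "c b' * m b' ?Q = 0" if b': "b' \<in> B0 - {b1}" for b'
    proof (rule ccontr)
      assume n: "c b' * m b' ?Q \<noteq> 0"
      then have cb: "c b' \<noteq> 0" and mb: "m b' ?Q \<noteq> 0" by auto
      have B': "b' \<in> B0" using b' by blast
      have h: "hom_count ?Q (sub b') > 0"
        using m_beta_nonzero[OF sub(1)[OF B'] sub(1)[OF b1(2)]] mb sub(2)[OF B'] by simp
      have "card (sub b') \<le> ?m" using finN B' cb by (intro Max_ge) auto
      then have "card ?Q = card (sub b')" using hom_count_pos(1)[OF h sub(1)[OF B']] b1(1) by simp
      then have "conjugate ?Q (sub b')" by (rule hom_count_pos(2)[OF h sub(1)[OF B']])
      then have "b1 = b'" using beta_eq_iff[OF sub(1)[OF b1(2)] sub(1)[OF B']] sub(2)[OF b1(2)] sub(2)[OF B'] by simp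
      then show False using b' by simp
    qed
    have "(\<Sum>b\<in>B0. c b * m b ?Q) = c b1 * m b1 ?Q + (\<Sum>b\<in>B0 - {b1}. c b * m b ?Q)"
      by (rule sum.remove[OF B(1) b1(2)])
    also have "(\<Sum>b\<in>B0 - {b1}. c b * m b ?Q) = 0" using other by (intro sum.neutral) blast
    finally have "c b1 * m b1 ?Q = 0" using sum0[of ?Q] by simp
    moreover have "m b1 ?Q \<noteq> 0" using m_beta_self[OF sub(1)[OF b1(2)]] sub(2)[OF b1(2)] by simp
    ultimately show False using b1(3) by simp
  qed
  then show "\<forall>b\<in>B0. c b = \<zero>\<^bsub>Z_loc p\<^esub>" by (simp add: Z_loc_def)
qed

lemma basis: "mod_basis (Z_loc p) M (A_char p S F) \<B>"
proof -
  have "mod_span (Z_loc p) M \<B> = A_char p S F"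
  proof
    show "mod_span (Z_loc p) M \<B> \<subseteq> A_char p S F"
      unfolding mod_span_def using ch_finsum(1) A_char_iff by blast
    show "A_char p S F \<subseteq> mod_span (Z_loc p) M \<B>"
    proof
      fix X assume "X \<in> A_char p S F"
      then have "ch X" using A_char_iff by blast
      then obtain c where "c \<in> \<B> \<rightarrow> R" "X = finsum M (\<lambda>b. c b \<odot>\<^bsub>M\<^esub> b) \<B>" by (rule basis_expansion)
      then show "X \<in> mod_span (Z_loc p) M \<B>" unfolding mod_span_def using finite_basis by blast
    qed
  qed
  moreover have "\<B> \<subseteq> carrier M" using basis_ch gen_closed by blast
  ultimately show ?thesis using basis_independent by (simp add: mod_basis_def)
qed

lemma basis_coeff_S:
  assumes "ch X"
  shows "basis_coeff (Z_loc p) M \<B> X (beta p S F (carrier S)) = m X (carrier S)"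
proof -
  let ?b = "beta p S F (carrier S)"
  have bB: "?b \<in> \<B>" unfolding beta_basis_def using carrier_sub by blast
  have coeff: "c ?b = m X (carrier S)"
    if B: "finite B0" "?b \<in> B0" "B0 \<subseteq> \<B>" "c \<in> B0 \<rightarrow> R" and X: "X = finsum M (\<lambda>b. c b \<odot>\<^bsub>M\<^esub> b) B0" for c B0
  proof -
    have "c b * m b (carrier S) = 0" if b: "b \<in> B0 - {?b}" for b
    proof -
      obtain P where P: "subgroup P S" "b = beta p S F P" using b B(3) unfolding beta_basis_def by blast
      then have "P \<noteq> carrier S" using b by blast
      then show ?thesis using m_beta_S[OF P(1)] P(2) by simp
    qed
    then have "(\<Sum>b\<in>B0 - {?b}. c b * m b (carrier S)) = 0" by (intro sum.neutral) blast
    moreover have "(\<Sum>b\<in>B0. c b * m b (carrier S)) = c ?b * m ?b (carrier S) + (\<Sum>b\<in>B0 - {?b}. c b * m b (carrier S))"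
      by (rule sum.remove[OF B(1,2)])
    ultimately have "(\<Sum>b\<in>B0. c b * m b (carrier S)) = c ?b" using m_beta_S[OF carrier_sub] by simp
    then show ?thesis using ch_finsum(2)[OF B(1,3,4), of "carrier S"] X by simp
  qed
  obtain c where c: "c \<in> \<B> \<rightarrow> R" "X = finsum M (\<lambda>b. c b \<odot>\<^bsub>M\<^esub> b) \<B>" using assms by (rule basis_expansion)
  show ?thesis unfolding basis_coeff_def
  proof (rule the_equality)
    show "\<exists>c B0. finite B0 \<and> ?b \<in> B0 \<and> B0 \<subseteq> \<B> \<and> c \<in> B0 \<rightarrow> R \<and>
        X = finsum M (\<lambda>b. c b \<odot>\<^bsub>M\<^esub> b) B0 \<and> m X (carrier S) = c ?b"
      using finite_basis bB c coeff[OF finite_basis bB subset_refl c] by (intro exI[of _ c] exI[of _ \<B>]) simp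
  next
    fix k assume "\<exists>c B0. finite B0 \<and> ?b \<in> B0 \<and> B0 \<subseteq> \<B> \<and> c \<in> B0 \<rightarrow> R \<and>
        X = finsum M (\<lambda>b. c b \<odot>\<^bsub>M\<^esub> b) B0 \<and> k = c ?b"
    then obtain c B0 where "finite B0" "?b \<in> B0" "B0 \<subseteq> \<B>" "c \<in> B0 \<rightarrow> R" "X = finsum M (\<lambda>b. c b \<odot>\<^bsub>M\<^esub> b) B0" "k = c ?b"
      by blast
    then show "k = m X (carrier S)" using coeff by simp
  qed
qed

lemma a_inv_eq: "X \<in> carrier M \<Longrightarrow> \<ominus>\<^bsub>M\<^esub> X = (- 1) \<odot>\<^bsub>M\<^esub> X"
  by (rule M.minus_equality, rule M_eqI)
    (auto simp: smult_closed add_closed zero_closed minus_one cc_add cc_smult cc_zero)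

lemma A_char_subring: "nonunital_subring (A_char p S F) M"
  unfolding nonunital_subring_def
proof (intro conjI ballI)
  show "subgroup (A_char p S F) (add_monoid M)"
  proof (rule group.subgroupI[OF M.a_group])
    show "A_char p S F \<subseteq> carrier (add_monoid M)" using A_char_iff gen_closed by auto
    show "A_char p S F \<noteq> {}" using A_char_iff ch_zero by blast
    show "inv\<^bsub>add_monoid M\<^esub> X \<in> A_char p S F" if "X \<in> A_char p S F" for X
      using that ch_smult[OF _ minus_one] a_inv_eq gen_closed A_char_iff by (simp add: a_inv_def)
    show "X \<otimes>\<^bsub>add_monoid M\<^esub> Y \<in> A_char p S F" if "X \<in> A_char p S F" "Y \<in> A_char p S F" for X Y
      using that ch_add A_char_iff by simp
  qed
  show "X \<otimes>\<^bsub>M\<^esub> Y \<in> A_char p S F" if "X \<in> A_char p S F" "Y \<in> A_char p S F" for X Y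
    using that ch_mult A_char_iff by blast
qed

text \<open>\<open>X\<close> is characteristic itself or the difference of \<open>X + \<omega>\<close> and \<open>\<omega>\<close>.\<close>

lemma A_char_generated:
  "A_char p S F = nonunital_subring_generated M {X \<in> carrier M. F_characteristic p S F X}"
proof
  let ?C = "{X \<in> carrier M. F_characteristic p S F X}"
  have "?C \<subseteq> A_char p S F" using characteristic_iff A_char_iff by blast
  then show "nonunital_subring_generated M ?C \<subseteq> A_char p S F"
    unfolding nonunital_subring_generated_def using A_char_subring by blast
  show "A_char p S F \<subseteq> nonunital_subring_generated M ?C"
    unfolding nonunital_subring_generated_def
  proof (intro subsetI InterI)
    fix X A assume X: "X \<in> A_char p S F" and "A \<in> {A. nonunital_subring A M \<and> ?C \<subseteq> A}"
    then have A: "subgroup A (add_monoid M)" "?C \<subseteq> A" by (auto simp: nonunital_subring_def)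
    have chX: "ch X" using X A_char_iff by blast
    have XM: "X \<in> carrier M" and wM: "\<omega> \<in> carrier M" using chX omega(1) gen_closed by auto
    have wC: "\<omega> \<in> ?C" using omega wM one_unit carrier_sub by (simp add: characteristic_iff_S)
    show "X \<in> A"
    proof (cases "m X (carrier S) \<in> Units (Z_loc p)")
      case True
      then show ?thesis using chX XM characteristic_iff_S A(2) by blast
    next
      case False
      have mR: "m X (carrier S) \<in> R" using m_cong(1)[OF _ carrier_sub] chX by blast
      have n: "m X (carrier S) / of_nat p \<in> R" using False Units_Z_loc_iff[OF prime_p mR] by blast
      have "m X (carrier S) + 1 \<in> Units (Z_loc p) \<longleftrightarrow> 1 \<in> Units (Z_loc p)"
        by (rule Units_Z_loc_cong[OF prime_p Z_loc_add[OF prime_p mR Z_loc_1[OF prime_p]] Z_loc_1[OF prime_p]])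
          (use n in simp)
      then have u: "m (X \<oplus>\<^bsub>M\<^esub> \<omega>) (carrier S) \<in> Units (Z_loc p)"
        using one_unit m_add[OF XM wM] omega(2)[OF carrier_sub] by simp
      have ch: "ch (X \<oplus>\<^bsub>M\<^esub> \<omega>)" using chX omega(1) by (rule ch_add)
      have "X \<oplus>\<^bsub>M\<^esub> \<omega> \<in> ?C"
        using u ch by (simp add: characteristic_iff_S gen_closed)
      then have XA: "X \<oplus>\<^bsub>M\<^esub> \<omega> \<in> A" by (rule subsetD[OF A(2)])
      have wA: "\<omega> \<in> A" by (rule subsetD[OF A(2) wC])
      have "(X \<oplus>\<^bsub>M\<^esub> \<omega>) \<oplus>\<^bsub>M\<^esub> (\<ominus>\<^bsub>M\<^esub> \<omega>) \<in> A"
        using subgroup.m_closed[OF A(1) XA subgroup.m_inv_closed[OF A(1) wA]] by (simp add: a_inv_def)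
      moreover have "(X \<oplus>\<^bsub>M\<^esub> \<omega>) \<oplus>\<^bsub>M\<^esub> (\<ominus>\<^bsub>M\<^esub> \<omega>) = X" using XM wM by (simp add: M.a_assoc M.r_neg)
      ultimately show ?thesis by simp
    qed
  qed
qed

lemma characteristic_by_coefficient:
  "{X \<in> carrier M. F_characteristic p S F X} =
    {X \<in> A_char p S F. basis_coeff (Z_loc p) M \<B> X (beta p S F (carrier S)) \<in> Units (Z_loc p)}"
proof -
  have "X \<in> carrier M \<and> F_characteristic p S F X \<longleftrightarrow>
      X \<in> A_char p S F \<and> basis_coeff (Z_loc p) M \<B> X (beta p S F (carrier S)) \<in> Units (Z_loc p)" for X
    using characteristic_iff_S[of X] A_char_iff[of X] basis_coeff_S[of X] gen_closed[of X] by auto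
  then show ?thesis by blast
qed

end

theorem proposition6p3:
  fixes p :: nat
    and S :: "('a, 'm) monoid_scheme"
    and F :: "'a set \<Rightarrow> 'a set \<Rightarrow> ('a \<Rightarrow> 'a) set"
  assumes "prime p"
    and "finite_p_group p S"
    and "fusion_system S F"
    and "saturated p S F"
  shows "nonunital_subring (A_char p S F) (burnside_ring p S) \<and>
    A_char p S F =
      nonunital_subring_generated (burnside_ring p S)
        {X \<in> carrier (burnside_ring p S). F_characteristic p S F X} \<and>
    mod_basis (Z_loc p) (burnside_ring p S) (A_char p S F) (beta_basis p S F) \<and>
    (\<forall>P Q. subgroup P S \<and> subgroup Q S \<longrightarrow>
      (beta p S F P = beta p S F Q \<longleftrightarrow> Q \<in> F_conjugates S F P)) \<and>
    beta p S F (carrier S) = characteristic_idempotent p S F \<and>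
    {X \<in> carrier (burnside_ring p S). F_characteristic p S F X} =
      {X \<in> A_char p S F.
         basis_coeff (Z_loc p) (burnside_ring p S) (beta_basis p S F) X (beta p S F (carrier S))
           \<in> Units (Z_loc p)}"
proof -
  have loc: "saturated_fusion_system S F p"
    using assms
    by (simp add: saturated_fusion_system_def saturated_fusion_system_axioms_def
      finite_fusion_system_def finite_fusion_system_axioms_def)
  have conj: "beta p S F P = beta p S F Q \<longleftrightarrow> Q \<in> F_conjugates S F P"
    if "subgroup P S" "subgroup Q S" for P Q
    using saturated_fusion_system.beta_eq_iff[OF loc that]
      finite_fusion_system.F_conjugates_iff[OF saturated_fusion_system.axioms(1)[OF loc] that(1)]
    by (simp only:)
  show ?thesis
    by (intro conjI allI impI saturated_fusion_system.A_char_subring[OF loc]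
      saturated_fusion_system.A_char_generated[OF loc] saturated_fusion_system.basis[OF loc]
      saturated_fusion_system.beta_S[OF loc] saturated_fusion_system.characteristic_by_coefficient[OF loc])
      (elim conjE, rule conj)
qed

end
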